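(* Let $X$ be an infinite-dimensional complex Banach space, $T\in L(X)$, let $f$ be a complex analytic function in a neighborhood of $\sigma(T)$, and let $\mathbf R$ be one of the classes $\mathcal M(X)$, $\mathcal Q(X)$, $L(X)^{-1}$, $\mathcal B_+(X)$, $\mathcal B_-(X)$, $\mathcal B(X)$, $\Phi_+(X)$, $\Phi_-(X)$, $\Phi(X)$, $\mathcal W_+(X)$, $\mathcal W_-(X)$, $\mathcal W(X)$. If $T\in \mathbf{gDR}\,\mathbf R(X)$ and $f^{-1}(0)\cap\sigma_{\mathbf R}(T)=\{0\}$, then $f(T)\in\mathbf{gDR}\,\mathbf R(X)$.
   Context: $f(T)$ is defined by the holomorphic functional calculus. $\mathcal M(X)$: bounded below operators (injective with closed range); $\mathcal Q(X)$: surjective operators; $L(X)^{-1}$: invertible operators; $\Phi_+$: $\alpha(S)=\dim N(S)<\infty$ and $R(S)$ closed; $\Phi_-$: $\beta(S)=\operatorname{codim}R(S)<\infty$; $\Phi=\Phi_+\cap\Phi_-$; $\operatorname{ind}S=\alpha(S)-\beta(S)$; $\mathcal W_+=\{S\in\Phi_+:\operatorname{ind}S\le0\}$, $\mathcal W_-=\{S\in\Phi_-:\operatorname{ind}S\ge0\}$, $\mathcal W=\{S\in\Phi:\operatorname{ind}S=0\}$; $\mathcal B_+$: upper semi-Fredholm with finite ascent; $\mathcal B_-$: lower semi-Fredholm with finite descent; $\mathcal B$: Fredholm with finite ascent and descent. (The same classes are used for operators on closed subspaces.) $S$ is Riesz if $S-\lambda$ is Fredholm for all $\lambda\neq0$.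 $\mathbf{gDR}\,\mathbf R(X)$ is the set of $T\in L(X)$ for which there are closed $T$-invariant subspaces $M,N$ with $X=M\oplus N$, $T_M$ in the class $\mathbf R$ (on $M$) and $T_N$ Riesz. $\sigma_{\mathbf R}(T)=\{\lambda: T-\lambda\notin\mathbf R\}$. *)

theory Defs
  imports "HOL-Complex_Analysis.Complex_Analysis"
begin

text \<open>A complex Banach space is encoded as a real Banach space of type 'a together
 with a real-linear map J (multiplication by the imaginary unit) with J (J x) = - x
 and norm (c * x) = |c| norm x for all complex c.\<close>

definition scaleC :: "('a::real_vector \<Rightarrow> 'a) \<Rightarrow> complex \<Rightarrow> 'a \<Rightarrow> 'a" where
  "scaleC J c x = Re c *\<^sub>R x + Im c *\<^sub>R J x"

definition complex_structure :: "('a::real_normed_vector \<Rightarrow> 'a) \<Rightarrow> bool" where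
  "complex_structure J \<longleftrightarrow> linear J \<and> (\<forall>x. J (J x) = - x)
     \<and> (\<forall>c x. norm (scaleC J c x) = cmod c * norm x)"

definition bop :: "('a::real_normed_vector \<Rightarrow> 'a) \<Rightarrow> ('a \<Rightarrow> 'a) \<Rightarrow> bool" where
  "bop J T \<longleftrightarrow> bounded_linear T \<and> (\<forall>x. T (J x) = J (T x))"

definition csubspace :: "('a::real_normed_vector \<Rightarrow> 'a) \<Rightarrow> 'a set \<Rightarrow> bool" where
  "csubspace J M \<longleftrightarrow> subspace M \<and> closed M \<and> (\<forall>x\<in>M. J x \<in> M)"

definition fin_dim :: "'a::real_vector set \<Rightarrow> bool" where
  "fin_dim S \<longleftrightarrow> (\<exists>B. finite B \<and> S \<subseteq> span B)"

text \<open>Complex dimension of a finite-dimensional complex subspace (= half the real dimension).\<close>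
definition cdim :: "'a::real_vector set \<Rightarrow> nat" where
  "cdim S = dim S div 2"

text \<open>Finite codimension of R in M and (complex) codimension (= half the real one).\<close>
definition fin_codim :: "'a::real_vector set \<Rightarrow> 'a set \<Rightarrow> bool" where
  "fin_codim M R \<longleftrightarrow> (\<exists>F. finite F \<and> M \<subseteq> span (R \<union> F))"

definition ccodim :: "'a::real_vector set \<Rightarrow> 'a set \<Rightarrow> nat" where
  "ccodim M R = (LEAST n. \<exists>F. finite F \<and> card F = n \<and> M \<subseteq> span (R \<union> F)) div 2"

definition kerM :: "'a set \<Rightarrow> ('a \<Rightarrow> 'a::real_vector) \<Rightarrow> 'a set" where
  "kerM M T = {x\<in>M. T x = 0}"

definition alphaM :: "'a set \<Rightarrow> ('a \<Rightarrow> 'a::real_vector) \<Rightarrow> nat" where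
  "alphaM M T = cdim (kerM M T)"

definition betaM :: "'a set \<Rightarrow> ('a \<Rightarrow> 'a::real_vector) \<Rightarrow> nat" where
  "betaM M T = ccodim M (T ` M)"

definition bounded_belowM :: "'a set \<Rightarrow> ('a \<Rightarrow> 'a::real_normed_vector) \<Rightarrow> bool" where
  "bounded_belowM M T \<longleftrightarrow> inj_on T M \<and> closed (T ` M)"

definition surjM :: "'a set \<Rightarrow> ('a \<Rightarrow> 'a) \<Rightarrow> bool" where
  "surjM M T \<longleftrightarrow> T ` M = M"

definition invertibleM :: "'a set \<Rightarrow> ('a \<Rightarrow> 'a::real_normed_vector) \<Rightarrow> bool" where
  "invertibleM M T \<longleftrightarrow> (\<exists>S. (\<forall>x\<in>M. S x \<in> M \<and> S (T x) = x \<and> T (S x) = x)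
                           \<and> (\<exists>C. \<forall>x\<in>M. norm (S x) \<le> C * norm x))"

definition upper_semiFredholmM :: "'a set \<Rightarrow> ('a \<Rightarrow> 'a::real_normed_vector) \<Rightarrow> bool" where
  "upper_semiFredholmM M T \<longleftrightarrow> fin_dim (kerM M T) \<and> closed (T ` M)"

definition lower_semiFredholmM :: "'a set \<Rightarrow> ('a \<Rightarrow> 'a::real_normed_vector) \<Rightarrow> bool" where
  "lower_semiFredholmM M T \<longleftrightarrow> fin_codim M (T ` M)"

definition FredholmM :: "'a set \<Rightarrow> ('a \<Rightarrow> 'a::real_normed_vector) \<Rightarrow> bool" where
  "FredholmM M T \<longleftrightarrow> upper_semiFredholmM M T \<and> lower_semiFredholmM M T"

definition finite_ascentM :: "'a set \<Rightarrow> ('a \<Rightarrow> 'a::real_vector) \<Rightarrow> bool" where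
  "finite_ascentM M T \<longleftrightarrow> (\<exists>n. kerM M (T ^^ n) = kerM M (T ^^ Suc n))"

definition finite_descentM :: "'a set \<Rightarrow> ('a \<Rightarrow> 'a) \<Rightarrow> bool" where
  "finite_descentM M T \<longleftrightarrow> (\<exists>n. (T ^^ n) ` M = (T ^^ Suc n) ` M)"

text \<open>The twelve classes R. The index is ind = alpha - beta (with the convention
 that ind = -infinity if beta = infinity and +infinity if alpha = infinity).\<close>
datatype opclass = M_cls | Q_cls | Inv_cls | Bplus_cls | Bminus_cls | B_cls
  | Phiplus_cls | Phiminus_cls | Phi_cls | Wplus_cls | Wminus_cls | W_cls

fun inClass :: "opclass \<Rightarrow> 'a set \<Rightarrow> ('a \<Rightarrow> 'a::real_normed_vector) \<Rightarrow> bool" where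
  "inClass M_cls M T = bounded_belowM M T"
| "inClass Q_cls M T = surjM M T"
| "inClass Inv_cls M T = invertibleM M T"
| "inClass Bplus_cls M T = (upper_semiFredholmM M T \<and> finite_ascentM M T)"
| "inClass Bminus_cls M T = (lower_semiFredholmM M T \<and> finite_descentM M T)"
| "inClass B_cls M T = (FredholmM M T \<and> finite_ascentM M T \<and> finite_descentM M T)"
| "inClass Phiplus_cls M T = upper_semiFredholmM M T"
| "inClass Phiminus_cls M T = lower_semiFredholmM M T"
| "inClass Phi_cls M T = FredholmM M T"
| "inClass Wplus_cls M T = (upper_semiFredholmM M T \<and>
      (fin_codim M (T ` M) \<longrightarrow> alphaM M T \<le> betaM M T))"
| "inClass Wminus_cls M T = (lower_semiFredholmM M T \<and>
      (fin_dim (kerM M T) \<longrightarrow> alphaM M T \<ge> betaM M T))"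
| "inClass W_cls M T = (FredholmM M T \<and> alphaM M T = betaM M T)"

definition shiftop :: "('a::real_vector \<Rightarrow> 'a) \<Rightarrow> ('a \<Rightarrow> 'a) \<Rightarrow> complex \<Rightarrow> 'a \<Rightarrow> 'a" where
  "shiftop J T l = (\<lambda>x. T x - scaleC J l x)"

definition rieszM :: "('a::real_normed_vector \<Rightarrow> 'a) \<Rightarrow> 'a set \<Rightarrow> ('a \<Rightarrow> 'a) \<Rightarrow> bool" where
  "rieszM J N T \<longleftrightarrow> (\<forall>l. l \<noteq> 0 \<longrightarrow> FredholmM N (shiftop J T l))"

definition gDR :: "opclass \<Rightarrow> ('a::real_normed_vector \<Rightarrow> 'a) \<Rightarrow> ('a \<Rightarrow> 'a) \<Rightarrow> bool" where
  "gDR R J T \<longleftrightarrow> bop J T \<and> (\<exists>M N. csubspace J M \<and> csubspace J N \<and> M \<inter> N = {0}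
      \<and> (\<forall>x. \<exists>m\<in>M. \<exists>n\<in>N. x = m + n)
      \<and> T ` M \<subseteq> M \<and> T ` N \<subseteq> N \<and> inClass R M T \<and> rieszM J N T)"

definition spectrumR :: "opclass \<Rightarrow> ('a::real_normed_vector \<Rightarrow> 'a) \<Rightarrow> ('a \<Rightarrow> 'a) \<Rightarrow> complex set" where
  "spectrumR R J T = {l. \<not> inClass R UNIV (shiftop J T l)}"

definition spectrum :: "('a::real_normed_vector \<Rightarrow> 'a) \<Rightarrow> ('a \<Rightarrow> 'a) \<Rightarrow> complex set" where
  "spectrum J T = {l. \<not> invertibleM UNIV (shiftop J T l)}"

definition resolvent :: "('a::real_vector \<Rightarrow> 'a) \<Rightarrow> ('a \<Rightarrow> 'a) \<Rightarrow> complex \<Rightarrow> 'a \<Rightarrow> 'a" where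
  "resolvent J T l = (THE S. \<forall>x. S (scaleC J l x - T x) = x \<and> scaleC J l (S x) - T (S x) = x)"

definition admissible_cycle :: "complex set \<Rightarrow> complex set \<Rightarrow> (real \<Rightarrow> complex) list \<Rightarrow> bool" where
  "admissible_cycle K U gs \<longleftrightarrow>
     (\<forall>g\<in>set gs. valid_path g \<and> pathfinish g = pathstart g \<and> path_image g \<subseteq> U - K)
     \<and> (\<forall>z\<in>K. (\<Sum>g\<leftarrow>gs. winding_number g z) = 1)
     \<and> (\<forall>z. z \<notin> U \<longrightarrow> (\<Sum>g\<leftarrow>gs. winding_number g z) = 0)"

definition hfc :: "('a::banach \<Rightarrow> 'a) \<Rightarrow> complex set \<Rightarrow> (complex \<Rightarrow> complex) \<Rightarrow> ('a \<Rightarrow> 'a) \<Rightarrow> 'a \<Rightarrow> 'a" where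
  "hfc J U f T = (THE S. \<forall>gs. admissible_cycle (spectrum J T) U gs \<longrightarrow>
      (\<forall>x. (\<Sum>g\<leftarrow>gs. integral {0..1} (\<lambda>t. scaleC J (f (g t) * vector_derivative g (at t within {0..1}))
                                              (resolvent J T (g t) x)))
           = scaleC J (2 * pi * \<i>) (S x)))"

end

theory Submission
  imports Defs
begin

text \<open>Let P be the projection onto M along N and Q = 1 - P. Since Q (T - t) is Fredholm on N for
  t \<noteq> 0 and the punctured plane is connected, its index there is 0, as it is for large t. Hence
  (T - l) P is in the class R on M for every zero l of f: for l = 0 by assumption, and otherwise
  because T - l is in R and its Weyl factor on N can be split off. Near the spectrum f is a product
  of linear factors, of a function without zeros, and of the indicator of an open and closed part on
  which f is not identically 0. The classes are closed under products of commuting operators, so the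
  first two kinds of factors keep f(T) in R on M. For the third, let P1 project onto the part of M
  where f vanishes identically: there T - t is in R for all t, and by connectedness it is Weyl for
  all t, so a Liouville argument modulo the finite rank (or zero) operators makes this part finite
  dimensional (or trivial). The same theorem applied to Q, to the Fredholm class and to f - c with
  c \<noteq> 0, whose zeros are not 0, shows that f(T) is Riesz on N.\<close>

section \<open>Banach space preliminaries\<close>

text \<open>Restrictions to \<open>M\<close> and \<open>N\<close> are never operators in their own
  right: \<open>cut P A\<close> lives on the whole space, so the single functional calculus of
  \<open>T\<close> serves both summands and no calculus for the restrictions is built. No index is
  ever computed either. A sign of the index is traded for a finite rank correction that makes the
  operator bounded below or onto; such corrections survive small changes of the operator and
  multiply well, and this is why \<open>weyl\<close> is what gets carried along connected sets.
  Splitting off the Weyl factor on \<open>N\<close> is forced by the index conditions: otherwise the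
  part on \<open>M\<close> could have another index than T - l. A component where \<open>f\<close>
  vanishes identically is the second obstacle, because no finite product of linear factors
  represents \<open>f\<close> there. Finally, \<open>hfc\<close> is a definite description over all
  admissible cycles, so a cycle must be shown to exist and all cycles must be shown to agree; grid
  edges do the first and the homology form of Cauchy's theorem the second.\<close>

lemma seminorm_dominated_functional:
  fixes p :: "'v::real_vector \<Rightarrow> real"
  assumes add: "\<And>x y. p (x + y) \<le> p x + p y" and scale: "\<And>c x. p (c *\<^sub>R x) = \<bar>c\<bar> * p x"
  obtains h where "linear h" "h v = p v" "\<And>x. \<bar>h x\<bar> \<le> p x"
proof -
  have p0: "p 0 = 0" using scale[of 0 0] by simp
  have pminus: "p (- x) = p x" for x using scale[of "-1" x] by simp
  have pnn: "0 \<le> p x" for x using add[of x "-x"] p0 pminus[of x] by simp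
  \<comment> \<open>Hahn-Banach through graphs: an element of \<open>A\<close> is the graph of a
    partial functional below \<open>p\<close>. Domination makes it single-valued, since (0, a) and
    (0, -a) in the graph force a = 0.\<close>
  define A where "A = {G :: ('v \<times> real) set. subspace G \<and> (v, p v) \<in> G \<and> (\<forall>(x,a)\<in>G. a \<le> p x)}"
  have "\<exists>M\<in>A. \<forall>X\<in>A. M \<subseteq> X \<longrightarrow> X = M"
  proof (rule subset_Zorn_nonempty)
    have "c * p v \<le> p (c *\<^sub>R v)" for c
      using scale[of c v] mult_right_mono[OF abs_ge_self[of c] pnn[of v]] by simp
    then have "a \<le> p x" if "(x, a) \<in> span {(v, p v)}" for x a
      using that by (auto simp: span_singleton)
    then have "span {(v, p v)} \<in> A"
      unfolding A_def by (auto simp: span_base subspace_span)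
    then show "A \<noteq> {}" by blast
  next
    fix C assume C: "C \<noteq> {}" "subset.chain A C"
    then have sub: "\<And>G. G \<in> C \<Longrightarrow> G \<in> A" and tot: "\<And>G H. G \<in> C \<Longrightarrow> H \<in> C \<Longrightarrow> G \<subseteq> H \<or> H \<subseteq> G"
      by (auto simp: subset_chain_def)
    have "subspace (\<Union>C)"
    proof (rule subspaceI)
      show "0 \<in> \<Union>C" using C(1) sub by (auto simp: A_def subspace_0)
      show "x + y \<in> \<Union>C" if xy: "x \<in> \<Union>C" "y \<in> \<Union>C" for x y
      proof -
        obtain G H where GH: "G \<in> C" "x \<in> G" "H \<in> C" "y \<in> H" using xy by blast
        then have "\<exists>K\<in>C. x \<in> K \<and> y \<in> K" using tot[of G H] by blast
        then show ?thesis using sub by (auto simp: A_def intro: subspace_add)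
      qed
      show "c *\<^sub>R x \<in> \<Union>C" if "x \<in> \<Union>C" for c x
        using that sub by (auto simp: A_def intro: subspace_scale)
    qed
    moreover have "(v, p v) \<in> \<Union>C" using C(1) sub unfolding A_def by blast
    moreover have "\<forall>(x,a)\<in>\<Union>C. a \<le> p x" using sub unfolding A_def by blast
    ultimately show "\<Union>C \<in> A" unfolding A_def by blast
  qed
  then obtain G where G: "G \<in> A" and max: "\<And>X. X \<in> A \<Longrightarrow> G \<subseteq> X \<Longrightarrow> X = G" by blast
  have sG: "subspace G" and vG: "(v, p v) \<in> G" and dom: "\<And>x a. (x,a) \<in> G \<Longrightarrow> a \<le> p x"
    using G by (auto simp: A_def)
  have total: "\<exists>a. (y,a) \<in> G" for y
  proof -
    define B where "B = (\<lambda>(x,a). a - p (x - y)) ` G"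
    \<comment> \<open>A value \<open>c\<close> at \<open>y\<close> is compatible with domination if
      it lies above all left-hand sides and below all right-hand sides; the supremum of the former
      will do.\<close>
    have ub: "a - p (x - y) \<le> p (x' + y) - a'" if "(x,a) \<in> G" "(x',a') \<in> G" for x a x' a'
    proof -
      have "(x + x', a + a') \<in> G" using subspace_add[OF sG that] by simp
      then have "a + a' \<le> p ((x - y) + (x' + y))" using dom by simp
      then show ?thesis using add[of "x - y" "x' + y"] by linarith
    qed
    define c where "c = Sup B"
    have Bne: "B \<noteq> {}" using vG unfolding B_def by blast
    have bdd: "bdd_above B"
      unfolding B_def bdd_above_def by (rule exI[of _ "p (v + y) - p v"]) (use ub[OF _ vG] in auto)
    have c1: "a - p (x - y) \<le> c" if "(x,a) \<in> G" for x a
      unfolding c_def by (rule cSup_upper[OF _ bdd]) (use that in \<open>force simp: B_def\<close>)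
    have c2: "c \<le> p (x + y) - a" if "(x,a) \<in> G" for x a
      unfolding c_def by (rule cSup_least[OF Bne]) (use ub[OF _ that] in \<open>auto simp: B_def\<close>)
    have le: "a + t * c \<le> p (x + t *\<^sub>R y)" if xa: "(x,a) \<in> G" for x a t
    proof (cases "t = 0")
      case True then show ?thesis using dom[OF xa] by simp
    next
      case False
      \<comment> \<open>Dividing by the absolute value of \<open>t\<close> leaves the coefficient 1
        or -1 in front of \<open>y\<close>, where \<open>c2\<close> or \<open>c1\<close>
        applies.\<close>
      define s where "s = \<bar>t\<bar>"
      have s: "s > 0" using False by (simp add: s_def)
      have xs: "(inverse s *\<^sub>R x, inverse s * a) \<in> G" using subspace_scale[OF sG xa, of "inverse s"] by simp
      have "inverse s * a + (t / s) * c \<le> p (inverse s *\<^sub>R x + (t / s) *\<^sub>R y)"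
      proof (cases "t > 0")
        case True
        then have "t / s = 1" using s by (simp add: s_def)
        then show ?thesis using c2[OF xs] by simp
      next
        case False
        then have "t / s = - 1" using s by (simp add: s_def)
        then show ?thesis using c1[OF xs] by simp
      qed
      then have "s * (inverse s * a + (t / s) * c) \<le> s * p (inverse s *\<^sub>R x + (t / s) *\<^sub>R y)"
        using s by (simp add: mult_left_mono)
      also have "\<dots> = p (s *\<^sub>R (inverse s *\<^sub>R x + (t / s) *\<^sub>R y))" using scale s by simp
      finally show ?thesis using s by (simp add: algebra_simps)
    qed
    define G' where "G' = span (insert (y,c) G)"
    have "G' \<in> A"
    proof -
      have "b \<le> p z" if zb: "(z,b) \<in> G'" for z b
      proof -
        obtain k where "(z,b) - k *\<^sub>R (y,c) \<in> span G"
          using zb unfolding G'_def span_breakdown_eq by blast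
        then have "(z - k *\<^sub>R y, b - k * c) \<in> G" using sG by (simp add: span_eq_iff[THEN iffD2])
        from le[OF this, of k] show ?thesis by simp
      qed
      then show ?thesis unfolding A_def G'_def using vG by (auto simp: span_base subspace_span)
    qed
    moreover have "G \<subseteq> G'" unfolding G'_def by (auto simp: span_base)
    ultimately have "G' = G" using max by blast
    then show ?thesis unfolding G'_def by (metis insertI1 span_base)
  qed
  have uniq: "a = b" if "(x,a) \<in> G" "(x,b) \<in> G" for x a b
  proof -
    have "(0, a - b) \<in> G" "(0, b - a) \<in> G"
      using subspace_diff[OF sG that] subspace_diff[OF sG that(2,1)] by simp_all
    then show ?thesis using dom[of 0 "a - b"] dom[of 0 "b - a"] p0 by simp
  qed
  define h where "h x = (THE a. (x,a) \<in> G)" for x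
  have hG: "(x, h x) \<in> G" for x
    unfolding h_def by (rule theI') (use total uniq in blast)
  have heq: "h x = a" if "(x,a) \<in> G" for x a using uniq[OF hG that] .
  have lin: "linear h"
  proof
    show "h (x + y) = h x + h y" for x y using subspace_add[OF sG hG hG, of x y] by (intro heq) simp
    show "h (c *\<^sub>R x) = c *\<^sub>R h x" for c x using subspace_scale[OF sG hG, of c x] by (intro heq) simp
  qed
  moreover have "h v = p v" using heq[OF vG] .
  moreover have "\<bar>h x\<bar> \<le> p x" for x
    using dom[OF hG, of x] dom[OF hG, of "-x"] pminus linear_neg[OF lin] by (simp add: abs_le_iff)
  ultimately show ?thesis using that by blast
qed

lemma infdist_subspace_scale_le:
  fixes M :: "'v::real_normed_vector set"
  assumes "subspace M"
  shows "infdist (c *\<^sub>R x) M \<le> \<bar>c\<bar> * infdist x M"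
proof (cases "c = 0")
  case True then show ?thesis using subspace_0[OF assms] by simp
next
  case False
  have ne: "M \<noteq> {}" using subspace_0[OF assms] by blast
  have "infdist (c *\<^sub>R x) M / \<bar>c\<bar> \<le> infdist x M"
    unfolding infdist_notempty[OF ne, of x]
  proof (rule cINF_greatest[OF ne])
    fix a assume "a \<in> M"
    then have "infdist (c *\<^sub>R x) M \<le> dist (c *\<^sub>R x) (c *\<^sub>R a)"
      using infdist_le subspace_scale[OF assms] by blast
    also have "\<dots> = \<bar>c\<bar> * dist x a" by (simp add: dist_norm flip: scaleR_diff_right)
    finally show "infdist (c *\<^sub>R x) M / \<bar>c\<bar> \<le> dist x a" using False by (simp add: field_simps)
  qed
  then show ?thesis using False by (simp add: field_simps)
qed

lemma infdist_subspace_seminorm: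
  fixes M :: "'v::real_normed_vector set"
  assumes "subspace M"
  shows "infdist (x + y) M \<le> infdist x M + infdist y M"
    and "infdist (c *\<^sub>R x) M = \<bar>c\<bar> * infdist x M"
    and "infdist x M \<le> norm x"
proof -
  have ne: "M \<noteq> {}" using subspace_0[OF assms] by blast
  have "infdist (x + y) M - infdist y M \<le> infdist x M"
    unfolding infdist_notempty[OF ne, of x]
  proof (rule cINF_greatest[OF ne])
    fix a assume a: "a \<in> M"
    have "infdist (x + y) M - dist x a \<le> infdist y M"
      unfolding infdist_notempty[OF ne, of y]
    proof (rule cINF_greatest[OF ne])
      fix b assume "b \<in> M"
      then have "infdist (x + y) M \<le> dist (x + y) (a + b)" using a subspace_add[OF assms] infdist_le by blast
      then show "infdist (x + y) M - dist x a \<le> dist y b" using dist_triangle_add[of x y a b] by linarith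
    qed
    then show "infdist (x + y) M - infdist y M \<le> dist x a" by linarith
  qed
  then show "infdist (x + y) M \<le> infdist x M + infdist y M" by linarith
  show "infdist (c *\<^sub>R x) M = \<bar>c\<bar> * infdist x M"
  proof (cases "c = 0")
    case True then show ?thesis using subspace_0[OF assms] by simp
  next
    case False
    have "infdist x M \<le> \<bar>inverse c\<bar> * infdist (c *\<^sub>R x) M"
      using infdist_subspace_scale_le[OF assms, of "inverse c" "c *\<^sub>R x"] False by simp
    then have "\<bar>c\<bar> * infdist x M \<le> infdist (c *\<^sub>R x) M" using False by (simp add: field_simps abs_inverse)
    then show ?thesis using infdist_subspace_scale_le[OF assms, of c x] by simp
  qed
  show "infdist x M \<le> norm x" using infdist_le[OF subspace_0[OF assms], of x] by simp
qed

text \<open>The distance to a subspace is the seminorm of the quotient, so a functional dominated by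
  it lives on the quotient. It separates points from closed subspaces here and detects operators
  modulo an ideal later.\<close>

lemma functional_infdist:
  fixes M :: "'v::real_normed_vector set"
  assumes "subspace M"
  obtains h where "bounded_linear h" "h v = infdist v M" "\<And>x. \<bar>h x\<bar> \<le> infdist x M"
proof -
  obtain h where h: "linear h" "h v = infdist v M" "\<And>x. \<bar>h x\<bar> \<le> infdist x M"
    using seminorm_dominated_functional[of "\<lambda>x. infdist x M" v] infdist_subspace_seminorm[OF assms] by metis
  have "bounded_linear h"
    by (rule bounded_linear_intro[where K=1])
      (use h infdist_subspace_seminorm(3)[OF assms] in \<open>auto simp: linear_add linear_scale intro: order_trans\<close>)
  then show ?thesis using that h by blast
qed

lemma functional_separating:
  fixes M :: "'v::real_normed_vector set"
  assumes "subspace M" "closed M" "v \<notin> M"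
  obtains h :: "'v \<Rightarrow> real" where "bounded_linear h" "h v = 1" "\<And>x. x \<in> M \<Longrightarrow> h x = 0"
proof -
  obtain h where h: "bounded_linear h" "h v = infdist v M" "\<And>x. \<bar>h x\<bar> \<le> infdist x M"
    using functional_infdist[OF assms(1)] by blast
  have "infdist v M \<noteq> 0" using in_closed_iff_infdist_zero[OF assms(2)] subspace_0[OF assms(1)] assms(3) by blast
  moreover have "h x = 0" if "x \<in> M" for x using h(3)[of x] that by simp
  moreover have "bounded_linear (\<lambda>x. h x / infdist v M)"
    using bounded_linear_compose[OF bounded_linear_divide h(1)] .
  ultimately show ?thesis using that[of "\<lambda>x. h x / infdist v M"] h(2) by simp
qed

lemma functional_nonzero:
  fixes v :: "'v::real_normed_vector"
  assumes "v \<noteq> 0"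
  obtains h :: "'v \<Rightarrow> real" where "bounded_linear h" "h v = 1"
proof -
  obtain h :: "'v \<Rightarrow> real" where "bounded_linear h" "h v = 1"
    using functional_separating[OF subspace_single_0 closed_singleton, of v] assms by (metis singletonD)
  then show ?thesis using that by blast
qed

text \<open>A continuous functional that vanishes on \<open>M\<close> and is 1 at \<open>w\<close>
  reads off the coefficient of \<open>w\<close>, so the span is the preimage of \<open>M\<close>
  under a continuous map.\<close>

lemma closed_span_insert:
  fixes M :: "'v::real_normed_vector set"
  assumes "subspace M" "closed M"
  shows "closed (span (insert w M))"
proof (cases "w \<in> M")
  case True then show ?thesis using assms by (simp add: insert_absorb span_eq_iff[THEN iffD2])
next
  case False
  obtain h :: "'v \<Rightarrow> real" where h: "bounded_linear h" "h w = 1" "\<And>x. x \<in> M \<Longrightarrow> h x = 0"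
    using functional_separating[OF assms False] by blast
  have "span (insert w M) = (\<lambda>x. x - h x *\<^sub>R w) -` M"
  proof -
    have "x - k *\<^sub>R w \<in> M \<Longrightarrow> k = h x" for x k
      using h(3)[of "x - k *\<^sub>R w"] h(1,2) by (simp add: bounded_linear.linear linear_diff linear_scale)
    then show ?thesis using assms by (auto simp: span_breakdown_eq span_eq_iff[THEN iffD2])
  qed
  moreover have "continuous_on UNIV (\<lambda>x. x - h x *\<^sub>R w)"
    by (intro continuous_intros bounded_linear.continuous_on[OF h(1)])
  ultimately show ?thesis using assms(2) by (simp add: closed_vimage)
qed

lemma closed_span_Un_finite:
  fixes M :: "'v::real_normed_vector set"
  assumes "finite F" "subspace M" "closed M"
  shows "closed (span (M \<union> F))"
  using assms(1)
proof induction
  case empty then show ?case using assms by (simp add: span_eq_iff[THEN iffD2])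
next
  case (insert w F)
  have "span (M \<union> insert w F) = span (insert w (span (M \<union> F)))"
    by (simp only: Un_insert_right span_insert span_span)
  then show ?case using closed_span_insert[OF subspace_span insert.IH] by simp
qed

lemma closed_span_finite: "finite F \<Longrightarrow> closed (span (F :: 'v::real_normed_vector set))"
  using closed_span_Un_finite[of F "{0}"] by (simp add: subspace_single_0 span_insert_0)

text \<open>Geometric iteration: a map that solves its equation up to half the right-hand side solves
  it exactly. The open mapping theorem and the stability of invertibility and of surjectivity all
  come from this.\<close>
lemma solvable_if_approximately_solvable:
  fixes S :: "'b::banach \<Rightarrow> 'a::real_normed_vector"
  assumes S: "bounded_linear S" and D: "subspace D" "closed D" and R: "subspace R" "S ` D \<subseteq> R"
    and C: "C \<ge> 0"
    and approx: "\<And>y. y \<in> R \<Longrightarrow> \<exists>x\<in>D. norm x \<le> C * norm y \<and> norm (y - S x) \<le> norm y / 2"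
    and y: "y \<in> R"
  shows "\<exists>x\<in>D. S x = y \<and> norm x \<le> 2 * C * norm y"
proof -
  obtain g where g: "\<And>y. y \<in> R \<Longrightarrow> g y \<in> D \<and> norm (g y) \<le> C * norm y \<and> norm (y - S (g y)) \<le> norm y / 2"
    using approx by metis
  define r where "r n = ((\<lambda>y. y - S (g y)) ^^ n) y" for n
  have r0: "r 0 = y" and rS: "r (Suc n) = r n - S (g (r n))" for n by (simp_all add: r_def)
  have rR: "r n \<in> R" for n
    by (induction n) (use r0 y rS g R in \<open>auto intro!: subspace_diff\<close>)
  have rn: "norm (r n) \<le> norm y * (1/2)^n" for n
  proof (induction n)
    case (Suc n) then show ?case using g[OF rR[of n]] rS[of n] by simp
  qed (simp add: r0)
  have gn: "norm (g (r n)) \<le> C * norm y * (1/2)^n" for n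
    using g[OF rR[of n]] mult_left_mono[OF rn[of n] C] by (simp add: mult.assoc)
  have sm: "summable (\<lambda>n. C * norm y * (1/2::real)^n)"
    by (intro summable_mult summable_geometric) simp
  have smn: "summable (\<lambda>n. norm (g (r n)))"
    by (rule summable_comparison_test'[OF sm, of 0]) (use gn in auto)
  define x where "x = (\<Sum>n. g (r n))"
  have sums: "(\<lambda>n. g (r n)) sums x" unfolding x_def using summable_norm_cancel[OF smn] by (rule summable_sums)
  have "x \<in> D"
  proof (rule closed_sequentially[OF D(2)])
    show "(\<lambda>n. \<Sum>i<n. g (r i)) \<longlonglongrightarrow> x" using sums by (simp add: sums_def)
    show "\<And>n. (\<Sum>i<n. g (r i)) \<in> D" using g rR by (intro subspace_sum[OF D(1)]) blast
  qed
  moreover have "S x = y"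
  proof -
    have "(\<lambda>n. S (g (r n))) sums S x" using bounded_linear.sums[OF S sums] .
    moreover have "(\<lambda>n. r n - r (Suc n)) sums (r 0 - 0)"
    proof (rule telescope_sums')
      have "(\<lambda>n. norm y * (1/2)^n) \<longlonglongrightarrow> norm y * 0"
        by (rule tendsto_mult[OF tendsto_const LIMSEQ_power_zero]) simp
      then have "(\<lambda>n. norm y * (1/2)^n) \<longlonglongrightarrow> 0" by simp
      then show "r \<longlonglongrightarrow> 0" by (rule Lim_null_comparison[OF always_eventually[OF allI[OF rn]]])
    qed
    moreover have "r n - r (Suc n) = S (g (r n))" for n using rS[of n] by simp
    ultimately show ?thesis using sums_unique2 r0 by fastforce
  qed
  moreover have "norm x \<le> 2 * C * norm y"
  proof -
    have "norm x \<le> (\<Sum>n. norm (g (r n)))" unfolding x_def by (rule summable_norm[OF smn])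
    also have "\<dots> \<le> (\<Sum>n. C * norm y * (1/2::real)^n)" by (rule suminf_le[OF gn smn sm])
    also have "\<dots> = C * norm y * 2" by (subst suminf_mult) (auto simp: suminf_geometric)
    finally show ?thesis by simp
  qed
  ultimately show ?thesis by blast
qed

text \<open>Baire category in the closed image gives a ball in which images of bounded vectors are
  dense; the geometric iteration then replaces density by exact solutions. The closed subspace
  \<open>D\<close> is there for products such as UNIV times \<open>span F\<close> or
  \<open>M\<close> times \<open>N\<close>.\<close>

lemma open_mapping_closed_image:
  fixes S :: "'b::banach \<Rightarrow> 'a::banach"
  assumes S: "bounded_linear S" and D: "subspace D" "closed D" and cl: "closed (S ` D)"
  obtains C where "C > 0" "\<And>y. y \<in> S ` D \<Longrightarrow> \<exists>x\<in>D. S x = y \<and> norm x \<le> C * norm y"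
proof -
  define Y where "Y = S ` D"
  have sY: "subspace Y" unfolding Y_def using S D by (simp add: bounded_linear.linear linear_subspace_image)
  define A where "A n = closure (S ` (D \<inter> cball 0 (real n)))" for n
  have AY: "A n \<subseteq> Y" for n unfolding A_def Y_def using cl by (intro closure_minimal) auto
  have UA: "Y = \<Union>(range A)"
  proof
    show "Y \<subseteq> \<Union>(range A)"
    proof
      fix y assume "y \<in> Y"
      then obtain x where x: "x \<in> D" "y = S x" by (auto simp: Y_def)
      obtain n where "norm x \<le> real n" using real_arch_simple by blast
      then have "y \<in> A n" using x closure_subset unfolding A_def by fastforce
      then show "y \<in> \<Union>(range A)" by blast
    qed
  qed (use AY in blast)
  have "\<exists>n. (top_of_set Y) interior_of (A n) \<noteq> {}"
  proof (rule ccontr)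
    assume "\<not> ?thesis"
    then have none: "top_of_set Y interior_of A n = {}" for n by blast
    have "(top_of_set Y) interior_of (\<Union>(range A)) = {}"
    proof (intro Baire_category_alt)
      show "completely_metrizable_space (top_of_set Y) \<or> locally_compact_space (top_of_set Y) \<and> regular_space (top_of_set Y)"
        using cl completely_metrizable_space_euclidean completely_metrizable_space_closedin
        unfolding Y_def by (metis closed_closedin)
      fix T assume "T \<in> range A"
      then show "closedin (top_of_set Y) T \<and> top_of_set Y interior_of T = {}"
        using none AY by (auto simp: A_def intro!: closed_subset)
    qed simp
    then have "Y = {}" using UA by (metis interior_of_topspace topspace_euclidean_subtopology)
    then show False using subspace_0[OF sY] by blast
  qed
  then obtain n y0 where y0: "y0 \<in> (top_of_set Y) interior_of (A n)" by blast
  then obtain T where T: "openin (top_of_set Y) T" "y0 \<in> T" "T \<subseteq> A n" by (auto simp: interior_of_def)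
  then obtain W where W: "open W" "T = Y \<inter> W" by (auto simp: openin_open)
  then obtain r where r: "r > 0" "ball y0 r \<subseteq> W" using T(2) by (meson IntD2 openE)
  have y0Y: "y0 \<in> Y" using T W by blast
  have ballA: "y0 + y \<in> A n" if "y \<in> Y" "norm y < r" for y
  proof -
    have "y0 + y \<in> ball y0 r" using that by (simp add: dist_norm)
    then show ?thesis using T(3) W r subspace_add[OF sY y0Y that(1)] by blast
  qed
  \<comment> \<open>The dense ball is centred at \<open>y0\<close>; subtracting approximate
    preimages of \<open>y0 + y\<close> and of \<open>y0\<close> moves it to the origin and doubles
    the norm bound.\<close>
  have near: "\<exists>x\<in>D. norm x \<le> 2 * real n \<and> norm (y - S x) < e" if y: "y \<in> Y" "norm y < r" and e: "e > 0" for y e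
  proof -
    obtain u where u: "u \<in> D" "norm u \<le> real n" "dist (S u) (y0 + y) < e / 2"
      using ballA[OF y] half_gt_zero[OF e] unfolding A_def closure_approachable by fastforce
    obtain v where v: "v \<in> D" "norm v \<le> real n" "dist (S v) y0 < e / 2"
      using ballA[OF subspace_0[OF sY]] r(1) half_gt_zero[OF e] unfolding A_def closure_approachable by fastforce
    have "y - S (u - v) = (S v - y0) - (S u - (y0 + y))"
      using S by (simp add: bounded_linear.linear linear_diff)
    then have "norm (y - S (u - v)) \<le> norm (S v - y0) + norm (S u - (y0 + y))"
      using norm_triangle_ineq4[of "S v - y0" "S u - (y0 + y)"] by metis
    then have "norm (y - S (u - v)) < e"
      using u(3) v(3) by (simp add: dist_norm)
    moreover have "norm (u - v) \<le> 2 * real n" using u(2) v(2) norm_triangle_ineq4[of u v] by linarith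
    ultimately show ?thesis using subspace_diff[OF D(1) u(1) v(1)] by blast
  qed
  \<comment> \<open>A vector rescaled to norm r/2 is hit up to r/4, half its norm, by something of
    norm at most 2n; scaling back gives the factor 4n/r.\<close>
  define C where "C = 4 * real n / r"
  have C0: "C \<ge> 0" using r by (simp add: C_def)
  have approx: "\<exists>x\<in>D. norm x \<le> C * norm y \<and> norm (y - S x) \<le> norm y / 2" if y: "y \<in> Y" for y
  proof (cases "y = 0")
    case True
    then show ?thesis using subspace_0[OF D(1)] S by (auto simp: bounded_linear.linear linear_0)
  next
    case False
    define t where "t = r / (2 * norm y)"
    have t: "t > 0" using r False by (simp add: t_def)
    have "norm (t *\<^sub>R y) = r / 2" using r False by (simp add: t_def)
    then obtain x where x: "x \<in> D" "norm x \<le> 2 * real n" "norm (t *\<^sub>R y - S x) < r / 4"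
      using near[of "t *\<^sub>R y" "r/4"] subspace_scale[OF sY y] r by auto
    have "y - S (inverse t *\<^sub>R x) = inverse t *\<^sub>R (t *\<^sub>R y - S x)"
      using t S by (simp add: bounded_linear.linear linear_scale algebra_simps)
    then have "norm (y - S (inverse t *\<^sub>R x)) = inverse t * norm (t *\<^sub>R y - S x)" using t by simp
    also have "\<dots> \<le> inverse t * (r / 4)" using x(3) t by (intro mult_left_mono) auto
    also have "\<dots> = norm y / 2" using r False by (simp add: t_def field_simps)
    finally have "norm (y - S (inverse t *\<^sub>R x)) \<le> norm y / 2" .
    moreover have "norm (inverse t *\<^sub>R x) \<le> C * norm y"
    proof -
      have "norm (inverse t *\<^sub>R x) = inverse t * norm x" using t by simp
      also have "\<dots> \<le> inverse t * (2 * real n)" using x(2) t by (intro mult_left_mono) auto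
      also have "\<dots> = C * norm y" using r False by (simp add: t_def C_def field_simps)
      finally show ?thesis .
    qed
    ultimately show ?thesis using subspace_scale[OF D(1) x(1)] by blast
  qed
  show ?thesis
  proof (rule that[of "2 * C + 1"])
    fix y assume "y \<in> S ` D"
    then have y: "y \<in> Y" by (simp add: Y_def)
    obtain x where x: "x \<in> D" "S x = y" "norm x \<le> 2 * C * norm y"
      using solvable_if_approximately_solvable[OF S D sY _ C0 approx y] by (auto simp: Y_def)
    have "2 * C * norm y \<le> (2 * C + 1) * norm y" by (simp add: distrib_right)
    then show "\<exists>x\<in>D. S x = y \<and> norm x \<le> (2 * C + 1) * norm y" using x by force
  qed (use C0 in simp)
qed

section \<open>Semi-Fredholm operators and finite rank perturbations\<close>

lemma fin_dim_subset: "fin_dim T \<Longrightarrow> S \<subseteq> T \<Longrightarrow> fin_dim S"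
  unfolding fin_dim_def by blast

lemma fin_dim_basis:
  assumes "fin_dim K" "subspace K"
  obtains B where "finite B" "B \<subseteq> K" "independent B" "span B = K" "card B = dim K"
proof -
  obtain A where A: "finite A" "K \<subseteq> span A" using assms(1) unfolding fin_dim_def by blast
  obtain B where B: "B \<subseteq> K" "independent B" "K \<subseteq> span B" "card B = dim K"
    using real_vector.basis_exists by blast
  have "finite B" using real_vector.independent_span_bound[OF A(1) B(2)] A(2) B(1) by auto
  moreover have "span B = K" using B(1,3) assms(2) by (metis span_subspace)
  ultimately show ?thesis using that B by blast
qed

lemma dim_eq_0_iff:
  assumes "fin_dim K" "subspace K"
  shows "dim K = 0 \<longleftrightarrow> K = {0}"
proof
  assume d: "dim K = 0"
  obtain B where B: "finite B" "span B = K" "card B = dim K"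
    using fin_dim_basis[OF assms] by metis
  then have "B = {}" using d by simp
  then show "K = {0}" using B(2) by simp
next
  assume "K = {0}"
  then have "dim K \<le> card ({} :: 'a set)" by (intro real_vector.dim_le_card) auto
  then show "dim K = 0" by simp
qed

lemma subspace_kerM: "linear S \<Longrightarrow> subspace (kerM UNIV S)"
  unfolding kerM_def by (auto intro!: subspaceI simp: linear_0 linear_add linear_scale)

lemma subspace_range_linear: "linear S \<Longrightarrow> subspace (range S)"
  by (simp add: linear_subspace_image)

text \<open>Steinitz exchange modulo \<open>R\<close>: a vector of \<open>F\<close> that is really
  used in expressing \<open>v\<close> can be recovered from \<open>v\<close> and the rest. Every
  comparison of codimensions below counts vectors by means of it.\<close>

lemma span_exchange:
  fixes R :: "'v::real_vector set"
  assumes "finite F" "v \<in> span (R \<union> F)" "v \<notin> span R"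
  shows "\<exists>f\<in>F. f \<in> span (insert v (R \<union> (F - {f})))"
  using assms
proof (induction F)
  case (insert f F)
  show ?case
  proof (cases "v \<in> span (R \<union> F)")
    case True
    then obtain f' where f': "f' \<in> F" "f' \<in> span (insert v (R \<union> (F - {f'})))"
      using insert by blast
    have "span (insert v (R \<union> (F - {f'}))) \<subseteq> span (insert v (R \<union> (insert f F - {f'})))"
      by (intro span_mono) blast
    then show ?thesis using f' by blast
  next
    case False
    then have "f \<in> span (insert v (R \<union> F))"
      using in_span_insert[of v f "R \<union> F"] insert.prems by simp
    then show ?thesis using insert.hyps by (metis Diff_insert_absorb insertI1)
  qed
qed simp

lemma span_remove_redundant:
  assumes "span (R \<union> F) = UNIV" "f \<in> span (R' \<union> (F - {f}))" "R \<subseteq> span R'"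
  shows "span (R' \<union> (F - {f})) = UNIV"
proof -
  have "R \<union> F \<subseteq> span (R' \<union> (F - {f}))"
  proof
    fix x assume "x \<in> R \<union> F"
    moreover have "span R' \<subseteq> span (R' \<union> (F - {f}))" by (intro span_mono) blast
    ultimately show "x \<in> span (R' \<union> (F - {f}))"
      using assms(2,3) by (cases "x = f") (auto intro: span_base)
  qed
  then have "span (R \<union> F) \<subseteq> span (R' \<union> (F - {f}))" by (simp add: span_minimal)
  then show ?thesis using assms(1) by blast
qed

text \<open>The open mapping theorem turns the closed range into a norm estimate, and completeness
  gives the converse. The estimate is the form that survives small perturbations and
  composition.\<close>

lemma bounded_below_iff:
  fixes S :: "'a::banach \<Rightarrow> 'a"
  assumes S: "bounded_linear S"
  shows "bounded_belowM UNIV S \<longleftrightarrow> (\<exists>c>0. \<forall>x. c * norm x \<le> norm (S x))"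
proof
  assume bb: "bounded_belowM UNIV S"
  then have inj: "inj S" and cl: "closed (range S)" by (auto simp: bounded_belowM_def)
  obtain C where C: "C > 0" "\<And>y. y \<in> range S \<Longrightarrow> \<exists>x\<in>UNIV. S x = y \<and> norm x \<le> C * norm y"
    using open_mapping_closed_image[OF S subspace_UNIV closed_UNIV cl] by blast
  have "inverse C * norm x \<le> norm (S x)" for x
  proof -
    obtain x' where "S x' = S x" "norm x' \<le> C * norm (S x)" using C(2)[of "S x"] by blast
    then have "norm x \<le> C * norm (S x)" using inj by (metis injD)
    then show ?thesis using C(1) by (simp add: field_simps)
  qed
  then show "\<exists>c>0. \<forall>x. c * norm x \<le> norm (S x)" using C(1) by (meson positive_imp_inverse_positive)
next
  assume "\<exists>c>0. \<forall>x. c * norm x \<le> norm (S x)"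
  then obtain c where c: "c > 0" "\<And>x. c * norm x \<le> norm (S x)" by blast
  have "x = 0" if "S x = 0" for x using c(2)[of x] c(1) that by (simp add: mult_le_0_iff)
  then have "inj S" using S by (simp add: bounded_linear.linear linear_injective_0)
  moreover have "complete (range S)"
    by (rule complete_isometric_image[OF c(1) subspace_UNIV S]) (use c(2) complete_UNIV in auto)
  ultimately show "bounded_belowM UNIV S" by (simp add: bounded_belowM_def complete_imp_closed)
qed

lemma surj_bound:
  fixes S :: "'a::banach \<Rightarrow> 'a"
  assumes S: "bounded_linear S" and "surj S"
  obtains C where "C > 0" "\<And>y. \<exists>x. S x = y \<and> norm x \<le> C * norm y"
  using open_mapping_closed_image[OF S subspace_UNIV closed_UNIV] assms(2) by auto

text \<open>\<open>Y\<close> and \<open>Y\<close> plus the kernel have the same image, and the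
  latter space is closed because the kernel is finite dimensional. Being saturated for
  \<open>S\<close>, it contains the preimages, supplied with norm control by the open mapping
  theorem, of a convergent sequence of images.\<close>

lemma closed_image_subspace:
  fixes S :: "'a::banach \<Rightarrow> 'a"
  assumes S: "bounded_linear S" and up: "upper_semiFredholmM UNIV S" and Y: "subspace Y" "closed Y"
  shows "closed (S ` Y)"
proof -
  have lin: "linear S" using S by (rule bounded_linear.linear)
  have cl: "closed (range S)" and fd: "fin_dim (kerM UNIV S)"
    using up by (auto simp: upper_semiFredholmM_def)
  obtain B where B: "finite B" "B \<subseteq> kerM UNIV S" "span B = kerM UNIV S"
    using fin_dim_basis[OF fd subspace_kerM[OF lin]] by metis
  define Z where "Z = span (Y \<union> B)"
  have Zcl: "closed Z" unfolding Z_def by (rule closed_span_Un_finite[OF B(1) Y])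
  have SZ: "S ` Z = S ` Y"
  proof
    show "S ` Z \<subseteq> S ` Y"
    proof
      fix y assume "y \<in> S ` Z"
      then obtain a b where "a \<in> span Y" "b \<in> span B" "y = S (a + b)"
        unfolding Z_def span_Un by blast
      then show "y \<in> S ` Y" using B(3) Y(1) lin
        by (auto simp: kerM_def linear_add span_eq_iff[THEN iffD2])
    qed
  qed (auto simp: Z_def span_base)
  have sat: "x \<in> Z" if "S x \<in> S ` Y" for x
  proof -
    obtain y where "y \<in> Y" "S x = S y" using \<open>S x \<in> S ` Y\<close> by blast
    then have "x - y \<in> span B" using B(3) lin by (simp add: kerM_def linear_diff)
    then have "y + (x - y) \<in> span (Y \<union> B)"
      by (intro span_add) (use \<open>y \<in> Y\<close> span_mono[of B "Y \<union> B"] in \<open>auto intro: span_base\<close>)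
    then show ?thesis by (simp add: Z_def)
  qed
  obtain C where C: "C > 0" "\<And>y. y \<in> range S \<Longrightarrow> \<exists>x\<in>UNIV. S x = y \<and> norm x \<le> C * norm y"
    using open_mapping_closed_image[OF S subspace_UNIV closed_UNIV cl] by blast
  show ?thesis
    unfolding closed_sequential_limits
  proof (intro allI impI, elim conjE)
    fix y l assume y: "\<forall>n. y n \<in> S ` Y" and lim: "y \<longlonglongrightarrow> l"
    have "l \<in> range S" by (rule closed_sequentially[OF cl _ lim]) (use y in blast)
    then obtain x where x: "l = S x" by blast
    have "\<exists>z. S z = y n - l \<and> norm z \<le> C * norm (y n - l)" for n
    proof -
      obtain u where "y n = S u" using y by blast
      then have "y n - l = S (u - x)" using x lin by (simp add: linear_diff)
      then have "y n - l \<in> range S" by blast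
      then show ?thesis using C(2) by blast
    qed
    then obtain z where z: "\<And>n. S (z n) = y n - l" "\<And>n. norm (z n) \<le> C * norm (y n - l)" by metis
    have "(\<lambda>n. C * norm (y n - l)) \<longlonglongrightarrow> C * 0"
      by (intro tendsto_mult tendsto_const tendsto_norm_zero LIM_zero lim)
    then have "(\<lambda>n. C * norm (y n - l)) \<longlonglongrightarrow> 0" by simp
    then have "z \<longlonglongrightarrow> 0" by (rule Lim_null_comparison[OF always_eventually[OF allI[OF z(2)]]])
    then have "(\<lambda>n. x + z n) \<longlonglongrightarrow> x" using tendsto_add[OF tendsto_const[of x]] by fastforce
    moreover have "x + z n \<in> Z" for n
    proof (rule sat)
      have "S (x + z n) = y n" using z(1) x lin by (simp add: linear_add)
      then show "S (x + z n) \<in> S ` Y" using y by simp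
    qed
    ultimately have "x \<in> Z" using closed_sequentially[OF Zcl, of "\<lambda>n. x + z n" x] by blast
    then show "l \<in> S ` Y" using SZ x by blast
  qed
qed

text \<open>Kato: the range together with an algebraic complement W of finite dimension gives a
  surjection from the product with W, and openness of the latter forces limits back into the range.\<close>
lemma closed_range_if_fin_codim:
  fixes S :: "'a::banach \<Rightarrow> 'a"
  assumes S: "bounded_linear S" and low: "lower_semiFredholmM UNIV S"
  shows "closed (range S)"
proof -
  have lin: "linear S" using S by (rule bounded_linear.linear)
  define P where "P F \<longleftrightarrow> finite F \<and> span (range S \<union> F) = UNIV" for F
  have "\<exists>F. P F" using low unfolding lower_semiFredholmM_def fin_codim_def P_def by blast
  then obtain F where F: "P F" and min: "\<And>F'. P F' \<Longrightarrow> card F \<le> card F'"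
    using ex_has_least_nat[of P _ card] by metis
  have finF: "finite F" and spF: "span (range S \<union> F) = UNIV" using F by (auto simp: P_def)
  \<comment> \<open>Minimality of \<open>F\<close> makes its span an algebraic complement: a nonzero
    vector of the range in \<open>span F\<close> could replace an element of
    \<open>F\<close>.\<close>
  have indep: "w = 0" if w: "w \<in> span F" "w \<in> range S" for w
  proof (rule ccontr)
    assume "w \<noteq> 0"
    then obtain f where f: "f \<in> F" "f \<in> span (insert w ({} \<union> (F - {f})))"
      using span_exchange[of F w "{}"] finF w(1) by auto
    have "span (insert w (F - {f})) \<subseteq> span (range S \<union> (F - {f}))"
      using w(2) by (intro span_mono) blast
    then have "P (F - {f})"
      using span_remove_redundant[OF spF, of f "range S"] f finF by (auto simp: P_def span_superset)
    then show False using min[of "F - {f}"] f(1) finF using card_Diff1_less[OF finF f(1)] by simp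
  qed
  define D where "D = (UNIV :: 'a set) \<times> span F"
  define G where "G = (\<lambda>p :: 'a \<times> 'a. S (fst p) + snd p)"
  have G: "bounded_linear G" unfolding G_def
    by (intro bounded_linear_add bounded_linear_compose[OF S] bounded_linear_fst bounded_linear_snd)
  have D: "subspace D" "closed D" unfolding D_def
    by (auto intro!: subspace_Times closed_Times closed_span_finite[OF finF])
  have GD: "G ` D = UNIV"
  proof -
    have "y \<in> G ` D" for y
    proof -
      obtain a b where "a \<in> span (range S)" "b \<in> span F" "y = a + b"
        using spF unfolding span_Un by blast
      moreover have "span (range S) = range S" using lin by (simp add: linear_subspace_image span_eq_iff[THEN iffD2])
      ultimately show ?thesis unfolding G_def D_def by force
    qed
    then show ?thesis by blast
  qed
  obtain C where C: "C > 0" "\<And>y. y \<in> G ` D \<Longrightarrow> \<exists>x\<in>D. G x = y \<and> norm x \<le> C * norm y"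
    using open_mapping_closed_image[OF G D] GD by auto
  show ?thesis
    unfolding closed_sequential_limits
  proof (intro allI impI, elim conjE)
    fix y l assume y: "\<forall>n. y n \<in> range S" and lim: "y \<longlonglongrightarrow> l"
    have "l \<in> G ` D" using GD by simp
    then obtain x w where xw: "w \<in> span F" "l = S x + w" unfolding G_def D_def by auto
    \<comment> \<open>Solving \<open>G p = y n - l\<close> with norm control, the second component
      of \<open>p\<close> is forced to be \<open>- w\<close> by \<open>indep\<close>. So
      \<open>w\<close> is bounded by quantities tending to 0.\<close>
    have "norm w \<le> C * norm (y n - l)" for n
    proof -
      obtain p where p: "p \<in> D" "G p = y n - l" "norm p \<le> C * norm (y n - l)" using C(2)[of "y n - l"] GD by auto
      obtain a b where ab: "p = (a, b)" by fastforce
      obtain u where u: "y n = S u" using y by blast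
      have "b + w = S (u - x - a)"
        using p(2) ab u xw(2) unfolding G_def by (simp add: linear_diff[OF lin] linear_add[OF lin] algebra_simps)
      moreover have "b + w \<in> span F" using p(1) ab xw(1) unfolding D_def by (auto intro: span_add)
      ultimately have "b + w = 0" using indep by blast
      then have "norm w = norm b" by (metis add.inverse_unique norm_minus_cancel)
      then show ?thesis using p(3) ab norm_snd_le[of b a] by simp
    qed
    moreover have "(\<lambda>n. C * norm (y n - l)) \<longlonglongrightarrow> C * 0"
      by (intro tendsto_mult tendsto_const tendsto_norm_zero LIM_zero lim)
    ultimately have "norm w \<le> C * 0" by (intro tendsto_lowerbound[where F=sequentially]) auto
    then show "l \<in> range S" using xw(2) by simp
  qed
qed

text \<open>Only real linearity is asked: the rank one maps used as corrections are built from real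
  functionals and in general do not commute with \<open>J\<close>.\<close>

definition finite_rank :: "('a::real_normed_vector \<Rightarrow> 'a) \<Rightarrow> bool" where
  "finite_rank F \<longleftrightarrow> bounded_linear F \<and> fin_dim (range F)"

lemma finite_rank_zero: "finite_rank (\<lambda>x. 0)"
  unfolding finite_rank_def fin_dim_def by (auto intro!: bounded_linear_zero exI[of _ "{}"])

lemma finite_rank_rank_one: "bounded_linear h \<Longrightarrow> finite_rank (\<lambda>x. h x *\<^sub>R w)"
  unfolding finite_rank_def fin_dim_def
  by (auto intro!: bounded_linear_scaleR_const exI[of _ "{w}"] simp: span_scale span_base)

lemma finite_rank_add:
  assumes "finite_rank F" "finite_rank G" shows "finite_rank (\<lambda>x. F x + G x)"
proof -
  obtain A B where A: "finite A" "range F \<subseteq> span A" and B: "finite B" "range G \<subseteq> span B"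
    using assms unfolding finite_rank_def fin_dim_def by blast
  have "range (\<lambda>x. F x + G x) \<subseteq> span (A \<union> B)"
    using A(2) B(2) span_mono[of A "A \<union> B"] span_mono[of B "A \<union> B"] by (auto intro!: span_add)
  then show ?thesis using assms A B unfolding finite_rank_def fin_dim_def
    by (auto intro!: bounded_linear_add exI[of _ "A \<union> B"])
qed

lemma finite_rank_comp_left:
  assumes "bounded_linear A" "finite_rank F" shows "finite_rank (\<lambda>x. A (F x))"
proof -
  obtain B where B: "finite B" "range F \<subseteq> span B" using assms unfolding finite_rank_def fin_dim_def by blast
  have "range (\<lambda>x. A (F x)) \<subseteq> A ` span B" using B(2) by blast
  also have "\<dots> = span (A ` B)" by (rule linear_span_image[OF bounded_linear.linear[OF assms(1)], symmetric])
  finally have "fin_dim (range (\<lambda>x. A (F x)))" using B(1) unfolding fin_dim_def by blast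
  moreover have "bounded_linear (\<lambda>x. A (F x))"
    using assms by (intro bounded_linear_compose[of A F]) (auto simp: finite_rank_def)
  ultimately show ?thesis by (simp add: finite_rank_def)
qed

lemma finite_rank_comp_right:
  assumes "bounded_linear A" "finite_rank F" shows "finite_rank (\<lambda>x. F (A x))"
  using assms fin_dim_subset[of "range F" "range (\<lambda>x. F (A x))"]
  unfolding finite_rank_def by (auto intro: bounded_linear_compose)

lemma finite_rank_scaleR: "finite_rank F \<Longrightarrow> finite_rank (\<lambda>x. c *\<^sub>R F x)"
  by (rule finite_rank_comp_left[where A="\<lambda>x. c *\<^sub>R x"]) (rule bounded_linear_scaleR_right)

lemma finite_rank_minus: "finite_rank F \<Longrightarrow> finite_rank (\<lambda>x. - F x)"
  using finite_rank_scaleR[of F "-1"] by simp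

text \<open>A functional that vanishes on all but one of the spanning vectors peels off the
  component along that one, which is a rank one operator. So stability has to be checked for rank
  one perturbations only.\<close>

lemma finite_rank_perturbation_induct:
  fixes F S :: "'a::real_normed_vector \<Rightarrow> 'a"
  assumes F: "finite_rank F" and S: "bounded_linear S" "Q S"
    and step: "\<And>S h w. bounded_linear S \<Longrightarrow> Q S \<Longrightarrow> bounded_linear h \<Longrightarrow> Q (\<lambda>x. S x + h x *\<^sub>R w)"
  shows "Q (\<lambda>x. S x + F x)"
proof -
  have "Q (\<lambda>x. S x + F x)" if "finite B" "bounded_linear F" "range F \<subseteq> span B" for B F
    using that
  proof (induction B arbitrary: F)
    case empty
    then have "F = (\<lambda>x. 0)" by (auto simp: image_subset_iff)
    then show ?case using S(2) by simp
  next
    case (insert b B)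
    show ?case
    proof (cases "b \<in> span B")
      case True then show ?thesis using insert by (simp add: span_redundant)
    next
      case False
      obtain g :: "'a \<Rightarrow> real" where g: "bounded_linear g" "g b = 1" "\<And>x. x \<in> span B \<Longrightarrow> g x = 0"
        using functional_separating[OF subspace_span closed_span_finite[OF insert.hyps(1)] False] by blast
      define h where "h x = g (F x)" for x
      define F1 where "F1 x = F x - h x *\<^sub>R b" for x
      have h: "bounded_linear h" unfolding h_def by (rule bounded_linear_compose[OF g(1) insert.prems(1)])
      have F1: "bounded_linear F1" unfolding F1_def
        by (intro bounded_linear_sub insert.prems bounded_linear_scaleR_const h)
      have "F1 x \<in> span B" for x
      proof -
        obtain k where k: "F x - k *\<^sub>R b \<in> span B"
          using insert.prems(2) by (metis rangeI span_breakdown_eq subset_eq)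
        then have "h x = k" using g(3)[OF k] g(1,2) unfolding h_def by (simp add: bounded_linear.linear linear_diff linear_scale)
        then show ?thesis using k by (simp add: F1_def)
      qed
      then have "Q (\<lambda>x. S x + F1 x)" using insert.IH[OF F1] by blast
      then have "Q (\<lambda>x. (S x + F1 x) + h x *\<^sub>R b)" by (intro step bounded_linear_add S(1) F1 h)
      then show ?thesis by (simp add: F1_def)
    qed
  qed
  then show ?thesis using F unfolding finite_rank_def fin_dim_def by blast
qed

text \<open>These are the two halves of "the index vanishes", phrased with real dimensions so that
  arbitrary real-linear finite rank perturbations can be used.\<close>
definition index_nonpos :: "('a::real_vector \<Rightarrow> 'a) \<Rightarrow> bool" where
  "index_nonpos S \<longleftrightarrow> (\<forall>F. finite F \<longrightarrow> span (range S \<union> F) = UNIV \<longrightarrow> dim (kerM UNIV S) \<le> card F)"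

definition index_nonneg :: "('a::real_vector \<Rightarrow> 'a) \<Rightarrow> bool" where
  "index_nonneg S \<longleftrightarrow> (fin_dim (kerM UNIV S) \<longrightarrow>
     (\<exists>F. finite F \<and> card F \<le> dim (kerM UNIV S) \<and> span (range S \<union> F) = UNIV))"

text \<open>Passing from the hyperplane \<open>H\<close> to the whole space adds one dimension.
  Either the image of \<open>u\<close> was already reached from \<open>H\<close> and the kernel
  gains a vector, or the image is new and the kernel stays inside \<open>H\<close>.\<close>

lemma hyperplane_cases:
  fixes S :: "'a::real_vector \<Rightarrow> 'a" and h :: "'a \<Rightarrow> real"
  assumes S: "linear S" and h: "linear h" and u: "h u = 1"
  defines "H \<equiv> {x. h x = 0}"
  obtains (1) v where "S v = 0" "h v = 1" "range S = S ` H"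
    | (2) "S u \<notin> span (S ` H)" "kerM UNIV S \<subseteq> H" "range S = span (insert (S u) (S ` H))"
proof (cases "S u \<in> S ` H")
  case True
  then obtain y where y: "h y = 0" "S u = S y" by (auto simp: H_def)
  have v: "S (u - y) = 0" "h (u - y) = 1" using y u S h by (simp_all add: linear_diff)
  have "S x \<in> S ` H" for x
  proof
    show "S x = S (x - h x *\<^sub>R (u - y))" using v S by (simp add: linear_diff linear_scale)
    show "x - h x *\<^sub>R (u - y) \<in> H"
      using linear_diff[OF h, of x "h x *\<^sub>R (u - y)"] linear_scale[OF h, of "h x" "u - y"] v(2) by (simp add: H_def)
  qed
  then show ?thesis using 1 v by blast
next
  case False
  have subH: "subspace H" unfolding H_def using h by (auto intro!: subspaceI simp: linear_0 linear_add linear_scale)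
  then have subSH: "subspace (S ` H)" using S by (simp add: linear_subspace_image)
  have "x \<in> H" if "S x = 0" for x
  proof (rule ccontr)
    assume "x \<notin> H"
    then have hx: "h x \<noteq> 0" by (simp add: H_def)
    have "S (u - inverse (h x) *\<^sub>R x) = S u" using that S by (simp add: linear_diff linear_scale)
    moreover have "u - inverse (h x) *\<^sub>R x \<in> H" using hx h u by (simp add: H_def linear_diff linear_scale)
    ultimately show False using False by (metis imageI)
  qed
  moreover have "range S = span (insert (S u) (S ` H))"
  proof
    show "range S \<subseteq> span (insert (S u) (S ` H))"
    proof
      fix y assume "y \<in> range S"
      then obtain x where x: "y = S x" by blast
      have "S (x - h x *\<^sub>R u) \<in> S ` H" using h u by (simp add: H_def linear_diff linear_scale)
      then have "y - h x *\<^sub>R S u \<in> span (S ` H)" using S x by (simp add: linear_diff linear_scale span_base)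
      then show "y \<in> span (insert (S u) (S ` H))" unfolding span_breakdown_eq by blast
    qed
    show "span (insert (S u) (S ` H)) \<subseteq> range S"
      by (rule span_minimal[OF _ subspace_range_linear[OF S]]) auto
  qed
  ultimately show ?thesis using 2 False subSH by (auto simp: kerM_def span_eq_iff[THEN iffD2])
qed

lemma kerM_hyperplane:
  fixes S :: "'a::real_vector \<Rightarrow> 'a" and h :: "'a \<Rightarrow> real"
  assumes S: "linear S" and h: "linear h" and v: "S v = 0" "h v = 1"
    and fd: "fin_dim (kerM {x. h x = 0} S)"
  shows "fin_dim (kerM UNIV S)" and "dim (kerM UNIV S) = Suc (dim (kerM {x. h x = 0} S))"
proof -
  define K where "K = kerM {x. h x = 0} S"
  have sK: "subspace K" unfolding K_def kerM_def
    using S h by (auto intro!: subspaceI simp: linear_0 linear_add linear_scale)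
  obtain B where B: "finite B" "B \<subseteq> K" "independent B" "span B = K" "card B = dim K"
    using fin_dim_basis[OF _ sK] fd unfolding K_def by blast
  have vK: "v \<notin> K" using v(2) by (simp add: K_def kerM_def)
  have sub: "kerM UNIV S \<subseteq> span (insert v B)"
  proof
    fix x assume "x \<in> kerM UNIV S"
    then have "x - h x *\<^sub>R v \<in> span B"
      using v S h B(4) by (simp add: K_def kerM_def linear_diff linear_scale)
    then show "x \<in> span (insert v B)" unfolding span_breakdown_eq by blast
  qed
  then show "fin_dim (kerM UNIV S)" unfolding fin_dim_def using B(1) by blast
  have "dim (kerM UNIV S) = card (insert v B)"
  proof (rule real_vector.basis_card_eq_dim[symmetric])
    show "insert v B \<subseteq> kerM UNIV S" using v(1) B(2) by (auto simp: K_def kerM_def)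
    show "independent (insert v B)" using B(3,4) vK by (simp add: independent_insertI)
  qed (rule sub)
  then show "dim (kerM UNIV S) = Suc (dim (kerM {x. h x = 0} S))"
    using B vK by (metis K_def card_insert_disjoint subset_eq)
qed

lemma hyperplane_fin_dim_iff:
  fixes S :: "'a::real_vector \<Rightarrow> 'a" and h :: "'a \<Rightarrow> real"
  assumes S: "linear S" and h: "linear h" and u: "h u = 1"
  shows "fin_dim (kerM UNIV S) \<longleftrightarrow> fin_dim (kerM {x. h x = 0} S)"
proof
  assume "fin_dim (kerM UNIV S)"
  then show "fin_dim (kerM {x. h x = 0} S)" by (rule fin_dim_subset) (auto simp: kerM_def)
next
  assume fd: "fin_dim (kerM {x. h x = 0} S)"
  from hyperplane_cases[OF S h u] show "fin_dim (kerM UNIV S)"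
  proof cases
    case (1 v) then show ?thesis using kerM_hyperplane[OF S h _ _ fd] by blast
  next
    case 2
    then have "kerM UNIV S = kerM {x. h x = 0} S" by (auto simp: kerM_def)
    then show ?thesis using fd by simp
  qed
qed

text \<open>Restricting to a hyperplane lowers the index by one, whatever the operator does.\<close>
lemma index_nonpos_hyperplane_iff:
  fixes S :: "'a::real_vector \<Rightarrow> 'a" and h :: "'a \<Rightarrow> real"
  assumes S: "linear S" and h: "linear h" and u: "h u = 1" and fd: "fin_dim (kerM UNIV S)"
  shows "index_nonpos S \<longleftrightarrow> (\<forall>F. finite F \<longrightarrow> span (S ` {x. h x = 0} \<union> F) = UNIV \<longrightarrow>
      Suc (dim (kerM {x. h x = 0} S)) \<le> card F)" (is "_ \<longleftrightarrow> ?R")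
proof -
  have fd0: "fin_dim (kerM {x. h x = 0} S)" using hyperplane_fin_dim_iff[OF S h u] fd by blast
  from hyperplane_cases[OF S h u] show ?thesis
  proof cases
    case (1 v)
    then show ?thesis unfolding index_nonpos_def using kerM_hyperplane(2)[OF S h _ _ fd0] by simp
  next
    case 2
    then have K: "kerM UNIV S = kerM {x. h x = 0} S" by (auto simp: kerM_def)
    show ?thesis
    proof
      assume i: "index_nonpos S"
      show ?R
      proof (intro allI impI)
        fix F assume F: "finite F" "span (S ` {x. h x = 0} \<union> F) = UNIV"
        then obtain f where f: "f \<in> F" "f \<in> span (insert (S u) (S ` {x. h x = 0} \<union> (F - {f})))"
          using span_exchange[of F "S u"] 2(1) by blast
        have "span (range S \<union> (F - {f})) = UNIV"
        proof (rule span_remove_redundant[OF F(2)])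
          have "insert (S u) (S ` {x. h x = 0} \<union> (F - {f})) \<subseteq> range S \<union> (F - {f})" by blast
          then show "f \<in> span (range S \<union> (F - {f}))" using f(2) span_mono by blast
          show "S ` {x. h x = 0} \<subseteq> span (range S)" by (auto intro: span_base)
        qed
        then have "dim (kerM UNIV S) \<le> card (F - {f})" using i F(1) unfolding index_nonpos_def by blast
        then show "Suc (dim (kerM {x. h x = 0} S)) \<le> card F"
          using K card_Suc_Diff1[OF F(1) f(1)] by simp
      qed
    next
      assume r: ?R
      show "index_nonpos S" unfolding index_nonpos_def
      proof (intro allI impI)
        fix F assume F: "finite F" "span (range S \<union> F) = UNIV"
        have "range S \<union> F \<subseteq> span (S ` {x. h x = 0} \<union> insert (S u) F)"
          unfolding 2(3) using span_mono[of "insert (S u) (S ` {x. h x = 0})" "S ` {x. h x = 0} \<union> insert (S u) F"]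
          by (auto intro: span_base)
        then have "span (S ` {x. h x = 0} \<union> insert (S u) F) = UNIV"
          using F(2) by (metis span_minimal subspace_span top.extremum_uniqueI)
        then have "Suc (dim (kerM {x. h x = 0} S)) \<le> card (insert (S u) F)" using r F(1) by blast
        also have "\<dots> \<le> Suc (card F)" using F(1) by (simp add: card_insert_if)
        finally show "dim (kerM UNIV S) \<le> card F" using K by simp
      qed
    qed
  qed
qed

text \<open>The same shift by one for the other sign, read as an upper bound on the number of
  missing vectors: leaving out \<open>u\<close> either removes one dimension of the kernel or adds
  one missing vector.\<close>

lemma index_nonneg_hyperplane_iff:
  fixes S :: "'a::real_vector \<Rightarrow> 'a" and h :: "'a \<Rightarrow> real"
  assumes S: "linear S" and h: "linear h" and u: "h u = 1"
  shows "index_nonneg S \<longleftrightarrow> (fin_dim (kerM {x. h x = 0} S) \<longrightarrow>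
    (\<exists>F. finite F \<and> card F \<le> Suc (dim (kerM {x. h x = 0} S)) \<and> span (S ` {x. h x = 0} \<union> F) = UNIV))"
    (is "_ \<longleftrightarrow> ?R")
proof (cases "fin_dim (kerM {x. h x = 0} S)")
  case False
  then show ?thesis unfolding index_nonneg_def using hyperplane_fin_dim_iff[OF S h u] by blast
next
  case fd0: True
  then have fd: "fin_dim (kerM UNIV S)" using hyperplane_fin_dim_iff[OF S h u] by blast
  from hyperplane_cases[OF S h u] show ?thesis
  proof cases
    case (1 v)
    then show ?thesis unfolding index_nonneg_def using kerM_hyperplane(2)[OF S h _ _ fd0] fd fd0 by simp
  next
    case 2
    then have K: "kerM UNIV S = kerM {x. h x = 0} S" by (auto simp: kerM_def)
    show ?thesis
    proof
      assume "index_nonneg S"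
      then obtain F where F: "finite F" "card F \<le> dim (kerM UNIV S)" "span (range S \<union> F) = UNIV"
        using fd unfolding index_nonneg_def by blast
      have "range S \<union> F \<subseteq> span (S ` {x. h x = 0} \<union> insert (S u) F)"
        unfolding 2(3) using span_mono[of "insert (S u) (S ` {x. h x = 0})" "S ` {x. h x = 0} \<union> insert (S u) F"]
        by (auto intro: span_base)
      then have "span (S ` {x. h x = 0} \<union> insert (S u) F) = UNIV"
        using F(3) by (metis span_minimal subspace_span top.extremum_uniqueI)
      moreover have "card (insert (S u) F) \<le> Suc (dim (kerM {x. h x = 0} S))"
        using F(1,2) K by (simp add: card_insert_if)
      ultimately show ?R using F(1) by (meson finite_insert)
    next
      assume ?R
      then obtain F where F: "finite F" "card F \<le> Suc (dim (kerM {x. h x = 0} S))"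
          "span (S ` {x. h x = 0} \<union> F) = UNIV" using fd0 by blast
      then obtain f where f: "f \<in> F" "f \<in> span (insert (S u) (S ` {x. h x = 0} \<union> (F - {f})))"
        using span_exchange[of F "S u"] 2(1) by blast
      have "span (range S \<union> (F - {f})) = UNIV"
      proof (rule span_remove_redundant[OF F(3)])
        have "insert (S u) (S ` {x. h x = 0} \<union> (F - {f})) \<subseteq> range S \<union> (F - {f})" by blast
        then show "f \<in> span (range S \<union> (F - {f}))" using f(2) span_mono by blast
        show "S ` {x. h x = 0} \<subseteq> span (range S)" by (auto intro: span_base)
      qed
      moreover have "card (F - {f}) \<le> dim (kerM UNIV S)"
        using K F(2) card_Suc_Diff1[OF F(1) f(1)] by simp
      ultimately show "index_nonneg S" unfolding index_nonneg_def using F(1) by (meson finite_Diff)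
    qed
  qed
qed

text \<open>The right-hand sides see \<open>S\<close> only on the hyperplane where \<open>h\<close>
  vanishes. Adding a rank one operator \<open>h x *\<^sub>R w\<close> changes nothing there, which
  is the purpose of all these characterizations.\<close>

lemma semiFredholm_hyperplane_iff:
  fixes S :: "'a::banach \<Rightarrow> 'a" and h :: "'a \<Rightarrow> real"
  assumes S: "bounded_linear S" and h: "bounded_linear h" and u: "h u = 1"
  shows "upper_semiFredholmM UNIV S \<longleftrightarrow> fin_dim (kerM {x. h x = 0} S) \<and> closed (S ` {x. h x = 0})"
    and "lower_semiFredholmM UNIV S \<longleftrightarrow> (\<exists>F. finite F \<and> span (S ` {x. h x = 0} \<union> F) = UNIV)"
proof -
  have lin: "linear S" "linear h" using S h by (auto intro: bounded_linear.linear)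
  have H: "subspace {x. h x = 0}" "closed {x. h x = 0}"
    using lin(2) bounded_linear.continuous_on[OF h continuous_on_id]
    by (auto intro!: subspaceI closed_Collect_eq continuous_intros simp: linear_0 linear_add linear_scale)
  have SH: "subspace (S ` {x. h x = 0})" using lin(1) H(1) by (simp add: linear_subspace_image)
  show "upper_semiFredholmM UNIV S \<longleftrightarrow> fin_dim (kerM {x. h x = 0} S) \<and> closed (S ` {x. h x = 0})"
  proof
    assume "upper_semiFredholmM UNIV S"
    then show "fin_dim (kerM {x. h x = 0} S) \<and> closed (S ` {x. h x = 0})"
      using closed_image_subspace[OF S _ H] hyperplane_fin_dim_iff[OF lin u]
      by (auto simp: upper_semiFredholmM_def)
  next
    assume r: "fin_dim (kerM {x. h x = 0} S) \<and> closed (S ` {x. h x = 0})"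
    from hyperplane_cases[OF lin u] have "closed (range S)"
    proof cases
      case (1 v) then show ?thesis using r by simp
    next
      case 2 then show ?thesis using closed_span_insert[OF SH] r by simp
    qed
    then show "upper_semiFredholmM UNIV S" using r hyperplane_fin_dim_iff[OF lin u]
      by (simp add: upper_semiFredholmM_def)
  qed
  show "lower_semiFredholmM UNIV S \<longleftrightarrow> (\<exists>F. finite F \<and> span (S ` {x. h x = 0} \<union> F) = UNIV)"
  proof
    assume "lower_semiFredholmM UNIV S"
    then obtain F where F: "finite F" "span (range S \<union> F) = UNIV"
      unfolding lower_semiFredholmM_def fin_codim_def by blast
    have "S x \<in> span (S ` {x. h x = 0} \<union> insert (S u) F)" for x
    proof -
      have "S (x - h x *\<^sub>R u) \<in> S ` {x. h x = 0}" using lin(2) u by (simp add: linear_diff linear_scale)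
      then have "S (x - h x *\<^sub>R u) + h x *\<^sub>R S u \<in> span (S ` {x. h x = 0} \<union> insert (S u) F)"
        by (intro span_add span_scale span_base) auto
      then show ?thesis using lin(1) by (simp add: linear_diff linear_scale)
    qed
    then have "range S \<union> F \<subseteq> span (S ` {x. h x = 0} \<union> insert (S u) F)" by (auto intro: span_base)
    then have "span (S ` {x. h x = 0} \<union> insert (S u) F) = UNIV"
      using F(2) by (metis span_minimal subspace_span top.extremum_uniqueI)
    then show "\<exists>F. finite F \<and> span (S ` {x. h x = 0} \<union> F) = UNIV" using F(1) by (meson finite_insert)
  next
    assume "\<exists>F. finite F \<and> span (S ` {x. h x = 0} \<union> F) = UNIV"
    then obtain F where F: "finite F" "span (S ` {x. h x = 0} \<union> F) = UNIV" by blast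
    have "span (S ` {x. h x = 0} \<union> F) \<subseteq> span (range S \<union> F)" by (intro span_mono) blast
    then show "lower_semiFredholmM UNIV S"
      using F unfolding lower_semiFredholmM_def fin_codim_def by blast
  qed
qed

text \<open>On the hyperplane \<open>h x = 0\<close> the operators \<open>S\<close> and
  \<open>S'\<close> coincide, and each of the four properties is determined by the operator on that
  hyperplane. If \<open>h\<close> is zero, the operators are equal.\<close>

lemma rank_one_perturbation:
  fixes S :: "'a::banach \<Rightarrow> 'a" and h :: "'a \<Rightarrow> real" and w :: 'a
  assumes S: "bounded_linear S" and h: "bounded_linear h"
  defines "S' \<equiv> \<lambda>x. S x + h x *\<^sub>R w"
  shows "upper_semiFredholmM UNIV S \<Longrightarrow> upper_semiFredholmM UNIV S'"
    and "upper_semiFredholmM UNIV S \<Longrightarrow> index_nonpos S \<Longrightarrow> index_nonpos S'"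
    and "lower_semiFredholmM UNIV S \<Longrightarrow> lower_semiFredholmM UNIV S'"
    and "index_nonneg S \<Longrightarrow> index_nonneg S'"
proof -
  have main: "(upper_semiFredholmM UNIV S \<longrightarrow> upper_semiFredholmM UNIV S') \<and>
    (upper_semiFredholmM UNIV S \<longrightarrow> index_nonpos S \<longrightarrow> index_nonpos S') \<and>
    (lower_semiFredholmM UNIV S \<longrightarrow> lower_semiFredholmM UNIV S') \<and> (index_nonneg S \<longrightarrow> index_nonneg S')"
  proof (cases "\<forall>x. h x = 0")
  case True
  then have "S' = S" by (auto simp: S'_def)
  then show ?thesis
    by simp
next
  case False
  then obtain u0 where "h u0 \<noteq> 0" by blast
  then have u: "h (inverse (h u0) *\<^sub>R u0) = 1" using h by (simp add: bounded_linear.linear linear_scale)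
  have S': "bounded_linear S'" unfolding S'_def by (intro bounded_linear_add S bounded_linear_scaleR_const h)
  have lin: "linear S" "linear h" "linear S'" using S h S' by (auto intro: bounded_linear.linear)
  have K: "kerM {x. h x = 0} S' = kerM {x. h x = 0} S" by (auto simp: kerM_def S'_def)
  have R: "S' ` {x. h x = 0} = S ` {x. h x = 0}" by (auto simp: S'_def image_iff)
  note iff = semiFredholm_hyperplane_iff[OF S h u] semiFredholm_hyperplane_iff[OF S' h u, unfolded K R]
  have up: "upper_semiFredholmM UNIV S \<longleftrightarrow> upper_semiFredholmM UNIV S'" using iff by simp
  then have "index_nonpos S'" if "upper_semiFredholmM UNIV S" "index_nonpos S"
    using that index_nonpos_hyperplane_iff[OF lin(1,2) u] index_nonpos_hyperplane_iff[OF lin(3,2) u, unfolded K R]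
    by (simp add: upper_semiFredholmM_def)
  moreover have "index_nonneg S'" if "index_nonneg S"
    using that index_nonneg_hyperplane_iff[OF lin(1,2) u] index_nonneg_hyperplane_iff[OF lin(3,2) u, unfolded K R]
    by simp
  ultimately show ?thesis
    using up iff by simp
  qed
  show "upper_semiFredholmM UNIV S \<Longrightarrow> upper_semiFredholmM UNIV S'"
    and "upper_semiFredholmM UNIV S \<Longrightarrow> index_nonpos S \<Longrightarrow> index_nonpos S'"
    and "lower_semiFredholmM UNIV S \<Longrightarrow> lower_semiFredholmM UNIV S'"
    and "index_nonneg S \<Longrightarrow> index_nonneg S'" using main by blast+
qed

section \<open>Stability under finite rank perturbations and reduction to bounded below or onto
  operators\<close>

lemma upper_finite_rank_perturbation:
  fixes S :: "'a::banach \<Rightarrow> 'a"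
  assumes "bounded_linear S" "upper_semiFredholmM UNIV S" "finite_rank F"
  shows "upper_semiFredholmM UNIV (\<lambda>x. S x + F x)"
  using finite_rank_perturbation_induct[OF assms(3,1), of "upper_semiFredholmM UNIV"] assms rank_one_perturbation(1)
  by blast

lemma index_nonpos_finite_rank_perturbation:
  fixes S :: "'a::banach \<Rightarrow> 'a"
  assumes "bounded_linear S" "upper_semiFredholmM UNIV S" "index_nonpos S" "finite_rank F"
  shows "index_nonpos (\<lambda>x. S x + F x)"
  using finite_rank_perturbation_induct[OF assms(4,1), of "\<lambda>S. upper_semiFredholmM UNIV S \<and> index_nonpos S"]
    assms rank_one_perturbation(1,2) by blast

lemma lower_finite_rank_perturbation:
  fixes S :: "'a::banach \<Rightarrow> 'a"
  assumes "bounded_linear S" "lower_semiFredholmM UNIV S" "finite_rank F"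
  shows "lower_semiFredholmM UNIV (\<lambda>x. S x + F x)"
  using finite_rank_perturbation_induct[OF assms(3,1), of "lower_semiFredholmM UNIV"] assms rank_one_perturbation(3)
  by blast

lemma index_nonneg_finite_rank_perturbation:
  fixes S :: "'a::banach \<Rightarrow> 'a"
  assumes "bounded_linear S" "index_nonneg S" "finite_rank F"
  shows "index_nonneg (\<lambda>x. S x + F x)"
  using finite_rank_perturbation_induct[OF assms(3,1), of "index_nonneg"] assms rank_one_perturbation(4)
  by blast

lemma kerM_trivial_iff: "linear S \<Longrightarrow> kerM UNIV S = {0} \<longleftrightarrow> inj S"
  by (auto simp: kerM_def linear_injective_0 linear_0)

lemma bounded_below_imp_upper:
  assumes "linear S" "bounded_belowM UNIV S"
  shows "upper_semiFredholmM UNIV S" "index_nonpos S"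
proof -
  have K: "kerM UNIV S = {0}" using assms kerM_trivial_iff by (auto simp: bounded_belowM_def)
  have fd: "fin_dim {0 :: 'a}" by (auto simp: fin_dim_def intro!: exI[of _ "{}"])
  then show "upper_semiFredholmM UNIV S" using K assms(2) by (simp add: upper_semiFredholmM_def bounded_belowM_def)
  show "index_nonpos S" unfolding index_nonpos_def K using dim_eq_0_iff[OF fd subspace_single_0] by simp
qed

lemma surj_imp_lower:
  assumes "surj S" shows "lower_semiFredholmM UNIV S" "index_nonneg S"
proof -
  have *: "span (range S \<union> {}) = UNIV" using assms by simp
  then show "lower_semiFredholmM UNIV S" unfolding lower_semiFredholmM_def fin_codim_def by blast
  show "index_nonneg S" unfolding index_nonneg_def using * by (metis card.empty finite.emptyI le0)
qed

lemma finite_rank_then_plus: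
  assumes "finite_rank F" "bounded_linear h"
    and "Q (\<lambda>x. (S x + h x *\<^sub>R w) + F x)"
  shows "\<exists>F'. finite_rank F' \<and> Q (\<lambda>x. S x + F' x)"
  by (rule exI[of _ "\<lambda>x. h x *\<^sub>R w + F x"])
    (use assms in \<open>auto intro!: finite_rank_add finite_rank_rank_one simp: add.assoc\<close>)

text \<open>While there are a kernel vector \<open>v\<close> and a vector \<open>w\<close> outside
  the range, a rank one operator sending \<open>v\<close> to \<open>w\<close> lowers the dimension
  of the kernel by one. The process stops when the operator is onto or when the kernel is trivial,
  and then the closed range makes it bounded below.\<close>

lemma upper_reduction:
  fixes S :: "'a::banach \<Rightarrow> 'a"
  assumes "bounded_linear S" "upper_semiFredholmM UNIV S"
  shows "\<exists>F. finite_rank F \<and> (bounded_belowM UNIV (\<lambda>x. S x + F x) \<or> surj (\<lambda>x. S x + F x))"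
proof -
  have "\<exists>F. finite_rank F \<and> (bounded_belowM UNIV (\<lambda>x. S x + F x) \<or> surj (\<lambda>x. S x + F x))"
    if "bounded_linear S" "upper_semiFredholmM UNIV S" "dim (kerM UNIV S) = n" for n and S :: "'a \<Rightarrow> 'a"
    using that
  proof (induction n arbitrary: S)
    case 0
    have lin: "linear S" using 0 by (simp add: bounded_linear.linear)
    have "kerM UNIV S = {0}"
      using 0 dim_eq_0_iff[OF _ subspace_kerM[OF lin]] by (simp add: upper_semiFredholmM_def)
    then have "bounded_belowM UNIV S"
      using 0(2) kerM_trivial_iff[OF lin] by (simp add: upper_semiFredholmM_def bounded_belowM_def)
    then show ?case using finite_rank_zero by (intro exI[of _ "\<lambda>x. 0"]) simp
  next
    case (Suc n)
    have lin: "linear S" using Suc by (simp add: bounded_linear.linear)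
    show ?case
    proof (cases "surj S")
      case True
      then show ?thesis using finite_rank_zero by (intro exI[of _ "\<lambda>x. 0"]) simp
    next
      case False
      then obtain w where w: "w \<notin> range S" by blast
      have fd: "fin_dim (kerM UNIV S)" using Suc.prems by (simp add: upper_semiFredholmM_def)
      have "kerM UNIV S \<noteq> {0}" using Suc.prems(3) dim_eq_0_iff[OF fd subspace_kerM[OF lin]] by simp
      then obtain v where v: "S v = 0" "v \<noteq> 0" using linear_0[OF lin] by (auto simp: kerM_def)
      obtain h :: "'a \<Rightarrow> real" where h: "bounded_linear h" "h v = 1" using functional_nonzero[OF v(2)] by blast
      have linh: "linear h" using h by (simp add: bounded_linear.linear)
      have "h x = 0" if "S x + h x *\<^sub>R w = 0" for x
      proof (rule ccontr)
        assume "h x \<noteq> 0"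
        moreover have "- S x = h x *\<^sub>R w" using that by (simp add: add_eq_0_iff)
        moreover have "S (- inverse (h x) *\<^sub>R x) = inverse (h x) *\<^sub>R (- S x)"
          using linear_scale[OF lin, of "- inverse (h x)" x] by simp
        ultimately have "w = S (- inverse (h x) *\<^sub>R x)" by simp
        then show False using w by blast
      qed
      then have "S x + h x *\<^sub>R w = 0 \<longleftrightarrow> S x = 0 \<and> h x = 0" for x by (cases "h x = 0") auto
      then have K: "kerM UNIV (\<lambda>x. S x + h x *\<^sub>R w) = kerM {x. h x = 0} S" by (auto simp: kerM_def)
      have "fin_dim (kerM {x. h x = 0} S)" using fd hyperplane_fin_dim_iff[OF lin linh h(2)] by blast
      then have "dim (kerM UNIV (\<lambda>x. S x + h x *\<^sub>R w)) = n"
        using kerM_hyperplane(2)[OF lin linh v(1) h(2)] Suc.prems(3) K by simp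
      moreover have "bounded_linear (\<lambda>x. S x + h x *\<^sub>R w)"
        by (intro bounded_linear_add Suc.prems bounded_linear_scaleR_const h)
      ultimately obtain F where "finite_rank F" "bounded_belowM UNIV (\<lambda>x. (S x + h x *\<^sub>R w) + F x) \<or>
          surj (\<lambda>x. (S x + h x *\<^sub>R w) + F x)"
        using Suc.IH rank_one_perturbation(1)[OF Suc.prems(1) h(1) Suc.prems(2)] by blast
      then show ?thesis
        using finite_rank_then_plus[OF _ h(1), where Q="\<lambda>S. bounded_belowM UNIV S \<or> surj S"] by blast
    qed
  qed
  then show ?thesis using assms by blast
qed

text \<open>The same exchange of a kernel vector for a missing one, but counted by the missing
  vectors, as the kernel may have infinite dimension. If it stops at an injective operator, finite
  codimension gives the closed range.\<close>

lemma lower_reduction: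
  fixes S :: "'a::banach \<Rightarrow> 'a"
  assumes "bounded_linear S" "lower_semiFredholmM UNIV S"
  shows "\<exists>F. finite_rank F \<and> (bounded_belowM UNIV (\<lambda>x. S x + F x) \<or> surj (\<lambda>x. S x + F x))"
proof -
  have "\<exists>F. finite_rank F \<and> (bounded_belowM UNIV (\<lambda>x. S x + F x) \<or> surj (\<lambda>x. S x + F x))"
    if "finite F" "bounded_linear S" "span (range S \<union> F) = UNIV" for F and S :: "'a \<Rightarrow> 'a"
    using that
  proof (induction F arbitrary: S)
    case empty
    then have "surj S" by (simp add: linear_subspace_image bounded_linear.linear span_eq_iff[THEN iffD2])
    then show ?case using finite_rank_zero by (intro exI[of _ "\<lambda>x. 0"]) simp
  next
    case (insert w F)
    have lin: "linear S" using insert by (simp add: bounded_linear.linear)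
    consider "w \<in> range S" | "inj S" | "w \<notin> range S" "\<not> inj S" by blast
    then show ?case
    proof cases
      case 1
      then have "range S \<union> insert w F = range S \<union> F" by blast
      then show ?thesis using insert by simp
    next
      case 2
      have "lower_semiFredholmM UNIV S"
        using insert.prems insert.hyps unfolding lower_semiFredholmM_def fin_codim_def
        by (intro exI[of _ "insert w F"]) simp
      then have "bounded_belowM UNIV S"
        using 2 closed_range_if_fin_codim[OF insert.prems(1)] by (simp add: bounded_belowM_def)
      then show ?thesis using finite_rank_zero by (intro exI[of _ "\<lambda>x. 0"]) simp
    next
      case 3
      then obtain v where v: "S v = 0" "v \<noteq> 0" using lin linear_injective_0 by blast
      obtain h :: "'a \<Rightarrow> real" where h: "bounded_linear h" "h v = 1" using functional_nonzero[OF v(2)] by blast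
      have linh: "linear h" using h by (simp add: bounded_linear.linear)
      have b: "bounded_linear (\<lambda>x. S x + h x *\<^sub>R w)"
        by (intro bounded_linear_add insert.prems bounded_linear_scaleR_const h)
      have "w = S v + h v *\<^sub>R w" using v h by simp
      then have "w \<in> range (\<lambda>x. S x + h x *\<^sub>R w)" by blast
      \<comment> \<open>Subtracting a multiple of \<open>v\<close> makes \<open>h\<close> vanish
        without changing the value of \<open>S\<close>, so the correction loses nothing of the old
        range.\<close>
      moreover have "S x = S (x - h x *\<^sub>R v) + h (x - h x *\<^sub>R v) *\<^sub>R w" for x
        using v h lin linh by (simp add: linear_diff linear_scale)
      then have "range S \<subseteq> range (\<lambda>x. S x + h x *\<^sub>R w)" by blast
      ultimately have "range S \<union> insert w F \<subseteq> range (\<lambda>x. S x + h x *\<^sub>R w) \<union> F" by blast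
      then have "span (range (\<lambda>x. S x + h x *\<^sub>R w) \<union> F) = UNIV"
        using insert.prems(2) span_mono by (metis top.extremum_uniqueI)
      then obtain F' where "finite_rank F'" "bounded_belowM UNIV (\<lambda>x. (S x + h x *\<^sub>R w) + F' x) \<or>
          surj (\<lambda>x. (S x + h x *\<^sub>R w) + F' x)"
        using insert.IH[OF b] by blast
      then show ?thesis
        using finite_rank_then_plus[OF _ h(1), where Q="\<lambda>S. bounded_belowM UNIV S \<or> surj S"] by blast
    qed
  qed
  then show ?thesis using assms unfolding lower_semiFredholmM_def fin_codim_def by blast
qed

lemma finite_rank_bounded_linear: "finite_rank F \<Longrightarrow> bounded_linear F"
  by (simp add: finite_rank_def)

text \<open>The sign of the index is stable under finite rank corrections and decides the
  alternative in \<open>upper_reduction\<close>: an onto operator of nonpositive index has trivial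
  kernel. The right-hand side is free of dimensions, hence easy to compose.\<close>

lemma upper_nonpos_iff:
  fixes S :: "'a::banach \<Rightarrow> 'a"
  assumes S: "bounded_linear S"
  shows "upper_semiFredholmM UNIV S \<and> index_nonpos S \<longleftrightarrow>
    (\<exists>F. finite_rank F \<and> bounded_belowM UNIV (\<lambda>x. S x + F x))"
proof
  assume a: "upper_semiFredholmM UNIV S \<and> index_nonpos S"
  then obtain F where F: "finite_rank F" "bounded_belowM UNIV (\<lambda>x. S x + F x) \<or> surj (\<lambda>x. S x + F x)"
    using upper_reduction[OF S] by blast
  have b: "bounded_linear (\<lambda>x. S x + F x)" using S F by (simp add: bounded_linear_add finite_rank_def)
  then have lin: "linear (\<lambda>x. S x + F x)" by (rule bounded_linear.linear)
  have up: "upper_semiFredholmM UNIV (\<lambda>x. S x + F x)" using upper_finite_rank_perturbation[OF S] a F by blast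
  have "bounded_belowM UNIV (\<lambda>x. S x + F x)" if "surj (\<lambda>x. S x + F x)"
  proof -
    have "index_nonpos (\<lambda>x. S x + F x)" using index_nonpos_finite_rank_perturbation[OF S] a F by blast
    then have "dim (kerM UNIV (\<lambda>x. S x + F x)) \<le> card ({} :: 'a set)"
      using that unfolding index_nonpos_def by (metis finite.emptyI span_UNIV sup_bot_right)
    then have "kerM UNIV (\<lambda>x. S x + F x) = {0}"
      using dim_eq_0_iff[OF _ subspace_kerM[OF lin]] up by (simp add: upper_semiFredholmM_def)
    then show ?thesis using kerM_trivial_iff[OF lin] up by (simp add: upper_semiFredholmM_def bounded_belowM_def)
  qed
  then show "\<exists>F. finite_rank F \<and> bounded_belowM UNIV (\<lambda>x. S x + F x)" using F by blast
next
  assume "\<exists>F. finite_rank F \<and> bounded_belowM UNIV (\<lambda>x. S x + F x)"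
  then obtain F where F: "finite_rank F" "bounded_belowM UNIV (\<lambda>x. S x + F x)" by blast
  have b: "bounded_linear (\<lambda>x. S x + F x)" using S F by (simp add: bounded_linear_add finite_rank_def)
  have "S = (\<lambda>x. (S x + F x) + - F x)" by simp
  then show "upper_semiFredholmM UNIV S \<and> index_nonpos S"
    using bounded_below_imp_upper[OF bounded_linear.linear[OF b] F(2)] finite_rank_minus[OF F(1)]
      upper_finite_rank_perturbation[OF b] index_nonpos_finite_rank_perturbation[OF b] by metis
qed

text \<open>Dually, a corrected operator that is bounded below and has nonnegative index needs no
  further vector to fill the space, so it is onto.\<close>

lemma lower_nonneg_iff:
  fixes S :: "'a::banach \<Rightarrow> 'a"
  assumes S: "bounded_linear S"
  shows "lower_semiFredholmM UNIV S \<and> index_nonneg S \<longleftrightarrow> (\<exists>F. finite_rank F \<and> surj (\<lambda>x. S x + F x))"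
proof
  assume a: "lower_semiFredholmM UNIV S \<and> index_nonneg S"
  then obtain F where F: "finite_rank F" "bounded_belowM UNIV (\<lambda>x. S x + F x) \<or> surj (\<lambda>x. S x + F x)"
    using lower_reduction[OF S] by blast
  have b: "bounded_linear (\<lambda>x. S x + F x)" using S F by (simp add: bounded_linear_add finite_rank_def)
  then have lin: "linear (\<lambda>x. S x + F x)" by (rule bounded_linear.linear)
  have "surj (\<lambda>x. S x + F x)" if bb: "bounded_belowM UNIV (\<lambda>x. S x + F x)"
  proof -
    have K: "kerM UNIV (\<lambda>x. S x + F x) = {0}" using bb kerM_trivial_iff[OF lin] by (simp add: bounded_belowM_def)
    have fd: "fin_dim {0 :: 'a}" by (auto simp: fin_dim_def intro!: exI[of _ "{}"])
    have "index_nonneg (\<lambda>x. S x + F x)" using index_nonneg_finite_rank_perturbation[OF S] a F by blast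
    then obtain E where "finite E" "card E \<le> dim {0 :: 'a}" "span (range (\<lambda>x. S x + F x) \<union> E) = UNIV"
      using fd unfolding index_nonneg_def K by blast
    then have "span (range (\<lambda>x. S x + F x)) = UNIV" using dim_eq_0_iff[OF fd subspace_single_0] by simp
    then show ?thesis using lin by (simp add: linear_subspace_image span_eq_iff[THEN iffD2])
  qed
  then show "\<exists>F. finite_rank F \<and> surj (\<lambda>x. S x + F x)" using F by blast
next
  assume "\<exists>F. finite_rank F \<and> surj (\<lambda>x. S x + F x)"
  then obtain F where F: "finite_rank F" "surj (\<lambda>x. S x + F x)" by blast
  have b: "bounded_linear (\<lambda>x. S x + F x)" using S F by (simp add: bounded_linear_add finite_rank_def)
  have "S = (\<lambda>x. (S x + F x) + - F x)" by simp
  then show "lower_semiFredholmM UNIV S \<and> index_nonneg S"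
    using surj_imp_lower[OF F(2)] finite_rank_minus[OF F(1)]
      lower_finite_rank_perturbation[OF b] index_nonneg_finite_rank_perturbation[OF b] by metis
qed

text \<open>Fredholm of index zero, in the form "invertible up to finite rank". The same correction
  can then be tried at neighbouring parameters, for which no dimension has to be followed.\<close>

definition weyl :: "('a::real_normed_vector \<Rightarrow> 'a) \<Rightarrow> bool" where
  "weyl S \<longleftrightarrow> (\<exists>F. finite_rank F \<and> bij (\<lambda>x. S x + F x))"

lemma weyl_add_finite_rank: "weyl S \<Longrightarrow> finite_rank F \<Longrightarrow> weyl (\<lambda>x. S x + F x)"
proof -
  assume "weyl S" and F: "finite_rank F"
  then obtain G where G: "finite_rank G" "bij (\<lambda>x. S x + G x)" unfolding weyl_def by blast
  have "finite_rank (\<lambda>x. - F x + G x)" using F G by (intro finite_rank_add finite_rank_minus)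
  moreover have "bij (\<lambda>x. (S x + F x) + (- F x + G x))" using G(2) by (simp add: algebra_simps)
  ultimately show "weyl (\<lambda>x. S x + F x)" unfolding weyl_def by blast
qed

lemma bij_imp_bounded_below:
  fixes S :: "'a::banach \<Rightarrow> 'a"
  shows "bij S \<Longrightarrow> bounded_belowM UNIV S"
  by (simp add: bounded_belowM_def bij_def)

text \<open>Index zero makes injectivity and surjectivity equivalent, as for square
  matrices.\<close>

lemma weyl_bij:
  fixes S :: "'a::banach \<Rightarrow> 'a"
  assumes S: "bounded_linear S" and w: "weyl S" and ij: "inj S \<or> surj S"
  shows "bij S"
proof -
  have lin: "linear S" using S by (rule bounded_linear.linear)
  obtain F where F: "finite_rank F" "bij (\<lambda>x. S x + F x)" using w unfolding weyl_def by blast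
  have pos: "upper_semiFredholmM UNIV S \<and> index_nonpos S"
    using upper_nonpos_iff[OF S] F bij_imp_bounded_below by blast
  have neg: "lower_semiFredholmM UNIV S \<and> index_nonneg S"
    using lower_nonneg_iff[OF S] F bij_is_surj by blast
  have fd: "fin_dim (kerM UNIV S)" using pos by (simp add: upper_semiFredholmM_def)
  show ?thesis
  proof (cases "inj S")
    case True
    then have "dim (kerM UNIV S) = 0" using kerM_trivial_iff[OF lin] dim_eq_0_iff[OF fd subspace_kerM[OF lin]] by simp
    then obtain E where "finite E" "card E = 0" "span (range S \<union> E) = UNIV"
      using neg fd unfolding index_nonneg_def by (metis le_zero_eq)
    then have "span (range S) = UNIV" by simp
    then have "surj S" using lin by (simp add: linear_subspace_image span_eq_iff[THEN iffD2])
    then show ?thesis using True by (simp add: bij_def)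
  next
    case False
    then have sj: "surj S" using ij by blast
    have "dim (kerM UNIV S) \<le> card ({} :: 'a set)"
      using sj pos unfolding index_nonpos_def by (metis finite.emptyI span_UNIV sup_bot_right)
    then have "inj S" using kerM_trivial_iff[OF lin] dim_eq_0_iff[OF fd subspace_kerM[OF lin]] by simp
    then show ?thesis using sj by (simp add: bij_def)
  qed
qed

lemma bounded_below_perturb:
  assumes "\<And>x. c * norm x \<le> norm (S x)" "\<And>x. norm (S' x - S x) \<le> e * norm x"
  shows "(c - e) * norm x \<le> norm (S' x)"
  using assms(1)[of x] assms(2)[of x] norm_triangle_ineq2[of "S x" "S x - S' x"]
  by (simp add: algebra_simps norm_minus_commute)

text \<open>An exact solution for \<open>S\<close> is an approximate one for \<open>S'\<close>, with
  error at most e C times the norm of the right-hand side; the bound 1/2 is what the geometric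
  iteration requires.\<close>

lemma surj_perturb:
  fixes S :: "'a::banach \<Rightarrow> 'a"
  assumes S': "bounded_linear S'" and C: "C \<ge> 0" and sol: "\<And>y. \<exists>x. S x = y \<and> norm x \<le> C * norm y"
    and near: "\<And>x. norm (S' x - S x) \<le> e * norm x" and e: "e \<ge> 0" "e * C \<le> 1/2"
  shows "\<exists>x. S' x = y \<and> norm x \<le> 2 * C * norm y"
proof -
  have "\<exists>x\<in>UNIV. S' x = y \<and> norm x \<le> 2 * C * norm y"
  proof (rule solvable_if_approximately_solvable[OF S' subspace_UNIV closed_UNIV subspace_UNIV _ C])
    fix y :: 'a
    obtain x where x: "S x = y" "norm x \<le> C * norm y" using sol by blast
    have "norm (y - S' x) \<le> e * norm x" using near[of x] x(1) by (simp add: norm_minus_commute)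
    also have "\<dots> \<le> e * (C * norm y)" using x(2) e(1) by (rule mult_left_mono)
    also have "\<dots> \<le> norm y / 2" using mult_right_mono[OF e(2) norm_ge_zero[of y]] by simp
    finally show "\<exists>x\<in>UNIV. norm x \<le> C * norm y \<and> norm (y - S' x) \<le> norm y / 2" using x(2) by blast
  qed auto
  then show ?thesis by blast
qed

lemma bij_perturb:
  fixes S :: "'a::banach \<Rightarrow> 'a"
  assumes S: "bounded_linear S'" and bij: "bij S" and c: "c > 0" "\<And>x. c * norm x \<le> norm (S x)"
    and near: "\<And>x. norm (S' x - S x) \<le> e * norm x" and e: "e \<ge> 0" "e \<le> c / 2"
  shows "bij S'"
proof -
  have "\<exists>x. S x = y \<and> norm x \<le> (1 / c) * norm y" for y
  proof -
    obtain x where x: "S x = y" using bij by (metis bij_pointE)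
    then show ?thesis using c(2)[of x] c(1) by (auto simp: field_simps)
  qed
  moreover have "e * (1 / c) \<le> 1 / 2" using e c(1) by (simp add: field_simps)
  moreover have "0 \<le> 1 / c" using c(1) by simp
  ultimately have "\<exists>x. S' x = y \<and> norm x \<le> 2 * (1 / c) * norm y" for y
    using surj_perturb[OF S _ _ near e(1), of "1/c" y] by blast
  then have "surj S'" by (metis surj_def)
  moreover have "inj S'"
  proof -
    have "x = 0" if "S' x = 0" for x
    proof -
      have "(c - e) * norm x \<le> 0" using bounded_below_perturb[OF c(2) near, of x] that by simp
      moreover have "c - e > 0" using e c by linarith
      ultimately show ?thesis by (simp add: mult_le_0_iff)
    qed
    then show ?thesis using S by (simp add: bounded_linear.linear linear_injective_0)
  qed
  ultimately show ?thesis by (simp add: bij_def)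
qed

text \<open>If the operator at t is corrected by a finite rank F to one that is bounded below or onto,
  then nearby Weyl operators corrected by the same F are invertible with uniformly bounded inverse,
  so being Weyl is locally constant in t.\<close>
lemma weyl_locally_constant:
  fixes S :: "complex \<Rightarrow> 'a::banach \<Rightarrow> 'a"
  assumes b: "\<And>t. bounded_linear (S t)"
    and cont: "\<And>t e. e > 0 \<Longrightarrow> \<exists>d>0. \<forall>s. cmod (s - t) < d \<longrightarrow> (\<forall>x. norm (S s x - S t x) \<le> e * norm x)"
    and semi: "upper_semiFredholmM UNIV (S t) \<or> lower_semiFredholmM UNIV (S t)"
  shows "\<exists>d>0. \<forall>s. cmod (s - t) < d \<longrightarrow> (weyl (S s) \<longleftrightarrow> weyl (S t))"
proof -
  have bF: "bounded_linear (\<lambda>x. S t x + F x)" if "finite_rank F" for F t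
    using that b by (simp add: bounded_linear_add finite_rank_def)
  show ?thesis
  proof (cases "weyl (S t)")
    case True
    then obtain F where F: "finite_rank F" "bij (\<lambda>x. S t x + F x)" unfolding weyl_def by blast
    obtain c where c: "c > 0" "\<And>x. c * norm x \<le> norm (S t x + F x)"
      using bij_imp_bounded_below[OF F(2)] bounded_below_iff[OF bF[OF F(1), of t]] by blast
    obtain d where d: "d > 0" "\<And>s. cmod (s - t) < d \<Longrightarrow> (\<forall>x. norm (S s x - S t x) \<le> c / 2 * norm x)"
      using cont[of "c/2"] c(1) by (metis half_gt_zero)
    have "bij (\<lambda>x. S s x + F x)" if "cmod (s - t) < d" for s
      by (rule bij_perturb[OF bF[OF F(1)] F(2) c, of _ "c/2"]) (use d(2)[OF that] c(1) in auto)
    then show ?thesis using True F(1) d(1) unfolding weyl_def by blast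
  next
    case False
    obtain F where F: "finite_rank F" "bounded_belowM UNIV (\<lambda>x. S t x + F x) \<or> surj (\<lambda>x. S t x + F x)"
      using semi upper_reduction[OF b] lower_reduction[OF b] by blast
    have nb: "\<not> bij (\<lambda>x. S t x + F x)" using False F(1) unfolding weyl_def by blast
    from F(2) show ?thesis
    proof
      assume "bounded_belowM UNIV (\<lambda>x. S t x + F x)"
      then obtain c where c: "c > 0" "\<And>x. c * norm x \<le> norm (S t x + F x)"
        using bounded_below_iff[OF bF[OF F(1), of t]] by blast
      \<comment> \<open>With c/4, the operator at \<open>s\<close> is bounded below by 3c/4, and c/4
        is still at most half of that. So invertibility at \<open>s\<close> would return to
        \<open>t\<close>.\<close>
      obtain d where d: "d > 0" "\<And>s. cmod (s - t) < d \<Longrightarrow> (\<forall>x. norm (S s x - S t x) \<le> c / 4 * norm x)"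
        using cont[of "c/4"] c(1) by (metis zero_less_divide_iff zero_less_numeral)
      have "\<not> weyl (S s)" if s: "cmod (s - t) < d" for s
      proof
        assume "weyl (S s)"
        have below: "(c - c / 4) * norm x \<le> norm (S s x + F x)" for x
          by (rule bounded_below_perturb[where S="\<lambda>x. S t x + F x"]) (use c d(2)[OF s] in auto)
        have cc: "c - c / 4 > 0" using c(1) by simp
        then have "inj (\<lambda>x. S s x + F x)"
          using below bounded_below_iff[OF bF[OF F(1), of s]] unfolding bounded_belowM_def by blast
        then have "bij (\<lambda>x. S s x + F x)"
          using weyl_bij[OF bF[OF F(1)] weyl_add_finite_rank[OF \<open>weyl (S s)\<close> F(1)]] by blast
        then have "bij (\<lambda>x. S t x + F x)"
          by (rule bij_perturb[OF bF[OF F(1)] _ cc below, of _ "c/4"])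
            (use d(2)[OF s] c(1) in \<open>auto simp: norm_minus_commute\<close>)
        then show False using nb by blast
      qed
      then show ?thesis using False d(1) by blast
    next
      assume "surj (\<lambda>x. S t x + F x)"
      then obtain C where C: "C > 0" "\<And>y. \<exists>x. S t x + F x = y \<and> norm x \<le> C * norm y"
        using surj_bound[OF bF[OF F(1), of t]] by blast
      \<comment> \<open>Near \<open>t\<close> equations are solvable with constant 2C, so a
        bijective operator there is bounded below by 1/(2C); \<open>e\<close> is half of this, as
        \<open>bij_perturb\<close> requires for the way back to \<open>t\<close>.\<close>
      define e where "e = 1 / (4 * C)"
      have e: "e > 0" "e * C \<le> 1/2" using C(1) by (simp_all add: e_def)
      obtain d where d: "d > 0" "\<And>s. cmod (s - t) < d \<Longrightarrow> (\<forall>x. norm (S s x - S t x) \<le> e * norm x)"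
        using cont[OF e(1)] by metis
      have "\<not> weyl (S s)" if s: "cmod (s - t) < d" for s
      proof
        assume "weyl (S s)"
        have sol: "\<exists>x. S s x + F x = y \<and> norm x \<le> 2 * C * norm y" for y
          by (rule surj_perturb[OF bF[OF F(1)] _ C(2), of _ e]) (use C(1) e d(2)[OF s] in auto)
        then have "surj (\<lambda>x. S s x + F x)" by (metis surj_def)
        then have bij: "bij (\<lambda>x. S s x + F x)"
          using weyl_bij[OF bF[OF F(1)] weyl_add_finite_rank[OF \<open>weyl (S s)\<close> F(1)]] by blast
        have "(1 / (2 * C)) * norm x \<le> norm (S s x + F x)" for x
        proof -
          obtain x' where "S s x' + F x' = S s x + F x" "norm x' \<le> 2 * C * norm (S s x + F x)" using sol by blast
          then have "norm x \<le> 2 * C * norm (S s x + F x)" using bij by (metis bij_is_inj injD)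
          then show ?thesis using C(1) by (simp add: field_simps)
        qed
        then have "bij (\<lambda>x. S t x + F x)"
          by (intro bij_perturb[OF bF[OF F(1)] bij, of "1/(2*C)" _ e])
            (use d(2)[OF s] C(1) e in \<open>auto simp: norm_minus_commute e_def\<close>)
        then show False using nb by blast
      qed
      then show ?thesis using False d(1) by blast
    qed
  qed
qed

lemma weyl_on_connected:
  fixes S :: "complex \<Rightarrow> 'a::banach \<Rightarrow> 'a"
  assumes b: "\<And>t. bounded_linear (S t)"
    and cont: "\<And>t e. e > 0 \<Longrightarrow> \<exists>d>0. \<forall>s. cmod (s - t) < d \<longrightarrow> (\<forall>x. norm (S s x - S t x) \<le> e * norm x)"
    and C: "connected C"
    and semi: "\<And>t. t \<in> C \<Longrightarrow> upper_semiFredholmM UNIV (S t) \<or> lower_semiFredholmM UNIV (S t)"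
    and s: "s \<in> C" "weyl (S s)" and t: "t \<in> C"
  shows "weyl (S t)"
proof -
  have "weyl (S s) = weyl (S t)"
  proof (rule connected_local_const[OF C s(1) t], rule ballI)
    fix a assume a: "a \<in> C"
    obtain d where d: "d > 0" "\<forall>s. cmod (s - a) < d \<longrightarrow> weyl (S s) = weyl (S a)"
      using weyl_locally_constant[OF b cont semi[OF a]] by blast
    then have near: "\<forall>x\<in>C. x \<noteq> a \<and> dist x a < d \<longrightarrow> weyl (S a) = weyl (S x)"
      unfolding dist_norm by blast
    then show "eventually (\<lambda>b. weyl (S a) = weyl (S b)) (at a within C)"
      unfolding eventually_at by (intro exI[of _ d] conjI d(1) near)
  qed
  then show ?thesis using s(2) by simp
qed

section \<open>A Liouville theorem modulo an operator ideal\<close>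

lemma fin_dim_inj_image:
  assumes F: "linear F" and V: "subspace V" "inj_on F V" and fd: "fin_dim (F ` V)"
  shows "fin_dim V"
proof -
  obtain B where B: "B \<subseteq> V" "independent B" "V \<subseteq> span B" "card B = dim V"
    using real_vector.basis_exists by blast
  have "span B = V" using B V(1) by (metis span_subspace)
  then have "independent (F ` B)" using linear_independent_injective_image[OF F B(2)] V(2) by simp
  moreover obtain E where E: "finite E" "F ` V \<subseteq> span E" using fd unfolding fin_dim_def by blast
  moreover have "F ` B \<subseteq> span E" using E(2) B(1) by blast
  ultimately have "finite (F ` B)" by (metis real_vector.independent_span_bound)
  then have "finite B" using V(2) B(1) by (metis finite_imageD inj_on_subset)
  then show ?thesis using B(3) unfolding fin_dim_def by blast
qed

definition cscale :: "('a::real_normed_vector \<Rightarrow>\<^sub>L 'a) \<Rightarrow> complex \<Rightarrow> ('a \<Rightarrow>\<^sub>L 'a) \<Rightarrow> 'a \<Rightarrow>\<^sub>L 'a" where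
  "cscale J c X = Re c *\<^sub>R X + Im c *\<^sub>R (J o\<^sub>L X)"

text \<open>Meant for the zero ideal and for the finite rank operators, so that one argument yields
  both a trivial and a finite dimensional range. As the finite rank operators are not closed in
  general, the distance \<open>q\<close> takes the place of a quotient norm.\<close>

locale operator_ideal =
  fixes I :: "('a::banach \<Rightarrow>\<^sub>L 'a) set"
  assumes subI: "subspace I"
    and left: "F \<in> I \<Longrightarrow> A o\<^sub>L F \<in> I"
    and right: "F \<in> I \<Longrightarrow> F o\<^sub>L A \<in> I"
begin

definition q :: "('a \<Rightarrow>\<^sub>L 'a) \<Rightarrow> real" where "q X = infdist X I"

lemma q_nonneg: "0 \<le> q X" by (simp add: q_def infdist_nonneg)
lemma q_add: "q (X + Y) \<le> q X + q Y" and q_scale: "q (c *\<^sub>R X) = \<bar>c\<bar> * q X" and q_norm: "q X \<le> norm X"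
  unfolding q_def by (rule infdist_subspace_seminorm[OF subI])+
lemma q_minus: "q (- X) = q X" using q_scale[of "-1" X] by simp
lemma q_diff: "q (X - Y) \<le> q X + q Y" using q_add[of X "- Y"] q_minus by simp
lemma q_mod: "X - Y \<in> I \<Longrightarrow> q X = q Y"
proof -
  assume XY: "X - Y \<in> I"
  then have "q (X - Y) = 0" "q (Y - X) = 0" using subspace_neg[OF subI XY] by (simp_all add: q_def)
  then show "q X = q Y" using q_add[of "X - Y" Y] q_add[of "Y - X" X] by simp
qed

lemma q_comp_right: "q (X o\<^sub>L Y) \<le> q X * norm Y"
proof (cases "norm Y = 0")
  case True then show ?thesis using q_norm[of "X o\<^sub>L Y"] by simp
next
  case False
  have ne: "I \<noteq> {}" using subspace_0[OF subI] by blast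
  have "q (X o\<^sub>L Y) / norm Y \<le> q X"
    unfolding q_def[of X] infdist_notempty[OF ne]
  proof (rule cINF_greatest[OF ne])
    fix F assume F: "F \<in> I"
    have "q (X o\<^sub>L Y) \<le> dist (X o\<^sub>L Y) (F o\<^sub>L Y)" unfolding q_def by (rule infdist_le[OF right[OF F]])
    also have "\<dots> = norm ((X - F) o\<^sub>L Y)" unfolding dist_norm
      by (rule arg_cong[where f=norm], rule blinfun_eqI) (simp add: blinfun.diff_left)
    also have "\<dots> \<le> dist X F * norm Y" using norm_blinfun_compose by (simp add: dist_norm)
    finally show "q (X o\<^sub>L Y) / norm Y \<le> dist X F" using False by (simp add: field_simps)
  qed
  then show ?thesis using False by (simp add: field_simps)
qed

lemma q_comp_left: "q (Y o\<^sub>L X) \<le> norm Y * q X"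
proof (cases "norm Y = 0")
  case True then show ?thesis using q_norm[of "Y o\<^sub>L X"] by simp
next
  case False
  have ne: "I \<noteq> {}" using subspace_0[OF subI] by blast
  have "q (Y o\<^sub>L X) / norm Y \<le> q X"
    unfolding q_def[of X] infdist_notempty[OF ne]
  proof (rule cINF_greatest[OF ne])
    fix F assume F: "F \<in> I"
    have "q (Y o\<^sub>L X) \<le> dist (Y o\<^sub>L X) (Y o\<^sub>L F)" unfolding q_def by (rule infdist_le[OF left[OF F]])
    also have "\<dots> = norm (Y o\<^sub>L (X - F))" unfolding dist_norm
      by (rule arg_cong[where f=norm], rule blinfun_eqI) (simp add: blinfun.diff_left blinfun.diff_right)
    also have "\<dots> \<le> norm Y * dist X F" using norm_blinfun_compose by (simp add: dist_norm)
    finally show "q (Y o\<^sub>L X) / norm Y \<le> dist X F" using False by (simp add: field_simps)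
  qed
  then show ?thesis using False by (simp add: field_simps)
qed

end


section \<open>Complex scalars through the map J\<close>

locale complex_operator =
  fixes J :: "'a::banach \<Rightarrow> 'a" and T :: "'a \<Rightarrow> 'a"
  assumes cs: "complex_structure J" and T: "bop J T"
begin

lemma linJ: "linear J" and JJ: "J (J x) = - x" and norm_scaleC: "norm (scaleC J c x) = cmod c * norm x"
  using cs by (auto simp: complex_structure_def)

lemma norm_J: "norm (J x) = norm x"
  using norm_scaleC[of \<i> x] by (simp add: scaleC_def)

lemma blJ: "bounded_linear J"
  using linJ by (intro bounded_linear_intro[of _ 1]) (auto simp: linear_add linear_scale norm_J)

lemma blT: "bounded_linear T" and TJ: "T (J x) = J (T x)"
  using T by (auto simp: bop_def)

lemma J_simps: "J (x + y) = J x + J y" "J (x - y) = J x - J y" "J (- x) = - J x" "J 0 = 0" "J (r *\<^sub>R x) = r *\<^sub>R J x"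
  using linJ by (simp_all add: linear_add linear_diff linear_neg linear_0 linear_scale)

lemma scaleC_add_right: "scaleC J c (x + y) = scaleC J c x + scaleC J c y"
  and scaleC_diff_right: "scaleC J c (x - y) = scaleC J c x - scaleC J c y"
  and scaleC_minus_right: "scaleC J c (- x) = - scaleC J c x"
  and scaleC_zero_right: "scaleC J c 0 = 0"
  and scaleC_add_left: "scaleC J (c + d) x = scaleC J c x + scaleC J d x"
  and scaleC_diff_left: "scaleC J (c - d) x = scaleC J c x - scaleC J d x"
  and scaleC_zero_left: "scaleC J 0 x = 0"
  and scaleC_one: "scaleC J 1 x = x"
  and scaleC_minus_left: "scaleC J (- c) x = - scaleC J c x"
  and scaleC_scaleC: "scaleC J c (scaleC J d x) = scaleC J (c * d) x"
  and scaleC_scaleR: "scaleC J c (r *\<^sub>R x) = r *\<^sub>R scaleC J c x"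
  and scaleC_of_real: "scaleC J (of_real r) x = r *\<^sub>R x"
  by (simp_all add: scaleC_def J_simps JJ algebra_simps)

lemma scaleC_bop: "bop J A \<Longrightarrow> A (scaleC J c x) = scaleC J c (A x)"
  by (simp add: bop_def scaleC_def linear_add linear_scale bounded_linear.linear)

lemma blscaleC: "bounded_linear (scaleC J c)"
  by (rule bounded_linear_intro[of _ "cmod c"])
    (simp_all add: scaleC_add_right scaleC_scaleR norm_scaleC mult.commute)

lemma bop_scaleC: "bop J (scaleC J c)"
  unfolding bop_def using blscaleC by (simp add: scaleC_def J_simps)

lemma scaleC_eq_0_iff: "scaleC J c x = 0 \<longleftrightarrow> c = 0 \<or> x = 0"
  by (metis norm_scaleC norm_eq_zero mult_eq_0_iff)

end

lemma bop_id: "bop J (\<lambda>x. x)"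
  by (simp add: bop_def bounded_linear_ident)

lemma bop_comp: "bop J A \<Longrightarrow> bop J B \<Longrightarrow> bop J (\<lambda>x. A (B x))"
  unfolding bop_def using bounded_linear_compose[of A B] by simp

lemma bop_add: "linear J \<Longrightarrow> bop J A \<Longrightarrow> bop J B \<Longrightarrow> bop J (\<lambda>x. A x + B x)"
  and bop_diff: "linear J \<Longrightarrow> bop J A \<Longrightarrow> bop J B \<Longrightarrow> bop J (\<lambda>x. A x - B x)"
  unfolding bop_def by (simp_all add: linear_add linear_diff bounded_linear_add bounded_linear_sub)

text \<open>Modulo the ideal the inverses B t of (T - t) P + (1 - P) depend holomorphically on t and
  P (B t) tends to 0 at infinity. Liouville's theorem for the scalar functions h (P (B t)), with h
  a functional dominated by the distance to the ideal, then shows that P has distance 0.\<close>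
lemma (in operator_ideal) invertible_modulo_everywhere:
  fixes J T P :: "'a \<Rightarrow>\<^sub>L 'a" and B :: "complex \<Rightarrow> 'a \<Rightarrow>\<^sub>L 'a"
  assumes cs: "complex_structure (blinfun_apply J)"
    and TJ: "\<And>x. T (J x) = J (T x)" and PJ: "\<And>x. P (J x) = J (P x)"
    and PP: "\<And>x. P (P x) = P x" and PT: "\<And>x. P (T x) = T (P x)"
  defines "S \<equiv> \<lambda>t. (T o\<^sub>L P) - cscale J t P + (id_blinfun - P)"
  assumes inv: "\<And>t. (S t o\<^sub>L B t) - id_blinfun \<in> I" "\<And>t. (B t o\<^sub>L S t) - id_blinfun \<in> I"
  shows "infdist P I = 0"
proof -
  interpret complex_operator "blinfun_apply J" "blinfun_apply T"
    by unfold_locales (use cs TJ in \<open>auto simp: bop_def blinfun.bounded_linear_right\<close>)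
  have apply_cscale: "blinfun_apply (cscale J c X) x = scaleC (blinfun_apply J) c (blinfun_apply X x)" for c X x
    by (simp add: cscale_def scaleC_def blinfun.bilinear_simps)
  have cs_comm: "blinfun_apply P (scaleC J c x) = scaleC J c (P x)"
    "blinfun_apply T (scaleC J c x) = scaleC J c (T x)" for c x
    by (simp_all add: scaleC_def blinfun.bilinear_simps TJ PJ)
  have S_apply: "blinfun_apply (S t) x = T (P x) - scaleC J t (P x) + (x - P x)" for t x
    by (simp add: S_def blinfun.bilinear_simps apply_cscale)
  note simps = blinfun.bilinear_simps apply_cscale S_apply cs_comm
    scaleC_add_right scaleC_diff_right scaleC_minus_right scaleC_zero_right scaleC_scaleC
  have norm_cscale_id: "norm (cscale J c id_blinfun) \<le> cmod c" for c
    by (rule norm_blinfun_bound) (simp_all add: apply_cscale norm_scaleC)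
  have q_cscale_le: "q (cscale J c X) \<le> cmod c * q X" for c X
  proof -
    have "cscale J c X = cscale J c id_blinfun o\<^sub>L X" by (rule blinfun_eqI) (simp add: simps)
    then have "q (cscale J c X) \<le> norm (cscale J c id_blinfun) * q X" using q_comp_left by metis
    also have "\<dots> \<le> cmod c * q X" by (rule mult_right_mono[OF norm_cscale_id q_nonneg])
    finally show ?thesis .
  qed
  have q_cscale: "q (cscale J c X) = cmod c * q X" for c X
  proof (cases "c = 0")
    case True then show ?thesis using q_cscale_le[of c X] q_nonneg[of "cscale J c X"] by simp
  next
    case False
    have "cscale J (inverse c) (cscale J c X) = X"
      using False by (intro blinfun_eqI) (simp add: simps scaleC_one)
    then have "q X \<le> cmod (inverse c) * q (cscale J c X)" using q_cscale_le[of "inverse c" "cscale J c X"] by simp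
    then have "cmod c * q X \<le> q (cscale J c X)" using False by (simp add: norm_inverse norm_divide field_simps)
    then show ?thesis using q_cscale_le[of c X] by simp
  qed
  obtain h where h: "bounded_linear h" "h P = infdist P I" "\<And>X. \<bar>h X\<bar> \<le> infdist X I"
    using functional_infdist[OF subI] by blast
  have hq: "\<bar>h X\<bar> \<le> q X" for X using h(3) by (simp add: q_def)
  have linh: "linear h" using h(1) by (rule bounded_linear.linear)
  \<comment> \<open>The usual complexification of a real functional; it is complex linear for
    \<open>cscale\<close>, and its modulus costs a factor 2.\<close>
  define k where "k X = Complex (h X) (- h (J o\<^sub>L X))" for X
  have k_le: "cmod (k X) \<le> 2 * q X" for X
  proof -
    have "J o\<^sub>L X = cscale J \<i> X" by (simp add: cscale_def)
    then have "\<bar>h (J o\<^sub>L X)\<bar> \<le> q X" using hq[of "J o\<^sub>L X"] q_cscale[of \<i> X] by simp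
    then show ?thesis using hq[of X] cmod_le[of "k X"] by (simp add: k_def)
  qed
  have k_add: "k (X + Y) = k X + k Y" for X Y
  proof -
    have "J o\<^sub>L (X + Y) = (J o\<^sub>L X) + (J o\<^sub>L Y)" by (rule blinfun_eqI) (simp add: simps)
    then show ?thesis by (simp add: k_def linear_add[OF linh] complex_eq_iff)
  qed
  have k_scaleR: "k (r *\<^sub>R X) = r * k X" for r X
  proof -
    have "J o\<^sub>L (r *\<^sub>R X) = r *\<^sub>R (J o\<^sub>L X)" by (rule blinfun_eqI) (simp add: simps)
    then show ?thesis by (simp add: k_def linear_scale[OF linh] complex_eq_iff)
  qed
  have k_diff: "k (X - Y) = k X - k Y" for X Y
    using k_add[of X "- Y"] k_scaleR[of "-1" Y] by simp
  have k_J: "k (J o\<^sub>L X) = \<i> * k X" for X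
  proof -
    have "J o\<^sub>L (J o\<^sub>L X) = (-1) *\<^sub>R X" by (rule blinfun_eqI) (simp add: simps JJ)
    then have "h (J o\<^sub>L (J o\<^sub>L X)) = - h X" by (simp only: linear_scale[OF linh]) simp
    then show ?thesis by (simp add: k_def complex_eq_iff)
  qed
  have k_cscale: "k (cscale J c X) = c * k X" for c X
    unfolding cscale_def k_add k_scaleR k_J by (simp add: algebra_simps complex_eq_iff)
  have k_mod: "k X = k Y" if "X - Y \<in> I" for X Y
    using k_le[of "X - Y"] that k_diff[of X Y] by (simp add: q_def)
  \<comment> \<open>The \<open>B t\<close> are only real linear, as the finite rank corrections are.
    Being inverses modulo the ideal of operators that commute with complex scalars, they commute
    with these scalars modulo the ideal.\<close>
  have B_comm: "cscale J c (B t) - (B t o\<^sub>L cscale J c id_blinfun) \<in> I" for c t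
  proof -
    let ?C = "cscale J c id_blinfun"
    have "(?C o\<^sub>L B t) - (B t o\<^sub>L ?C) =
      (B t o\<^sub>L (?C o\<^sub>L ((S t o\<^sub>L B t) - id_blinfun))) - (((B t o\<^sub>L S t) - id_blinfun) o\<^sub>L (?C o\<^sub>L B t))"
      by (rule blinfun_eqI) (simp add: simps algebra_simps)
    moreover have "cscale J c (B t) = ?C o\<^sub>L B t" by (rule blinfun_eqI) (simp add: simps)
    ultimately show ?thesis
      using subspace_diff[OF subI left[OF left[OF inv(1)]] right[OF inv(2)]] by metis
  qed
  \<comment> \<open>The resolvent identity modulo the ideal; it comes from S t - S s = (s - t)
    P.\<close>
  have B_diff: "B s - B t - cscale J (s - t) (B s o\<^sub>L (P o\<^sub>L B t)) \<in> I" for s t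
  proof -
    let ?C = "cscale J (s - t) id_blinfun"
    have "B s - B t - cscale J (s - t) (B s o\<^sub>L (P o\<^sub>L B t)) =
      (((B s o\<^sub>L S s) - id_blinfun) o\<^sub>L B t) - (B s o\<^sub>L ((S t o\<^sub>L B t) - id_blinfun))
        - ((cscale J (s - t) (B s) - (B s o\<^sub>L ?C)) o\<^sub>L (P o\<^sub>L B t))"
      by (rule blinfun_eqI) (simp add: simps scaleC_diff_left algebra_simps)
    then show ?thesis
      using subspace_diff[OF subI subspace_diff[OF subI right[OF inv(2)] left[OF inv(1)]] right[OF B_comm]] by metis
  qed
  define g where "g t = k (P o\<^sub>L B t)" for t
  define R where "R s t = (P o\<^sub>L B s) o\<^sub>L (P o\<^sub>L B t)" for s t
  have g_diff: "g s - g t = (s - t) * k (R s t)" for s t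
  proof -
    have "((P o\<^sub>L B s) - (P o\<^sub>L B t)) - cscale J (s - t) (R s t) =
        P o\<^sub>L (B s - B t - cscale J (s - t) (B s o\<^sub>L (P o\<^sub>L B t)))"
      by (rule blinfun_eqI) (simp add: simps R_def)
    then have "((P o\<^sub>L B s) - (P o\<^sub>L B t)) - cscale J (s - t) (R s t) \<in> I" using left[OF B_diff] by simp
    then show ?thesis using k_mod k_diff k_cscale unfolding g_def by metis
  qed
  have deriv: "(g has_field_derivative k (R t t)) (at t)" for t
  proof -
    define b where "b = norm (P o\<^sub>L B t)"
    \<comment> \<open>The inverses at different parameters are chosen independently, so no
      continuity is available; the resolvent identity itself bounds \<open>q (B s)\<close> for
      \<open>s\<close> near \<open>t\<close>.\<close>
    have qB: "q (B s) \<le> 2 * q (B t)" if "cmod (s - t) * b \<le> 1/2" for s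
    proof -
      have "q (B s) = q (B t + cscale J (s - t) (B s o\<^sub>L (P o\<^sub>L B t)))"
        by (rule q_mod) (use B_diff[of s t] in \<open>simp add: algebra_simps\<close>)
      also have "\<dots> \<le> q (B t) + cmod (s - t) * q (B s o\<^sub>L (P o\<^sub>L B t))" using q_add q_cscale by metis
      also have "\<dots> \<le> q (B t) + cmod (s - t) * (q (B s) * b)"
        unfolding b_def by (intro add_left_mono mult_left_mono q_comp_right) simp
      also have "\<dots> \<le> q (B t) + 1/2 * q (B s)" using mult_right_mono[OF that q_nonneg[of "B s"]] by (simp add: mult_ac)
      finally show ?thesis by simp
    qed
    have est: "cmod (k (R s t) - k (R t t)) \<le> cmod (s - t) * (4 * norm P * q (B t) * b * b)"
      if s: "cmod (s - t) * b \<le> 1/2" for s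
    proof -
      have "q (B s - B t) = q (cscale J (s - t) (B s o\<^sub>L (P o\<^sub>L B t)))" by (rule q_mod[OF B_diff])
      also have "\<dots> \<le> cmod (s - t) * (q (B s) * b)"
        unfolding q_cscale b_def by (intro mult_left_mono q_comp_right) simp
      also have "\<dots> \<le> cmod (s - t) * (2 * q (B t) * b)"
        by (intro mult_left_mono mult_right_mono qB[OF s]) (auto simp: b_def)
      finally have d: "q (B s - B t) \<le> cmod (s - t) * (2 * q (B t) * b)" .
      have "R s t - R t t = P o\<^sub>L ((B s - B t) o\<^sub>L (P o\<^sub>L B t))"
        by (rule blinfun_eqI) (simp add: simps R_def)
      then have "q (R s t - R t t) \<le> norm P * q ((B s - B t) o\<^sub>L (P o\<^sub>L B t))" using q_comp_left by metis
      also have "\<dots> \<le> norm P * (q (B s - B t) * b)"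
        unfolding b_def by (intro mult_left_mono q_comp_right) simp
      also have "\<dots> \<le> norm P * ((cmod (s - t) * (2 * q (B t) * b)) * b)"
        by (intro mult_left_mono mult_right_mono d) (auto simp: b_def)
      finally have "2 * q (R s t - R t t) \<le> cmod (s - t) * (4 * norm P * q (B t) * b * b)"
        by (simp add: mult_ac)
      from order_trans[OF k_le this] show ?thesis by (simp only: k_diff)
    qed
    have "((\<lambda>s. k (R s t)) \<longlongrightarrow> k (R t t)) (at t)"
    proof (rule LIM_zero_cancel, rule Lim_null_comparison)
      have "((\<lambda>s. cmod (s - t) * b) \<longlongrightarrow> cmod (t - t) * b) (at t)" by (intro tendsto_intros)
      then have "\<forall>\<^sub>F s in at t. cmod (s - t) * b < 1/2" by (rule order_tendstoD) simp
      then show "\<forall>\<^sub>F s in at t. norm (k (R s t) - k (R t t)) \<le> cmod (s - t) * (4 * norm P * q (B t) * b * b)"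
        by (rule eventually_mono) (use est in force)
      have "((\<lambda>s. cmod (s - t) * (4 * norm P * q (B t) * b * b)) \<longlongrightarrow> cmod (t - t) * (4 * norm P * q (B t) * b * b)) (at t)"
        by (intro tendsto_intros)
      then show "((\<lambda>s. cmod (s - t) * (4 * norm P * q (B t) * b * b)) \<longlongrightarrow> 0) (at t)" by simp
    qed
    then have "((\<lambda>s. (g s - g t) / (s - t)) \<longlongrightarrow> k (R t t)) (at t)"
      by (rule Lim_transform_eventually) (auto simp: g_diff eventually_at_filter)
    then show ?thesis by (simp add: has_field_derivative_iff)
  qed
  then have hol: "g holomorphic_on UNIV" by (auto simp: holomorphic_on_def field_differentiable_def intro: has_field_derivative_at_within)
  \<comment> \<open>Applying \<open>P\<close> to the right inverse relation gives (T - t) P B t = P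
    modulo the ideal, whence decay of order 1/|t| at infinity.\<close>
  have PB: "cscale J t (P o\<^sub>L B t) - ((T o\<^sub>L (P o\<^sub>L B t)) - P) \<in> I" for t
  proof -
    have "cscale J t (P o\<^sub>L B t) - ((T o\<^sub>L (P o\<^sub>L B t)) - P) = - (P o\<^sub>L ((S t o\<^sub>L B t) - id_blinfun))"
      by (rule blinfun_eqI) (simp add: simps PP PT algebra_simps)
    then show ?thesis using subspace_neg[OF subI left[OF inv(1)]] by metis
  qed
  have qPB: "q (P o\<^sub>L B t) \<le> q P / (cmod t - norm T)" if t: "cmod t > norm T" for t
  proof -
    have "cmod t * q (P o\<^sub>L B t) = q ((T o\<^sub>L (P o\<^sub>L B t)) - P)" using q_mod[OF PB[of t]] q_cscale by simp
    also have "\<dots> \<le> norm T * q (P o\<^sub>L B t) + q P" using q_diff q_comp_left order_trans add_right_mono by meson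
    finally show ?thesis using t by (simp add: field_simps)
  qed
  have lim0: "((\<lambda>t. 2 * (q P / (cmod t - norm T))) \<longlongrightarrow> 0) at_infinity"
  proof -
    have "filterlim (\<lambda>t. - norm T + cmod t) at_top at_infinity"
      by (rule filterlim_tendsto_add_at_top[OF tendsto_const filterlim_norm_at_top])
    then have "((\<lambda>t. 2 * q P / (- norm T + cmod t)) \<longlongrightarrow> 0) at_infinity"
      by (intro tendsto_divide_0[OF tendsto_const] filterlim_at_top_imp_at_infinity)
    then show ?thesis by simp
  qed
  have big: "\<forall>\<^sub>F t in at_infinity. cmod t > norm T"
    unfolding eventually_at_infinity by (rule exI[of _ "norm T + 1"]) auto
  have "(g \<longlongrightarrow> 0) at_infinity"
  proof (rule Lim_null_comparison[OF _ lim0], rule eventually_mono[OF big])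
    fix t assume "norm T < cmod t"
    then have "2 * q (P o\<^sub>L B t) \<le> 2 * (q P / (cmod t - norm T))" by (intro mult_left_mono qPB) simp_all
    then show "norm (g t) \<le> 2 * (q P / (cmod t - norm T))" using k_le[of "P o\<^sub>L B t"] unfolding g_def by linarith
  qed
  then have g0: "g t = 0" for t using Liouville_weak[OF hol] by blast
  \<comment> \<open>Since \<open>g\<close> vanishes, the same relation leaves k P = k (T P B t) for
    every \<open>t\<close>, and the right-hand side tends to 0.\<close>
  have "cmod (k P) \<le> norm T * (2 * (q P / (cmod t - norm T)))" if t: "cmod t > norm T" for t
  proof -
    have "k (cscale J t (P o\<^sub>L B t)) = k (T o\<^sub>L (P o\<^sub>L B t)) - k P" using k_mod[OF PB[of t]] k_diff by simp
    then have "k P = k (T o\<^sub>L (P o\<^sub>L B t))" using g0[of t] k_cscale by (simp add: g_def)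
    then have "cmod (k P) \<le> 2 * q (T o\<^sub>L (P o\<^sub>L B t))" using k_le by metis
    also have "\<dots> \<le> 2 * (norm T * q (P o\<^sub>L B t))" using q_comp_left by simp
    also have "\<dots> \<le> 2 * (norm T * (q P / (cmod t - norm T)))"
      using mult_left_mono[OF qPB[OF t] norm_ge_zero[of T]] by simp
    finally show ?thesis by (simp add: mult_ac)
  qed
  then have ev: "\<forall>\<^sub>F t in at_infinity. cmod (k P) \<le> norm T * (2 * (q P / (cmod t - norm T)))"
    by (rule eventually_mono[OF big])
  have "((\<lambda>t. norm T * (2 * (q P / (cmod t - norm T)))) \<longlongrightarrow> norm T * 0) (at_infinity :: complex filter)"
    by (intro tendsto_mult tendsto_const lim0)
  then have "cmod (k P) \<le> norm T * 0"
    by (rule tendsto_lowerbound[OF _ ev trivial_limit_at_infinity])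
  then have "k P = 0" by simp
  then show ?thesis using h(2) by (simp add: k_def complex_eq_iff)
qed


lemma operator_ideal_zero: "operator_ideal {0 :: 'a::banach \<Rightarrow>\<^sub>L 'a}"
  by unfold_locales (auto simp: subspace_single_0)

lemma operator_ideal_finite_rank: "operator_ideal {X :: 'a::banach \<Rightarrow>\<^sub>L 'a. finite_rank (blinfun_apply X)}"
proof
  show "subspace {X :: 'a \<Rightarrow>\<^sub>L 'a. finite_rank (blinfun_apply X)}"
    by (rule subspaceI)
      (auto simp: finite_rank_zero plus_blinfun.rep_eq scaleR_blinfun.rep_eq zero_blinfun.rep_eq
        intro: finite_rank_add finite_rank_scaleR)
  fix F A :: "'a \<Rightarrow>\<^sub>L 'a" assume F: "F \<in> {X. finite_rank (blinfun_apply X)}"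
  have "blinfun_apply (A o\<^sub>L F) = (\<lambda>x. A (F x))" "blinfun_apply (F o\<^sub>L A) = (\<lambda>x. F (A x))" by auto
  then show "A o\<^sub>L F \<in> {X. finite_rank (blinfun_apply X)}" "F o\<^sub>L A \<in> {X. finite_rank (blinfun_apply X)}"
    using F finite_rank_comp_left[of "blinfun_apply A" F] finite_rank_comp_right[of "blinfun_apply A" F]
    by (simp_all add: blinfun.bounded_linear_right)
qed

lemma bounded_linear_inv:
  fixes S :: "'a::banach \<Rightarrow> 'a"
  assumes S: "bounded_linear S" and bij: "bij S"
  shows "bounded_linear (inv S)"
proof -
  obtain c where c: "c > 0" "\<And>x. c * norm x \<le> norm (S x)"
    using bij_imp_bounded_below[OF bij] bounded_below_iff[OF S] by blast
  have "linear (inv S)"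
  proof
    have lin: "linear S" using S by (rule bounded_linear.linear)
    have SI: "S (inv S y) = y" for y using bij by (simp add: bij_is_surj surj_f_inv_f)
    fix x y r
    show "inv S (x + y) = inv S x + inv S y"
      by (rule inv_f_eq[OF bij_is_inj[OF bij]]) (simp add: linear_add[OF lin] SI)
    show "inv S (r *\<^sub>R x) = r *\<^sub>R inv S x"
      by (rule inv_f_eq[OF bij_is_inj[OF bij]]) (simp add: linear_scale[OF lin] SI)
  qed
  moreover have "norm (inv S y) \<le> norm y * (1 / c)" for y
    using c(2)[of "inv S y"] c(1) bij by (simp add: field_simps bij_is_surj surj_f_inv_f)
  ultimately show ?thesis by (intro bounded_linear_intro[of _ "1/c"]) (simp_all add: linear_add linear_scale)
qed

text \<open>A finite rank operator at distance below 1 from \<open>P\<close> is injective on the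
  range of \<open>P\<close>, where \<open>P\<close> is the identity: a vector it kills would be
  shorter than itself.\<close>

lemma idempotent_fin_dim_if_near_finite_rank:
  fixes P :: "'a::banach \<Rightarrow>\<^sub>L 'a"
  assumes PP: "\<And>x. P (P x) = P x" and d: "infdist P {X. finite_rank (blinfun_apply X)} = 0"
  shows "fin_dim (range P)"
proof -
  interpret operator_ideal "{X :: 'a \<Rightarrow>\<^sub>L 'a. finite_rank (blinfun_apply X)}" by (rule operator_ideal_finite_rank)
  have "{X :: 'a \<Rightarrow>\<^sub>L 'a. finite_rank (blinfun_apply X)} \<noteq> {}" using subspace_0[OF subI] by blast
  then have "P \<in> closure {X. finite_rank (blinfun_apply X)}"
    using d by (simp add: in_closure_iff_infdist_zero)
  then obtain F :: "'a \<Rightarrow>\<^sub>L 'a" where F: "finite_rank (blinfun_apply F)" "dist P F < 1"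
    unfolding closure_approachable by (metis (no_types, lifting) dist_commute mem_Collect_eq zero_less_one)
  have lin: "linear (blinfun_apply P)" "linear (blinfun_apply F)" by (simp_all add: blinfun.bounded_linear_right bounded_linear.linear)
  have "x = 0" if x: "x \<in> range P" "F x = 0" for x
  proof -
    have "P x = x" using x(1) PP by auto
    then have "norm x = norm ((P - F) x)" using x(2) by (simp add: blinfun.diff_left)
    also have "\<dots> \<le> dist P F * norm x" unfolding dist_norm by (rule norm_blinfun)
    finally have "(1 - dist P F) * norm x \<le> 0" by (simp add: algebra_simps)
    then show ?thesis using F(2) by (simp add: mult_le_0_iff)
  qed
  then have "inj_on (blinfun_apply F) (range P)"
    using lin subspace_range_linear[OF lin(1)] by (simp add: linear_inj_on_iff_eq_0)
  moreover have "fin_dim (F ` range P)"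
    by (rule fin_dim_subset[of "range (blinfun_apply F)"]) (use F(1) in \<open>auto simp: finite_rank_def\<close>)
  ultimately show ?thesis using fin_dim_inj_image[OF lin(2) subspace_range_linear[OF lin(1)]] by blast
qed

section \<open>Consequences of the Liouville argument for plain operators\<close>

context complex_operator
begin

text \<open>Carries the Liouville argument from the type of bounded operators over to functions,
  where the inverses modulo the ideal are merely known to exist for each \<open>t\<close>.\<close>

lemma infdist_if_invertible_modulo_everywhere:
  assumes I: "operator_ideal I"
    and P: "bop J P" "\<And>x. P (P x) = P x" "\<And>x. P (T x) = T (P x)"
    and inv: "\<And>t. \<exists>B. bounded_linear B \<and>
      Blinfun (\<lambda>x. shiftop J T t (P (B x)) + (B x - P (B x)) - x) \<in> I \<and>
      Blinfun (\<lambda>x. B (shiftop J T t (P x) + (x - P x)) - x) \<in> I"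
  shows "infdist (Blinfun P) I = 0"
proof -
  interpret operator_ideal I by (rule I)
  define Q where "Q t B \<longleftrightarrow> bounded_linear B \<and>
      Blinfun (\<lambda>x. shiftop J T t (P (B x)) + (B x - P (B x)) - x) \<in> I \<and>
      Blinfun (\<lambda>x. B (shiftop J T t (P x) + (x - P x)) - x) \<in> I" for t B
  have "\<forall>t. \<exists>B. Q t B" unfolding Q_def using inv by (rule allI)
  then obtain B where "\<forall>t. Q t (B t)" by (rule choice[THEN exE])
  then have B: "\<And>t. bounded_linear (B t)"
      "\<And>t. Blinfun (\<lambda>x. shiftop J T t (P (B t x)) + (B t x - P (B t x)) - x) \<in> I"
      "\<And>t. Blinfun (\<lambda>x. B t (shiftop J T t (P x) + (x - P x)) - x) \<in> I"
    unfolding Q_def by blast+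
  have bl: "bounded_linear P" using P(1) by (simp add: bop_def)
  have ap: "blinfun_apply (Blinfun T) = T" "blinfun_apply (Blinfun J) = J" "blinfun_apply (Blinfun P) = P"
    "blinfun_apply (Blinfun (B t)) = B t" for t
    using blT blJ bl B(1) by (simp_all add: bounded_linear_Blinfun_apply)
  define S where "S t = (Blinfun T o\<^sub>L Blinfun P) - cscale (Blinfun J) t (Blinfun P) + (id_blinfun - Blinfun P)" for t
  have S: "blinfun_apply (S t) x = shiftop J T t (P x) + (x - P x)" for t x
    by (simp add: S_def blinfun.bilinear_simps ap cscale_def shiftop_def scaleC_def)
  show ?thesis
  proof (rule invertible_modulo_everywhere[of "Blinfun J" "Blinfun T" "Blinfun P" "\<lambda>t. Blinfun (B t)", folded S_def])
    fix t
    have "(S t o\<^sub>L Blinfun (B t)) - id_blinfun = Blinfun (\<lambda>x. blinfun_apply ((S t o\<^sub>L Blinfun (B t)) - id_blinfun) x)"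
      by (simp add: blinfun_apply_inverse)
    also have "\<dots> = Blinfun (\<lambda>x. shiftop J T t (P (B t x)) + (B t x - P (B t x)) - x)"
      by (simp add: blinfun.bilinear_simps S ap)
    finally show "(S t o\<^sub>L Blinfun (B t)) - id_blinfun \<in> I" using B(2) by simp
    have "(Blinfun (B t) o\<^sub>L S t) - id_blinfun = Blinfun (\<lambda>x. blinfun_apply ((Blinfun (B t) o\<^sub>L S t) - id_blinfun) x)"
      by (simp add: blinfun_apply_inverse)
    also have "\<dots> = Blinfun (\<lambda>x. B t (shiftop J T t (P x) + (x - P x)) - x)"
      by (simp add: blinfun.bilinear_simps S ap)
    finally show "(Blinfun (B t) o\<^sub>L S t) - id_blinfun \<in> I" using B(3) by simp
  qed (use P TJ cs in \<open>auto simp: ap bop_def\<close>)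
qed

lemma bl_shift: "bop J P \<Longrightarrow> bounded_linear (\<lambda>x. shiftop J T t (P x) + (x - P x))"
proof -
  assume "bop J P"
  then have P: "bounded_linear P" by (simp add: bop_def)
  show ?thesis unfolding shiftop_def
    by (intro bounded_linear_add bounded_linear_sub bounded_linear_compose[OF blT P]
        bounded_linear_compose[OF blscaleC P] bounded_linear_ident P)
qed

text \<open>If \<open>B\<close> inverts S + F, then S B - 1 = - F B and B S - 1 = - B F, so
  \<open>B\<close> inverts \<open>S\<close> modulo the finite rank operators.\<close>

lemma fin_dim_if_weyl_everywhere:
  assumes P: "bop J P" "\<And>x. P (P x) = P x" "\<And>x. P (T x) = T (P x)"
    and w: "\<And>t. weyl (\<lambda>x. shiftop J T t (P x) + (x - P x))"
  shows "fin_dim (range P)"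
proof -
  have "infdist (Blinfun P) {X. finite_rank (blinfun_apply X)} = 0"
  proof (rule infdist_if_invertible_modulo_everywhere[OF operator_ideal_finite_rank P])
    fix t
    define S where "S x = shiftop J T t (P x) + (x - P x)" for x
    have bS: "bounded_linear S" using bl_shift[OF P(1), of t] by (simp add: S_def[abs_def])
    obtain F where F: "finite_rank F" "bij (\<lambda>x. S x + F x)" using w[of t] unfolding weyl_def S_def by blast
    define B where "B = inv (\<lambda>x. S x + F x)"
    have bV: "bounded_linear (\<lambda>x. S x + F x)" using bS F(1) by (simp add: bounded_linear_add finite_rank_def)
    have bB: "bounded_linear B" unfolding B_def by (rule bounded_linear_inv[OF bV F(2)])
    have VB: "S (B x) + F (B x) = x" for x
      unfolding B_def using surj_f_inv_f[OF bij_is_surj[OF F(2)], of x] .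
    have "B (S x + F x) = x" for x
      unfolding B_def using inv_f_f[OF bij_is_inj[OF F(2)], of x] .
    then have "B (S x) + B (F x) = x" for x using linear_add[OF bounded_linear.linear[OF bB]] by simp
    then have e: "S (B x) - x = - F (B x)" "B (S x) - x = - B (F x)" for x
      using VB by (metis add_diff_cancel_left' minus_diff_eq)+
    have fr: "finite_rank (\<lambda>x. - F (B x))" "finite_rank (\<lambda>x. - B (F x))"
      by (intro finite_rank_minus finite_rank_comp_left[OF bB F(1)] finite_rank_comp_right[OF bB F(1)])+
    show "\<exists>B. bounded_linear B \<and>
      Blinfun (\<lambda>x. shiftop J T t (P (B x)) + (B x - P (B x)) - x) \<in> {X. finite_rank (blinfun_apply X)} \<and>
      Blinfun (\<lambda>x. B (shiftop J T t (P x) + (x - P x)) - x) \<in> {X. finite_rank (blinfun_apply X)}"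
    proof (intro exI[of _ B] conjI bB)
      show "Blinfun (\<lambda>x. shiftop J T t (P (B x)) + (B x - P (B x)) - x) \<in> {X. finite_rank (blinfun_apply X)}"
        unfolding S_def[symmetric] e using fr(1) by (simp add: bounded_linear_Blinfun_apply finite_rank_def)
      show "Blinfun (\<lambda>x. B (shiftop J T t (P x) + (x - P x)) - x) \<in> {X. finite_rank (blinfun_apply X)}"
        unfolding S_def[symmetric] e using fr(2) by (simp add: bounded_linear_Blinfun_apply finite_rank_def)
    qed
  qed
  moreover have "blinfun_apply (Blinfun P) = P" using P(1) by (simp add: bop_def bounded_linear_Blinfun_apply)
  ultimately show ?thesis using idempotent_fin_dim_if_near_finite_rank[of "Blinfun P"] P(2) by simp
qed

text \<open>Nonemptiness of the spectrum, for the part of \<open>T\<close> on the range of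
  \<open>P\<close>: the distance of \<open>P\<close> to the zero ideal is its norm.\<close>

lemma zero_if_bij_everywhere:
  assumes P: "bop J P" "\<And>x. P (P x) = P x" "\<And>x. P (T x) = T (P x)"
    and w: "\<And>t. bij (\<lambda>x. shiftop J T t (P x) + (x - P x))"
  shows "P x = 0"
proof -
  have "infdist (Blinfun P) {0} = 0"
  proof (rule infdist_if_invertible_modulo_everywhere[OF operator_ideal_zero P])
    fix t
    define S where "S x = shiftop J T t (P x) + (x - P x)" for x
    have bS: "bounded_linear S" using bl_shift[OF P(1), of t] by (simp add: S_def[abs_def])
    have bij: "bij S" using w[of t] by (simp add: S_def[abs_def])
    have e: "S (inv S x) - x = 0" "inv S (S x) - x = 0" for x
      using bij by (simp_all add: bij_is_inj inv_f_f bij_is_surj surj_f_inv_f)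
    have "Blinfun (\<lambda>x. 0) = (0 :: 'a \<Rightarrow>\<^sub>L 'a)" by (simp add: zero_blinfun_def)
    then show "\<exists>B. bounded_linear B \<and>
      Blinfun (\<lambda>x. shiftop J T t (P (B x)) + (B x - P (B x)) - x) \<in> {0} \<and>
      Blinfun (\<lambda>x. B (shiftop J T t (P x) + (x - P x)) - x) \<in> {0}"
      using bounded_linear_inv[OF bS bij] e unfolding S_def[symmetric] by (intro exI[of _ "inv S"]) simp
  qed
  then have "norm (Blinfun P) = 0" by (simp add: infdist_def)
  then have "blinfun_apply (Blinfun P) x = 0" by simp
  then show ?thesis using P(1) by (simp add: bop_def bounded_linear_Blinfun_apply)
qed

end

section \<open>Cycles of grid edges\<close>

definition edge_integral :: "(complex \<times> complex) set \<Rightarrow> (complex \<Rightarrow> complex) \<Rightarrow> complex" where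
  "edge_integral E F = (\<Sum>(a,b)\<in>E. contour_integral (linepath a b) F)"

text \<open>A contour around \<open>L\<close> as a set of directed edges. The clause on arbitrary
  vertex functions says that as many edges enter a vertex as leave it, so the edges close up to
  loops; the last two clauses are Cauchy's formula inside and outside.\<close>

definition cauchy_edges :: "complex set \<Rightarrow> complex set \<Rightarrow> (complex \<times> complex) set \<Rightarrow> bool" where
  "cauchy_edges L V E \<longleftrightarrow> finite E \<and> (\<forall>(a,b)\<in>E. closed_segment a b \<subseteq> V - L)
     \<and> (\<forall>p :: complex \<Rightarrow> complex. (\<Sum>(a,b)\<in>E. p a - p b) = 0)
     \<and> (\<forall>F z. F holomorphic_on V \<longrightarrow> z \<in> L \<longrightarrow> edge_integral E (\<lambda>w. F w / (w - z)) = 2 * pi * \<i> * F z)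
     \<and> (\<forall>F z. F holomorphic_on V \<longrightarrow> z \<notin> V \<longrightarrow> edge_integral E (\<lambda>w. F w / (w - z)) = 0)"

text \<open>Counterclockwise, and in integer coordinates so that coincidence of edges is exact; the
  mesh size enters only with \<open>grid_point\<close>.\<close>

definition square_edges :: "int \<times> int \<Rightarrow> ((int \<times> int) \<times> (int \<times> int)) set" where
  "square_edges = (\<lambda>(m,n). {((m,n),(m+1,n)), ((m+1,n),(m+1,n+1)), ((m+1,n+1),(m,n+1)), ((m,n+1),(m,n))})"

definition boundary_edges :: "(int \<times> int) set \<Rightarrow> ((int \<times> int) \<times> (int \<times> int)) set" where
  "boundary_edges Q = {e \<in> \<Union>(square_edges ` Q). prod.swap e \<notin> \<Union>(square_edges ` Q)}"

text \<open>A directed edge has a single square on its left.\<close>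

lemma square_edges_disjoint: "s \<noteq> t \<Longrightarrow> square_edges s \<inter> square_edges t = {}"
  by (cases s; cases t) (auto simp: square_edges_def)

lemma finite_boundary_edges: "finite Q \<Longrightarrow> finite (boundary_edges Q)"
  by (simp add: boundary_edges_def square_edges_def case_prod_beta)

text \<open>Interior edges occur twice with opposite directions and cancel.\<close>
lemma sum_boundary_edges:
  fixes I :: "int \<times> int \<Rightarrow> int \<times> int \<Rightarrow> complex"
  assumes Q: "finite Q" and anti: "\<And>a b. I b a = - I a b"
  shows "(\<Sum>(a,b)\<in>boundary_edges Q. I a b) = (\<Sum>s\<in>Q. \<Sum>(a,b)\<in>square_edges s. I a b)"
proof -
  define A where "A = \<Union>(square_edges ` Q)"
  have finA: "finite A" using Q by (simp add: A_def square_edges_def case_prod_beta)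
  define D where "D = {e \<in> A. prod.swap e \<in> A}"
  have A: "A = boundary_edges Q \<union> D" "boundary_edges Q \<inter> D = {}"
    by (auto simp: boundary_edges_def A_def D_def)
  have finite: "finite (boundary_edges Q)" "finite D" using finA A(1) by (metis finite_Un)+
  have "(\<Sum>(a,b)\<in>D. I a b) = (\<Sum>(a,b)\<in>D. - I a b)"
  proof (rule sum.reindex_bij_witness[where i=prod.swap and j=prod.swap])
    fix e
    show "(case prod.swap e of (a,b) \<Rightarrow> - I a b) = (case e of (a,b) \<Rightarrow> I a b)"
      using anti[of "fst e" "snd e"] by (simp add: case_prod_unfold)
  qed (auto simp: D_def)
  then have "(\<Sum>(a,b)\<in>D. I a b) = - (\<Sum>(a,b)\<in>D. I a b)" by (simp add: sum_negf case_prod_unfold)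
  then have D0: "(\<Sum>(a,b)\<in>D. I a b) = 0" by simp
  have "(\<Sum>s\<in>Q. \<Sum>(a,b)\<in>square_edges s. I a b) = (\<Sum>(a,b)\<in>A. I a b)"
    unfolding A_def
  proof (rule sum.UNION_disjoint[symmetric, OF Q])
    show "\<forall>i\<in>Q. finite (square_edges i)" by (simp add: square_edges_def case_prod_beta)
    show "\<forall>i\<in>Q. \<forall>j\<in>Q. i \<noteq> j \<longrightarrow> square_edges i \<inter> square_edges j = {}" using square_edges_disjoint by blast
  qed
  also have "\<dots> = (\<Sum>(a,b)\<in>boundary_edges Q. I a b) + (\<Sum>(a,b)\<in>D. I a b)"
    unfolding A(1) using finite A(2) by (rule sum.union_disjoint)
  finally show ?thesis using D0 by simp
qed

definition grid_point :: "real \<Rightarrow> int \<times> int \<Rightarrow> complex" where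
  "grid_point d = (\<lambda>(m,n). Complex (d * of_int m) (d * of_int n))"

definition grid_square :: "real \<Rightarrow> int \<times> int \<Rightarrow> complex set" where
  "grid_square d = (\<lambda>(m,n). cbox (grid_point d (m,n)) (grid_point d (m+1,n+1)))"

lemma mem_grid_square:
  "z \<in> grid_square d (m,n) \<longleftrightarrow> d * of_int m \<le> Re z \<and> Re z \<le> d * of_int (m+1) \<and> d * of_int n \<le> Im z \<and> Im z \<le> d * of_int (n+1)"
  by (auto simp: grid_square_def grid_point_def in_cbox_complex_iff)

lemma segment_grid_square: "d > 0 \<Longrightarrow> (a,b) \<in> square_edges s \<Longrightarrow>
    closed_segment (grid_point d a) (grid_point d b) \<subseteq> grid_square d s"
proof -
  assume d: "d > 0" and ab: "(a,b) \<in> square_edges s"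
  have "convex (grid_square d s)" by (simp add: grid_square_def case_prod_beta)
  moreover have "grid_point d a \<in> grid_square d s" "grid_point d b \<in> grid_square d s"
    using d ab by (cases s; auto simp: square_edges_def mem_grid_square grid_point_def)+
  ultimately show ?thesis by (simp add: closed_segment_subset)
qed

text \<open>For a boundary edge, the square on its other side is not among the chosen ones, so it
  misses the compact set, and the edge with it.\<close>

lemma square_edge_neighbour:
  assumes "(a,b) \<in> square_edges s"
  shows "\<exists>t. (b,a) \<in> square_edges t"
proof -
  obtain m n where s: "s = (m,n)" by fastforce
  have "(b,a) \<in> square_edges (m,n-1) \<or> (b,a) \<in> square_edges (m+1,n) \<or> (b,a) \<in> square_edges (m,n+1) \<or> (b,a) \<in> square_edges (m-1,n)"
    using assms by (auto simp: s square_edges_def)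
  then show ?thesis by blast
qed

lemma square_integral:
  assumes d: "d > 0" and f: "continuous_on (path_image (rectpath (grid_point d (m,n)) (grid_point d (m+1,n+1)))) f"
  shows "(\<Sum>(a,b)\<in>square_edges (m,n). contour_integral (linepath (grid_point d a) (grid_point d b)) f) =
    contour_integral (rectpath (grid_point d (m,n)) (grid_point d (m+1,n+1))) f"
proof -
  define p where "p = grid_point d"
  have r: "rectpath (p (m,n)) (p (m+1,n+1)) =
      linepath (p (m,n)) (p (m+1,n)) +++ linepath (p (m+1,n)) (p (m+1,n+1)) +++
      linepath (p (m+1,n+1)) (p (m,n+1)) +++ linepath (p (m,n+1)) (p (m,n))"
    by (simp add: rectpath_def p_def grid_point_def Let_def)
  have c: "continuous_on (closed_segment (p (m,n)) (p (m+1,n))) f" "continuous_on (closed_segment (p (m+1,n)) (p (m+1,n+1))) f"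
    "continuous_on (closed_segment (p (m+1,n+1)) (p (m,n+1))) f" "continuous_on (closed_segment (p (m,n+1)) (p (m,n))) f"
    using f unfolding p_def[symmetric] r by (auto simp: path_image_join intro: continuous_on_subset)
  note i = c[THEN contour_integrable_continuous_linepath]
  have "contour_integral (rectpath (p (m,n)) (p (m+1,n+1))) f =
      contour_integral (linepath (p (m,n)) (p (m+1,n))) f + (contour_integral (linepath (p (m+1,n)) (p (m+1,n+1))) f +
      (contour_integral (linepath (p (m+1,n+1)) (p (m,n+1))) f + contour_integral (linepath (p (m,n+1)) (p (m,n))) f))"
    unfolding r using i by (simp add: contour_integrable_joinI valid_path_join)
  then show ?thesis by (simp add: square_edges_def p_def)
qed

lemma square_cauchy:
  assumes d: "d > 0" and V: "grid_square d (m,n) \<subseteq> V" and F: "F holomorphic_on V"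
  shows "z \<in> interior (grid_square d (m,n)) \<Longrightarrow>
      (\<Sum>(a,b)\<in>square_edges (m,n). contour_integral (linepath (grid_point d a) (grid_point d b)) (\<lambda>w. F w / (w - z))) = 2 * pi * \<i> * F z"
    and "z \<notin> grid_square d (m,n) \<Longrightarrow>
      (\<Sum>(a,b)\<in>square_edges (m,n). contour_integral (linepath (grid_point d a) (grid_point d b)) (\<lambda>w. F w / (w - z))) = 0"
proof -
  define p q where "p = grid_point d (m,n)" and "q = grid_point d (m+1,n+1)"
  have sq: "grid_square d (m,n) = cbox p q" by (simp add: grid_square_def p_def q_def)
  have pq: "Re p < Re q" "Im p < Im q" using d by (simp_all add: p_def q_def grid_point_def)
  have FS: "F holomorphic_on cbox p q" using F V sq by (simp add: holomorphic_on_subset)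
  have im: "path_image (rectpath p q) = cbox p q - box p q"
    using pq by (intro path_image_rectpath_cbox_minus_box) auto
  have cont: "continuous_on (path_image (rectpath p q)) (\<lambda>w. F w / (w - z))" if "z \<notin> path_image (rectpath p q)"
    using that im by (intro continuous_intros holomorphic_on_imp_continuous_on holomorphic_on_subset[OF FS]) auto
  {
    assume z: "z \<in> interior (grid_square d (m,n))"
    then have zb: "z \<in> box p q" by (simp add: sq interior_cbox)
    then have zi: "z \<notin> path_image (rectpath p q)" using im by blast
    have "((\<lambda>w. F w / (w - z)) has_contour_integral (2*pi * \<i> * winding_number (rectpath p q) z * F z)) (rectpath p q)"
      by (rule Cauchy_integral_formula_convex_simple[OF convex_box(1) FS]) (use z zi im in \<open>auto simp: sq\<close>)
    then show "(\<Sum>(a,b)\<in>square_edges (m,n). contour_integral (linepath (grid_point d a) (grid_point d b)) (\<lambda>w. F w / (w - z))) = 2 * pi * \<i> * F z"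
      using square_integral[OF d cont[OF zi, unfolded p_def q_def]] winding_number_rectpath[OF zb]
      by (simp add: contour_integral_unique p_def q_def)
  }
  {
    assume z: "z \<notin> grid_square d (m,n)"
    then have zi: "z \<notin> path_image (rectpath p q)" using im sq by blast
    have "((\<lambda>w. F w / (w - z)) has_contour_integral 0) (rectpath p q)"
    proof (rule Cauchy_theorem_convex_simple[where S="cbox p q"])
      show "(\<lambda>w. F w / (w - z)) holomorphic_on cbox p q"
        by (intro holomorphic_intros FS) (use z sq in auto)
    qed (use im in auto)
    then show "(\<Sum>(a,b)\<in>square_edges (m,n). contour_integral (linepath (grid_point d a) (grid_point d b)) (\<lambda>w. F w / (w - z))) = 0"
      using square_integral[OF d cont[OF zi, unfolded p_def q_def]]
      by (simp add: contour_integral_unique p_def q_def)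
  }
qed

lemma interior_grid_square_unique:
  assumes d: "d > 0" and z: "z \<in> interior (grid_square d s)" "z \<in> grid_square d t"
  shows "s = t"
proof -
  obtain m n m' n' where st: "s = (m,n)" "t = (m',n')" by fastforce
  have 1: "d * of_int m < Re z" "Re z < d * of_int (m+1)" "d * of_int n < Im z" "Im z < d * of_int (n+1)"
    using z(1) by (auto simp: st grid_square_def grid_point_def interior_cbox in_box_complex_iff)
  have 2: "d * of_int m' \<le> Re z" "Re z \<le> d * of_int (m'+1)" "d * of_int n' \<le> Im z" "Im z \<le> d * of_int (n'+1)"
    using z(2) by (auto simp: st mem_grid_square)
  have lt: "x < y" if "d * of_int x < d * of_int y" for x y :: int using that d by simp
  have "m < m' + 1" "m' < m + 1" "n < n' + 1" "n' < n + 1"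
    by (rule lt, use 1 2 in linarith)+
  then show ?thesis by (simp add: st)
qed

lemma segment_cauchy_integral_holomorphic:
  assumes F: "continuous_on (closed_segment a b) F"
  shows "(\<lambda>z. contour_integral (linepath a b) (\<lambda>w. F w / (w - z))) holomorphic_on - closed_segment a b"
proof -
  have "((\<lambda>z. contour_integral (linepath a b) (\<lambda>w. F w / (w - z))) has_field_derivative
      of_nat 1 * contour_integral (linepath a b) (\<lambda>w. F w / (w - z) ^ Suc 1)) (at z)"
    if z: "z \<notin> closed_segment a b" for z
  proof (rule Cauchy_next_derivative(2)[where S=UNIV and B="norm (b - a)"])
    fix w assume "w \<in> UNIV - path_image (linepath a b)"
    then have "(\<lambda>u. F u / (u - w)) contour_integrable_on linepath a b"
      by (intro contour_integrable_continuous_linepath continuous_intros F) auto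
    then show "((\<lambda>u. F u / (u - w) ^ 1) has_contour_integral contour_integral (linepath a b) (\<lambda>u. F u / (u - w))) (linepath a b)"
      by (simp add: has_contour_integral_integral)
  qed (use F z in auto)
  then show ?thesis by (subst holomorphic_on_open) (auto simp: open_Compl)
qed

text \<open>The boundary of the union of all small grid squares that meet \<open>L\<close>. Cauchy's
  formula is immediate in the interiors of the squares, where just one square contributes; points of
  \<open>L\<close> on grid lines are reached by continuity.\<close>

lemma cauchy_edges_exist:
  assumes L: "compact L" and V: "open V" "L \<subseteq> V"
  shows "\<exists>E. cauchy_edges L V E"
proof -
  obtain e where e: "e > 0" "(\<Union>x\<in>L. cball x e) \<subseteq> V"
    using compact_subset_open_imp_cball_epsilon_subset[OF L V] by blast
  \<comment> \<open>Two points of one square differ by at most \<open>d\<close> in each coordinate,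
    so the mesh e/2 keeps every square that meets \<open>L\<close> within distance \<open>e\<close>
    of \<open>L\<close>.\<close>
  define d where "d = e / 2"
  have d: "d > 0" using e(1) by (simp add: d_def)
  define Q where "Q = {s. grid_square d s \<inter> L \<noteq> {}}"
  have QV: "grid_square d s \<subseteq> V" if s: "s \<in> Q" for s
  proof
    fix w assume w: "w \<in> grid_square d s"
    obtain z where z: "z \<in> L" "z \<in> grid_square d s" using s by (auto simp: Q_def)
    obtain m n where mn: "s = (m,n)" by fastforce
    have "\<bar>Re (w - z)\<bar> \<le> d" "\<bar>Im (w - z)\<bar> \<le> d"
      using w z(2) by (auto simp: mn mem_grid_square algebra_simps abs_le_iff)
    then have "dist z w \<le> e" using cmod_le[of "w - z"] by (simp add: dist_norm norm_minus_commute d_def)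
    then have "w \<in> cball z e" by simp
    then show "w \<in> V" using e(2) z(1) by blast
  qed
  have finQ: "finite Q"
  proof -
    obtain B where B: "\<And>z. z \<in> L \<Longrightarrow> norm z \<le> B" using compact_imp_bounded[OF L] by (auto simp: bounded_iff)
    define K where "K = \<lceil>B / d\<rceil> + 1"
    have K: "\<bar>k\<bar> \<le> K" if "d * of_int k \<le> x" "x \<le> d * of_int (k + 1)" "\<bar>x\<bar> \<le> B" for k x
    proof -
      have "of_int k \<le> B / d" "- (B / d) \<le> of_int k + 1" using that d by (auto simp: field_simps)
      then have "of_int k \<le> (of_int K :: real)" "- of_int K \<le> (of_int k :: real)" unfolding K_def by linarith+
      then show ?thesis by linarith
    qed
    have "Q \<subseteq> {-K..K} \<times> {-K..K}"
    proof
      fix s assume "s \<in> Q"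
      then obtain z where z: "z \<in> L" "z \<in> grid_square d s" by (auto simp: Q_def)
      obtain m n where mn: "s = (m,n)" by fastforce
      have "\<bar>Re z\<bar> \<le> B" "\<bar>Im z\<bar> \<le> B"
        using B[OF z(1)] abs_Re_le_cmod[of z] abs_Im_le_cmod[of z] by linarith+
      then have "\<bar>m\<bar> \<le> K" "\<bar>n\<bar> \<le> K" using K z(2) unfolding mn mem_grid_square by blast+
      then show "s \<in> {-K..K} \<times> {-K..K}" by (auto simp: mn)
    qed
    then show ?thesis by (rule finite_subset) simp
  qed
  define p where "p = grid_point d"
  have injp: "inj p" unfolding p_def grid_point_def inj_def using d by auto
  define E where "E = (\<lambda>(a,b). (p a, p b)) ` boundary_edges Q"
  have sumE: "(\<Sum>(a,b)\<in>E. g a b) = (\<Sum>(a,b)\<in>boundary_edges Q. g (p a) (p b))" for g :: "complex \<Rightarrow> complex \<Rightarrow> complex"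
    unfolding E_def by (subst sum.reindex) (use injp in \<open>auto simp: inj_on_def inj_def case_prod_unfold\<close>)
  have sum_squares: "edge_integral E f = (\<Sum>s\<in>Q. \<Sum>(a,b)\<in>square_edges s. contour_integral (linepath (p a) (p b)) f)" for f
    unfolding edge_integral_def sumE
  proof (rule sum_boundary_edges[OF finQ])
    show "contour_integral (linepath (p b) (p a)) f = - contour_integral (linepath (p a) (p b)) f" for a b
      using contour_integral_reversepath[of "linepath (p a) (p b)" f] by simp
  qed
  have seg: "closed_segment (p a) (p b) \<subseteq> V - L" if ab: "(a,b) \<in> boundary_edges Q" for a b
  proof -
    obtain s where s: "s \<in> Q" "(a,b) \<in> square_edges s" using ab by (auto simp: boundary_edges_def)
    obtain t where t: "(b,a) \<in> square_edges t" using square_edge_neighbour[OF s(2)] by blast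
    then have "t \<notin> Q" using ab by (auto simp: boundary_edges_def)
    then have "closed_segment (p a) (p b) \<inter> L = {}"
      using segment_grid_square[OF d t] unfolding Q_def p_def by (auto simp: closed_segment_commute)
    then show ?thesis using segment_grid_square[OF d s(2)] QV[OF s(1)] unfolding p_def by blast
  qed
  have segE: "\<forall>(a,b)\<in>E. closed_segment a b \<subseteq> V - L"
  proof (rule ballI)
    fix x assume "x \<in> E"
    then obtain a b where "(a,b) \<in> boundary_edges Q" "x = (p a, p b)" by (force simp: E_def)
    then show "case x of (a,b) \<Rightarrow> closed_segment a b \<subseteq> V - L" using seg by simp
  qed
  have bal: "(\<Sum>(a,b)\<in>E. g a - g b) = 0" for g :: "complex \<Rightarrow> complex"
  proof -
    have "(\<Sum>(a,b)\<in>E. g a - g b) = (\<Sum>s\<in>Q. \<Sum>(a,b)\<in>square_edges s. g (p a) - g (p b))"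
      unfolding sumE by (rule sum_boundary_edges[OF finQ]) simp
    also have "\<dots> = 0"
    proof (rule sum.neutral, rule ballI)
      fix s :: "int \<times> int"
      obtain m n where "s = (m,n)" by fastforce
      then show "(\<Sum>(a,b)\<in>square_edges s. g (p a) - g (p b)) = 0" by (simp add: square_edges_def)
    qed
    finally show ?thesis .
  qed
  have outside: "edge_integral E (\<lambda>w. F w / (w - z)) = 0" if F: "F holomorphic_on V" and z: "z \<notin> V" for F z
    unfolding sum_squares
  proof (rule sum.neutral, rule ballI)
    fix s assume s: "s \<in> Q"
    obtain m n where mn: "s = (m,n)" by fastforce
    show "(\<Sum>(a,b)\<in>square_edges s. contour_integral (linepath (p a) (p b)) (\<lambda>w. F w / (w - z))) = 0"
      using square_cauchy(2)[OF d _ F] QV[OF s] z unfolding mn p_def by blast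
  qed
  have inside: "edge_integral E (\<lambda>w. F w / (w - z)) = 2 * pi * \<i> * F z"
    if F: "F holomorphic_on V" and s: "s \<in> Q" "z \<in> interior (grid_square d s)" for F z s
  proof -
    obtain m n where mn: "s = (m,n)" by fastforce
    have "edge_integral E (\<lambda>w. F w / (w - z)) =
        (\<Sum>(a,b)\<in>square_edges s. contour_integral (linepath (p a) (p b)) (\<lambda>w. F w / (w - z)))"
      unfolding sum_squares
    proof (rule sum.remove[OF finQ s(1), THEN trans])
      have "(\<Sum>t\<in>Q - {s}. \<Sum>(a,b)\<in>square_edges t. contour_integral (linepath (p a) (p b)) (\<lambda>w. F w / (w - z))) = 0"
      proof (rule sum.neutral, rule ballI)
        fix t assume t: "t \<in> Q - {s}"
        obtain k l where kl: "t = (k,l)" by fastforce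
        have "z \<notin> grid_square d t" using interior_grid_square_unique[OF d s(2)] t by blast
        then show "(\<Sum>(a,b)\<in>square_edges t. contour_integral (linepath (p a) (p b)) (\<lambda>w. F w / (w - z))) = 0"
          using square_cauchy(2)[OF d _ F] QV[of t] t unfolding kl p_def by blast
      qed
      then show "(\<Sum>(a,b)\<in>square_edges s. contour_integral (linepath (p a) (p b)) (\<lambda>w. F w / (w - z))) +
          (\<Sum>t\<in>Q - {s}. \<Sum>(a,b)\<in>square_edges t. contour_integral (linepath (p a) (p b)) (\<lambda>w. F w / (w - z))) =
          (\<Sum>(a,b)\<in>square_edges s. contour_integral (linepath (p a) (p b)) (\<lambda>w. F w / (w - z)))" by simp
    qed
    also have "\<dots> = 2 * pi * \<i> * F z"
      using square_cauchy(1)[OF d _ F] QV[OF s(1)] s(2) unfolding mn p_def by blast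
    finally show ?thesis .
  qed
  have onL: "edge_integral E (\<lambda>w. F w / (w - z)) = 2 * pi * \<i> * F z" if F: "F holomorphic_on V" and z: "z \<in> L" for F z
  proof -
    define s where "s = (\<lfloor>Re z / d\<rfloor>, \<lfloor>Im z / d\<rfloor>)"
    have zs: "z \<in> grid_square d s"
    proof -
      have "real_of_int \<lfloor>x / d\<rfloor> * d \<le> x" "x \<le> (real_of_int \<lfloor>x / d\<rfloor> + 1) * d" for x
        by (simp_all only: pos_le_divide_eq[OF d, symmetric] pos_divide_le_eq[OF d, symmetric]
            of_int_floor_le real_of_int_floor_add_one_ge)
      then have "d * of_int \<lfloor>x / d\<rfloor> \<le> x" "x \<le> d * of_int (\<lfloor>x / d\<rfloor> + 1)" for x
        by (simp_all add: mult.commute)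
      then show ?thesis unfolding s_def mem_grid_square by blast
    qed
    then have s: "s \<in> Q" using z by (auto simp: Q_def)
    show ?thesis
    proof (cases "z \<in> interior (grid_square d s)")
      case True then show ?thesis using inside[OF F s] by blast
    next
      \<comment> \<open>On a grid line, both sides of the formula are continuous at
        \<open>z\<close>, because the edges avoid \<open>L\<close>. They agree in the interior of
        the square, whose closure contains \<open>z\<close>.\<close>
      case False
      obtain m n where mn: "s = (m,n)" by fastforce
      have "box (p (m,n)) (p (m+1,n+1)) \<noteq> {}"
        using d by (auto simp: p_def grid_point_def box_ne_empty Basis_complex_def)
      then have "closure (interior (grid_square d s)) = grid_square d s"
        by (simp add: mn grid_square_def interior_cbox p_def)
      then have "z islimpt interior (grid_square d s)" using zs False by (auto simp: closure_def)
      then have nt: "at z within interior (grid_square d s) \<noteq> bot" by (simp add: trivial_limit_within)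
      define G where "G z = edge_integral E (\<lambda>w. F w / (w - z)) - 2 * pi * \<i> * F z" for z
      have "isCont G z"
        unfolding G_def edge_integral_def
      proof (intro continuous_intros isCont_diff isCont_sum ballI)
        show "isCont F z"
          using F V z by (metis continuous_on_eq_continuous_at holomorphic_on_imp_continuous_on subsetD)
        fix x assume "x \<in> E"
        then obtain a b where ab: "x = (a,b)" "closed_segment a b \<subseteq> V - L" using segE by force
        show "isCont (\<lambda>z. case x of (a,b) \<Rightarrow> contour_integral (linepath a b) (\<lambda>w. F w / (w - z))) z"
          unfolding ab(1) prod.case
        proof (rule continuous_on_interior)
          show "continuous_on (- closed_segment a b) (\<lambda>z. contour_integral (linepath a b) (\<lambda>w. F w / (w - z)))"
            using ab(2) F by (intro holomorphic_on_imp_continuous_on segment_cauchy_integral_holomorphic)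
              (auto elim: holomorphic_on_subset)
          show "z \<in> interior (- closed_segment a b)"
            using ab(2) z by (simp add: interior_open open_Compl) blast
        qed
      qed
      then have "(G \<longlongrightarrow> G z) (at z within interior (grid_square d s))"
        unfolding isCont_def by (rule tendsto_within_subset) simp
      moreover have "(G \<longlongrightarrow> 0) (at z within interior (grid_square d s))"
        by (rule tendsto_eventually) (auto simp: eventually_at_filter G_def inside[OF F s])
      ultimately have "G z = 0" using tendsto_unique[OF nt] by blast
      then show ?thesis by (simp add: G_def)
    qed
  qed
  have "finite E" unfolding E_def using finite_boundary_edges[OF finQ] by simp
  then have "cauchy_edges L V E"
    unfolding cauchy_edges_def using segE bal outside onL by blast
  then show ?thesis by blast
qed

section \<open>Cauchy's theorem in homology form and independence of the cycle\<close>

lemma cauchy_edges_subset: "cauchy_edges L V E \<Longrightarrow> K \<subseteq> L \<Longrightarrow> cauchy_edges K V E"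
  unfolding cauchy_edges_def by blast

text \<open>Exchanging two contour integrals requires a continuous derivative, which a valid path
  may lack at finitely many points. A polynomial loop close to the given one has the same integrals
  of holomorphic functions.\<close>

lemma polynomial_loop_nearby:
  assumes V: "open V" and g: "valid_path g" "pathfinish g = pathstart g" "path_image g \<subseteq> V"
  shows "\<exists>p. polynomial_function p \<and> pathfinish p = pathstart p \<and> path_image p \<subseteq> V \<and>
    (\<forall>F. F holomorphic_on V \<longrightarrow> contour_integral p F = contour_integral g F)"
proof -
  have pg: "path g" using g(1) by (rule valid_path_imp_path)
  obtain d where d: "d > 0" "\<And>k h. valid_path k \<and> valid_path h \<and>
      (\<forall>t\<in>{0..1}. norm (k t - g t) < d \<and> norm (h t - g t) < d) \<and>
      pathfinish k = pathstart k \<and> pathfinish h = pathstart h \<Longrightarrow>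
      path_image k \<subseteq> V \<and> path_image h \<subseteq> V \<and> (\<forall>f. f holomorphic_on V \<longrightarrow> contour_integral h f = contour_integral k f)"
    using contour_integral_nearby_loops[OF V pg g(3)] by blast
  obtain p where p: "polynomial_function p" "pathstart p = pathstart g" "pathfinish p = pathfinish g"
      "\<And>t. t \<in> {0..1} \<Longrightarrow> norm (p t - g t) < d"
    using path_approx_polynomial_function[OF pg d(1)] by blast
  have "path_image g \<subseteq> V \<and> path_image p \<subseteq> V \<and> (\<forall>f. f holomorphic_on V \<longrightarrow> contour_integral p f = contour_integral g f)"
    by (rule d(2)) (use p g d(1) valid_path_polynomial_function in auto)
  then show ?thesis using p g(2) by metis
qed

lemma sum_list_sum_swap:
  fixes f :: "'a \<Rightarrow> 'b \<Rightarrow> 'c::comm_monoid_add"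
  shows "(\<Sum>g\<leftarrow>gs. \<Sum>e\<in>E. f g e) = (\<Sum>e\<in>E. \<Sum>g\<leftarrow>gs. f g e)"
  by (induction gs) (simp_all add: sum.distrib)

lemma continuous_vector_derivative_polynomial_function:
  fixes p :: "real \<Rightarrow> complex"
  assumes "polynomial_function p" shows "continuous_on {0..1} (\<lambda>t. vector_derivative p (at t))"
proof -
  obtain p' where p': "polynomial_function p'" "\<And>x. (p has_vector_derivative (p' x)) (at x)"
    using has_vector_derivative_polynomial_function[OF assms] by blast
  then have "(\<lambda>t. vector_derivative p (at t)) = p'" using vector_derivative_at by blast
  then show ?thesis using p'(1) by (simp add: continuous_on_polymonial_function)
qed

text \<open>The winding set L of a cycle is compact, so F on L is the Cauchy integral over edges off L.
  After exchanging the integrals, the inner one is a winding number at a point off L, which is 0.\<close>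
lemma cauchy_theorem_cycle:
  assumes V: "open V"
    and gs: "\<And>g. g \<in> set gs \<Longrightarrow> valid_path g \<and> pathfinish g = pathstart g \<and> path_image g \<subseteq> V"
    and wn: "\<And>z. z \<notin> V \<Longrightarrow> (\<Sum>g\<leftarrow>gs. winding_number g z) = 0"
    and F: "F holomorphic_on V"
  shows "(\<Sum>g\<leftarrow>gs. contour_integral g F) = 0"
proof -
  obtain q where q: "\<And>g. g \<in> set gs \<Longrightarrow> polynomial_function (q g) \<and> pathfinish (q g) = pathstart (q g) \<and>
      path_image (q g) \<subseteq> V \<and> (\<forall>F. F holomorphic_on V \<longrightarrow> contour_integral (q g) F = contour_integral g F)"
    using polynomial_loop_nearby[OF V] gs by metis
  have vq: "valid_path (q g)" "path (q g)" if "g \<in> set gs" for g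
    using q[OF that] valid_path_polynomial_function path_polynomial_function by blast+
  define n where "n z = (\<Sum>g\<leftarrow>gs. winding_number (q g) z)" for z
  have n0: "n z = 0" if z: "z \<notin> V" for z
  proof -
    have "winding_number (q g) z = winding_number g z" if g: "g \<in> set gs" for g
    proof -
      have "(\<lambda>w. 1 / (w - z)) holomorphic_on V" using z by (intro holomorphic_intros) auto
      then have "contour_integral (q g) (\<lambda>w. 1 / (w - z)) = contour_integral g (\<lambda>w. 1 / (w - z))" using q[OF g] by blast
      moreover have "z \<notin> path_image g" "z \<notin> path_image (q g)" using q[OF g] gs[OF g] z by blast+
      ultimately show ?thesis using vq(1)[OF g] gs[OF g] by (simp add: winding_number_valid_path)
    qed
    then show ?thesis using wn[OF z] unfolding n_def by (simp cong: map_cong)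
  qed
  define L where "L = {z. (\<exists>g\<in>set gs. z \<in> path_image (q g)) \<or> n z \<noteq> 0}"
  have LV: "L \<subseteq> V" using q n0 unfolding L_def by blast
  have "open (- L)"
  proof (rule open_subopen[THEN iffD2], rule ballI)
    fix z assume z: "z \<in> - L"
    define W where "W = (\<Inter>g\<in>set gs. {x. x \<notin> path_image (q g) \<and> winding_number (q g) x = winding_number (q g) z})"
    have "open W" unfolding W_def
      by (intro open_INT ballI finite_set open_winding_number_levelsets vq) (use q in auto)
    moreover have "z \<in> W" using z by (auto simp: W_def L_def)
    moreover have "W \<subseteq> - L"
    proof
      fix x assume x: "x \<in> W"
      then have "n x = n z" unfolding n_def W_def by (simp cong: map_cong)
      then show "x \<in> - L" using x z by (auto simp: L_def W_def)
    qed
    ultimately show "\<exists>T. open T \<and> z \<in> T \<and> T \<subseteq> - L" by blast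
  qed
  moreover have "bounded L"
  proof -
    have "\<exists>B. \<forall>z. B \<le> norm z \<longrightarrow> z \<notin> path_image (q g) \<and> winding_number (q g) z = 0" if g: "g \<in> set gs" for g
    proof -
      obtain B1 where B1: "\<And>z. B1 \<le> norm z \<Longrightarrow> winding_number (q g) z = 0"
        using winding_number_zero_at_infinity[OF vq(2)[OF g]] q[OF g] by blast
      obtain B2 where "path_image (q g) \<subseteq> ball 0 B2"
        using bounded_subset_ballD[OF bounded_path_image[OF vq(2)[OF g]]] by blast
      then have "z \<notin> path_image (q g)" if "B2 \<le> norm z" for z using that by auto
      then show ?thesis using B1 by (intro exI[of _ "max B1 B2"]) simp
    qed
    then obtain b where b: "\<And>g z. g \<in> set gs \<Longrightarrow> b g \<le> norm z \<Longrightarrow> z \<notin> path_image (q g) \<and> winding_number (q g) z = 0"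
      by metis
    have "z \<notin> L" if z: "(\<Sum>g\<in>set gs. \<bar>b g\<bar>) \<le> norm z" for z
    proof -
      have bz: "b g \<le> norm z" if g: "g \<in> set gs" for g
        using member_le_sum[of g "set gs" "\<lambda>g. \<bar>b g\<bar>"] g z by simp
      then have "n z = 0" unfolding n_def using b by (simp cong: map_cong)
      then show ?thesis using b bz by (auto simp: L_def)
    qed
    then have "L \<subseteq> cball 0 (\<Sum>g\<in>set gs. \<bar>b g\<bar>)" by (auto simp: not_le) (meson linear)
    then show ?thesis by (rule bounded_subset[OF bounded_cball])
  qed
  ultimately have "compact L" by (simp add: compact_eq_bounded_closed closed_def)
  then obtain E where E: "cauchy_edges L V E" using cauchy_edges_exist[OF _ V LV] by blast
  then have seg: "\<And>a b. (a,b) \<in> E \<Longrightarrow> closed_segment a b \<subseteq> V - L"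
    and rep: "\<And>z. z \<in> L \<Longrightarrow> edge_integral E (\<lambda>w. F w / (w - z)) = 2 * pi * \<i> * F z"
    and finE: "finite E"
    using F by (auto simp: cauchy_edges_def)
  have contF: "continuous_on (closed_segment a b) F" if "(a,b) \<in> E" for a b
    using seg[OF that] F by (meson Diff_subset continuous_on_subset holomorphic_on_imp_continuous_on order_trans)
  have off: "closed_segment a b \<inter> path_image (q g) = {}" if "(a,b) \<in> E" "g \<in> set gs" for a b g
    using seg[OF that(1)] that(2) by (auto simp: L_def)
  have swap: "contour_integral (q g) (\<lambda>z. contour_integral (linepath a b) (\<lambda>w. F w / (w - z))) =
      (- 2 * pi * \<i> * contour_integral (linepath a b) F) * winding_number (q g) a"
    if ab: "(a,b) \<in> E" and g: "g \<in> set gs" for a b g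
  proof -
    have "contour_integral (q g) (\<lambda>z. contour_integral (linepath a b) (\<lambda>w. F w / (w - z))) =
        contour_integral (linepath a b) (\<lambda>w. contour_integral (q g) (\<lambda>z. F w / (w - z)))"
    proof (rule contour_integral_swap)
      show "continuous_on (path_image (q g) \<times> path_image (linepath a b)) (\<lambda>(z, w). F w / (w - z))"
        unfolding case_prod_beta
      proof (intro continuous_intros)
        show "continuous_on (path_image (q g) \<times> path_image (linepath a b)) (\<lambda>x. F (snd x))"
          by (rule continuous_on_compose2[OF contF[OF ab] continuous_on_snd[OF continuous_on_id]]) auto
        show "\<forall>x\<in>path_image (q g) \<times> path_image (linepath a b). snd x - fst x \<noteq> 0"
          using off[OF ab g] by auto
      qed
      show "continuous_on {0..1} (\<lambda>t. vector_derivative (q g) (at t))"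
        using q[OF g] continuous_vector_derivative_polynomial_function by blast
    qed (auto simp: vq[OF g])
    \<comment> \<open>The segment avoids the path, so the winding number is constant on it and may
      be taken at the endpoint \<open>a\<close>. The sign comes from w - z in place of z -
      w.\<close>
    also have "\<dots> = contour_integral (linepath a b) (\<lambda>w. (- 2 * pi * \<i> * winding_number (q g) a) * F w)"
    proof (rule contour_integral_eq)
      fix w assume w: "w \<in> path_image (linepath a b)"
      then have wq: "w \<notin> path_image (q g)" using off[OF ab g] by auto
      have "winding_number (q g) w = winding_number (q g) a"
        by (rule winding_number_eq[OF vq(2)[OF g], where S="closed_segment a b"])
          (use w q[OF g] off[OF ab g] in auto)
      moreover have "contour_integral (q g) (\<lambda>z. 1 / (z - w)) = 2 * pi * \<i> * winding_number (q g) w"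
        using vq(1)[OF g] wq by (simp add: winding_number_valid_path)
      moreover have "contour_integral (q g) (\<lambda>z. F w / (w - z)) = contour_integral (q g) (\<lambda>z. (- F w) * (1 / (z - w)))"
        by (intro contour_integral_eq) (metis minus_diff_eq minus_divide_divide mult_minus_left mult.right_neutral times_divide_eq_right minus_divide_left minus_divide_right)
      moreover have "contour_integral (q g) (\<lambda>z. (- F w) * (1 / (z - w))) = - F w * contour_integral (q g) (\<lambda>z. 1 / (z - w))"
        by (intro contour_integral_lmul contour_integrable_inversediff vq(1)[OF g] wq)
      ultimately show "contour_integral (q g) (\<lambda>z. F w / (w - z)) = (- 2 * pi * \<i> * winding_number (q g) a) * F w"
        by (simp add: algebra_simps)
    qed
    also have "\<dots> = (- 2 * pi * \<i> * winding_number (q g) a) * contour_integral (linepath a b) F"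
      by (intro contour_integral_lmul contour_integrable_continuous_linepath contF[OF ab])
    finally show ?thesis by (simp add: mult_ac)
  qed
  have "2 * pi * \<i> * contour_integral (q g) F =
      (\<Sum>(a,b)\<in>E. (- 2 * pi * \<i> * contour_integral (linepath a b) F) * winding_number (q g) a)"
    if g: "g \<in> set gs" for g
  proof -
    have "F contour_integrable_on (q g)"
      using contour_integrable_holomorphic_simple[OF F V vq(1)[OF g]] q[OF g] by blast
    then have "2 * pi * \<i> * contour_integral (q g) F = contour_integral (q g) (\<lambda>z. 2 * pi * \<i> * F z)"
      by (simp add: contour_integral_lmul)
    also have "\<dots> = contour_integral (q g) (\<lambda>z. \<Sum>e\<in>E. contour_integral (linepath (fst e) (snd e)) (\<lambda>w. F w / (w - z)))"
    proof (rule contour_integral_eq)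
      fix z assume "z \<in> path_image (q g)"
      then have "z \<in> L" using g by (auto simp: L_def)
      then show "2 * pi * \<i> * F z = (\<Sum>e\<in>E. contour_integral (linepath (fst e) (snd e)) (\<lambda>w. F w / (w - z)))"
        using rep[of z] by (simp add: edge_integral_def case_prod_beta)
    qed
    also have "\<dots> = (\<Sum>e\<in>E. contour_integral (q g) (\<lambda>z. contour_integral (linepath (fst e) (snd e)) (\<lambda>w. F w / (w - z))))"
    proof (rule contour_integral_sum[OF finE])
      fix e assume e: "e \<in> E"
      then have e': "(fst e, snd e) \<in> E" by simp
      show "(\<lambda>z. contour_integral (linepath (fst e) (snd e)) (\<lambda>w. F w / (w - z))) contour_integrable_on (q g)"
        by (rule contour_integrable_holomorphic_simple[OF segment_cauchy_integral_holomorphic[OF contF[OF e']] _ vq(1)[OF g]])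
          (use off[OF e' g] in \<open>auto simp: open_Compl\<close>)
    qed
    also have "\<dots> = (\<Sum>(a,b)\<in>E. (- 2 * pi * \<i> * contour_integral (linepath a b) F) * winding_number (q g) a)"
      unfolding case_prod_beta by (intro sum.cong refl swap g) simp
    finally show ?thesis .
  qed
  then have "(\<Sum>g\<leftarrow>gs. 2 * pi * \<i> * contour_integral (q g) F) =
      (\<Sum>g\<leftarrow>gs. \<Sum>(a,b)\<in>E. (- 2 * pi * \<i> * contour_integral (linepath a b) F) * winding_number (q g) a)"
    by (intro arg_cong[where f=sum_list] map_cong refl)
  also have "\<dots> = (\<Sum>(a,b)\<in>E. (- 2 * pi * \<i> * contour_integral (linepath a b) F) * n a)"
    unfolding n_def sum_list_sum_swap case_prod_beta by (simp only: sum_list_const_mult)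
  also have "\<dots> = 0"
  proof (rule sum.neutral, rule ballI)
    fix e assume "e \<in> E"
    then have "fst e \<in> V - L" using seg[of "fst e" "snd e"] by auto
    then show "(case e of (a,b) \<Rightarrow> (- 2 * pi * \<i> * contour_integral (linepath a b) F) * n a) = 0"
      by (simp add: L_def case_prod_beta)
  qed
  finally have "2 * pi * \<i> * (\<Sum>g\<leftarrow>gs. contour_integral (q g) F) = 0" by (simp add: sum_list_const_mult)
  then have "(\<Sum>g\<leftarrow>gs. contour_integral (q g) F) = 0" by simp
  moreover have "(\<Sum>g\<leftarrow>gs. contour_integral (q g) F) = (\<Sum>g\<leftarrow>gs. contour_integral g F)"
    using q F by (intro arg_cong[where f=sum_list] map_cong refl) blast
  ultimately show ?thesis by simp
qed

text \<open>Each edge is closed up by fixed paths from a base point of its component to its two ends.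
  As the edges are balanced, these auxiliary paths cancel in every contour integral.\<close>
lemma loops_from_balanced_edges:
  assumes V: "open V" and E: "finite E" and seg: "\<And>a b. (a,b) \<in> E \<Longrightarrow> closed_segment a b \<subseteq> V"
    and bal: "\<And>p :: complex \<Rightarrow> complex. (\<Sum>(a,b)\<in>E. p a - p b) = 0"
  shows "\<exists>gs. (\<forall>g\<in>set gs. valid_path g \<and> pathfinish g = pathstart g \<and> path_image g \<subseteq> V) \<and>
    (\<forall>F. F holomorphic_on V \<longrightarrow> (\<Sum>g\<leftarrow>gs. contour_integral g F) = edge_integral E F)"
proof -
  define B where "B v = (SOME x. x \<in> connected_component_set V v)" for v
  have "\<exists>g. valid_path g \<and> path_image g \<subseteq> V \<and> pathstart g = B v \<and> pathfinish g = v" if v: "v \<in> V" for v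
  proof -
    have vc: "v \<in> connected_component_set V v" using v by simp
    then have "B v \<in> connected_component_set V v" unfolding B_def by (rule someI)
    then obtain g where g: "polynomial_function g" "path_image g \<subseteq> connected_component_set V v" "pathstart g = B v" "pathfinish g = v"
      using connected_open_polynomial_connected[OF open_connected_component[OF V] connected_connected_component _ vc] by blast
    then show ?thesis using valid_path_polynomial_function connected_component_subset by (metis subset_trans)
  qed
  then obtain c where c: "\<And>v. v \<in> V \<Longrightarrow> valid_path (c v) \<and> path_image (c v) \<subseteq> V \<and> pathstart (c v) = B v \<and> pathfinish (c v) = v"
    by metis
  define loop where "loop = (\<lambda>(a,b). c a +++ linepath a b +++ reversepath (c b))"
  obtain xs where xs: "set xs = E" "distinct xs" using finite_distinct_list[OF E] by blast
  have ends: "a \<in> V" "b \<in> V" "B a = B b" if ab: "(a,b) \<in> E" for a b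
  proof -
    show "a \<in> V" "b \<in> V" using seg[OF ab] by auto
    have "connected_component V a b" unfolding connected_component_def
      using seg[OF ab] by (intro exI[of _ "closed_segment a b"]) auto
    then show "B a = B b" unfolding B_def using connected_component_eq_eq by (metis connected_component_eq mem_Collect_eq)
  qed
  have loop: "valid_path (loop e) \<and> pathfinish (loop e) = pathstart (loop e) \<and> path_image (loop e) \<subseteq> V" if e: "e \<in> E" for e
  proof -
    obtain a b where ab: "e = (a,b)" by fastforce
    show ?thesis using ends[of a b] e c[of a] c[of b] seg[of a b]
      by (auto simp: ab loop_def path_image_join intro!: valid_path_join)
  qed
  have "(\<Sum>g\<leftarrow>map loop xs. contour_integral g F) = edge_integral E F" if F: "F holomorphic_on V" for F
  proof -
    have "contour_integral (loop (a,b)) F = contour_integral (linepath a b) F + (contour_integral (c a) F - contour_integral (c b) F)"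
      if ab: "(a,b) \<in> E" for a b
    proof -
      note e = ends[OF ab] c[OF ends(1)[OF ab]] c[OF ends(2)[OF ab]] seg[OF ab]
      have i: "F contour_integrable_on c a" "F contour_integrable_on linepath a b" "F contour_integrable_on reversepath (c b)"
        using e by (auto intro!: contour_integrable_holomorphic_simple[OF F V])
      then have "F contour_integrable_on (linepath a b +++ reversepath (c b))" using e by (simp add: contour_integrable_joinI)
      then show ?thesis using i e unfolding loop_def by (simp add: valid_path_join contour_integral_reversepath)
    qed
    then have "(\<Sum>e\<in>E. contour_integral (loop e) F) =
        (\<Sum>(a,b)\<in>E. contour_integral (linepath a b) F + (contour_integral (c a) F - contour_integral (c b) F))"
      by (intro sum.cong) auto
    also have "\<dots> = edge_integral E F"
      using bal[of "\<lambda>v. contour_integral (c v) F"] by (simp add: edge_integral_def case_prod_beta sum.distrib)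
    finally show ?thesis using xs by (simp add: sum_list_distinct_conv_sum_set o_def)
  qed
  then show ?thesis using loop xs(1) by (intro exI[of _ "map loop xs"]) auto
qed

text \<open>The total winding number is the edge integral of the Cauchy kernel with the constant
  function 1, which is 2 pi i on \<open>K\<close> and 0 off \<open>U\<close>. The second property is
  stated for functions on \<open>U - K\<close> because the resolvent lives only there.\<close>

lemma cauchy_edges_loops:
  assumes U: "open U" and K: "closed K" and E: "cauchy_edges K U E"
  obtains gs where "admissible_cycle K U gs"
    "\<And>F. F holomorphic_on U - K \<Longrightarrow> (\<Sum>g\<leftarrow>gs. contour_integral g F) = edge_integral E F"
proof -
  have V: "open (U - K)" using U K by blast
  obtain gs where gs: "\<And>g. g \<in> set gs \<Longrightarrow> valid_path g \<and> pathfinish g = pathstart g \<and> path_image g \<subseteq> U - K"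
      "\<And>F. F holomorphic_on U - K \<Longrightarrow> (\<Sum>g\<leftarrow>gs. contour_integral g F) = edge_integral E F"
    using loops_from_balanced_edges[OF V, of E] E unfolding cauchy_edges_def by blast
  have w: "2 * pi * \<i> * (\<Sum>g\<leftarrow>gs. winding_number g z) = edge_integral E (\<lambda>w. 1 / (w - z))" if z: "z \<notin> U - K" for z
  proof -
    have "2 * pi * \<i> * (\<Sum>g\<leftarrow>gs. winding_number g z) = (\<Sum>g\<leftarrow>gs. 2 * pi * \<i> * winding_number g z)"
      by (simp add: sum_list_const_mult)
    also have "\<dots> = (\<Sum>g\<leftarrow>gs. contour_integral g (\<lambda>w. 1 / (w - z)))"
      using gs(1) z by (intro arg_cong[where f=sum_list] map_cong refl) (subst winding_number_valid_path, auto)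
    also have "\<dots> = edge_integral E (\<lambda>w. 1 / (w - z))"
      using z by (intro gs(2) holomorphic_intros) auto
    finally show ?thesis .
  qed
  have one: "(\<lambda>w. 1) holomorphic_on U" by simp
  then have "edge_integral E (\<lambda>w. 1 / (w - z)) = 2 * pi * \<i>" if "z \<in> K" for z
    using E that unfolding cauchy_edges_def by fastforce
  then have "(\<Sum>g\<leftarrow>gs. winding_number g z) = 1" if "z \<in> K" for z
    using w[of z] that by simp
  moreover have "edge_integral E (\<lambda>w. 1 / (w - z)) = 0" if "z \<notin> U" for z
    using E that one unfolding cauchy_edges_def by fastforce
  then have "(\<Sum>g\<leftarrow>gs. winding_number g z) = 0" if "z \<notin> U" for z
    using w[of z] that by simp
  ultimately have "admissible_cycle K U gs"
    unfolding admissible_cycle_def using gs(1) by blast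
  then show ?thesis using gs(2) that by blast
qed

text \<open>The given cycle together with the reversed loops obtained from \<open>E\<close> has
  winding number 0 at every point off \<open>U - K\<close>, so Cauchy's theorem for cycles applies
  to the difference.\<close>

lemma admissible_cycle_integral:
  assumes U: "open U" and K: "closed K" and E: "cauchy_edges K U E"
    and gs: "admissible_cycle K U gs" and F: "F holomorphic_on U - K"
  shows "(\<Sum>g\<leftarrow>gs. contour_integral g F) = edge_integral E F"
proof -
  obtain hs where hs: "admissible_cycle K U hs"
    "\<And>F. F holomorphic_on U - K \<Longrightarrow> (\<Sum>g\<leftarrow>hs. contour_integral g F) = edge_integral E F"
    using cauchy_edges_loops[OF U K E] by blast
  have V: "open (U - K)" using U K by blast
  have gp: "\<And>g. g \<in> set gs \<Longrightarrow> valid_path g \<and> pathfinish g = pathstart g \<and> path_image g \<subseteq> U - K"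
    and hp: "\<And>g. g \<in> set hs \<Longrightarrow> valid_path g \<and> pathfinish g = pathstart g \<and> path_image g \<subseteq> U - K"
    using gs hs(1) by (auto simp: admissible_cycle_def)
  have "(\<Sum>g\<leftarrow>gs @ map reversepath hs. contour_integral g F) = 0"
  proof (rule cauchy_theorem_cycle[OF V _ _ F])
    show "valid_path g \<and> pathfinish g = pathstart g \<and> path_image g \<subseteq> U - K"
      if g: "g \<in> set (gs @ map reversepath hs)" for g
    proof (cases "g \<in> set gs")
      case True then show ?thesis using gp by blast
    next
      case False
      then obtain h where "h \<in> set hs" "g = reversepath h" using g by auto
      then show ?thesis using hp[of h] by simp
    qed
    fix z assume z: "z \<notin> U - K"
    have "(\<Sum>g\<leftarrow>map reversepath hs. winding_number g z) = (\<Sum>g\<leftarrow>hs. - winding_number g z)"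
      unfolding map_map o_def
      using z hp by (intro arg_cong[where f=sum_list] map_cong refl winding_number_reversepath) (auto intro: valid_path_imp_path)
    also have "\<dots> = - (\<Sum>g\<leftarrow>hs. winding_number g z)" by (simp add: uminus_sum_list_map o_def)
    finally show "(\<Sum>g\<leftarrow>gs @ map reversepath hs. winding_number g z) = 0"
      using gs hs(1) z unfolding admissible_cycle_def by auto
  qed
  moreover have "(\<Sum>g\<leftarrow>map reversepath hs. contour_integral g F) = (\<Sum>g\<leftarrow>hs. - contour_integral g F)"
    unfolding map_map o_def
    using hp by (intro arg_cong[where f=sum_list] map_cong refl contour_integral_reversepath) auto
  moreover have "\<dots> = - (\<Sum>g\<leftarrow>hs. contour_integral g F)" by (simp add: uminus_sum_list_map o_def)
  ultimately show ?thesis using hs(2)[OF F] by simp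
qed

section \<open>Resolvents and the functional calculus\<close>

context complex_operator
begin

lemma bop_shiftop: "bop J (shiftop J T t)"
  unfolding shiftop_def[abs_def] by (rule bop_diff[OF linJ T bop_scaleC])

lemma invertible_iff_bij:
  fixes S :: "'a \<Rightarrow> 'a"
  assumes "bounded_linear S" shows "invertibleM UNIV S \<longleftrightarrow> bij S"
proof
  assume "invertibleM UNIV S"
  then obtain R where "\<And>x. R (S x) = x" "\<And>x. S (R x) = x" unfolding invertibleM_def by blast
  then show "bij S" by (metis bijI')
next
  assume b: "bij S"
  obtain C where "\<And>x. norm (inv S x) \<le> norm x * C"
    using bounded_linear.bounded[OF bounded_linear_inv[OF assms b]] by blast
  then have "\<forall>x. norm (inv S x) \<le> C * norm x" by (simp add: mult.commute)
  then show "invertibleM UNIV S" unfolding invertibleM_def using b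
    by (intro exI[of _ "inv S"]) (auto simp: bij_is_inj inv_f_f bij_is_surj surj_f_inv_f)
qed

lemma spectrum_iff: "t \<in> spectrum J T \<longleftrightarrow> \<not> bij (shiftop J T t)"
  using invertible_iff_bij[of "shiftop J T t"] bop_shiftop by (auto simp: spectrum_def bop_def)

text \<open>The minus sign turns the inverse of T - t into the inverse of t - T, the convention of
  \<open>resolvent\<close>.\<close>

definition R :: "complex \<Rightarrow> 'a \<Rightarrow> 'a" where "R t x = - inv (shiftop J T t) x"

lemma R_inverse:
  assumes "t \<notin> spectrum J T"
  shows "R t (scaleC J t x - T x) = x" "scaleC J t (R t x) - T (R t x) = x"
proof -
  have b: "bij (shiftop J T t)" using assms by (simp add: spectrum_iff)
  have lin: "linear (shiftop J T t)" using bop_shiftop by (simp add: bop_def bounded_linear.linear)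
  have bl: "linear (inv (shiftop J T t))"
    using bounded_linear_inv[OF _ b] bop_shiftop by (simp add: bop_def bounded_linear.linear)
  have "scaleC J t x - T x = - shiftop J T t x" by (simp add: shiftop_def)
  then show "R t (scaleC J t x - T x) = x" unfolding R_def using b bl by (simp add: linear_neg bij_is_inj inv_f_f)
  have "scaleC J t (R t x) - T (R t x) = - shiftop J T t (R t x)" by (simp add: shiftop_def)
  also have "\<dots> = x" unfolding R_def using b lin by (simp add: linear_neg bij_is_surj surj_f_inv_f)
  finally show "scaleC J t (R t x) - T (R t x) = x" .
qed

lemma R_unique: "t \<notin> spectrum J T \<Longrightarrow> scaleC J t y - T y = x \<Longrightarrow> y = R t x"
  using R_inverse(1) by metis

lemma resolvent_eq: "t \<notin> spectrum J T \<Longrightarrow> resolvent J T t = R t"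
  unfolding resolvent_def by (rule the_equality) (use R_inverse R_unique in \<open>auto intro!: ext\<close>)

lemma R_commute:
  assumes t: "t \<notin> spectrum J T" and A: "bop J A" "\<And>x. A (T x) = T (A x)"
  shows "A (R t x) = R t (A x)"
proof (rule R_unique[OF t])
  have "scaleC J t (A (R t x)) - T (A (R t x)) = A (scaleC J t (R t x) - T (R t x))"
    using A by (simp add: scaleC_bop[OF A(1)] bop_def bounded_linear.linear linear_diff)
  then show "scaleC J t (A (R t x)) - T (A (R t x)) = A x" using R_inverse(2)[OF t] by simp
qed

lemma bop_R: "t \<notin> spectrum J T \<Longrightarrow> bop J (R t)"
proof -
  assume t: "t \<notin> spectrum J T"
  have bl: "bounded_linear (shiftop J T t)" and b: "bij (shiftop J T t)"
    using bop_shiftop t by (simp_all add: bop_def spectrum_iff)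
  have "bounded_linear (R t)" unfolding R_def[abs_def]
    by (rule bounded_linear_minus[OF bounded_linear_inv[OF bl b]])
  moreover have "J (R t x) = R t (J x)" for x
    by (rule R_commute[OF t]) (auto simp: bop_def blJ TJ)
  ultimately show ?thesis by (simp add: bop_def)
qed

lemma R_linear:
  assumes "t \<notin> spectrum J T"
  shows "R t (x + y) = R t x + R t y" "R t (x - y) = R t x - R t y" "R t (scaleC J c x) = scaleC J c (R t x)"
    "R t (r *\<^sub>R x) = r *\<^sub>R R t x"
  using bop_R[OF assms] scaleC_bop[OF bop_R[OF assms]]
  by (simp_all add: bop_def bounded_linear.linear linear_add linear_diff linear_scale)

lemma R_diff:
  assumes s: "s \<notin> spectrum J T" and t: "t \<notin> spectrum J T"
  shows "R s x - R t x = scaleC J (t - s) (R s (R t x))"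
proof -
  have "R s x - R t x = R s (scaleC J t (R t x) - T (R t x)) - R s (scaleC J s (R t x) - T (R t x))"
    using R_inverse[OF s] R_inverse[OF t] by simp
  also have "\<dots> = R s (scaleC J (t - s) (R t x))" by (simp add: R_linear[OF s, symmetric] scaleC_diff_left)
  finally show ?thesis using R_linear(3)[OF s] by simp
qed

text \<open>A lower bound \<open>c\<close> of T - t leaves the lower bound c/2 for T - s when
  \<open>s\<close> is closer than c/2; its inverse bounds the resolvent.\<close>

lemma R_locally_bounded:
  assumes "t \<notin> spectrum J T"
  shows "\<exists>d>0. \<exists>B. \<forall>s. cmod (s - t) < d \<longrightarrow> s \<notin> spectrum J T \<and> (\<forall>x. norm (R s x) \<le> B * norm x)"
proof -
  have bl: "bounded_linear (shiftop J T s)" for s using bop_shiftop by (simp add: bop_def)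
  have b: "bij (shiftop J T t)" using assms by (simp add: spectrum_iff)
  obtain c where c: "c > 0" "\<And>x. c * norm x \<le> norm (shiftop J T t x)"
    using bij_imp_bounded_below[OF b] bounded_below_iff[OF bl, of t] by blast
  have "s \<notin> spectrum J T \<and> (\<forall>x. norm (R s x) \<le> (2 / c) * norm x)" if s: "cmod (s - t) < c / 2" for s
  proof -
    have near: "norm (shiftop J T s x - shiftop J T t x) \<le> c / 2 * norm x" for x
    proof -
      have "shiftop J T s x - shiftop J T t x = scaleC J (t - s) x"
        by (simp add: shiftop_def scaleC_diff_left)
      then have "norm (shiftop J T s x - shiftop J T t x) = cmod (s - t) * norm x"
        by (simp add: norm_scaleC norm_minus_commute)
      also have "\<dots> \<le> c / 2 * norm x" using s by (intro mult_right_mono) auto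
      finally show ?thesis .
    qed
    have ns: "s \<notin> spectrum J T" unfolding spectrum_iff
      using bij_perturb[OF bl b c near] c(1) by simp
    moreover have "norm (R s x) \<le> (2 / c) * norm x" for x
    proof -
      have "(c - c / 2) * norm (R s x) \<le> norm (shiftop J T s (R s x))"
        by (rule bounded_below_perturb[OF c(2) near])
      also have "\<dots> = norm x"
        using R_inverse(2)[OF ns, of x] by (metis shiftop_def norm_minus_commute)
      finally show ?thesis using c(1) by (simp add: field_simps)
    qed
    ultimately show ?thesis by blast
  qed
  then show ?thesis using c(1) by (meson half_gt_zero)
qed

lemma closed_spectrum: "closed (spectrum J T)"
proof -
  have "open (- spectrum J T)"
    unfolding open_dist using R_locally_bounded by (simp add: dist_norm) blast
  then show ?thesis by (simp add: closed_def)
qed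

lemma bij_scaleC: "c \<noteq> 0 \<Longrightarrow> bij (scaleC J c)"
  by (rule o_bij[of "scaleC J (inverse c)"]) (auto simp: fun_eq_iff scaleC_scaleC scaleC_one)

text \<open>Once |t| is twice a bound of \<open>T\<close>, the operator T - t is a perturbation of
  multiplication by -t of at most half its size.\<close>

lemma bij_shiftop_large: "\<exists>B>0. \<forall>t. cmod t \<ge> B \<longrightarrow> bij (shiftop J T t)"
proof -
  obtain B where B: "\<And>x. norm (T x) \<le> norm x * B" "B > 0"
    using bounded_linear.pos_bounded[OF blT] by blast
  have "bij (shiftop J T t)" if t: "cmod t \<ge> 2 * B" for t
  proof (rule bij_perturb[where S="scaleC J (- t)" and c="cmod t" and e=B])
    show "bounded_linear (shiftop J T t)" using bop_shiftop by (simp add: bop_def)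
    show "bij (scaleC J (- t))" using t B(2) by (intro bij_scaleC) auto
    show "norm (shiftop J T t x - scaleC J (- t) x) \<le> B * norm x" for x
      using B(1)[of x] by (simp add: shiftop_def scaleC_minus_left mult.commute)
  qed (use t B(2) in \<open>auto simp: norm_scaleC\<close>)
  then show ?thesis using B(2) by (intro exI[of _ "2 * B"]) auto
qed

lemma compact_spectrum: "compact (spectrum J T)"
proof -
  obtain B where "\<And>t. cmod t \<ge> B \<Longrightarrow> t \<notin> spectrum J T" using bij_shiftop_large spectrum_iff by blast
  then have "spectrum J T \<subseteq> cball 0 B" by (auto simp: not_le) (meson linear)
  then show ?thesis using closed_spectrum bounded_subset[OF bounded_cball] by (simp add: compact_eq_bounded_closed)
qed

lemma continuous_on_R: "continuous_on (- spectrum J T) (\<lambda>t. R t x)"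
  unfolding continuous_on_def
proof
  fix t assume t: "t \<in> - spectrum J T"
  obtain d B where d: "d > 0" "\<And>s. cmod (s - t) < d \<Longrightarrow> s \<notin> spectrum J T \<and> (\<forall>x. norm (R s x) \<le> B * norm x)"
    using R_locally_bounded[of t] t by blast
  have "((\<lambda>s. R s x) \<longlongrightarrow> R t x) (at t)"
  proof (rule LIM_zero_cancel, rule Lim_null_comparison)
    show "\<forall>\<^sub>F s in at t. norm (R s x - R t x) \<le> cmod (t - s) * (B * norm (R t x))"
      unfolding eventually_at
    proof (intro exI[of _ d] conjI d(1) ballI impI)
      fix s assume "s \<noteq> t \<and> dist s t < d"
      then have s: "s \<notin> spectrum J T" "\<And>x. norm (R s x) \<le> B * norm x" using d(2)[of s] by (auto simp: dist_norm)
      have "R s x - R t x = scaleC J (t - s) (R s (R t x))" using R_diff s(1) t by simp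
      then show "norm (R s x - R t x) \<le> cmod (t - s) * (B * norm (R t x))"
        using s(2) by (simp add: norm_scaleC mult_left_mono)
    qed
    have "((\<lambda>s. cmod (t - s) * (B * norm (R t x))) \<longlongrightarrow> cmod (t - t) * (B * norm (R t x))) (at t)"
      by (intro tendsto_intros)
    then show "((\<lambda>s. cmod (t - s) * (B * norm (R t x))) \<longlongrightarrow> 0) (at t)" by simp
  qed
  then show "((\<lambda>s. R s x) \<longlongrightarrow> R t x) (at t within - spectrum J T)"
    by (rule tendsto_within_subset) simp
qed

text \<open>Complex linear continuous functionals. Identities between vector-valued integrals are
  tested on them and so reduced to scalar Cauchy theory.\<close>

definition cfun :: "('a \<Rightarrow> complex) \<Rightarrow> bool" where
  "cfun p \<longleftrightarrow> bounded_linear p \<and> (\<forall>x. p (J x) = \<i> * p x)"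

lemma cfun_simps:
  assumes "cfun p"
  shows "p (x + y) = p x + p y" "p (x - y) = p x - p y" "p (scaleC J c x) = c * p x" "p 0 = 0"
  using assms by (simp_all add: cfun_def scaleC_def bounded_linear.linear linear_add linear_diff linear_scale linear_0
      scaleR_conv_of_real complex_eq_iff)

lemma cfun_comp: "cfun p \<Longrightarrow> bop J A \<Longrightarrow> cfun (\<lambda>x. p (A x))"
  unfolding cfun_def bop_def using bounded_linear_compose[of p A] by simp

text \<open>A real functional \<open>h\<close> that does not vanish at x - y is the real part of the
  complex linear functional h z - i h (J z).\<close>

lemma eq_if_cfun_eq:
  assumes "\<And>p. cfun p \<Longrightarrow> p x = p y" shows "x = y"
proof (rule ccontr)
  assume "x \<noteq> y"
  then have ne: "x - y \<noteq> 0" by simp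
  obtain h :: "'a \<Rightarrow> real" where h: "bounded_linear h" "h (x - y) = 1"
    using functional_nonzero[OF ne] by blast
  define p where "p x = complex_of_real (h x) - \<i> * complex_of_real (h (J x))" for x
  have "bounded_linear p" unfolding p_def
    by (intro bounded_linear_sub bounded_linear_compose[OF bounded_linear_of_real h(1)]
        bounded_linear_const_mult bounded_linear_compose[OF bounded_linear_of_real bounded_linear_compose[OF h(1) blJ]])
  then have "cfun p" unfolding cfun_def p_def
    using h(1) by (simp add: JJ bounded_linear.linear linear_neg algebra_simps)
  moreover have "Re (p (x - y)) = 1" using h(2) by (simp add: p_def)
  ultimately show False using assms[of p] cfun_simps(2)[of p x y] by simp
qed

lemma R_holomorphic:
  assumes p: "cfun p" shows "(\<lambda>t. p (R t x)) holomorphic_on - spectrum J T"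
proof (subst holomorphic_on_open)
  show "open (- spectrum J T)" using closed_spectrum by blast
  show "\<forall>t\<in>- spectrum J T. \<exists>f'. ((\<lambda>t. p (R t x)) has_field_derivative f') (at t)"
  proof
    fix t assume t: "t \<in> - spectrum J T"
    have blp: "bounded_linear p" using p by (simp add: cfun_def)
    have op: "open (- spectrum J T)" using closed_spectrum by blast
    have "((\<lambda>s. R s (R t x)) \<longlongrightarrow> R t (R t x)) (at t)"
      using continuous_on_R t op by (simp add: continuous_on_eq_continuous_at isCont_def)
    then have lim: "((\<lambda>s. - p (R s (R t x))) \<longlongrightarrow> - p (R t (R t x))) (at t)"
      by (intro tendsto_minus bounded_linear.tendsto[OF blp])
    have "((\<lambda>s. (p (R s x) - p (R t x)) / (s - t)) \<longlongrightarrow> - p (R t (R t x))) (at t)"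
    proof (rule Lim_transform_within_open[OF lim op t])
      fix s assume s: "s \<in> - spectrum J T" "s \<noteq> t"
      have "p (R s x) - p (R t x) = (t - s) * p (R s (R t x))"
        using R_diff[of s t x] s t cfun_simps(2,3)[OF p] by (metis ComplD)
      then show "- p (R s (R t x)) = (p (R s x) - p (R t x)) / (s - t)"
        using s(2) by (simp add: field_simps)
    qed
    then show "\<exists>f'. ((\<lambda>t. p (R t x)) has_field_derivative f') (at t)"
      unfolding has_field_derivative_iff by blast
  qed
qed

section \<open>Vector-valued integrals along segments and paths\<close>

definition seg :: "complex \<Rightarrow> complex \<Rightarrow> (complex \<Rightarrow> 'a) \<Rightarrow> 'a" where
  "seg a b F = integral {0..1} (\<lambda>t. scaleC J (b - a) (F (linepath a b t)))"

lemma continuous_on_scaleC: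
  assumes "continuous_on A f" "continuous_on A F" shows "continuous_on A (\<lambda>z. scaleC J (f z) (F z))"
  unfolding scaleC_def
  by (intro continuous_intros assms bounded_linear.continuous_on[OF blJ])

lemma seg_continuous:
  assumes "continuous_on (closed_segment a b) F"
  shows "continuous_on {0..1} (\<lambda>t. scaleC J (b - a) (F (linepath a b t)))"
proof -
  have "continuous_on {0..1} (\<lambda>t. F (linepath a b t))"
    by (rule continuous_on_compose2[OF assms continuous_on_linepath]) (auto simp: linepath_image_01[symmetric])
  then show ?thesis by (intro continuous_on_scaleC continuous_on_const)
qed

lemma seg_integrable:
  assumes "continuous_on (closed_segment a b) F"
  shows "(\<lambda>t. scaleC J (b - a) (F (linepath a b t))) integrable_on {0..1}"
  by (rule integrable_continuous_real[OF seg_continuous[OF assms]])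

lemma cfun_seg:
  assumes p: "cfun p" and F: "continuous_on (closed_segment a b) F"
  shows "p (seg a b F) = contour_integral (linepath a b) (\<lambda>z. p (F z))"
proof -
  have "p (seg a b F) = integral {0..1} (p \<circ> (\<lambda>t. scaleC J (b - a) (F (linepath a b t))))"
    unfolding seg_def using p by (intro integral_linear[symmetric] seg_integrable F) (simp add: cfun_def)
  also have "\<dots> = contour_integral (linepath a b) (\<lambda>z. p (F z))"
    unfolding contour_integral_integral
    by (rule integral_cong) (simp add: vector_derivative_linepath_within cfun_simps[OF p] mult.commute)
  finally show ?thesis .
qed

lemma norm_seg_le:
  assumes F: "continuous_on (closed_segment a b) F" and B: "B \<ge> 0" "\<And>z. z \<in> closed_segment a b \<Longrightarrow> norm (F z) \<le> B"
  shows "norm (seg a b F) \<le> cmod (b - a) * B"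
proof -
  have "norm (integral {0..1} (\<lambda>t. scaleC J (b - a) (F (linepath a b t)))) \<le> (cmod (b - a) * B) * (1 - 0)"
  proof (rule integral_bound[OF _ seg_continuous[OF F]])
    fix t :: real assume "t \<in> {0..1}"
    then have "linepath a b t \<in> closed_segment a b" by (simp add: linepath_in_path)
    then show "norm (scaleC J (b - a) (F (linepath a b t))) \<le> cmod (b - a) * B"
      using B(2) by (simp add: norm_scaleC mult_left_mono)
  qed simp
  then show ?thesis by (simp add: seg_def)
qed

text \<open>Weak holomorphy with norm continuity: both are easily checked for the resolvent, and
  together they yield norm differentiable primitives.\<close>

definition wholo :: "(complex \<Rightarrow> 'a) \<Rightarrow> complex set \<Rightarrow> bool" where
  "wholo F V \<longleftrightarrow> continuous_on V F \<and> (\<forall>p. cfun p \<longrightarrow> (\<lambda>z. p (F z)) holomorphic_on V)"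

text \<open>The primitive is the integral from the centre. Cauchy's theorem on triangles, applied
  after each functional, identifies its increments with integrals over the segment from
  \<open>z\<close> to \<open>w\<close>, and norm continuity gives the derivative.\<close>

lemma wholo_local_primitive:
  assumes F: "wholo F (ball c r)"
  shows "\<exists>G. \<forall>z\<in>ball c r. (G has_derivative (\<lambda>h. scaleC J h (F z))) (at z)"
proof (rule exI, rule ballI)
  fix z assume z: "z \<in> ball c r"
  have seg_in: "closed_segment a b \<subseteq> ball c r" if "a \<in> ball c r" "b \<in> ball c r" for a b
    using that by (simp add: closed_segment_subset)
  have cont: "continuous_on (closed_segment a b) F" if "a \<in> ball c r" "b \<in> ball c r" for a b
    using F seg_in[OF that] unfolding wholo_def by (blast intro: continuous_on_subset)
  have c: "c \<in> ball c r" using z by (metis centre_in_ball dist_not_less_zero le_less_linear mem_ball order_less_le_trans zero_le_dist not_less)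
  have diff: "seg c w F - seg c z F = seg z w F" if w: "w \<in> ball c r" for w
  proof (rule eq_if_cfun_eq)
    fix p assume p: "cfun p"
    have hol: "(\<lambda>z. p (F z)) holomorphic_on ball c r" using F p by (simp add: wholo_def)
    have sub: "convex hull {c, z, w} \<subseteq> ball c r" using c z w by (simp add: subset_hull)
    have "((\<lambda>z. p (F z)) has_contour_integral 0) (linepath c z +++ linepath z w +++ linepath w c)"
      by (rule Cauchy_theorem_triangle[OF holomorphic_on_subset[OF hol sub]])
    then have "contour_integral (linepath c z) (\<lambda>z. p (F z)) + contour_integral (linepath z w) (\<lambda>z. p (F z)) +
        contour_integral (linepath w c) (\<lambda>z. p (F z)) = 0"
      by (rule has_chain_integral_chain_integral3)
    moreover have "contour_integral (linepath w c) (\<lambda>z. p (F z)) = - contour_integral (linepath c w) (\<lambda>z. p (F z))"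
      using contour_integral_reversepath[of "linepath c w"] by simp
    ultimately show "p (seg c w F - seg c z F) = p (seg z w F)"
      unfolding cfun_simps(2)[OF p] cfun_seg[OF p cont[OF c w]] cfun_seg[OF p cont[OF c z]] cfun_seg[OF p cont[OF z w]]
      by (simp add: algebra_simps)
  qed
  show "((\<lambda>z. seg c z F) has_derivative (\<lambda>h. scaleC J h (F z))) (at z)"
    unfolding has_derivative_at_alt
  proof (intro conjI allI impI)
    show "bounded_linear (\<lambda>h. scaleC J h (F z))"
      by (rule bounded_linear_intro[of _ "norm (F z)"])
        (simp_all add: scaleC_add_left norm_scaleC, simp add: scaleC_def algebra_simps)
    fix e :: real assume e: "e > 0"
    have "isCont F z" using F z unfolding wholo_def by (simp add: continuous_on_eq_continuous_at)
    then obtain d where d: "d > 0" "\<And>w. cmod (w - z) < d \<Longrightarrow> norm (F w - F z) < e"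
      using e unfolding continuous_at_eps_delta dist_norm by blast
    obtain d' where d': "d' > 0" "ball z d' \<subseteq> ball c r" using openE[OF open_ball z] by blast
    have "norm (seg c w F - seg c z F - scaleC J (w - z) (F z)) \<le> e * cmod (w - z)"
      if w: "cmod (w - z) < min d d'" for w
    proof -
      have "w \<in> ball z d'" using w by (simp add: dist_norm norm_minus_commute)
      then have wb: "w \<in> ball c r" using d'(2) by blast
      have "seg z w F - scaleC J (w - z) (F z) = seg z w (\<lambda>u. F u - F z)"
      proof -
        have "seg z w (\<lambda>u. F u - F z) = integral {0..1} (\<lambda>t. scaleC J (w - z) (F (linepath z w t)) - scaleC J (w - z) (F z))"
          by (simp add: seg_def scaleC_diff_right)
        also have "\<dots> = seg z w F - integral {0..1::real} (\<lambda>t. scaleC J (w - z) (F z))"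
          unfolding seg_def by (rule integral_diff[OF seg_integrable[OF cont[OF z wb]] integrable_const_ivl])
        finally show ?thesis by simp
      qed
      moreover have "norm (seg z w (\<lambda>u. F u - F z)) \<le> cmod (w - z) * e"
      proof (rule norm_seg_le)
        show "continuous_on (closed_segment z w) (\<lambda>u. F u - F z)"
          by (intro continuous_intros cont z wb)
        fix u assume "u \<in> closed_segment z w"
        then have "cmod (u - z) \<le> cmod (w - z)" by (rule segment_bound1)
        then show "norm (F u - F z) \<le> e" using d(2)[of u] w by simp
      qed (use e in simp)
      ultimately show ?thesis using diff[OF wb] by (simp add: mult.commute)
    qed
    then show "\<exists>d>0. \<forall>y. cmod (y - z) < d \<longrightarrow> norm (seg c y F - seg c z F - scaleC J (y - z) (F z)) \<le> e * cmod (y - z)"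
      using d(1) d'(1) by (intro exI[of _ "min d d'"]) auto
  qed
qed

text \<open>Valid paths need not be rectifiable, so integrability is obtained from local primitives.\<close>
lemma wholo_integrable:
  assumes V: "open V" and F: "wholo F V" and g: "valid_path g" "path_image g \<subseteq> V"
  shows "(\<lambda>t. scaleC J (vector_derivative g (at t within {0..1})) (F (g t))) integrable_on {0..1}"
proof -
  obtain S where S: "finite S" "g C1_differentiable_on {0..1} - S" and contg: "continuous_on {0..1} g"
    using g(1) unfolding valid_path_def piecewise_C1_differentiable_on_def by blast
  let ?f = "\<lambda>t. scaleC J (vector_derivative g (at t within {0..1})) (F (g t))"
  have "?f integrable_on cbox 0 1"
  proof (rule integrable_on_little_subintervals, rule ballI)
    fix t :: real assume t: "t \<in> cbox 0 1"
    then have "g t \<in> V" using g(2) by (auto simp: path_image_def)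
    then obtain r where r: "r > 0" "ball (g t) r \<subseteq> V" using V open_contains_ball by blast
    have "wholo F (ball (g t) r)"
      using F r(2) unfolding wholo_def by (blast intro: continuous_on_subset holomorphic_on_subset)
    then obtain G where G: "\<And>z. z \<in> ball (g t) r \<Longrightarrow> (G has_derivative (\<lambda>h. scaleC J h (F z))) (at z)"
      using wholo_local_primitive by blast
    obtain d where d: "d > 0" "\<And>s. s \<in> {0..1} \<Longrightarrow> dist s t < d \<Longrightarrow> dist (g s) (g t) < r"
      using contg t r(1) unfolding continuous_on_iff by (metis box_real(2))
    show "\<exists>d>0. \<forall>u v. t \<in> cbox u v \<and> cbox u v \<subseteq> ball t d \<and> cbox u v \<subseteq> cbox 0 1 \<longrightarrow> ?f integrable_on cbox u v"
    proof (intro exI[of _ d] conjI d(1) allI impI)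
      fix u v assume uv: "t \<in> cbox u v \<and> cbox u v \<subseteq> ball t d \<and> cbox u v \<subseteq> cbox 0 1"
      then have uv': "u \<le> v" "{u..v} \<subseteq> {0..1}" "{u..v} \<subseteq> ball t d" by auto
      have gin: "g s \<in> ball (g t) r" if "s \<in> {u..v}" for s
      proof -
        have "s \<in> {0..1}" "dist s t < d" using that uv' by (auto simp: dist_commute)
        then show ?thesis using d(2)[of s] by (simp add: dist_commute)
      qed
      \<comment> \<open>Off the finite set \<open>S\<close> the composition of \<open>G\<close> with
        the path has the integrand as derivative; at the remaining points this form of the
        fundamental theorem uses only continuity.\<close>
      have "(?f has_integral (G (g v) - G (g u))) {u..v}"
      proof (rule fundamental_theorem_of_calculus_interior_strong[OF S(1) uv'(1)])
        fix s assume s: "s \<in> {u<..<v} - S"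
        have "u \<in> {0..1}" "v \<in> {0..1}" using uv'(1,2) by (auto simp: subset_iff)
        then have s01: "s \<in> {0<..<1}" using s by auto
        moreover have "s \<in> {0..1} - S" using s s01 by auto
        ultimately have "g differentiable at s" using S(2) unfolding C1_differentiable_on_eq by blast
        then have gd: "(g has_vector_derivative vector_derivative g (at s)) (at s)"
          using vector_derivative_works by blast
        have vd: "vector_derivative g (at s within {0..1}) = vector_derivative g (at s)"
          by (subst at_within_interior) (use s01 in \<open>simp_all add: interior_atLeastAtMost_real\<close>)
        have "(G \<circ> g has_derivative (\<lambda>h. scaleC J h (F (g s))) \<circ> (\<lambda>h. h *\<^sub>R vector_derivative g (at s))) (at s)"
          by (rule diff_chain_at[OF gd[unfolded has_vector_derivative_def] G[OF gin]]) (use s in auto)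
        moreover have "(\<lambda>h. scaleC J h (F (g s))) \<circ> (\<lambda>h. h *\<^sub>R vector_derivative g (at s)) =
            (\<lambda>h. h *\<^sub>R scaleC J (vector_derivative g (at s)) (F (g s)))"
          by (rule ext) (simp add: scaleC_def scaleR_add_right)
        ultimately show "((\<lambda>x. G (g x)) has_vector_derivative ?f s) (at s)"
          unfolding has_vector_derivative_def vd o_def by simp
      next
        have "continuous_on (ball (g t) r) G" using G has_derivative_continuous by (meson continuous_at_imp_continuous_on)
        then show "continuous_on {u..v} (\<lambda>x. G (g x))"
          using gin by (intro continuous_on_compose2[OF _ continuous_on_subset[OF contg uv'(2)]]) auto
      qed
      then show "?f integrable_on cbox u v" by auto
    qed
  qed
  then show ?thesis by simp
qed

lemma cfun_path_integral:
  assumes p: "cfun p" and V: "open V" and F: "wholo F V" and g: "valid_path g" "path_image g \<subseteq> V"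
  shows "p (integral {0..1} (\<lambda>t. scaleC J (vector_derivative g (at t within {0..1})) (F (g t)))) =
    contour_integral g (\<lambda>z. p (F z))"
proof -
  have "((p \<circ> (\<lambda>t. scaleC J (vector_derivative g (at t within {0..1})) (F (g t)))) has_integral
      p (integral {0..1} (\<lambda>t. scaleC J (vector_derivative g (at t within {0..1})) (F (g t))))) {0..1}"
    using p by (intro has_integral_linear integrable_integral wholo_integrable[OF V F g]) (simp add: cfun_def)
  then have "((\<lambda>z. p (F z)) has_contour_integral
      p (integral {0..1} (\<lambda>t. scaleC J (vector_derivative g (at t within {0..1})) (F (g t))))) g"
    unfolding has_contour_integral_def by (simp add: o_def cfun_simps[OF p] mult.commute)
  then show ?thesis by (simp add: contour_integral_unique)
qed

end

section \<open>Calculus with edge integrals\<close>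

lemma cauchy_edges_mono:
  assumes "cauchy_edges K V E" "V \<subseteq> U"
  shows "cauchy_edges K U E"
  unfolding cauchy_edges_def
proof (intro conjI allI impI)
  show "finite E" "\<And>p :: complex \<Rightarrow> complex. (\<Sum>(a,b)\<in>E. p a - p b) = 0"
    using assms(1) by (auto simp: cauchy_edges_def)
  show "\<forall>(a,b)\<in>E. closed_segment a b \<subseteq> U - K"
    using assms unfolding cauchy_edges_def by blast
  show "edge_integral E (\<lambda>w. F w / (w - z)) = 2 * pi * \<i> * F z" if "F holomorphic_on U" "z \<in> K" for F z
    using assms that holomorphic_on_subset unfolding cauchy_edges_def by blast
  show "edge_integral E (\<lambda>w. F w / (w - z)) = 0" if "F holomorphic_on U" "z \<notin> U" for F z
    using assms that holomorphic_on_subset unfolding cauchy_edges_def by blast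
qed

lemma cauchy_edgesD:
  assumes "cauchy_edges K U E"
  shows "finite E" "(a,b) \<in> E \<Longrightarrow> closed_segment a b \<subseteq> U - K"
    "F holomorphic_on U \<Longrightarrow> z \<in> K \<Longrightarrow> edge_integral E (\<lambda>w. F w / (w - z)) = 2 * pi * \<i> * F z"
    "F holomorphic_on U \<Longrightarrow> z \<notin> U \<Longrightarrow> edge_integral E (\<lambda>w. F w / (w - z)) = 0"
  using assms unfolding cauchy_edges_def by blast+

lemma edge_integral_cong:
  assumes "\<And>a b z. (a,b) \<in> E \<Longrightarrow> z \<in> closed_segment a b \<Longrightarrow> F z = G z"
  shows "edge_integral E F = edge_integral E G"
  unfolding edge_integral_def
  by (rule sum.cong[OF refl]) (use assms in \<open>auto intro!: contour_integral_eq\<close>)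

lemma edge_integral_linear:
  assumes F: "\<And>a b. (a,b) \<in> E \<Longrightarrow> continuous_on (closed_segment a b) F"
    and G: "\<And>a b. (a,b) \<in> E \<Longrightarrow> continuous_on (closed_segment a b) G"
  shows "edge_integral E (\<lambda>z. F z + G z) = edge_integral E F + edge_integral E G"
    and "edge_integral E (\<lambda>z. F z - G z) = edge_integral E F - edge_integral E G"
proof -
  have i: "F contour_integrable_on linepath (fst e) (snd e)" "G contour_integrable_on linepath (fst e) (snd e)"
    if "e \<in> E" for e
    using that F G by (simp_all add: contour_integrable_continuous_linepath)
  show "edge_integral E (\<lambda>z. F z + G z) = edge_integral E F + edge_integral E G"
    unfolding edge_integral_def case_prod_beta sum.distrib[symmetric]
    by (intro sum.cong refl contour_integral_add i)
  show "edge_integral E (\<lambda>z. F z - G z) = edge_integral E F - edge_integral E G"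
    unfolding edge_integral_def case_prod_beta sum_subtractf[symmetric]
    by (intro sum.cong refl contour_integral_diff i)
qed

lemma edge_integral_cmult:
  assumes F: "\<And>a b. (a,b) \<in> E \<Longrightarrow> continuous_on (closed_segment a b) F"
  shows "edge_integral E (\<lambda>z. c * F z) = c * edge_integral E F"
  unfolding edge_integral_def case_prod_beta sum_distrib_left
  by (intro sum.cong refl contour_integral_lmul contour_integrable_continuous_linepath F) simp

text \<open>Fubini for the Cauchy kernel over two families of edges; as the families do not meet,
  the kernel is jointly continuous. The multiplicativity of the functional calculus rests on this
  exchange.\<close>

lemma edge_integral_swap:
  assumes E: "finite E" "finite E'"
    and f: "\<And>a b. (a,b) \<in> E \<Longrightarrow> continuous_on (closed_segment a b) f"
    and k: "\<And>c d. (c,d) \<in> E' \<Longrightarrow> continuous_on (closed_segment c d) k"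
    and off: "\<And>a b c d. (a,b) \<in> E \<Longrightarrow> (c,d) \<in> E' \<Longrightarrow> closed_segment a b \<inter> closed_segment c d = {}"
  shows "edge_integral E (\<lambda>w. f w * edge_integral E' (\<lambda>z. k z / (w - z))) =
    edge_integral E' (\<lambda>z. k z * edge_integral E (\<lambda>w. f w / (w - z)))"
proof -
  let ?I = "\<lambda>e. contour_integral (linepath (fst e) (snd e))"
  have off': "closed_segment (fst e) (snd e) \<inter> closed_segment (fst e') (snd e') = {}" if "e \<in> E" "e' \<in> E'" for e e'
    using off that by simp
  have fc: "continuous_on (closed_segment (fst e) (snd e)) f" if "e \<in> E" for e using f that by simp
  have kc: "continuous_on (closed_segment (fst e) (snd e)) k" if "e \<in> E'" for e using k that by simp
  have inner: "continuous_on (closed_segment (fst e) (snd e)) (\<lambda>w. ?I e' (\<lambda>z. k z / (w - z)))"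
    if e: "e \<in> E" "e' \<in> E'" for e e'
  proof -
    have "continuous_on (closed_segment (fst e) (snd e)) (\<lambda>w. ?I e' (\<lambda>z. (- k z) / (z - w)))"
      by (rule continuous_on_subset[OF holomorphic_on_imp_continuous_on[OF segment_cauchy_integral_holomorphic]])
        (use kc[OF e(2)] off'[OF e] in \<open>auto intro!: continuous_intros\<close>)
    moreover have "(\<lambda>z. (- k z) / (z - w)) = (\<lambda>z. k z / (w - z))" for w
      by (rule ext) (metis minus_diff_eq minus_divide_divide)
    ultimately show ?thesis by simp
  qed
  have inner': "continuous_on (closed_segment (fst e') (snd e')) (\<lambda>z. ?I e (\<lambda>w. f w / (w - z)))"
    if e: "e \<in> E" "e' \<in> E'" for e e'
    by (rule continuous_on_subset[OF holomorphic_on_imp_continuous_on[OF segment_cauchy_integral_holomorphic]])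
      (use fc[OF e(1)] off'[OF e] in auto)
  have swap: "?I e (\<lambda>w. f w * ?I e' (\<lambda>z. k z / (w - z))) = ?I e' (\<lambda>z. k z * ?I e (\<lambda>w. f w / (w - z)))"
    if e: "e \<in> E" "e' \<in> E'" for e e'
  proof -
    have "?I e (\<lambda>w. f w * ?I e' (\<lambda>z. k z / (w - z))) = ?I e (\<lambda>w. ?I e' (\<lambda>z. f w * (k z / (w - z))))"
    proof (rule contour_integral_eq)
      fix w assume "w \<in> path_image (linepath (fst e) (snd e))"
      then have "(\<lambda>z. k z / (w - z)) contour_integrable_on linepath (fst e') (snd e')"
        using off'[OF e] by (intro contour_integrable_continuous_linepath continuous_intros kc e) auto
      then show "f w * ?I e' (\<lambda>z. k z / (w - z)) = ?I e' (\<lambda>z. f w * (k z / (w - z)))"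
        by (simp only: contour_integral_lmul)
    qed
    also have "\<dots> = ?I e' (\<lambda>z. ?I e (\<lambda>w. f w * (k z / (w - z))))"
    proof (rule contour_integral_swap)
      show "continuous_on (path_image (linepath (fst e) (snd e)) \<times> path_image (linepath (fst e') (snd e')))
          (\<lambda>(w, z). f w * (k z / (w - z)))"
        unfolding case_prod_beta
      proof (intro continuous_intros)
        show "continuous_on (path_image (linepath (fst e) (snd e)) \<times> path_image (linepath (fst e') (snd e'))) (\<lambda>x. f (fst x))"
          by (rule continuous_on_compose2[OF fc[OF e(1)] continuous_on_fst[OF continuous_on_id]]) auto
        show "continuous_on (path_image (linepath (fst e) (snd e)) \<times> path_image (linepath (fst e') (snd e'))) (\<lambda>x. k (snd x))"
          by (rule continuous_on_compose2[OF kc[OF e(2)] continuous_on_snd[OF continuous_on_id]]) auto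
        show "\<forall>x\<in>path_image (linepath (fst e) (snd e)) \<times> path_image (linepath (fst e') (snd e')). fst x - snd x \<noteq> 0"
          using off'[OF e] by auto
      qed
    qed auto
    also have "\<dots> = ?I e' (\<lambda>z. k z * ?I e (\<lambda>w. f w / (w - z)))"
    proof (rule contour_integral_eq)
      fix z assume "z \<in> path_image (linepath (fst e') (snd e'))"
      then have "(\<lambda>w. f w / (w - z)) contour_integrable_on linepath (fst e) (snd e)"
        using off'[OF e] by (intro contour_integrable_continuous_linepath continuous_intros fc e) auto
      then have "k z * ?I e (\<lambda>w. f w / (w - z)) = ?I e (\<lambda>w. k z * (f w / (w - z)))"
        by (simp only: contour_integral_lmul)
      then show "?I e (\<lambda>w. f w * (k z / (w - z))) = k z * ?I e (\<lambda>w. f w / (w - z))" by (simp add: mult_ac)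
    qed
    finally show ?thesis .
  qed
  have "edge_integral E (\<lambda>w. f w * edge_integral E' (\<lambda>z. k z / (w - z))) =
      (\<Sum>e\<in>E. \<Sum>e'\<in>E'. ?I e (\<lambda>w. f w * ?I e' (\<lambda>z. k z / (w - z))))"
    unfolding edge_integral_def case_prod_beta sum_distrib_left
    by (intro sum.cong refl contour_integral_sum E contour_integrable_continuous_linepath continuous_intros fc inner)
  also have "\<dots> = (\<Sum>e\<in>E. \<Sum>e'\<in>E'. ?I e' (\<lambda>z. k z * ?I e (\<lambda>w. f w / (w - z))))"
    by (intro sum.cong refl swap)
  also have "\<dots> = (\<Sum>e'\<in>E'. \<Sum>e\<in>E. ?I e' (\<lambda>z. k z * ?I e (\<lambda>w. f w / (w - z))))" by (rule sum.swap)
  also have "\<dots> = edge_integral E' (\<lambda>z. k z * edge_integral E (\<lambda>w. f w / (w - z)))"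
    unfolding edge_integral_def case_prod_beta sum_distrib_left
    by (intro sum.cong refl contour_integral_sum[symmetric] E contour_integrable_continuous_linepath continuous_intros kc inner')
  finally show ?thesis .
qed

context complex_operator
begin

text \<open>A concrete representative of \<open>hfc\<close>, with the factor 2 pi i already divided
  out.\<close>

definition hf :: "(complex \<times> complex) set \<Rightarrow> (complex \<Rightarrow> complex) \<Rightarrow> 'a \<Rightarrow> 'a" where
  "hf E f x = scaleC J (1 / (2 * pi * \<i>)) (\<Sum>(a,b)\<in>E. seg a b (\<lambda>z. scaleC J (f z) (R z x)))"

lemma wholo_R:
  assumes "f holomorphic_on V" "V \<inter> spectrum J T = {}"
  shows "wholo (\<lambda>z. scaleC J (f z) (R z x)) V"
proof -
  have V: "V \<subseteq> - spectrum J T" using assms(2) by blast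
  show ?thesis unfolding wholo_def
  proof (intro conjI allI impI)
    show "continuous_on V (\<lambda>z. scaleC J (f z) (R z x))"
      by (intro continuous_on_scaleC holomorphic_on_imp_continuous_on assms(1) continuous_on_subset[OF continuous_on_R V])
    fix p assume p: "cfun p"
    have "(\<lambda>z. f z * p (R z x)) holomorphic_on V"
      by (intro holomorphic_intros assms(1) holomorphic_on_subset[OF R_holomorphic[OF p] V])
    then show "(\<lambda>z. p (scaleC J (f z) (R z x))) holomorphic_on V" by (simp add: cfun_simps[OF p])
  qed
qed

lemma cfun_sum: "cfun p \<Longrightarrow> p (sum h A) = (\<Sum>a\<in>A. p (h a))"
  unfolding cfun_def by (simp add: bounded_linear.linear linear_sum)

lemma cfun_sum_list: "cfun p \<Longrightarrow> p (\<Sum>g\<leftarrow>gs. h g) = (\<Sum>g\<leftarrow>gs. p (h g))"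
  by (induction gs) (simp_all add: cfun_simps)

lemma edges_holomorphic_continuous:
  assumes E: "cauchy_edges (spectrum J T) U E" and f: "f holomorphic_on U" and ab: "(a,b) \<in> E"
  shows "continuous_on (closed_segment a b) f" "continuous_on (closed_segment a b) (\<lambda>z. R z x)"
    and "cfun p \<Longrightarrow> continuous_on (closed_segment a b) (\<lambda>z. p (R z x))"
proof -
  have s: "closed_segment a b \<subseteq> U" "closed_segment a b \<subseteq> - spectrum J T" using cauchy_edgesD(2)[OF E ab] by auto
  show "continuous_on (closed_segment a b) f"
    using continuous_on_subset[OF holomorphic_on_imp_continuous_on[OF f] s(1)] .
  show "continuous_on (closed_segment a b) (\<lambda>z. R z x)"
    using continuous_on_subset[OF continuous_on_R s(2)] .
  show "continuous_on (closed_segment a b) (\<lambda>z. p (R z x))" if "cfun p"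
    using continuous_on_subset[OF holomorphic_on_imp_continuous_on[OF R_holomorphic[OF that]] s(2)] .
qed

lemma cfun_hf:
  assumes p: "cfun p" and E: "cauchy_edges (spectrum J T) U E" and f: "f holomorphic_on U"
  shows "p (hf E f x) = 1 / (2 * pi * \<i>) * edge_integral E (\<lambda>z. f z * p (R z x))"
proof -
  have "p (seg (fst e) (snd e) (\<lambda>z. scaleC J (f z) (R z x))) =
      contour_integral (linepath (fst e) (snd e)) (\<lambda>z. f z * p (R z x))" if "e \<in> E" for e
  proof -
    have e: "(fst e, snd e) \<in> E" using that by simp
    have "continuous_on (closed_segment (fst e) (snd e)) (\<lambda>z. scaleC J (f z) (R z x))"
      by (intro continuous_on_scaleC edges_holomorphic_continuous[OF E f e])
    then show ?thesis using cfun_seg[OF p] by (simp add: cfun_simps[OF p])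
  qed
  then have "(\<Sum>e\<in>E. p (seg (fst e) (snd e) (\<lambda>z. scaleC J (f z) (R z x)))) =
      (\<Sum>e\<in>E. contour_integral (linepath (fst e) (snd e)) (\<lambda>z. f z * p (R z x)))" by (rule sum.cong[OF refl])
  then show ?thesis unfolding hf_def edge_integral_def case_prod_beta
    by (simp only: cfun_simps(3)[OF p] cfun_sum[OF p])
qed

text \<open>The definite description in \<open>hfc\<close> is justified here: every admissible cycle
  gives the edge integral, and since at least one admissible cycle exists, the required equation
  determines the operator.\<close>

lemma hfc_eq_hf:
  assumes U: "open U" and E: "cauchy_edges (spectrum J T) U E" and f: "f holomorphic_on U"
  shows "hfc J U f T = hf E f"
proof -
  have V: "open (U - spectrum J T)" using U closed_spectrum by blast
  have fV: "f holomorphic_on U - spectrum J T" using f holomorphic_on_subset by blast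
  have sums: "(\<Sum>g\<leftarrow>gs. integral {0..1} (\<lambda>t. scaleC J (f (g t) * vector_derivative g (at t within {0..1}))
      (resolvent J T (g t) x))) = scaleC J (2 * pi * \<i>) (hf E f x)"
    if gs: "admissible_cycle (spectrum J T) U gs" for gs x
  proof (rule eq_if_cfun_eq)
    fix p assume p: "cfun p"
    have "p (integral {0..1} (\<lambda>t. scaleC J (f (g t) * vector_derivative g (at t within {0..1})) (resolvent J T (g t) x))) =
        contour_integral g (\<lambda>z. f z * p (R z x))" if "g \<in> set gs" for g
    proof -
      have g: "valid_path g" "path_image g \<subseteq> U - spectrum J T" using gs that by (auto simp: admissible_cycle_def)
      have "g t \<notin> spectrum J T" if "t \<in> {0..1}" for t using g(2) that unfolding path_image_def by blast
      then have "integral {0..1} (\<lambda>t. scaleC J (f (g t) * vector_derivative g (at t within {0..1})) (resolvent J T (g t) x)) =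
          integral {0..1} (\<lambda>t. scaleC J (vector_derivative g (at t within {0..1})) (scaleC J (f (g t)) (R (g t) x)))"
        by (intro integral_cong) (simp add: resolvent_eq scaleC_scaleC mult.commute)
      then show ?thesis
        using cfun_path_integral[OF p V wholo_R[OF fV] g] by (simp add: cfun_simps[OF p] Diff_Int_distrib2)
    qed
    then have "(\<Sum>g\<leftarrow>gs. p (integral {0..1} (\<lambda>t. scaleC J (f (g t) * vector_derivative g (at t within {0..1})) (resolvent J T (g t) x)))) =
        (\<Sum>g\<leftarrow>gs. contour_integral g (\<lambda>z. f z * p (R z x)))"
      by (intro arg_cong[where f=sum_list] map_cong refl)
    also have "\<dots> = edge_integral E (\<lambda>z. f z * p (R z x))"
      by (intro admissible_cycle_integral[OF U closed_spectrum E gs] holomorphic_intros fV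
          holomorphic_on_subset[OF R_holomorphic[OF p]]) auto
    finally show "p (\<Sum>g\<leftarrow>gs. integral {0..1} (\<lambda>t. scaleC J (f (g t) * vector_derivative g (at t within {0..1}))
        (resolvent J T (g t) x))) = p (scaleC J (2 * pi * \<i>) (hf E f x))"
      by (simp add: cfun_sum_list[OF p] cfun_simps[OF p] cfun_hf[OF p E f])
  qed
  obtain gs where gs: "admissible_cycle (spectrum J T) U gs" using cauchy_edges_loops[OF U closed_spectrum E] by blast
  show ?thesis unfolding hfc_def
  proof (rule the_equality)
    show "\<forall>gs. admissible_cycle (spectrum J T) U gs \<longrightarrow> (\<forall>x. (\<Sum>g\<leftarrow>gs. integral {0..1} (\<lambda>t. scaleC J (f (g t) * vector_derivative g (at t within {0..1}))
        (resolvent J T (g t) x))) = scaleC J (2 * pi * \<i>) (hf E f x))" using sums by blast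
  next
    fix S assume S: "\<forall>gs. admissible_cycle (spectrum J T) U gs \<longrightarrow> (\<forall>x. (\<Sum>g\<leftarrow>gs. integral {0..1} (\<lambda>t. scaleC J (f (g t) * vector_derivative g (at t within {0..1}))
        (resolvent J T (g t) x))) = scaleC J (2 * pi * \<i>) (S x))"
    have "scaleC J (2 * pi * \<i>) (S x) = scaleC J (2 * pi * \<i>) (hf E f x)" for x
      by (rule trans[OF S[rule_format, OF gs, symmetric] sums[OF gs]])
    then have "scaleC J (2 * pi * \<i>) (S x - hf E f x) = 0" for x by (simp add: scaleC_diff_right)
    then show "S = hf E f" by (auto simp: scaleC_eq_0_iff)
  qed
qed

lemma R_bounded_on_compact:
  assumes C: "compact C" "C \<inter> spectrum J T = {}"
  shows "\<exists>M\<ge>0. \<forall>z\<in>C. \<forall>x. norm (R z x) \<le> M * norm x"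
proof -
  have "\<forall>t\<in>C. \<exists>d>0. \<exists>B. \<forall>s. cmod (s - t) < d \<longrightarrow> (\<forall>x. norm (R s x) \<le> B * norm x)"
    using R_locally_bounded C(2) by (meson disjoint_iff)
  then obtain d B where dB: "\<And>t. t \<in> C \<Longrightarrow> d t > 0" "\<And>t s x. t \<in> C \<Longrightarrow> cmod (s - t) < d t \<Longrightarrow> norm (R s x) \<le> B t * norm x"
    by metis
  obtain D where D: "D \<subseteq> C" "finite D" "C \<subseteq> (\<Union>t\<in>D. ball t (d t))"
    using compactE_image[OF C(1), of C "\<lambda>t. ball t (d t)"] dB(1) by (metis (no_types, lifting) UN_I centre_in_ball open_ball subsetI)
  define M where "M = (\<Sum>t\<in>D. \<bar>B t\<bar>)"
  have "norm (R z x) \<le> M * norm x" if z: "z \<in> C" for z x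
  proof -
    obtain t where t: "t \<in> D" "z \<in> ball t (d t)" using D(3) z by blast
    then have "norm (R z x) \<le> B t * norm x" using dB(2)[of t z x] D(1) by (auto simp: dist_norm norm_minus_commute)
    also have "\<dots> \<le> M * norm x"
      using member_le_sum[of t D "\<lambda>t. \<bar>B t\<bar>"] t(1) D(2) unfolding M_def by (intro mult_right_mono) auto
    finally show ?thesis .
  qed
  moreover have "M \<ge> 0" unfolding M_def by (simp add: sum_nonneg)
  ultimately show ?thesis by blast
qed

end

section \<open>Algebraic properties of the functional calculus\<close>

context complex_operator
begin

lemma edges_exist:
  assumes "open U" "spectrum J T \<subseteq> U"
  obtains E where "cauchy_edges (spectrum J T) U E"
  using cauchy_edges_exist[OF compact_spectrum assms] by blast

text \<open>Turns identities for the calculus into identities between scalar edge integrals.\<close>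

lemma hfc_functional:
  assumes U: "open U" and E: "cauchy_edges (spectrum J T) U E" and f: "f holomorphic_on U" and p: "cfun p"
  shows "p (hfc J U f T x) = 1 / (2 * pi * \<i>) * edge_integral E (\<lambda>z. f z * p (R z x))"
  using cfun_hf[OF p E f] hfc_eq_hf[OF U E f] by simp

lemma bop_hfc:
  assumes U: "open U" "spectrum J T \<subseteq> U" and f: "f holomorphic_on U"
  shows "bop J (hfc J U f T)"
proof -
  obtain E where E: "cauchy_edges (spectrum J T) U E" using edges_exist[OF U] .
  note fn = hfc_functional[OF U(1) E f]
  note cts = edges_holomorphic_continuous[OF E f]
  have ns: "z \<notin> spectrum J T" if "(a,b) \<in> E" "z \<in> closed_segment a b" for a b z
    using cauchy_edgesD(2)[OF E that(1)] that(2) by blast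
  have add: "hfc J U f T (x + y) = hfc J U f T x + hfc J U f T y" for x y
  proof (rule eq_if_cfun_eq)
    fix p assume p: "cfun p"
    have "edge_integral E (\<lambda>z. f z * p (R z (x + y))) = edge_integral E (\<lambda>z. f z * p (R z x) + f z * p (R z y))"
    proof (rule edge_integral_cong)
      fix a b z assume z: "(a,b) \<in> E" "z \<in> closed_segment a b"
      show "f z * p (R z (x + y)) = f z * p (R z x) + f z * p (R z y)"
        by (simp add: R_linear(1)[OF ns[OF z]] cfun_simps(1)[OF p] distrib_left)
    qed
    also have "\<dots> = edge_integral E (\<lambda>z. f z * p (R z x)) + edge_integral E (\<lambda>z. f z * p (R z y))"
      by (intro edge_integral_linear continuous_intros cts(1) cts(3)[OF _ p])
    finally show "p (hfc J U f T (x + y)) = p (hfc J U f T x + hfc J U f T y)"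
      unfolding cfun_simps(1)[OF p] fn[OF p] by (simp add: distrib_left)
  qed
  have scale: "hfc J U f T (scaleC J c x) = scaleC J c (hfc J U f T x)" for c x
  proof (rule eq_if_cfun_eq)
    fix p assume p: "cfun p"
    have "edge_integral E (\<lambda>z. f z * p (R z (scaleC J c x))) = edge_integral E (\<lambda>z. c * (f z * p (R z x)))"
    proof (rule edge_integral_cong)
      fix a b z assume z: "(a,b) \<in> E" "z \<in> closed_segment a b"
      show "f z * p (R z (scaleC J c x)) = c * (f z * p (R z x))"
        by (simp add: R_linear(3)[OF ns[OF z]] cfun_simps(3)[OF p])
    qed
    also have "\<dots> = c * edge_integral E (\<lambda>z. f z * p (R z x))"
      by (intro edge_integral_cmult continuous_intros cts(1) cts(3)[OF _ p])
    finally show "p (hfc J U f T (scaleC J c x)) = p (scaleC J c (hfc J U f T x))"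
      unfolding cfun_simps(3)[OF p] fn[OF p] by simp
  qed
  \<comment> \<open>Linearity could be tested by functionals; boundedness is estimated on the vector
    integrals themselves, using that \<open>f\<close> and the resolvent are bounded on the compact
    union of the edges.\<close>
  define C where "C = (\<Union>(a,b)\<in>E. closed_segment a b)"
  have "compact C" unfolding C_def case_prod_beta using cauchy_edgesD(1)[OF E] by (intro compact_UN) auto
  moreover have "C \<inter> spectrum J T = {}" using ns unfolding C_def by auto
  ultimately obtain M where M0: "M \<ge> 0" "\<forall>z\<in>C. \<forall>x. norm (R z x) \<le> M * norm x"
    using R_bounded_on_compact[of C] by blast
  then have M: "M \<ge> 0" "\<And>z x. z \<in> C \<Longrightarrow> norm (R z x) \<le> M * norm x" by simp_all
  have "continuous_on C f"
    by (rule continuous_on_subset[OF holomorphic_on_imp_continuous_on[OF f]])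
      (use cauchy_edgesD(2)[OF E] in \<open>auto simp: C_def\<close>)
  then have "bounded (f ` C)" using \<open>compact C\<close> compact_continuous_image compact_imp_bounded by blast
  then obtain N where N: "\<And>z. z \<in> C \<Longrightarrow> cmod (f z) \<le> N" "N > 0" by (auto simp: bounded_pos)
  have bound: "norm (seg (fst e) (snd e) (\<lambda>z. scaleC J (f z) (R z x))) \<le> cmod (snd e - fst e) * (N * (M * norm x))"
    if e: "e \<in> E" for e x
  proof (rule norm_seg_le)
    have e': "(fst e, snd e) \<in> E" using e by simp
    show "continuous_on (closed_segment (fst e) (snd e)) (\<lambda>z. scaleC J (f z) (R z x))"
      by (intro continuous_on_scaleC cts e')
    fix z assume "z \<in> closed_segment (fst e) (snd e)"
    then have "z \<in> C" using e' unfolding C_def by blast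
    then show "norm (scaleC J (f z) (R z x)) \<le> N * (M * norm x)"
      unfolding norm_scaleC using N(2) M(1) by (intro mult_mono N(1) M(2)) auto
  qed (use N M in auto)
  define B where "B = cmod (1 / (2 * pi * \<i>)) * (\<Sum>e\<in>E. cmod (snd e - fst e) * (N * M))"
  have "norm (hfc J U f T x) \<le> norm x * B" for x
  proof -
    have "norm (hfc J U f T x) = cmod (1 / (2 * pi * \<i>)) * norm (\<Sum>e\<in>E. seg (fst e) (snd e) (\<lambda>z. scaleC J (f z) (R z x)))"
      unfolding hfc_eq_hf[OF U(1) E f] hf_def norm_scaleC case_prod_beta ..
    also have "\<dots> \<le> cmod (1 / (2 * pi * \<i>)) * (\<Sum>e\<in>E. cmod (snd e - fst e) * (N * (M * norm x)))"
      by (intro mult_left_mono sum_norm_le bound) simp_all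
    also have "\<dots> = norm x * B" unfolding B_def by (simp add: sum_distrib_left sum_distrib_right mult_ac)
    finally show ?thesis .
  qed
  then have "bounded_linear (hfc J U f T)"
    using add scale[of "of_real r" for r] by (intro bounded_linear_intro) (simp_all only: scaleC_of_real)
  moreover have "hfc J U f T (J x) = J (hfc J U f T x)" for x
    using scale[of \<i> x] by (simp add: scaleC_def)
  ultimately show ?thesis by (simp add: bop_def)
qed

lemma hfc_commute:
  assumes U: "open U" "spectrum J T \<subseteq> U" and f: "f holomorphic_on U"
    and A: "bop J A" "\<And>x. A (T x) = T (A x)"
  shows "A (hfc J U f T x) = hfc J U f T (A x)"
proof (rule eq_if_cfun_eq)
  fix p assume p: "cfun p"
  obtain E where E: "cauchy_edges (spectrum J T) U E" using edges_exist[OF U] .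
  have ns: "z \<notin> spectrum J T" if "(a,b) \<in> E" "z \<in> closed_segment a b" for a b z
    using cauchy_edgesD(2)[OF E that(1)] that(2) by blast
  have "edge_integral E (\<lambda>z. f z * p (A (R z x))) = edge_integral E (\<lambda>z. f z * p (R z (A x)))"
    by (rule edge_integral_cong) (simp add: R_commute[OF ns A])
  then show "p (A (hfc J U f T x)) = p (hfc J U f T (A x))"
    using hfc_functional[OF U(1) E f p, of "A x"] hfc_functional[OF U(1) E f cfun_comp[OF p A(1)], of x] by simp
qed

lemma hfc_linear:
  assumes U: "open U" "spectrum J T \<subseteq> U" and f: "f holomorphic_on U" and g: "g holomorphic_on U"
  shows "hfc J U (\<lambda>z. f z - g z) T x = hfc J U f T x - hfc J U g T x"
    and "hfc J U (\<lambda>z. c * f z) T x = scaleC J c (hfc J U f T x)"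
proof -
  obtain E where E: "cauchy_edges (spectrum J T) U E" using edges_exist[OF U] .
  note cts = edges_holomorphic_continuous[OF E f] edges_holomorphic_continuous[OF E g]
  show "hfc J U (\<lambda>z. f z - g z) T x = hfc J U f T x - hfc J U g T x"
  proof (rule eq_if_cfun_eq)
    fix p assume p: "cfun p"
    have "edge_integral E (\<lambda>z. (f z - g z) * p (R z x)) = edge_integral E (\<lambda>z. f z * p (R z x) - g z * p (R z x))"
      by (rule edge_integral_cong) (simp add: left_diff_distrib)
    also have "\<dots> = edge_integral E (\<lambda>z. f z * p (R z x)) - edge_integral E (\<lambda>z. g z * p (R z x))"
      by (intro edge_integral_linear continuous_intros cts(1,4) cts(3)[OF _ p])
    finally have "edge_integral E (\<lambda>z. (f z - g z) * p (R z x)) = \<dots>" .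
    then show "p (hfc J U (\<lambda>z. f z - g z) T x) = p (hfc J U f T x - hfc J U g T x)"
      unfolding cfun_simps(2)[OF p] hfc_functional[OF U(1) E f p] hfc_functional[OF U(1) E g p]
        hfc_functional[OF U(1) E holomorphic_on_diff[OF f g] p] by (simp add: right_diff_distrib)
  qed
  show "hfc J U (\<lambda>z. c * f z) T x = scaleC J c (hfc J U f T x)"
  proof (rule eq_if_cfun_eq)
    fix p assume p: "cfun p"
    have cf: "(\<lambda>z. c * f z) holomorphic_on U" by (intro holomorphic_intros f)
    have "edge_integral E (\<lambda>z. (c * f z) * p (R z x)) = edge_integral E (\<lambda>z. c * (f z * p (R z x)))"
      by (simp add: mult_ac)
    also have "\<dots> = c * edge_integral E (\<lambda>z. f z * p (R z x))"
      by (intro edge_integral_cmult continuous_intros cts(1,4) cts(3)[OF _ p])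
    finally show "p (hfc J U (\<lambda>z. c * f z) T x) = p (scaleC J c (hfc J U f T x))"
      unfolding cfun_simps(3)[OF p] hfc_functional[OF U(1) E f p] hfc_functional[OF U(1) E cf p] by simp
  qed
qed

text \<open>Edges drawn inside the smaller set serve for both domains. This permits shrinking the
  domain until an auxiliary factor has no zeros in it.\<close>

lemma hfc_subset:
  assumes U: "open U" and V: "open V" "spectrum J T \<subseteq> V" "V \<subseteq> U" and f: "f holomorphic_on U"
  shows "hfc J V f T = hfc J U f T"
proof -
  obtain E where E: "cauchy_edges (spectrum J T) V E" using edges_exist[OF V(1,2)] .
  show ?thesis
    using hfc_eq_hf[OF V(1) E holomorphic_on_subset[OF f V(3)]] hfc_eq_hf[OF U cauchy_edges_mono[OF E V(3)] f] by simp
qed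

lemma hfc_cong:
  assumes U: "open U" "spectrum J T \<subseteq> U" and f: "f holomorphic_on U" and fg: "\<And>z. z \<in> U \<Longrightarrow> f z = g z"
  shows "hfc J U f T = hfc J U g T"
proof (rule ext, rule eq_if_cfun_eq)
  fix x p assume p: "cfun p"
  obtain E where E: "cauchy_edges (spectrum J T) U E" using edges_exist[OF U] .
  have g: "g holomorphic_on U" using f fg holomorphic_cong by metis
  have "edge_integral E (\<lambda>z. f z * p (R z x)) = edge_integral E (\<lambda>z. g z * p (R z x))"
  proof (rule edge_integral_cong)
    fix a b z assume "(a,b) \<in> E" "z \<in> closed_segment a b"
    then have "z \<in> U" using cauchy_edgesD(2)[OF E] by blast
    then show "f z * p (R z x) = g z * p (R z x)" using fg by simp
  qed
  then show "p (hfc J U f T x) = p (hfc J U g T x)"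
    unfolding hfc_functional[OF U(1) E f p] hfc_functional[OF U(1) E g p] by simp
qed

text \<open>The contour of g is placed inside the contour of f. The resolvent identity splits the double
  integral into two terms; one vanishes since the outer contour lies outside the inner one.\<close>
lemma hfc_mult:
  assumes U: "open U" "spectrum J T \<subseteq> U" and f: "f holomorphic_on U" and g: "g holomorphic_on U"
  shows "hfc J U f T (hfc J U g T x) = hfc J U (\<lambda>z. f z * g z) T x"
proof (rule eq_if_cfun_eq)
  fix p assume p: "cfun p"
  let ?S = "spectrum J T"
  obtain e where e: "e > 0" "(\<Union>x\<in>?S. cball x e) \<subseteq> U"
    using compact_subset_open_imp_cball_epsilon_subset[OF compact_spectrum U] by blast
  define V where "V = (\<Union>x\<in>?S. ball x e)"
  define L where "L = (\<Union>x\<in>?S. cball x e)"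
  have "V \<subseteq> L" by (force simp: V_def L_def)
  then have V: "open V" "?S \<subseteq> V" "V \<subseteq> L" "V \<subseteq> U" using e unfolding V_def L_def by auto
  have "L = {y + z | y z. y \<in> ?S \<and> z \<in> cball 0 e}"
  proof (intro set_eqI iffI)
    fix w assume "w \<in> L"
    then obtain y where "y \<in> ?S" "dist y w \<le> e" by (auto simp: L_def)
    then show "w \<in> {y + z | y z. y \<in> ?S \<and> z \<in> cball 0 e}"
      by (intro CollectI exI[of _ y] exI[of _ "w - y"]) (simp add: dist_norm norm_minus_commute)
  next
    fix w assume "w \<in> {y + z | y z. y \<in> ?S \<and> z \<in> cball 0 e}"
    then obtain y z where "w = y + z" "y \<in> ?S" "norm z \<le> e" by auto
    then show "w \<in> L" unfolding L_def by (intro UN_I[of y]) (simp_all add: dist_norm)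
  qed
  then have "compact L" using compact_sums[OF compact_spectrum compact_cball[of 0 e]] by (simp only:)
  then obtain E where EL: "cauchy_edges L U E" using cauchy_edges_exist[OF _ U(1)] e(2) L_def by metis
  have E: "cauchy_edges ?S U E" using cauchy_edges_subset[OF EL] V by blast
  obtain E' where E'V: "cauchy_edges ?S V E'" using edges_exist[OF V(1,2)] .
  have E': "cauchy_edges ?S U E'" using cauchy_edges_mono[OF E'V V(4)] .
  note fE = edges_holomorphic_continuous[OF E f] and gE' = edges_holomorphic_continuous[OF E' g]
  have offL: "w \<notin> L" "w \<notin> ?S" "w \<notin> V" if "(a,b) \<in> E" "w \<in> closed_segment a b" for a b w
    using cauchy_edgesD(2)[OF EL that(1)] that(2) V by blast+
  have inV: "z \<in> V" "z \<notin> ?S" "z \<in> L" if "(a,b) \<in> E'" "z \<in> closed_segment a b" for a b z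
    using cauchy_edgesD(2)[OF E'V that(1)] that(2) V by blast+
  define k where "k z = g z * p (R z x)" for z
  have kc: "continuous_on (closed_segment a b) k" if "(a,b) \<in> E'" for a b
    unfolding k_def by (intro continuous_intros gE' that p)
  let ?c = "1 / (2 * pi * \<i>)"
  have inner: "p (R w (hfc J U g T x)) = ?c * edge_integral E' (\<lambda>z. k z / (w - z))"
    if w: "(a,b) \<in> E" "w \<in> closed_segment a b" for a b w
  proof -
    have pw: "cfun (\<lambda>y. p (R w y))" by (rule cfun_comp[OF p bop_R[OF offL(2)[OF w]]])
    have ne: "w - z \<noteq> 0" if "(a',b') \<in> E'" "z \<in> closed_segment a' b'" for a' b' z
      using inV(3)[OF that] offL(1)[OF w] by auto
    have "edge_integral E' (\<lambda>z. g z * p (R w (R z x))) = edge_integral E' (\<lambda>z. k z / (w - z) - p (R w x) * (g z / (w - z)))"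
    proof (rule edge_integral_cong)
      fix a' b' z assume z: "(a',b') \<in> E'" "z \<in> closed_segment a' b'"
      have "R w (R z x) = R z (R w x)" by (rule R_commute[OF inV(2)[OF z] bop_R[OF offL(2)[OF w]]]) (rule R_commute[OF offL(2)[OF w] T refl, symmetric])
      then have "(w - z) * p (R w (R z x)) = p (R z x) - p (R w x)"
        using R_diff[OF inV(2)[OF z] offL(2)[OF w], of x] cfun_simps(2,3)[OF p] by metis
      then have "p (R w (R z x)) = (p (R z x) - p (R w x)) / (w - z)" using ne[OF z] by (simp add: field_simps)
      then show "g z * p (R w (R z x)) = k z / (w - z) - p (R w x) * (g z / (w - z))"
        by (simp add: k_def diff_divide_distrib right_diff_distrib mult.commute)
    qed
    also have "\<dots> = edge_integral E' (\<lambda>z. k z / (w - z)) - edge_integral E' (\<lambda>z. p (R w x) * (g z / (w - z)))"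
      by (intro edge_integral_linear continuous_intros kc gE'(1) ballI ne) auto
    also have "edge_integral E' (\<lambda>z. p (R w x) * (g z / (w - z))) = p (R w x) * edge_integral E' (\<lambda>z. g z / (w - z))"
      by (intro edge_integral_cmult continuous_intros gE'(1) ballI ne) auto
    also have "edge_integral E' (\<lambda>z. g z / (w - z)) = 0"
    proof -
      have "(\<lambda>z. g z / (w - z)) = (\<lambda>z. (- g z) / (z - w))" by (rule ext) (metis minus_diff_eq minus_divide_divide)
      moreover have "(\<lambda>z. - g z) holomorphic_on V" using g V(4) by (intro holomorphic_intros) (rule holomorphic_on_subset)
      ultimately show ?thesis using cauchy_edgesD(4)[OF E'V _ offL(3)[OF w], of "\<lambda>z. - g z"] by simp
    qed
    finally show ?thesis using hfc_functional[OF U(1) E' g pw, of x] by simp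
  qed
  have "p (hfc J U f T (hfc J U g T x)) = ?c * edge_integral E (\<lambda>w. f w * p (R w (hfc J U g T x)))"
    by (rule hfc_functional[OF U(1) E f p])
  also have "edge_integral E (\<lambda>w. f w * p (R w (hfc J U g T x))) =
      edge_integral E (\<lambda>w. (?c * f w) * edge_integral E' (\<lambda>z. k z / (w - z)))"
    by (rule edge_integral_cong) (simp add: inner)
  also have "\<dots> = edge_integral E' (\<lambda>z. k z * edge_integral E (\<lambda>w. (?c * f w) / (w - z)))"
  proof (rule edge_integral_swap[OF cauchy_edgesD(1)[OF E] cauchy_edgesD(1)[OF E']])
    show "continuous_on (closed_segment a b) (\<lambda>w. ?c * f w)" if "(a,b) \<in> E" for a b
      by (intro continuous_intros fE that)
    show "closed_segment a b \<inter> closed_segment c d = {}" if "(a,b) \<in> E" "(c,d) \<in> E'" for a b c d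
      using offL(1)[OF that(1)] inV(3)[OF that(2)] by blast
  qed (rule kc)
  also have "\<dots> = edge_integral E' (\<lambda>z. (f z * g z) * p (R z x))"
  proof (rule edge_integral_cong)
    fix a b z assume z: "(a,b) \<in> E'" "z \<in> closed_segment a b"
    have "(\<lambda>w. ?c * f w) holomorphic_on U" by (intro holomorphic_intros f)
    then have "edge_integral E (\<lambda>w. (?c * f w) / (w - z)) = 2 * pi * \<i> * (?c * f z)"
      by (rule cauchy_edgesD(3)[OF EL _ inV(3)[OF z]])
    then show "k z * edge_integral E (\<lambda>w. (?c * f w) / (w - z)) = (f z * g z) * p (R z x)"
      by (simp add: k_def)
  qed
  also have "?c * \<dots> = p (hfc J U (\<lambda>z. f z * g z) T x)"
    by (rule hfc_functional[OF U(1) E' holomorphic_on_mult[OF f g] p, symmetric])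
  finally show "p (hfc J U f T (hfc J U g T x)) = p (hfc J U (\<lambda>z. f z * g z) T x)" .
qed

text \<open>The constant 1 is entire, so the edges may be compared with large circles in the whole
  plane, where the resolvent is 1/z up to an error of order 1/|z|^2.\<close>

lemma hfc_one:
  assumes U: "open U" "spectrum J T \<subseteq> U"
  shows "hfc J U (\<lambda>z. 1) T x = x"
proof (rule eq_if_cfun_eq)
  fix p assume p: "cfun p"
  obtain E where E: "cauchy_edges (spectrum J T) U E" using edges_exist[OF U] .
  have E1: "cauchy_edges (spectrum J T) UNIV E" using cauchy_edges_mono[OF E] by simp
  define I where "I = edge_integral E (\<lambda>z. p (R z x))"
  obtain B where B: "\<And>x. norm (T x) \<le> norm x * B" "B > 0" using bounded_linear.pos_bounded[OF blT] by blast
  obtain D where D: "D > 0" "\<And>t. cmod t \<ge> D \<Longrightarrow> t \<notin> spectrum J T"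
    using bij_shiftop_large spectrum_iff by blast
  obtain C where C: "\<And>x. cmod (p x) \<le> norm x * C" "C > 0" using bounded_linear.pos_bounded p unfolding cfun_def by blast
  \<comment> \<open>For radius r at least 2 B the resolvent has norm at most 2/r, and
    \<open>p (R z x)\<close> differs from \<open>p x / z\<close> by
    \<open>p (R z (T x)) / z\<close>; the error on the circle is thus at most M / r^2.\<close>
  define M where "M = 2 * norm (T x) * C"
  have est: "cmod (I - 2 * pi * \<i> * p x) \<le> M * (2 * pi) / r" if r: "r \<ge> D" "r \<ge> 2 * B" for r
  proof -
    have r0: "r > 0" using D(1) r by linarith
    have ns: "z \<notin> spectrum J T" if "cmod z = r" for z using D(2)[of z] that r by simp
    have "spectrum J T \<subseteq> ball 0 r" using D(2) r by (force simp: not_le)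
    then have "admissible_cycle (spectrum J T) UNIV [circlepath 0 r]"
      unfolding admissible_cycle_def using r0 ns by (auto simp: winding_number_circlepath subset_iff)
    then have "I = contour_integral (circlepath 0 r) (\<lambda>z. p (R z x))"
      using admissible_cycle_integral[OF open_UNIV closed_spectrum E1, of "[circlepath 0 r]" "\<lambda>z. p (R z x)"] R_holomorphic[OF p]
      by (simp add: I_def Compl_eq_Diff_UNIV)
    moreover have "(\<lambda>z. p (R z x)) contour_integrable_on circlepath 0 r"
      by (rule contour_integrable_holomorphic_simple[OF R_holomorphic[OF p]])
        (use closed_spectrum r0 ns in auto)
    ultimately have 1: "((\<lambda>z. p (R z x)) has_contour_integral I) (circlepath 0 r)"
      by (simp add: has_contour_integral_integral)
    have "((\<lambda>z. 1 / (z - 0)) has_contour_integral (2 * pi * \<i> * winding_number (circlepath 0 r) 0)) (circlepath 0 r)"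
      by (rule has_contour_integral_winding_number) (use r0 in auto)
    then have "((\<lambda>z. p x * (1 / (z - 0))) has_contour_integral (p x * (2 * pi * \<i> * 1))) (circlepath 0 r)"
      using r0 by (intro has_contour_integral_lmul) (simp add: winding_number_circlepath_centre)
    from has_contour_integral_diff[OF 1 this]
    have 2: "((\<lambda>z. p (R z x) - p x * (1 / (z - 0))) has_contour_integral (I - p x * (2 * pi * \<i> * 1))) (circlepath 0 r)" .
    have "cmod (I - p x * (2 * pi * \<i> * 1)) \<le> (M / r / r) * (2 * pi * r)"
    proof (rule has_contour_integral_bound_circlepath[OF 2])
      show "0 \<le> M / r / r" using C(2) r0 by (simp add: M_def)
      fix z :: complex assume "cmod (z - 0) = r"
      then have z: "cmod z = r" by simp
      have zs: "z \<notin> spectrum J T" using ns z by blast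
      have bd: "norm (R z y) \<le> 2 * norm y / r" for y
      proof -
        have "scaleC J z (R z y) = y + T (R z y)" using R_inverse(2)[OF zs, of y] by (simp add: algebra_simps)
        then have "r * norm (R z y) \<le> norm y + norm (R z y) * B"
          using norm_triangle_ineq[of y "T (R z y)"] B(1)[of "R z y"] z by (metis norm_scaleC add_left_mono order_trans)
        moreover have "norm (R z y) * B \<le> norm (R z y) * (r / 2)" using r(2) by (intro mult_left_mono) auto
        ultimately show ?thesis using r0 by (simp add: field_simps)
      qed
      have z0: "z \<noteq> 0" using z r0 by auto
      have "scaleC J z (R z x) = x + R z (T x)"
        using R_inverse(2)[OF zs, of x] R_commute[OF zs T refl, of x] by (simp add: algebra_simps)
      then have "z * p (R z x) = p x + p (R z (T x))" using cfun_simps(1,3)[OF p] by metis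
      then have "p (R z x) - p x * (1 / (z - 0)) = p (R z (T x)) / z" using z0 by (simp add: field_simps)
      then have "cmod (p (R z x) - p x * (1 / (z - 0))) = cmod (p (R z (T x))) / r" by (simp add: norm_divide z)
      also have "\<dots> \<le> (M / r) / r"
      proof (rule divide_right_mono)
        have "cmod (p (R z (T x))) \<le> norm (R z (T x)) * C" by (rule C(1))
        also have "\<dots> \<le> (2 * norm (T x) / r) * C" by (intro mult_right_mono bd) (use C(2) in simp)
        finally show "cmod (p (R z (T x))) \<le> M / r" by (simp add: M_def)
      qed (use r0 in simp)
      finally show "cmod (p (R z x) - p x * (1 / (z - 0))) \<le> M / r / r" .
    qed (use r0 in simp)
    then show ?thesis using r0 by (simp add: mult_ac)
  qed
  have "\<forall>\<^sub>F r in at_top. cmod (I - 2 * pi * \<i> * p x) \<le> M * (2 * pi) / r"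
    using eventually_ge_at_top[of D] eventually_ge_at_top[of "2 * B"] by eventually_elim (rule est)
  moreover have "((\<lambda>r. M * (2 * pi) / r) \<longlongrightarrow> 0) at_top"
    by (intro tendsto_divide_0[OF tendsto_const] filterlim_at_top_imp_at_infinity filterlim_ident)
  ultimately have "cmod (I - 2 * pi * \<i> * p x) \<le> 0" by (intro tendsto_lowerbound[where F=at_top]) auto
  then have "I = 2 * pi * \<i> * p x" by simp
  then show "p (hfc J U (\<lambda>z. 1) T x) = p x"
    using hfc_functional[OF U(1) E _ p, of "\<lambda>z. 1" x] by (simp add: I_def)
qed

text \<open>The relation z R_z x = R_z (T x) + x reduces the claim to the constant function 1; the
  extra constant integrates to 0 because the edges are balanced.\<close>

lemma hfc_ident:
  assumes U: "open U" "spectrum J T \<subseteq> U"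
  shows "hfc J U (\<lambda>z. z) T x = T x"
proof (rule eq_if_cfun_eq)
  fix p assume p: "cfun p"
  obtain E where E: "cauchy_edges (spectrum J T) U E" using edges_exist[OF U] .
  have ns: "z \<notin> spectrum J T" if "(a,b) \<in> E" "z \<in> closed_segment a b" for a b z
    using cauchy_edgesD(2)[OF E that(1)] that(2) by blast
  have one: "(\<lambda>z. 1) holomorphic_on U" and id: "(\<lambda>z. z) holomorphic_on U" by simp_all
  have "edge_integral E (\<lambda>z. z * p (R z x)) = edge_integral E (\<lambda>z. 1 * p (R z (T x)) + p x)"
  proof (rule edge_integral_cong)
    fix a b z assume z: "(a,b) \<in> E" "z \<in> closed_segment a b"
    have "scaleC J z (R z x) = R z (T x) + x"
      using R_inverse(2)[OF ns[OF z], of x] R_commute[OF ns[OF z] T refl, of x] by (simp add: algebra_simps)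
    then show "z * p (R z x) = 1 * p (R z (T x)) + p x" using cfun_simps(1,3)[OF p] by (metis mult_1)
  qed
  also have "\<dots> = edge_integral E (\<lambda>z. 1 * p (R z (T x))) + edge_integral E (\<lambda>z. p x)"
    by (intro edge_integral_linear continuous_intros edges_holomorphic_continuous[OF E one] p)
  also have "edge_integral E (\<lambda>z. p x) = 0"
  proof -
    have bal: "(\<Sum>(a,b)\<in>E. h a - h b) = 0" for h :: "complex \<Rightarrow> complex" using E unfolding cauchy_edges_def by blast
    show ?thesis using bal[of "\<lambda>a. - (p x * a)"] by (simp add: edge_integral_def right_diff_distrib case_prod_beta)
  qed
  finally have "p (hfc J U (\<lambda>z. z) T x) = p (hfc J U (\<lambda>z. 1) T (T x))"
    unfolding hfc_functional[OF U(1) E one p] hfc_functional[OF U(1) E id p] by simp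
  then show "p (hfc J U (\<lambda>z. z) T x) = p (T x)" by (simp add: hfc_one[OF U])
qed

end

section \<open>The operator classes\<close>

lemma span_Un_eq: "span A = span B \<Longrightarrow> span (A \<union> F) = span (B \<union> F)"
  unfolding span_Un by simp

text \<open>A complex subspace of finite relative codimension has even real codimension: representatives
  are chosen in pairs f, J f.\<close>
lemma even_relative_codim:
  fixes J :: "'a::real_vector \<Rightarrow> 'a"
  assumes J: "linear J" "\<And>x. J (J x) = - x"
    and V: "subspace V" "\<And>x. x \<in> V \<Longrightarrow> J x \<in> V"
    and F: "finite F" "F \<subseteq> V"
    and R: "subspace R" "\<And>x. x \<in> R \<Longrightarrow> J x \<in> R" "R \<subseteq> V" "V \<subseteq> span (R \<union> F)"
  shows "\<exists>B. finite B \<and> B \<subseteq> V \<and> even (card B) \<and> V \<subseteq> span (R \<union> B) \<and>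
    (\<forall>E. finite E \<longrightarrow> V \<subseteq> span (R \<union> E) \<longrightarrow> card B \<le> card E)"
  using F R
proof (induction "card F" arbitrary: F R rule: less_induct)
  case less
  note F = less.prems(1,2) and R = less.prems(3-6)
  show ?case
  proof (cases "V \<subseteq> R")
    case True
    then show ?thesis by (intro exI[of _ "{}"]) (auto intro: span_base)
  next
    case False
    have spanR: "span R = R" using R(1) by (simp add: span_eq_iff)
    have "\<not> F \<subseteq> R"
    proof
      assume "F \<subseteq> R"
      then have "R \<union> F = R" by blast
      then show False using R(4) False spanR by simp
    qed
    then obtain f where f: "f \<in> F" "f \<notin> R" by blast
    \<comment> \<open>If J f = k f + r with r in \<open>R\<close>, then applying \<open>J\<close>
      gives (1 + k^2) f in \<open>R\<close>. So \<open>f\<close> and \<open>J f\<close> always add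
      two real dimensions.\<close>
    have Jf: "J f \<notin> span (insert f R)"
    proof
      assume "J f \<in> span (insert f R)"
      then obtain k where k: "J f - k *\<^sub>R f \<in> R" unfolding span_breakdown_eq spanR by blast
      define r where "r = J f - k *\<^sub>R f"
      have rR: "r \<in> R" using k by (simp add: r_def)
      have Jr: "J r = - f - k *\<^sub>R J f" using J by (simp add: r_def linear_diff linear_scale)
      have "- (J r + k *\<^sub>R r) = (1 + k * k) *\<^sub>R f" unfolding Jr by (simp add: r_def algebra_simps)
      moreover have "- (J r + k *\<^sub>R r) \<in> R" using R(1,2) rR by (intro subspace_neg subspace_add subspace_scale)
      ultimately have "inverse (1 + k * k) *\<^sub>R ((1 + k * k) *\<^sub>R f) \<in> R"
        using subspace_scale[OF R(1)] by metis
      moreover have "1 + k * k \<noteq> 0" using zero_le_square[of k] by linarith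
      ultimately show False using f(2) by simp
    qed
    define R' where "R' = span (insert (J f) (insert f R))"
    have fV: "f \<in> V" "J f \<in> V" using f(1) F(2) V(2) by auto
    have subR': "R \<subseteq> R'" "f \<in> R'" "J f \<in> R'" unfolding R'_def by (auto intro: span_base)
    have "insert (J f) (insert f R) \<subseteq> V" using fV R(3) by blast
    then have R': "subspace R'" "R' \<subseteq> V" unfolding R'_def
      using span_minimal[OF _ V(1)] by (simp_all only: subspace_span)
    have "J x \<in> R'" if x: "x \<in> R'" for x
    proof -
      obtain a b where "x - a *\<^sub>R J f - b *\<^sub>R f \<in> R"
        using x unfolding R'_def span_breakdown_eq spanR by blast
      then have "J (x - a *\<^sub>R J f - b *\<^sub>R f) \<in> R'" using R(2) subR'(1) by blast
      then have "J (x - a *\<^sub>R J f - b *\<^sub>R f) - a *\<^sub>R f + b *\<^sub>R J f \<in> R'"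
        using subR'(2,3) R'(1) by (intro subspace_add subspace_diff subspace_scale)
      moreover have "J (x - a *\<^sub>R J f - b *\<^sub>R f) - a *\<^sub>R f + b *\<^sub>R J f = J x"
        using J by (simp add: linear_diff linear_scale)
      ultimately show ?thesis by simp
    qed
    moreover have "V \<subseteq> span (R' \<union> (F - {f}))"
    proof -
      have "R \<union> F \<subseteq> R' \<union> (F - {f})" using subR' by blast
      then show ?thesis using R(4) span_mono by blast
    qed
    moreover have "finite (F - {f})" "F - {f} \<subseteq> V" using F by auto
    ultimately obtain B where B: "finite B" "B \<subseteq> V" "even (card B)" "V \<subseteq> span (R' \<union> B)"
        "\<And>E. finite E \<Longrightarrow> V \<subseteq> span (R' \<union> E) \<Longrightarrow> card B \<le> card E"
      using less.hyps[OF card_Diff1_less[OF F(1) f(1)], of R'] R' by blast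
    have notB: "b \<notin> B" if b: "b \<in> R'" for b
    proof
      assume bB: "b \<in> B"
      have "R' \<union> B = R' \<union> (B - {b})" using b by blast
      then have "card B \<le> card (B - {b})" using B(1,4,5) by simp
      then show False using card_Diff1_less[OF B(1) bB] by simp
    qed
    have ne: "f \<noteq> J f" using Jf by (metis insertI1 span_base)
    have R'B: "span (R' \<union> B) = span (R \<union> insert f (insert (J f) B))"
    proof -
      have "span R' = span (insert (J f) (insert f R))" by (simp add: R'_def)
      then have "span (R' \<union> B) = span (insert (J f) (insert f R) \<union> B)" by (rule span_Un_eq)
      moreover have "insert (J f) (insert f R) \<union> B = R \<union> insert f (insert (J f) B)" by blast
      ultimately show ?thesis by simp
    qed
    show ?thesis
    proof (intro exI[of _ "insert f (insert (J f) B)"] conjI allI impI)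
      show "even (card (insert f (insert (J f) B)))"
        using B(1,3) notB[OF subR'(2)] notB[OF subR'(3)] ne by simp
      show "V \<subseteq> span (R \<union> insert f (insert (J f) B))" using B(4) R'B by simp
      fix E assume E: "finite E" "V \<subseteq> span (R \<union> E)"
      \<comment> \<open>Two exchanges trade elements of \<open>E\<close> for \<open>f\<close> and
        \<open>J f\<close>; what remains of \<open>E\<close> completes \<open>R'\<close>, and the
        minimality of \<open>B\<close> applies to it.\<close>
      obtain e1 where e1: "e1 \<in> E" "e1 \<in> span (insert f (R \<union> (E - {e1})))"
        using span_exchange[of E f R] E fV(1) f(2) spanR by auto
      have V1: "V \<subseteq> span (insert f R \<union> (E - {e1}))"
      proof -
        have "R \<union> E \<subseteq> span (insert f R \<union> (E - {e1}))"
          using e1 by (auto intro: span_base)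
        then show ?thesis using E(2) by (meson order_trans span_minimal subspace_span)
      qed
      obtain e2 where e2: "e2 \<in> E - {e1}" "e2 \<in> span (insert (J f) (insert f R \<union> (E - {e1} - {e2})))"
        using span_exchange[of "E - {e1}" "J f" "insert f R"] E(1) V1 fV(2) Jf by auto
      have "V \<subseteq> span (R' \<union> (E - {e1} - {e2}))"
      proof -
        have s: "insert (J f) (insert f R \<union> (E - {e1} - {e2})) \<subseteq> R' \<union> (E - {e1} - {e2})" using subR' by blast
        have "insert f R \<union> (E - {e1}) \<subseteq> span (R' \<union> (E - {e1} - {e2}))"
          using e2(2) span_mono[OF s] s by (auto intro: span_base)
        then show ?thesis using V1 by (meson order_trans span_minimal subspace_span)
      qed
      then have "card B \<le> card (E - {e1} - {e2})" using B(5) E(1) by simp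
      moreover have "card E = Suc (Suc (card (E - {e1} - {e2})))"
        using E(1) e1(1) e2(1) by (metis card_Suc_Diff1 finite_Diff)
      moreover have "card (insert f (insert (J f) B)) = Suc (Suc (card B))"
        using B(1) notB[OF subR'(2)] notB[OF subR'(3)] ne by simp
      ultimately show "card (insert f (insert (J f) B)) \<le> card E" by linarith
    qed (use B fV in auto)
  qed
qed

text \<open>\<open>B\<close> maps the kernel of the product into the kernel of \<open>A\<close>. A
  basis of the image, lifted back and joined with a basis of the kernel of \<open>B\<close>, spans
  the kernel of the product.\<close>

lemma dim_ker_comp:
  assumes A: "linear A" and B: "linear B" and fd: "fin_dim (kerM UNIV A)" "fin_dim (kerM UNIV B)"
  shows "fin_dim (kerM UNIV (\<lambda>x. A (B x)))"
    and "dim (kerM UNIV (\<lambda>x. A (B x))) \<le> dim (kerM UNIV A) + dim (kerM UNIV B)"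
proof -
  let ?K = "kerM UNIV (\<lambda>x. A (B x))"
  have sub: "subspace ?K" by (rule subspace_kerM[OF linear_compose[OF B A, unfolded o_def]])
  have BK: "subspace (B ` ?K)" "B ` ?K \<subseteq> kerM UNIV A"
    using B sub by (auto simp: linear_subspace_image kerM_def)
  obtain D where D: "finite D" "D \<subseteq> B ` ?K" "independent D" "span D = B ` ?K"
    using fin_dim_basis[OF fin_dim_subset[OF fd(1) BK(2)] BK(1)] by metis
  obtain D0 where D0: "finite D0" "span D0 = kerM UNIV A" "card D0 = dim (kerM UNIV A)"
    using fin_dim_basis[OF fd(1) subspace_kerM[OF A]] by metis
  obtain C where C: "finite C" "span C = kerM UNIV B" "card C = dim (kerM UNIV B)"
    using fin_dim_basis[OF fd(2) subspace_kerM[OF B]] by metis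
  have "card D \<le> card D0"
    using real_vector.independent_span_bound[OF D0(1) D(3)] D(2) BK(2) D0(2) by blast
  moreover obtain D' where D': "finite D'" "D = B ` D'" "card D' = card D"
  proof -
    obtain D' where "D' \<subseteq> ?K" "finite D'" "D = B ` D'" "card D' = card D"
      using D(1,2) subset_image_inj[of D B ?K] by (metis card_image finite_imageD)
    then show ?thesis using that by blast
  qed
  moreover have "?K \<subseteq> span (D' \<union> C)"
  proof
    fix x assume "x \<in> ?K"
    then have "B x \<in> span (B ` D')" using D(4) D'(2) by blast
    then obtain y where y: "y \<in> span D'" "B x = B y" using linear_span_image[OF B, of D'] by auto
    then have "x - y \<in> span C" using C(2) B by (simp add: kerM_def linear_diff)
    then have "y + (x - y) \<in> span (D' \<union> C)" using y(1) by (intro span_add) (auto intro: span_mono[THEN subsetD])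
    then show "x \<in> span (D' \<union> C)" by simp
  qed
  ultimately show "fin_dim ?K" "dim ?K \<le> dim (kerM UNIV A) + dim (kerM UNIV B)"
    using C(1,3) D0(3) real_vector.dim_le_card[of ?K "D' \<union> C"] card_Un_le[of D' C]
    unfolding fin_dim_def by (blast, force)
qed

section \<open>Ascent and descent as bounds on dimensions\<close>

lemma linear_funpow:
  fixes S :: "'a::real_vector \<Rightarrow> 'a"
  shows "linear S \<Longrightarrow> linear (S ^^ n)"
  by (induction n) (simp_all add: linear_iff)

lemma funpow_comp:
  fixes S :: "'a \<Rightarrow> 'a"
  shows "(S ^^ Suc n) = (\<lambda>x. S ((S ^^ n) x))"
  by (simp add: o_def)

lemma kerM_funpow_mono:
  fixes S :: "'a::real_vector \<Rightarrow> 'a"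
  shows "linear S \<Longrightarrow> m \<le> n \<Longrightarrow> kerM UNIV (S ^^ m) \<subseteq> kerM UNIV (S ^^ n)"
proof -
  assume S: "linear S" and mn: "m \<le> n"
  then obtain k where k: "n = k + m" by (metis add.commute le_Suc_ex)
  show ?thesis using linear_0[OF linear_funpow[OF S, of k]] by (auto simp: kerM_def k funpow_add)
qed

lemma fin_dim_kerM_funpow:
  fixes S :: "'a::real_vector \<Rightarrow> 'a"
  assumes "linear S" "fin_dim (kerM UNIV S)" shows "fin_dim (kerM UNIV (S ^^ n))"
proof (induction n)
  case 0 then show ?case by (auto simp: kerM_def fin_dim_def intro!: exI[of _ "{}"])
next
  case (Suc n) then show ?case unfolding funpow_comp
    using dim_ker_comp(1)[OF assms(1) linear_funpow[OF assms(1)] assms(2)] by blast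
qed

lemma dim_mono_fin_dim:
  assumes "fin_dim L" "subspace K" "subspace L" "K \<subseteq> L"
  shows "dim K \<le> dim L" and "K \<noteq> L \<Longrightarrow> dim K < dim L"
proof -
  obtain B where B: "finite B" "B \<subseteq> K" "independent B" "span B = K" "card B = dim K"
    using fin_dim_basis[OF fin_dim_subset[OF assms(1,4)] assms(2)] by metis
  obtain C where C: "finite C" "span C = L" "card C = dim L"
    using fin_dim_basis[OF assms(1,3)] by metis
  show "dim K \<le> dim L"
    using real_vector.independent_span_bound[OF C(1) B(3)] B C assms(4) by auto
  show "dim K < dim L" if "K \<noteq> L"
  proof -
    obtain v where v: "v \<in> L" "v \<notin> K" using \<open>K \<noteq> L\<close> assms(4) by blast
    then have "independent (insert v B)" using B(3,4) by (simp add: independent_insertI)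
    then have "card (insert v B) \<le> card C"
      using real_vector.independent_span_bound[OF C(1), of "insert v B"] B(2) C(2) assms(4) v(1) by auto
    moreover have "v \<notin> B" using v(2) B(2) by blast
    ultimately show ?thesis using B(1,5) C(3) by simp
  qed
qed

text \<open>Every strict step in the chain of kernels raises the dimension, and one equality stops
  the chain. A bound on the dimensions has the advantage of adding up under products of commuting
  operators.\<close>

lemma finite_ascent_iff:
  fixes S :: "'a::real_vector \<Rightarrow> 'a"
  assumes S: "linear S" and fd: "fin_dim (kerM UNIV S)"
  shows "finite_ascentM UNIV S \<longleftrightarrow> (\<exists>c. \<forall>n. dim (kerM UNIV (S ^^ n)) \<le> c)"
proof
  assume "finite_ascentM UNIV S"
  then obtain p where p: "kerM UNIV (S ^^ p) = kerM UNIV (S ^^ Suc p)" unfolding finite_ascentM_def by blast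
  have stab: "kerM UNIV (S ^^ (p + k)) = kerM UNIV (S ^^ p)" for k
  proof (induction k)
    case (Suc k)
    have "(S ^^ Suc p) ((S ^^ k) x) = (S ^^ (p + Suc k)) x" for x
      using fun_cong[OF funpow_add[of "Suc p" k S], of x] by (simp del: funpow.simps)
    then have "x \<in> kerM UNIV (S ^^ (p + Suc k)) \<longleftrightarrow> (S ^^ k) x \<in> kerM UNIV (S ^^ Suc p)" for x
      by (simp add: kerM_def del: funpow.simps)
    moreover have "(S ^^ k) x \<in> kerM UNIV (S ^^ p) \<longleftrightarrow> x \<in> kerM UNIV (S ^^ (p + k))" for x
      by (simp add: kerM_def funpow_add)
    ultimately show ?case using p Suc by blast
  qed simp
  have "dim (kerM UNIV (S ^^ n)) \<le> dim (kerM UNIV (S ^^ p))" for n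
  proof -
    have "kerM UNIV (S ^^ n) \<subseteq> kerM UNIV (S ^^ (p + n))" by (rule kerM_funpow_mono[OF S]) simp
    then show ?thesis unfolding stab
      by (intro dim_mono_fin_dim fin_dim_kerM_funpow[OF S fd] subspace_kerM linear_funpow S)
  qed
  then show "\<exists>c. \<forall>n. dim (kerM UNIV (S ^^ n)) \<le> c" by blast
next
  assume "\<exists>c. \<forall>n. dim (kerM UNIV (S ^^ n)) \<le> c"
  then obtain c where c: "\<And>n. dim (kerM UNIV (S ^^ n)) \<le> c" by blast
  show "finite_ascentM UNIV S"
  proof (rule ccontr)
    assume "\<not> finite_ascentM UNIV S"
    then have ne: "kerM UNIV (S ^^ n) \<noteq> kerM UNIV (S ^^ Suc n)" for n unfolding finite_ascentM_def by blast
    have "n \<le> dim (kerM UNIV (S ^^ n))" for n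
    proof (induction n)
      case (Suc n)
      have "dim (kerM UNIV (S ^^ n)) < dim (kerM UNIV (S ^^ Suc n))"
        by (intro dim_mono_fin_dim(2) fin_dim_kerM_funpow[OF S fd] subspace_kerM linear_funpow S ne kerM_funpow_mono) simp
      then show ?case using Suc by linarith
    qed simp
    from this[of "Suc c"] c[of "Suc c"] show False by simp
  qed
qed

lemma range_funpow_mono:
  fixes S :: "'a \<Rightarrow> 'a"
  shows "m \<le> n \<Longrightarrow> range (S ^^ n) \<subseteq> range (S ^^ m)"
proof -
  assume "m \<le> n"
  then obtain k where "n = m + k" using le_Suc_ex by blast
  then have "S ^^ n = (S ^^ m) \<circ> (S ^^ k)" by (simp add: funpow_add)
  then show ?thesis by auto
qed

text \<open>What is missing from the range of a product consists of what \<open>A\<close> misses and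
  of the images of what \<open>B\<close> misses; this is the dual of the kernel estimate.\<close>

lemma span_range_comp:
  assumes A: "linear A" and B: "linear B"
    and F: "span (range A \<union> F) = UNIV" and G: "span (range B \<union> G) = UNIV"
  shows "span (range (\<lambda>x. A (B x)) \<union> (A ` G \<union> F)) = UNIV"
proof -
  have sB: "span (range B) = range B" using B by (simp add: linear_subspace_image span_eq_iff[THEN iffD2])
  have "A x \<in> span (range (\<lambda>x. A (B x)) \<union> (A ` G \<union> F))" for x
  proof -
    obtain b g where "b \<in> range B" "g \<in> span G" "x = b + g" using G unfolding span_Un sB by blast
    moreover from this have "A g \<in> span (A ` G)" using linear_span_image[OF A, of G] by blast
    ultimately have "A b \<in> span (range (\<lambda>x. A (B x)) \<union> (A ` G \<union> F))" "A g \<in> span (range (\<lambda>x. A (B x)) \<union> (A ` G \<union> F))" "A x = A b + A g"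
      using A span_mono[of "A ` G" "range (\<lambda>x. A (B x)) \<union> (A ` G \<union> F)"] by (auto intro: span_base simp: linear_add)
    then show ?thesis by (simp add: span_add)
  qed
  then have "range A \<union> F \<subseteq> span (range (\<lambda>x. A (B x)) \<union> (A ` G \<union> F))" by (auto intro: span_base)
  then show ?thesis using F by (metis span_minimal subspace_span top.extremum_uniqueI)
qed

lemma fin_codim_funpow:
  fixes S :: "'a::real_normed_vector \<Rightarrow> 'a"
  assumes S: "linear S" and low: "lower_semiFredholmM UNIV S"
  shows "\<exists>F. finite F \<and> span (range (S ^^ n) \<union> F) = UNIV"
proof (induction n)
  case 0 then show ?case by (intro exI[of _ "{}"]) simp
next
  case (Suc n)
  then obtain G where G: "finite G" "span (range (S ^^ n) \<union> G) = UNIV" by blast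
  obtain F where F: "finite F" "span (range S \<union> F) = UNIV"
    using low unfolding lower_semiFredholmM_def fin_codim_def by blast
  show ?case unfolding funpow_comp
    using span_range_comp[OF S linear_funpow[OF S] F(2) G(2)] F(1) G(1) by (intro exI[of _ "S ` G \<union> F"]) simp
qed

text \<open>Dual to the ascent: by the exchange lemma, every strict decrease of the ranges costs one
  more vector to fill the space.\<close>

lemma finite_descent_iff:
  fixes S :: "'a::real_normed_vector \<Rightarrow> 'a"
  assumes S: "linear S" and low: "lower_semiFredholmM UNIV S"
  shows "finite_descentM UNIV S \<longleftrightarrow>
    (\<exists>c. \<forall>n. \<exists>F. finite F \<and> card F \<le> c \<and> span (range (S ^^ n) \<union> F) = UNIV)"
proof
  assume "finite_descentM UNIV S"
  then obtain p where p: "range (S ^^ p) = range (S ^^ Suc p)" unfolding finite_descentM_def by blast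
  have stab: "range (S ^^ (k + p)) = range (S ^^ p)" for k
  proof (induction k)
    case (Suc k)
    have "range (S ^^ (Suc k + p)) = S ` range (S ^^ (k + p))" by (simp add: image_comp)
    also have "\<dots> = range (S ^^ Suc p)" using Suc by (simp add: image_comp)
    finally show ?case using p by simp
  qed simp
  obtain F where F: "finite F" "span (range (S ^^ p) \<union> F) = UNIV" using fin_codim_funpow[OF S low] by blast
  have "span (range (S ^^ n) \<union> F) = UNIV" for n
  proof -
    have "range (S ^^ p) \<subseteq> range (S ^^ n)" using range_funpow_mono[of n "n + p" S] stab[of n] by simp
    then have "span (range (S ^^ p) \<union> F) \<subseteq> span (range (S ^^ n) \<union> F)" by (intro span_mono) blast
    then show ?thesis using F(2) by blast
  qed
  then show "\<exists>c. \<forall>n. \<exists>F. finite F \<and> card F \<le> c \<and> span (range (S ^^ n) \<union> F) = UNIV" using F(1) by blast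
next
  assume "\<exists>c. \<forall>n. \<exists>F. finite F \<and> card F \<le> c \<and> span (range (S ^^ n) \<union> F) = UNIV"
  then obtain c where c: "\<And>n. \<exists>F. finite F \<and> card F \<le> c \<and> span (range (S ^^ n) \<union> F) = UNIV" by blast
  show "finite_descentM UNIV S"
  proof (rule ccontr)
    assume "\<not> finite_descentM UNIV S"
    then have ne: "range (S ^^ n) \<noteq> range (S ^^ Suc n)" for n unfolding finite_descentM_def by blast
    have "finite F \<Longrightarrow> span (range (S ^^ n) \<union> F) = UNIV \<Longrightarrow> n \<le> card F" for n F
    proof (induction n arbitrary: F)
      case (Suc n)
      have sub: "range (S ^^ Suc n) \<subseteq> range (S ^^ n)" by (rule range_funpow_mono) simp
      then obtain w where w: "w \<in> range (S ^^ n)" "w \<notin> range (S ^^ Suc n)" using ne by blast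
      have "span (range (S ^^ Suc n)) = range (S ^^ Suc n)"
        using subspace_range_linear[OF linear_funpow[OF S, of "Suc n"]] by (simp only: span_eq_iff)
      then have "w \<notin> span (range (S ^^ Suc n))" using w(2) by (simp only:) simp
      then obtain f where f: "f \<in> F" "f \<in> span (insert w (range (S ^^ Suc n) \<union> (F - {f})))"
        using span_exchange[OF Suc.prems(1), of w "range (S ^^ Suc n)"] Suc.prems(2) by blast
      have "span (range (S ^^ n) \<union> (F - {f})) = UNIV"
      proof (rule span_remove_redundant[OF Suc.prems(2)])
        have "insert w (range (S ^^ Suc n) \<union> (F - {f})) \<subseteq> range (S ^^ n) \<union> (F - {f})" using sub w(1) by blast
        then show "f \<in> span (range (S ^^ n) \<union> (F - {f}))" using f(2) span_mono by blast
        show "range (S ^^ Suc n) \<subseteq> span (range (S ^^ n))" using sub span_superset by blast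
      qed
      then have "n \<le> card (F - {f})" using Suc.IH Suc.prems(1) by simp
      then show ?case using card_Suc_Diff1[OF Suc.prems(1) f(1)] by linarith
    qed simp
    then show False using c[of "Suc c"] by (metis Suc_n_not_le_n order_trans)
  qed
qed

text \<open>The parity result relative to the zero subspace. Parity matters because
  \<open>cdim\<close> and \<open>ccodim\<close> divide by 2, and comparing halves is faithful only
  for even numbers.\<close>

lemma even_dim:
  assumes J: "linear J" "\<And>x. J (J x) = - x" and K: "subspace K" "\<And>x. x \<in> K \<Longrightarrow> J x \<in> K" "fin_dim K"
  shows "even (dim K)"
proof -
  obtain D where D: "finite D" "D \<subseteq> K" "span D = K" "card D = dim K"
    using fin_dim_basis[OF K(3,1)] by metis
  have s0: "span ({0} \<union> E) = span E" for E :: "'a set" by (simp add: span_insert_0)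
  obtain B where B: "finite B" "B \<subseteq> K" "even (card B)" "K \<subseteq> span ({0} \<union> B)"
      "\<And>E. finite E \<Longrightarrow> K \<subseteq> span ({0} \<union> E) \<Longrightarrow> card B \<le> card E"
    using even_relative_codim[OF J K(1,2) D(1,2), of "{0}"] D(3) K(1) linear_0[OF J(1)]
    by (auto simp: subspace_single_0 subspace_0 s0 simp del: insert_is_Un[symmetric])
  have "dim K \<le> card B" using real_vector.dim_le_card[of K B] B(1,4) s0 by simp
  moreover have "card B \<le> dim K" using B(5)[OF D(1)] D(3,4) s0 by simp
  ultimately show ?thesis using B(3) by simp
qed

lemma codim_least:
  fixes J :: "'a::real_vector \<Rightarrow> 'a"
  assumes J: "linear J" "\<And>x. J (J x) = - x" and R: "subspace R" "\<And>x. x \<in> R \<Longrightarrow> J x \<in> R"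
    and fc: "fin_codim UNIV R"
  obtains n where "even n" "ccodim UNIV R = n div 2" "\<exists>F. finite F \<and> card F = n \<and> span (R \<union> F) = UNIV"
    "\<And>F. finite F \<Longrightarrow> span (R \<union> F) = UNIV \<Longrightarrow> n \<le> card F"
proof -
  obtain F where F: "finite F" "UNIV \<subseteq> span (R \<union> F)" using fc unfolding fin_codim_def by blast
  obtain B where B: "finite B" "even (card B)" "UNIV \<subseteq> span (R \<union> B)"
      "\<And>E. finite E \<Longrightarrow> UNIV \<subseteq> span (R \<union> E) \<Longrightarrow> card B \<le> card E"
    using even_relative_codim[OF J subspace_UNIV _ F(1) _ R _ F(2)] by auto
  have "(LEAST n. \<exists>F. finite F \<and> card F = n \<and> UNIV \<subseteq> span (R \<union> F)) = card B"
    by (rule Least_equality) (use B in auto)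
  then show ?thesis using that[of "card B"] B by (auto simp: ccodim_def)
qed

section \<open>The twelve classes and products of commuting operators\<close>

context complex_operator
begin

lemma bopD: "bop J S \<Longrightarrow> bounded_linear S" "bop J S \<Longrightarrow> linear S" "bop J S \<Longrightarrow> S (J x) = J (S x)"
  by (auto simp: bop_def bounded_linear.linear)

lemma J_range: "bop J S \<Longrightarrow> y \<in> range S \<Longrightarrow> J y \<in> range S"
  using bopD(3)[of S, symmetric] by auto

text \<open>Both the kernel dimension and the minimal number of missing vectors are even, so
  comparing complex dimensions is the same as comparing real ones. For infinite codimension both
  index conditions are vacuous.\<close>

lemma Wplus_iff:
  assumes S: "bop J S"
  shows "inClass Wplus_cls UNIV S \<longleftrightarrow> upper_semiFredholmM UNIV S \<and> index_nonpos S"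
proof (cases "upper_semiFredholmM UNIV S")
  case False then show ?thesis by simp
next
  case up: True
  have "even (dim (kerM UNIV S))"
    by (rule even_dim[OF linJ JJ subspace_kerM[OF bopD(2)[OF S]]])
      (use up bopD(3)[OF S] J_simps(4) in \<open>auto simp: kerM_def upper_semiFredholmM_def\<close>)
  moreover have "(fin_codim UNIV (range S) \<longrightarrow> dim (kerM UNIV S) div 2 \<le> ccodim UNIV (range S)) \<longleftrightarrow> index_nonpos S"
  proof (cases "fin_codim UNIV (range S)")
    case False
    then show ?thesis unfolding index_nonpos_def fin_codim_def by blast
  next
    case True
    obtain n where n: "even n" "ccodim UNIV (range S) = n div 2" "\<exists>F. finite F \<and> card F = n \<and> span (range S \<union> F) = UNIV"
        "\<And>F. finite F \<Longrightarrow> span (range S \<union> F) = UNIV \<Longrightarrow> n \<le> card F"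
      using codim_least[OF linJ JJ subspace_range_linear[OF bopD(2)[OF S]] J_range[OF S] True] by blast
    have "index_nonpos S \<longleftrightarrow> dim (kerM UNIV S) \<le> n"
      unfolding index_nonpos_def using n(3,4) by (metis order_trans)
    then show ?thesis using True n(1,2) \<open>even (dim (kerM UNIV S))\<close> by (auto elim!: evenE)
  qed
  ultimately show ?thesis using up by (simp add: alphaM_def betaM_def cdim_def)
qed

lemma Wminus_iff:
  assumes S: "bop J S"
  shows "inClass Wminus_cls UNIV S \<longleftrightarrow> lower_semiFredholmM UNIV S \<and> index_nonneg S"
proof (cases "lower_semiFredholmM UNIV S")
  case False then show ?thesis by simp
next
  case low: True
  then have fc: "fin_codim UNIV (range S)" by (simp add: lower_semiFredholmM_def)
  obtain n where n: "even n" "ccodim UNIV (range S) = n div 2" "\<exists>F. finite F \<and> card F = n \<and> span (range S \<union> F) = UNIV"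
      "\<And>F. finite F \<Longrightarrow> span (range S \<union> F) = UNIV \<Longrightarrow> n \<le> card F"
    using codim_least[OF linJ JJ subspace_range_linear[OF bopD(2)[OF S]] J_range[OF S] fc] by blast
  have "(fin_dim (kerM UNIV S) \<longrightarrow> n div 2 \<le> dim (kerM UNIV S) div 2) \<longleftrightarrow> index_nonneg S"
  proof (cases "fin_dim (kerM UNIV S)")
    case False then show ?thesis by (simp add: index_nonneg_def)
  next
    case True
    have "even (dim (kerM UNIV S))"
      by (rule even_dim[OF linJ JJ subspace_kerM[OF bopD(2)[OF S]]])
        (use True bopD(3)[OF S] J_simps(4) in \<open>auto simp: kerM_def\<close>)
    moreover have "index_nonneg S \<longleftrightarrow> n \<le> dim (kerM UNIV S)"
      unfolding index_nonneg_def using True n(3,4) by (metis order_trans)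
    ultimately show ?thesis using True n(1) by (auto elim!: evenE)
  qed
  then show ?thesis using low n(2) by (simp add: alphaM_def betaM_def cdim_def)
qed

lemma class_conjunctions:
  "inClass W_cls UNIV S \<longleftrightarrow> inClass Wplus_cls UNIV S \<and> inClass Wminus_cls UNIV S"
  "inClass Phi_cls UNIV S \<longleftrightarrow> inClass Phiplus_cls UNIV S \<and> inClass Phiminus_cls UNIV S"
  "inClass B_cls UNIV S \<longleftrightarrow> inClass Bplus_cls UNIV S \<and> inClass Bminus_cls UNIV S"
  by (auto simp: FredholmM_def upper_semiFredholmM_def lower_semiFredholmM_def)

lemma Inv_iff:
  assumes S: "bop J S" shows "inClass Inv_cls UNIV S \<longleftrightarrow> inClass M_cls UNIV S \<and> inClass Q_cls UNIV S"
  using invertible_iff_bij[OF bopD(1)[OF S]]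
  by (auto simp: bounded_belowM_def surjM_def bij_def)

text \<open>Eight one-sided classes carry the content, and the other four are conjunctions of them.
  The predicate \<open>C\<close> on class names lets the rule serve both for products and for
  passing to a summand.\<close>

lemma class_split:
  assumes S: "bop J S"
    and "inClass M_cls UNIV S \<Longrightarrow> C M_cls" "inClass Q_cls UNIV S \<Longrightarrow> C Q_cls"
    and "inClass Bplus_cls UNIV S \<Longrightarrow> C Bplus_cls" "inClass Bminus_cls UNIV S \<Longrightarrow> C Bminus_cls"
    and "inClass Phiplus_cls UNIV S \<Longrightarrow> C Phiplus_cls" "inClass Phiminus_cls UNIV S \<Longrightarrow> C Phiminus_cls"
    and "inClass Wplus_cls UNIV S \<Longrightarrow> C Wplus_cls" "inClass Wminus_cls UNIV S \<Longrightarrow> C Wminus_cls"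
    and "C M_cls \<Longrightarrow> C Q_cls \<Longrightarrow> C Inv_cls" "C Bplus_cls \<Longrightarrow> C Bminus_cls \<Longrightarrow> C B_cls"
    and "C Phiplus_cls \<Longrightarrow> C Phiminus_cls \<Longrightarrow> C Phi_cls" "C Wplus_cls \<Longrightarrow> C Wminus_cls \<Longrightarrow> C W_cls"
    and K: "inClass K UNIV S"
  shows "C K"
proof (cases K)
  case M_cls
  show ?thesis unfolding M_cls by (rule assms(2)[OF K[unfolded M_cls]])
next
  case Q_cls
  show ?thesis unfolding Q_cls by (rule assms(3)[OF K[unfolded Q_cls]])
next
  case Bplus_cls
  show ?thesis unfolding Bplus_cls by (rule assms(4)[OF K[unfolded Bplus_cls]])
next
  case Bminus_cls
  show ?thesis unfolding Bminus_cls by (rule assms(5)[OF K[unfolded Bminus_cls]])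
next
  case Phiplus_cls
  show ?thesis unfolding Phiplus_cls by (rule assms(6)[OF K[unfolded Phiplus_cls]])
next
  case Phiminus_cls
  show ?thesis unfolding Phiminus_cls by (rule assms(7)[OF K[unfolded Phiminus_cls]])
next
  case Wplus_cls
  show ?thesis unfolding Wplus_cls by (rule assms(8)[OF K[unfolded Wplus_cls]])
next
  case Wminus_cls
  show ?thesis unfolding Wminus_cls by (rule assms(9)[OF K[unfolded Wminus_cls]])
next
  case Inv_cls
  note c = K[unfolded Inv_cls Inv_iff[OF S]]
  show ?thesis unfolding Inv_cls by (rule assms(10)[OF assms(2)[OF c[THEN conjunct1]] assms(3)[OF c[THEN conjunct2]]])
next
  case B_cls
  note c = K[unfolded B_cls class_conjunctions(3)]
  show ?thesis unfolding B_cls by (rule assms(11)[OF assms(4)[OF c[THEN conjunct1]] assms(5)[OF c[THEN conjunct2]]])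
next
  case Phi_cls
  note c = K[unfolded Phi_cls class_conjunctions(2)]
  show ?thesis unfolding Phi_cls by (rule assms(12)[OF assms(6)[OF c[THEN conjunct1]] assms(7)[OF c[THEN conjunct2]]])
next
  case W_cls
  note c = K[unfolded W_cls class_conjunctions(1)]
  show ?thesis unfolding W_cls by (rule assms(13)[OF assms(8)[OF c[THEN conjunct1]] assms(9)[OF c[THEN conjunct2]]])
qed

lemma class_combine:
  assumes S: "bop J S"
  shows "inClass M_cls UNIV S \<Longrightarrow> inClass Q_cls UNIV S \<Longrightarrow> inClass Inv_cls UNIV S"
    and "inClass Bplus_cls UNIV S \<Longrightarrow> inClass Bminus_cls UNIV S \<Longrightarrow> inClass B_cls UNIV S"
    and "inClass Phiplus_cls UNIV S \<Longrightarrow> inClass Phiminus_cls UNIV S \<Longrightarrow> inClass Phi_cls UNIV S"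
    and "inClass Wplus_cls UNIV S \<Longrightarrow> inClass Wminus_cls UNIV S \<Longrightarrow> inClass W_cls UNIV S"
  using class_conjunctions[of S] Inv_iff[OF S] by blast+

lemma funpow_commute_comp:
  fixes A B :: "'a \<Rightarrow> 'a"
  assumes "\<And>x. A (B x) = B (A x)"
  shows "((\<lambda>x. A (B x)) ^^ n) = (\<lambda>x. (A ^^ n) ((B ^^ n) x))"
proof (induction n)
  case (Suc n)
  have "B ((A ^^ n) y) = (A ^^ n) (B y)" for y by (induction n) (simp_all add: assms[symmetric])
  then show ?case by (simp add: Suc fun_eq_iff)
qed simp

lemma comp_upper:
  assumes A: "bop J A" and B: "bop J B" and up: "upper_semiFredholmM UNIV A" "upper_semiFredholmM UNIV B"
  shows "upper_semiFredholmM UNIV (\<lambda>x. A (B x))"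
proof -
  have "closed (A ` range B)"
    using up(2) by (intro closed_image_subspace[OF bopD(1)[OF A] up(1)] subspace_range_linear bopD(2)[OF B])
      (simp add: upper_semiFredholmM_def)
  then show ?thesis
    using dim_ker_comp(1)[OF bopD(2)[OF A] bopD(2)[OF B]] up by (simp add: upper_semiFredholmM_def image_image)
qed

lemma comp_lower:
  assumes A: "bop J A" and B: "bop J B" and low: "lower_semiFredholmM UNIV A" "lower_semiFredholmM UNIV B"
  shows "lower_semiFredholmM UNIV (\<lambda>x. A (B x))"
proof -
  obtain F G where F: "finite F" "span (range A \<union> F) = UNIV" and G: "finite G" "span (range B \<union> G) = UNIV"
    using low unfolding lower_semiFredholmM_def fin_codim_def by blast
  have "span (range (\<lambda>x. A (B x)) \<union> (A ` G \<union> F)) = UNIV"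
    by (rule span_range_comp[OF bopD(2)[OF A] bopD(2)[OF B] F(2) G(2)])
  then show ?thesis unfolding lower_semiFredholmM_def fin_codim_def
    using F(1) G(1) by (intro exI[of _ "A ` G \<union> F"]) simp
qed

text \<open>The product of two corrected factors is a correction of the product, which replaces the
  additivity of the index.\<close>

lemma comp_finite_rank_perturbation:
  assumes A: "bop J A" and B: "bop J B" and F: "finite_rank F" and G: "finite_rank G"
  shows "\<exists>H. finite_rank H \<and> (\<lambda>x. A (B x) + H x) = (\<lambda>x. (\<lambda>y. A y + F y) (B x + G x))"
proof (intro exI[of _ "\<lambda>x. A (G x) + F (B x + G x)"] conjI)
  have "bounded_linear (\<lambda>x. B x + G x)" by (intro bounded_linear_add bopD(1)[OF B] finite_rank_bounded_linear[OF G])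
  then show "finite_rank (\<lambda>x. A (G x) + F (B x + G x))"
    by (intro finite_rank_add finite_rank_comp_left[OF bopD(1)[OF A] G]) (rule finite_rank_comp_right[OF _ F])
  show "(\<lambda>x. A (B x) + (A (G x) + F (B x + G x))) = (\<lambda>x. A (B x + G x) + F (B x + G x))"
    by (simp add: linear_add[OF bopD(2)[OF A]] add.assoc)
qed

lemma comp_bounded_below:
  fixes A B :: "'a \<Rightarrow> 'a"
  assumes "bounded_linear A" "bounded_linear B" "bounded_belowM UNIV A" "bounded_belowM UNIV B"
  shows "bounded_belowM UNIV (\<lambda>x. A (B x))"
proof -
  obtain c d where cd: "c > 0" "\<And>x. c * norm x \<le> norm (A x)" "d > 0" "\<And>x. d * norm x \<le> norm (B x)"
    using assms bounded_below_iff by metis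
  have "(c * d) * norm x \<le> norm (A (B x))" for x
  proof -
    have "c * (d * norm x) \<le> c * norm (B x)" using cd(1) by (intro mult_left_mono cd(4)) simp
    also have "\<dots> \<le> norm (A (B x))" by (rule cd(2))
    finally show ?thesis by (simp add: mult.assoc)
  qed
  moreover have "c * d > 0" using cd by simp
  ultimately show ?thesis using bounded_below_iff[OF bounded_linear_compose[OF assms(1,2)]] by blast
qed

text \<open>Commutation splits the powers of the product, so the bounds behind ascent and descent
  add. For the index conditions, the factors are first corrected to be bounded below or
  onto.\<close>

lemma class_comp:
  assumes A: "bop J A" and B: "bop J B" and AB: "\<And>x. A (B x) = B (A x)"
    and K: "inClass K UNIV A" "inClass K UNIV B"
  shows "inClass K UNIV (\<lambda>x. A (B x))"
proof -
  have C: "bop J (\<lambda>x. A (B x))" by (rule bop_comp[OF A B])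
  have lin: "linear A" "linear B" "linear (\<lambda>x. A (B x))" using A B C by (auto intro: bopD)
  \<comment> \<open>Putting the class of \<open>B\<close> into the predicate makes
    \<open>class_split\<close>, which takes only the class of \<open>A\<close> apart, treat both
    factors in parallel.\<close>
  have "inClass K UNIV B \<longrightarrow> inClass K UNIV (\<lambda>x. A (B x))"
  proof (rule class_split[OF A, where K=K])
    show "inClass M_cls UNIV B \<longrightarrow> inClass M_cls UNIV (\<lambda>x. A (B x))" if "inClass M_cls UNIV A"
      using that comp_bounded_below[OF bopD(1)[OF A] bopD(1)[OF B]] by simp
    show "inClass Q_cls UNIV B \<longrightarrow> inClass Q_cls UNIV (\<lambda>x. A (B x))" if "inClass Q_cls UNIV A"
      using that by (auto simp: surjM_def image_image[symmetric])
    show phip: "inClass Phiplus_cls UNIV B \<longrightarrow> inClass Phiplus_cls UNIV (\<lambda>x. A (B x))" if "inClass Phiplus_cls UNIV A"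
      using that comp_upper[OF A B] by simp
    show phim: "inClass Phiminus_cls UNIV B \<longrightarrow> inClass Phiminus_cls UNIV (\<lambda>x. A (B x))" if "inClass Phiminus_cls UNIV A"
      using that comp_lower[OF A B] by simp
    show "inClass Bplus_cls UNIV B \<longrightarrow> inClass Bplus_cls UNIV (\<lambda>x. A (B x))" if a: "inClass Bplus_cls UNIV A"
    proof
      assume b: "inClass Bplus_cls UNIV B"
      have up: "upper_semiFredholmM UNIV A" "upper_semiFredholmM UNIV B" "upper_semiFredholmM UNIV (\<lambda>x. A (B x))"
        using a b comp_upper[OF A B] by simp_all
      then have fd: "fin_dim (kerM UNIV A)" "fin_dim (kerM UNIV B)" "fin_dim (kerM UNIV (\<lambda>x. A (B x)))"
        by (simp_all add: upper_semiFredholmM_def)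
      obtain c d where "\<And>n. dim (kerM UNIV (A ^^ n)) \<le> c" "\<And>n. dim (kerM UNIV (B ^^ n)) \<le> d"
        using a b finite_ascent_iff[OF lin(1) fd(1)] finite_ascent_iff[OF lin(2) fd(2)] by auto
      then have "dim (kerM UNIV ((\<lambda>x. A (B x)) ^^ n)) \<le> c + d" for n
        unfolding funpow_commute_comp[of A B, OF AB]
        using dim_ker_comp(2)[OF linear_funpow[OF lin(1)] linear_funpow[OF lin(2)] fin_dim_kerM_funpow[OF lin(1) fd(1)] fin_dim_kerM_funpow[OF lin(2) fd(2)]]
        by (meson add_mono order_trans)
      then show "inClass Bplus_cls UNIV (\<lambda>x. A (B x))"
        using finite_ascent_iff[OF lin(3) fd(3)] up(3) by auto
    qed
    show "inClass Bminus_cls UNIV B \<longrightarrow> inClass Bminus_cls UNIV (\<lambda>x. A (B x))" if a: "inClass Bminus_cls UNIV A"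
    proof
      assume b: "inClass Bminus_cls UNIV B"
      have low: "lower_semiFredholmM UNIV A" "lower_semiFredholmM UNIV B" "lower_semiFredholmM UNIV (\<lambda>x. A (B x))"
        using a b comp_lower[OF A B] by simp_all
      obtain c where c: "\<And>n. \<exists>F. finite F \<and> card F \<le> c \<and> span (range (A ^^ n) \<union> F) = UNIV"
        using a finite_descent_iff[OF lin(1) low(1)] by auto
      obtain d where d: "\<And>n. \<exists>F. finite F \<and> card F \<le> d \<and> span (range (B ^^ n) \<union> F) = UNIV"
        using b finite_descent_iff[OF lin(2) low(2)] by auto
      have "\<exists>F. finite F \<and> card F \<le> d + c \<and> span (range ((\<lambda>x. A (B x)) ^^ n) \<union> F) = UNIV" for n
      proof -
        obtain F G where F: "finite F" "card F \<le> c" "span (range (A ^^ n) \<union> F) = UNIV"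
          and G: "finite G" "card G \<le> d" "span (range (B ^^ n) \<union> G) = UNIV" using c d by meson
        have "card ((A ^^ n) ` G \<union> F) \<le> d + c"
          using card_Un_le[of "(A ^^ n) ` G" F] card_image_le[OF G(1), of "A ^^ n"] F(2) G(2) by linarith
        then show ?thesis unfolding funpow_commute_comp[of A B, OF AB]
          using span_range_comp[OF linear_funpow[OF lin(1)] linear_funpow[OF lin(2)] F(3) G(3)] F(1) G(1)
          by (intro exI[of _ "(A ^^ n) ` G \<union> F"]) simp
      qed
      then show "inClass Bminus_cls UNIV (\<lambda>x. A (B x))"
        using finite_descent_iff[OF lin(3) low(3)] low(3) by auto
    qed
    show "inClass Wplus_cls UNIV B \<longrightarrow> inClass Wplus_cls UNIV (\<lambda>x. A (B x))" if a: "inClass Wplus_cls UNIV A"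
    proof
      assume b: "inClass Wplus_cls UNIV B"
      obtain F where F: "finite_rank F" "bounded_belowM UNIV (\<lambda>x. A x + F x)"
        using a Wplus_iff[OF A] upper_nonpos_iff[OF bopD(1)[OF A]] by blast
      obtain G where G: "finite_rank G" "bounded_belowM UNIV (\<lambda>x. B x + G x)"
        using b Wplus_iff[OF B] upper_nonpos_iff[OF bopD(1)[OF B]] by blast
      have "bounded_belowM UNIV (\<lambda>x. (\<lambda>y. A y + F y) (B x + G x))"
        by (rule comp_bounded_below[OF _ _ F(2) G(2)])
          (intro bounded_linear_add bopD(1) A B finite_rank_bounded_linear F(1) G(1))+
      then show "inClass Wplus_cls UNIV (\<lambda>x. A (B x))"
        using comp_finite_rank_perturbation[OF A B F(1) G(1)] Wplus_iff[OF C] upper_nonpos_iff[OF bopD(1)[OF C]] by metis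
    qed
    show "inClass Wminus_cls UNIV B \<longrightarrow> inClass Wminus_cls UNIV (\<lambda>x. A (B x))" if a: "inClass Wminus_cls UNIV A"
    proof
      assume b: "inClass Wminus_cls UNIV B"
      obtain F where F: "finite_rank F" "surj (\<lambda>x. A x + F x)"
        using a Wminus_iff[OF A] lower_nonneg_iff[OF bopD(1)[OF A]] by blast
      obtain G where G: "finite_rank G" "surj (\<lambda>x. B x + G x)"
        using b Wminus_iff[OF B] lower_nonneg_iff[OF bopD(1)[OF B]] by blast
      have "surj (\<lambda>x. (\<lambda>y. A y + F y) (B x + G x))"
        using comp_surj[OF G(2) F(2)] by (simp add: o_def)
      then show "inClass Wminus_cls UNIV (\<lambda>x. A (B x))"
        using comp_finite_rank_perturbation[OF A B F(1) G(1)] Wminus_iff[OF C] lower_nonneg_iff[OF bopD(1)[OF C]] by metis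
    qed
  qed (use class_conjunctions[of B] class_combine[OF C] Inv_iff[OF B] K(1) in blast)+
  then show ?thesis using K(2) by blast
qed

lemma weyl_class:
  assumes S: "bop J S" and w: "weyl S"
  shows "inClass Wplus_cls UNIV S" "inClass Wminus_cls UNIV S"
  using w upper_nonpos_iff[OF bopD(1)[OF S]] lower_nonneg_iff[OF bopD(1)[OF S]] Wplus_iff[OF S] Wminus_iff[OF S]
    bij_imp_bounded_below bij_is_surj unfolding weyl_def by blast+

lemma bij_class:
  assumes S: "bop J S" and b: "bij S" shows "inClass K UNIV S"
proof -
  have "weyl S" unfolding weyl_def using b finite_rank_zero by (intro exI[of _ "\<lambda>x. 0"]) simp
  note w = weyl_class[OF S this]
  have "finite_ascentM UNIV S" unfolding finite_ascentM_def
    by (rule exI[of _ 0]) (use b linear_0[OF bopD(2)[OF S]] in \<open>auto simp: kerM_def linear_injective_0[OF bopD(2)[OF S]] bij_def\<close>)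
  moreover have "finite_descentM UNIV S" unfolding finite_descentM_def
    by (rule exI[of _ 0]) (use b in \<open>auto simp: bij_is_surj\<close>)
  moreover have "inClass M_cls UNIV S" "inClass Q_cls UNIV S"
    using b bij_imp_bounded_below by (simp_all add: surjM_def bij_is_surj)
  ultimately show ?thesis using w class_combine[OF S] by (cases K) (auto simp: FredholmM_def)
qed

text \<open>The operator A P + (1 - P), which is A on the range of P and the identity on its kernel. It
  replaces the restriction of A to the range of P.\<close>
definition cut :: "('a \<Rightarrow> 'a) \<Rightarrow> ('a \<Rightarrow> 'a) \<Rightarrow> 'a \<Rightarrow> 'a" where
  "cut P A x = A (P x) + (x - P x)"

section \<open>Operators on the range of a projection\<close>

definition proj :: "('a \<Rightarrow> 'a) \<Rightarrow> bool" where
  "proj P \<longleftrightarrow> bop J P \<and> (\<forall>x. P (P x) = P x)"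

lemma projD: "proj P \<Longrightarrow> bop J P" "proj P \<Longrightarrow> P (P x) = P x"
  by (simp_all add: proj_def)

lemma proj_linear:
  assumes "proj P" shows "P (x + y) = P x + P y" "P (x - y) = P x - P y" "P (x - P x) = 0" "P 0 = 0"
  using assms bopD(2)[OF projD(1)[OF assms]] by (simp_all add: linear_add linear_diff linear_0 projD(2))

lemma proj_compl:
  assumes P: "proj P" shows "proj (\<lambda>x. x - P x)"
  unfolding proj_def
  using bop_diff[OF linJ bop_id projD(1)[OF P]] by (simp add: proj_linear(2)[OF P] projD(2)[OF P])

lemma bop_cut:
  assumes P: "bop J P" and A: "bop J A" shows "bop J (cut P A)"
  unfolding cut_def[abs_def] by (rule bop_add[OF linJ bop_comp[OF A P] bop_diff[OF linJ bop_id P]])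

lemma cut_cut_comp:
  assumes P: "proj P" and A: "bop J A" "\<And>x. P (A x) = A (P x)" and B: "bop J B" "\<And>x. P (B x) = B (P x)"
  shows "cut P A (cut P B x) = cut P (\<lambda>x. A (B x)) x"
proof -
  have "P (cut P B x) = B (P x)" unfolding cut_def using proj_linear[OF P] B(2) projD(2)[OF P] by simp
  then show ?thesis by (simp add: cut_def)
qed

lemma funpow_cut:
  assumes P: "proj P" and A: "bop J A" "\<And>x. P (A x) = A (P x)"
  shows "(cut P A ^^ n) = cut P (A ^^ n)"
proof (induction n)
  case 0 then show ?case by (simp add: cut_def fun_eq_iff)
next
  case (Suc n)
  have "P ((A ^^ n) y) = (A ^^ n) (P y)" for y by (induction n) (simp_all add: A(2))
  then have "P (cut P (A ^^ n) x) = (A ^^ n) (P x)" for x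
    unfolding cut_def using proj_linear[OF P] projD(2)[OF P] by simp
  note e = this
  show ?case
  proof
    fix x
    have "(cut P A ^^ Suc n) x = cut P A (cut P (A ^^ n) x)" by (simp add: Suc)
    also have "\<dots> = A ((A ^^ n) (P x)) + (cut P (A ^^ n) x - (A ^^ n) (P x))" unfolding cut_def[of P A] e ..
    also have "\<dots> = cut P (A ^^ Suc n) x" by (simp add: cut_def)
    finally show "(cut P A ^^ Suc n) x = cut P (A ^^ Suc n) x" .
  qed
qed

lemma kerM_cut:
  assumes P: "proj P" and A: "linear A" "\<And>x. P (A x) = A (P x)"
  shows "kerM UNIV (cut P A) = kerM (range P) A"
proof (intro set_eqI iffI)
  fix x assume "x \<in> kerM UNIV (cut P A)"
  then have c: "A (P x) + (x - P x) = 0" by (simp add: kerM_def cut_def)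
  have "P (A (P x) + (x - P x)) = A (P x)" using proj_linear[OF P] A(2) projD(2)[OF P] by simp
  then have "A (P x) = 0" using c proj_linear(4)[OF P] by simp
  then show "x \<in> kerM (range P) A" using c by (auto simp: kerM_def intro: rev_image_eqI)
next
  fix x assume "x \<in> kerM (range P) A"
  then show "x \<in> kerM UNIV (cut P A)" using projD(2)[OF P] by (auto simp: kerM_def cut_def)
qed

text \<open>The complementary component of a vector is unrestricted, so the range is saturated under
  \<open>P\<close>. Closedness passes one way by preimage under \<open>P\<close> and the other way
  by intersection with the range of \<open>P\<close>.\<close>

lemma range_cut:
  assumes P: "proj P" and A: "\<And>x. P (A x) = A (P x)"
  shows "range (cut P A) = P -` (A ` range P)"
proof (intro set_eqI iffI)
  fix y assume "y \<in> range (cut P A)"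
  then obtain x where "y = cut P A x" by blast
  then have "P y = A (P x)" unfolding cut_def using proj_linear[OF P] A projD(2)[OF P] by simp
  then show "y \<in> P -` (A ` range P)" by simp
next
  fix y assume "y \<in> P -` (A ` range P)"
  then obtain x where x: "P y = A (P x)" by auto
  have "P (P x + (y - P y)) = P x" using proj_linear[OF P] projD(2)[OF P] by simp
  then have "cut P A (P x + (y - P y)) = y" unfolding cut_def using x by simp
  then show "y \<in> range (cut P A)" by (metis rangeI)
qed

lemma A_range_proj:
  assumes P: "proj P" and A: "\<And>x. P (A x) = A (P x)"
  shows "A ` range P = range (cut P A) \<inter> range P" "A ` range P \<subseteq> range P"
proof -
  show sub: "A ` range P \<subseteq> range P" using A[symmetric] by auto
  show "A ` range P = range (cut P A) \<inter> range P"
    unfolding range_cut[of P A, OF P A] using sub projD(2)[OF P] A by auto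
qed

lemma closed_range_proj:
  assumes P: "proj P" shows "closed (range P)"
proof -
  have "range P = {x. P x = x}" using projD(2)[OF P] by (auto, metis rangeI)
  then show ?thesis
    using closed_Collect_eq[OF bounded_linear.continuous_on[OF bopD(1)[OF projD(1)[OF P]] continuous_on_id] continuous_on_id]
    by simp
qed

lemma closed_range_cut_iff:
  assumes P: "proj P" and A: "\<And>x. P (A x) = A (P x)"
  shows "closed (range (cut P A)) \<longleftrightarrow> closed (A ` range P)"
proof
  assume "closed (range (cut P A))"
  then show "closed (A ` range P)" unfolding A_range_proj(1)[of P A, OF P A] by (intro closed_Int closed_range_proj[OF P])
next
  assume c: "closed (A ` range P)"
  show "closed (range (cut P A))" unfolding range_cut[of P A, OF P A]
    by (rule closed_vimage[OF c bounded_linear.continuous_on[OF bopD(1)[OF projD(1)[OF P]] continuous_on_id]])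
qed

lemma span_range_cut:
  assumes P: "proj P" and A: "\<And>x. P (A x) = A (P x)" and A0: "A 0 = 0"
  shows "range P \<subseteq> span (A ` range P \<union> F) \<Longrightarrow> span (range (cut P A) \<union> F) = UNIV"
    and "span (range (cut P A) \<union> F) = UNIV \<Longrightarrow> range P \<subseteq> span (A ` range P \<union> P ` F)"
proof -
  assume s: "range P \<subseteq> span (A ` range P \<union> F)"
  have sub: "A ` range P \<subseteq> range (cut P A)" using A_range_proj(1)[of P A, OF P A] by blast
  have "x \<in> span (range (cut P A) \<union> F)" for x
  proof -
    have "P x \<in> span (range (cut P A) \<union> F)"
      using s sub span_mono[of "A ` range P \<union> F" "range (cut P A) \<union> F"] by blast
    moreover have "x - P x = cut P A (x - P x)" unfolding cut_def proj_linear(3)[OF P] A0 by simp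
    then have "x - P x \<in> span (range (cut P A) \<union> F)" by (metis UnI1 rangeI span_base)
    ultimately have "P x + (x - P x) \<in> span (range (cut P A) \<union> F)" by (rule span_add)
    then show ?thesis by simp
  qed
  then show "span (range (cut P A) \<union> F) = UNIV" by blast
next
  assume s: "span (range (cut P A) \<union> F) = UNIV"
  have "P ` (range (cut P A) \<union> F) \<subseteq> A ` range P \<union> P ` F" unfolding range_cut[of P A, OF P A] by blast
  then have "P ` span (range (cut P A) \<union> F) \<subseteq> span (A ` range P \<union> P ` F)"
    using linear_span_image[OF bopD(2)[OF projD(1)[OF P]], of "range (cut P A) \<union> F"] span_mono by metis
  then show "range P \<subseteq> span (A ` range P \<union> P ` F)" using s by simp
qed

text \<open>Vectors completing the smaller range also complete the larger one, and conversely their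
  images under \<open>P\<close> do, whose number does not increase; hence the minima agree.\<close>

lemma fin_codim_cut:
  assumes P: "proj P" and A: "\<And>x. P (A x) = A (P x)" and A0: "A 0 = 0"
  shows "fin_codim UNIV (range (cut P A)) \<longleftrightarrow> fin_codim (range P) (A ` range P)"
    and "fin_codim UNIV (range (cut P A)) \<Longrightarrow> ccodim UNIV (range (cut P A)) = ccodim (range P) (A ` range P)"
proof -
  note s = span_range_cut[of P A, OF P A A0]
  show iff: "fin_codim UNIV (range (cut P A)) \<longleftrightarrow> fin_codim (range P) (A ` range P)"
  proof
    assume "fin_codim UNIV (range (cut P A))"
    then obtain F where "finite F" "span (range (cut P A) \<union> F) = UNIV" unfolding fin_codim_def by blast
    then show "fin_codim (range P) (A ` range P)" unfolding fin_codim_def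
      using s(2)[of F] by (intro exI[of _ "P ` F"]) simp
  next
    assume "fin_codim (range P) (A ` range P)"
    then show "fin_codim UNIV (range (cut P A))" unfolding fin_codim_def using s(1) by blast
  qed
  assume fc: "fin_codim UNIV (range (cut P A))"
  define X where "X n \<longleftrightarrow> (\<exists>F. finite F \<and> card F = n \<and> UNIV \<subseteq> span (range (cut P A) \<union> F))" for n
  define Y where "Y n \<longleftrightarrow> (\<exists>F. finite F \<and> card F = n \<and> range P \<subseteq> span (A ` range P \<union> F))" for n
  have "\<exists>n. X n" "\<exists>n. Y n" using fc iff unfolding fin_codim_def X_def Y_def by blast+
  then have X: "X (LEAST n. X n)" and Y: "Y (LEAST n. Y n)" by (auto intro: LeastI)
  have "X n" if "Y n" for n using that s(1) unfolding X_def Y_def by blast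
  then have "(LEAST n. X n) \<le> (LEAST n. Y n)" using Y Least_le by metis
  moreover have "\<exists>m\<le>n. Y m" if n: "X n" for n
  proof -
    obtain F where F: "finite F" "card F = n" "span (range (cut P A) \<union> F) = UNIV" using n unfolding X_def by blast
    then have "Y (card (P ` F))" unfolding Y_def using s(2)[of F] by blast
    then show ?thesis using card_image_le[OF F(1), of P] F(2) by blast
  qed
  then have "(LEAST n. Y n) \<le> (LEAST n. X n)" using X Least_le by (metis order_trans)
  ultimately show "ccodim UNIV (range (cut P A)) = ccodim (range P) (A ` range P)"
    unfolding ccodim_def X_def Y_def by simp
qed

lemma range_cut_funpow_eq_iff:
  assumes P: "proj P" and A: "bop J A" "\<And>x. P (A x) = A (P x)"
  shows "range (cut P A ^^ m) = range (cut P A ^^ n) \<longleftrightarrow> (A ^^ m) ` range P = (A ^^ n) ` range P"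
proof -
  have Ak: "P ((A ^^ k) y) = (A ^^ k) (P y)" for k y by (induction k) (simp_all add: A(2))
  have r: "range (cut P A ^^ k) = P -` ((A ^^ k) ` range P)" for k
    unfolding funpow_cut[of P A, OF P A] using range_cut[of P "A ^^ k", OF P Ak] .
  have b: "(A ^^ k) ` range P = range (cut P A ^^ k) \<inter> range P" for k
    unfolding funpow_cut[of P A, OF P A] using A_range_proj(1)[of P "A ^^ k", OF P Ak] .
  show ?thesis using r b by metis
qed

text \<open>The kernel is unchanged and the range becomes a preimage under \<open>P\<close>, also
  for all powers, so every ingredient of the classes transfers separately. This is the passage
  between the subspace classes of the statement and operators on the whole space.\<close>

lemma class_range_iff_cut:
  assumes P: "proj P" and A: "bop J A" "\<And>x. P (A x) = A (P x)"
  shows "inClass K (range P) A \<longleftrightarrow> inClass K UNIV (cut P A)"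
proof -
  have lin: "linear A" "linear (cut P A)" using A bop_cut[OF projD(1)[OF P] A(1)] by (simp_all add: bopD)
  have A0: "A 0 = 0" using linear_0[OF lin(1)] .
  have bE: "bop J (cut P A)" by (rule bop_cut[OF projD(1)[OF P] A(1)])
  note ker = kerM_cut[of P A, OF P lin(1) A(2)]
  note rng = range_cut[of P A, OF P A(2)]
  note fc = fin_codim_cut[of P A, OF P A(2) A0]
  have kern: "kerM UNIV (cut P A ^^ n) = kerM (range P) (A ^^ n)" for n
  proof -
    have "P ((A ^^ n) y) = (A ^^ n) (P y)" for y by (induction n) (simp_all add: A(2))
    then show ?thesis unfolding funpow_cut[of P A, OF P A]
      using kerM_cut[of P "A ^^ n", OF P linear_funpow[OF lin(1)]] by blast
  qed
  have up: "upper_semiFredholmM (range P) A \<longleftrightarrow> upper_semiFredholmM UNIV (cut P A)"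
    unfolding upper_semiFredholmM_def ker using closed_range_cut_iff[of P A, OF P A(2)] by simp
  have low: "lower_semiFredholmM (range P) A \<longleftrightarrow> lower_semiFredholmM UNIV (cut P A)"
    unfolding lower_semiFredholmM_def using fc(1) by simp
  have asc: "finite_ascentM (range P) A \<longleftrightarrow> finite_ascentM UNIV (cut P A)"
    unfolding finite_ascentM_def kern ..
  have desc: "finite_descentM (range P) A \<longleftrightarrow> finite_descentM UNIV (cut P A)"
    by (simp only: finite_descentM_def range_cut_funpow_eq_iff[of P A, OF P A])
  have al: "alphaM (range P) A = alphaM UNIV (cut P A)" unfolding alphaM_def ker ..
  have be: "betaM (range P) A = betaM UNIV (cut P A)" if "fin_codim UNIV (range (cut P A))"
    unfolding betaM_def by (rule fc(2)[OF that, symmetric])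
  have inj: "inj_on A (range P) \<longleftrightarrow> inj (cut P A)"
  proof -
    have "0 \<in> range P" using proj_linear(4)[OF P] by (metis rangeI)
    then have "inj_on A (range P) \<longleftrightarrow> kerM (range P) A = {0}"
      unfolding linear_inj_on_iff_eq_0[OF lin(1) subspace_range_linear[OF bopD(2)[OF projD(1)[OF P]]]] kerM_def
      using A0 by blast
    then show ?thesis using kerM_trivial_iff[OF lin(2)] ker by simp
  qed
  have sur: "surjM (range P) A \<longleftrightarrow> surjM UNIV (cut P A)"
  proof
    assume "surjM (range P) A"
    then show "surjM UNIV (cut P A)" unfolding surjM_def rng by auto
  next
    assume "surjM UNIV (cut P A)"
    then show "surjM (range P) A" unfolding surjM_def using A_range_proj(1)[of P A, OF P A(2)] by simp
  qed
  have invr: "invertibleM (range P) A \<longleftrightarrow> invertibleM UNIV (cut P A)"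
  proof
    assume "invertibleM (range P) A"
    then obtain S where S: "\<And>x. x \<in> range P \<Longrightarrow> S x \<in> range P \<and> S (A x) = x \<and> A (S x) = x"
      unfolding invertibleM_def by blast
    have "inj_on A (range P)" using S by (metis inj_onI)
    moreover have "surjM (range P) A" unfolding surjM_def
      using S A_range_proj(2)[of P A, OF P A(2)] by (metis imageI subsetI subset_antisym)
    ultimately have "bij (cut P A)" using inj sur by (simp add: bij_def surjM_def)
    then show "invertibleM UNIV (cut P A)" using invertible_iff_bij[OF bopD(1)[OF bE]] by blast
  next
    assume "invertibleM UNIV (cut P A)"
    then obtain S C where S: "\<And>x. S (cut P A x) = x" "\<And>x. cut P A (S x) = x" "\<And>x. norm (S x) \<le> C * norm x"
      unfolding invertibleM_def by blast
    have PE: "P (cut P A y) = cut P A (P y)" for y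
      unfolding cut_def using proj_linear[OF P] A(2) projD(2)[OF P] by simp
    have "S x \<in> range P \<and> S (A x) = x \<and> A (S x) = x" if x: "x \<in> range P" for x
    proof -
      have Px: "P x = x" using x projD(2)[OF P] by auto
      then have "cut P A (P (S x)) = cut P A (S x)" using PE[of "S x"] S(2)[of x] by simp
      then have PS: "P (S x) = S x" using S(1) by metis
      moreover have "cut P A y = A y" if "P y = y" for y using that by (simp add: cut_def)
      ultimately have "A (S x) = x" "S (A x) = x" using S(1,2)[of x] Px by metis+
      then show ?thesis using PS by (metis rangeI)
    qed
    then show "invertibleM (range P) A" unfolding invertibleM_def using S(3) by blast
  qed
  have cr: "closed (A ` range P) \<longleftrightarrow> closed (range (cut P A))" using closed_range_cut_iff[of P A, OF P A(2)] by simp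
  have fd: "fin_dim (kerM (range P) A) \<longleftrightarrow> fin_dim (kerM UNIV (cut P A))" unfolding ker ..
  have fr: "FredholmM (range P) A \<longleftrightarrow> FredholmM UNIV (cut P A)" unfolding FredholmM_def up low ..
  have be': "betaM (range P) A = betaM UNIV (cut P A)" if "lower_semiFredholmM UNIV (cut P A)"
    using be that unfolding lower_semiFredholmM_def .
  show ?thesis
  proof (cases K)
    case M_cls
    show ?thesis unfolding M_cls inClass.simps bounded_belowM_def inj cr ..
  next
    case Wplus_cls
    show ?thesis unfolding Wplus_cls inClass.simps up fc(1)[symmetric] al
      by (cases "fin_codim UNIV (range (cut P A))") (simp_all only: be simp_thms)
  next
    case Wminus_cls
    show ?thesis unfolding Wminus_cls inClass.simps low fd al
      by (cases "lower_semiFredholmM UNIV (cut P A)") (simp_all only: be' simp_thms)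
  next
    case W_cls
    show ?thesis unfolding W_cls inClass.simps fr al unfolding FredholmM_def
      by (cases "lower_semiFredholmM UNIV (cut P A)") (simp_all only: be' simp_thms)
  next
    case Q_cls
    show ?thesis unfolding Q_cls inClass.simps sur ..
  next
    case Inv_cls
    show ?thesis unfolding Inv_cls inClass.simps invr ..
  next
    case Bplus_cls
    show ?thesis unfolding Bplus_cls inClass.simps up asc ..
  next
    case Bminus_cls
    show ?thesis unfolding Bminus_cls inClass.simps low desc ..
  next
    case B_cls
    show ?thesis unfolding B_cls inClass.simps fr asc desc ..
  next
    case Phiplus_cls
    show ?thesis unfolding Phiplus_cls inClass.simps up ..
  next
    case Phiminus_cls
    show ?thesis unfolding Phiminus_cls inClass.simps low ..
  next
    case Phi_cls
    show ?thesis unfolding Phi_cls inClass.simps fr ..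
  qed
qed

end

context complex_operator
begin

section \<open>Passing to a summand and cancelling a Weyl factor\<close>

lemma range_proj_Int:
  assumes P: "proj P" and A: "\<And>x. P (A x) = A (P x)"
  shows "A ` range P = range A \<inter> range P"
proof
  show "range A \<inter> range P \<subseteq> A ` range P"
  proof
    fix y assume "y \<in> range A \<inter> range P"
    then obtain x where x: "y = A x" by blast
    have "P y = y" using \<open>y \<in> range A \<inter> range P\<close> projD(2)[OF P] by auto
    then have "y = A (P x)" using A[of x] x by simp
    then show "y \<in> A ` range P" by blast
  qed
qed (use A_range_proj(2)[of P A, OF P A] in blast)

lemma upper_range_proj:
  assumes P: "proj P" and A: "\<And>x. P (A x) = A (P x)" and up: "upper_semiFredholmM UNIV A"
  shows "upper_semiFredholmM (range P) A"
  unfolding upper_semiFredholmM_def range_proj_Int[of P A, OF P A]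
  using up closed_range_proj[OF P] fin_dim_subset[of "kerM UNIV A" "kerM (range P) A"]
  by (auto simp: upper_semiFredholmM_def kerM_def)

lemma lower_range_proj:
  assumes P: "proj P" and A: "\<And>x. P (A x) = A (P x)" and low: "lower_semiFredholmM UNIV A"
  shows "lower_semiFredholmM (range P) A"
proof -
  obtain F where F: "finite F" "span (range A \<union> F) = UNIV"
    using low unfolding lower_semiFredholmM_def fin_codim_def by blast
  have "P ` (range A \<union> F) \<subseteq> A ` range P \<union> P ` F" using A by auto
  then have "P ` span (range A \<union> F) \<subseteq> span (A ` range P \<union> P ` F)"
    using linear_span_image[OF bopD(2)[OF projD(1)[OF P]], of "range A \<union> F"] span_mono by metis
  then show ?thesis unfolding lower_semiFredholmM_def fin_codim_def
    using F by (intro exI[of _ "P ` F"]) simp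
qed

lemma funpow_image_proj:
  assumes A: "\<And>x. P (A x) = A (P x)"
  shows "(A ^^ n) ` range P = P ` range (A ^^ n)"
proof -
  have "P ((A ^^ n) y) = (A ^^ n) (P y)" for y by (induction n) (simp_all add: A)
  then show ?thesis by (simp add: image_image)
qed

text \<open>An operator is the product of its two parts, each completed by the identity; in this
  form a Weyl part can be cancelled.\<close>

lemma cut_compl_comp:
  assumes P: "proj P" and A: "bop J A" "\<And>x. P (A x) = A (P x)"
  shows "cut P A (cut (\<lambda>x. x - P x) A x) = A x"
proof -
  have "P (A (x - P x)) = 0" using A(2) proj_linear(3)[OF P] linear_0[OF bopD(2)[OF A(1)]] by simp
  then have "P (cut (\<lambda>x. x - P x) A x) = P x"
    unfolding cut_def using proj_linear[OF P] projD(2)[OF P] by simp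
  then show ?thesis unfolding cut_def by (simp add: linear_diff[OF bopD(2)[OF A(1)]])
qed

text \<open>With B Weyl and A = C B, one has C + finite rank = (A + finite rank) V where V is the inverse
  of B + finite rank, so C inherits the sign of the index from A.\<close>
lemma left_factor_of_weyl:
  assumes C: "bop J C" and B: "bop J B" "weyl B" and A: "\<And>x. A x = C (B x)" and G: "finite_rank G"
  shows "\<exists>H V. finite_rank H \<and> bij V \<and> bounded_linear V \<and> (\<lambda>x. C x + H x) = (\<lambda>x. (\<lambda>y. A y + G y) (V x))"
proof -
  obtain F where F: "finite_rank F" "bij (\<lambda>x. B x + F x)" using B(2) unfolding weyl_def by blast
  define V where "V = inv (\<lambda>x. B x + F x)"
  have "bounded_linear (\<lambda>x. B x + F x)" by (intro bounded_linear_add bopD(1)[OF B(1)] finite_rank_bounded_linear[OF F(1)])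
  then have V: "bounded_linear V" unfolding V_def by (rule bounded_linear_inv[OF _ F(2)])
  have bijV: "bij V" unfolding V_def using F(2) by (rule bij_imp_bij_inv)
  have BV: "B (V x) + F (V x) = x" for x
    unfolding V_def using surj_f_inv_f[OF bij_is_surj[OF F(2)], of x] .
  have "finite_rank (\<lambda>y. - C (F y) + G y)"
    by (intro finite_rank_add finite_rank_minus finite_rank_comp_left[OF bopD(1)[OF C] F(1)] G)
  then have "finite_rank (\<lambda>x. - C (F (V x)) + G (V x))" by (rule finite_rank_comp_right[OF V])
  moreover have "C x + (- C (F (V x)) + G (V x)) = A (V x) + G (V x)" for x
    using BV[of x] linear_add[OF bopD(2)[OF C], of "B (V x)" "F (V x)"] A[of "V x"] by simp
  ultimately show ?thesis using bijV V by blast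
qed

text \<open>Kernels are intersected with the range of \<open>P\<close> and complements are projected
  to it. Only the sign of the index is delicate, and there \<open>w\<close> guarantees that the
  complementary factor contributes index zero.\<close>

lemma class_range_proj:
  assumes P: "proj P" and A: "bop J A" "\<And>x. P (A x) = A (P x)" and w: "weyl (cut (\<lambda>x. x - P x) A)"
    and K: "inClass K UNIV A"
  shows "inClass K UNIV (cut P A)"
proof -
  have C: "bop J (cut P A)" and B: "bop J (cut (\<lambda>x. x - P x) A)"
    by (rule bop_cut[OF projD(1)[OF P] A(1)], rule bop_cut[OF projD(1)[OF proj_compl[OF P]] A(1)])
  note iff = class_range_iff_cut[of P A, OF P A]
  note fact = cut_compl_comp[of P A, OF P A, symmetric]
  show ?thesis
  proof (rule class_split[OF A(1), where C="\<lambda>K. inClass K UNIV (cut P A)"])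
    show "inClass M_cls UNIV (cut P A)" if "inClass M_cls UNIV A"
      using that closed_range_proj[OF P] unfolding iff[symmetric]
      by (auto simp: bounded_belowM_def range_proj_Int[of P A, OF P A(2)] intro: inj_on_subset)
    show "inClass Q_cls UNIV (cut P A)" if "inClass Q_cls UNIV A"
      using that unfolding iff[symmetric] by (simp add: surjM_def range_proj_Int[of P A, OF P A(2)])
    show "inClass Phiplus_cls UNIV (cut P A)" if "inClass Phiplus_cls UNIV A"
      using that upper_range_proj[of P A, OF P A(2)] unfolding iff[symmetric] by simp
    show "inClass Phiminus_cls UNIV (cut P A)" if "inClass Phiminus_cls UNIV A"
      using that lower_range_proj[of P A, OF P A(2)] unfolding iff[symmetric] by simp
    show "inClass Bplus_cls UNIV (cut P A)" if b: "inClass Bplus_cls UNIV A"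
    proof -
      have k: "kerM (range P) X = kerM UNIV X \<inter> range P" for X :: "'a \<Rightarrow> 'a" by (auto simp: kerM_def)
      obtain n where n: "kerM UNIV (A ^^ n) = kerM UNIV (A ^^ Suc n)" using b unfolding inClass.simps finite_ascentM_def by blast
      have "finite_ascentM (range P) A"
        unfolding finite_ascentM_def k by (intro exI[of _ n]) (simp only: n)
      then show ?thesis using b upper_range_proj[of P A, OF P A(2)] unfolding iff[symmetric] by simp
    qed
    show "inClass Bminus_cls UNIV (cut P A)" if b: "inClass Bminus_cls UNIV A"
    proof -
      obtain n where n: "range (A ^^ n) = range (A ^^ Suc n)" using b unfolding inClass.simps finite_descentM_def by blast
      have "finite_descentM (range P) A"
        unfolding finite_descentM_def funpow_image_proj[of P A, OF A(2)] by (intro exI[of _ n]) (simp only: n)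
      then show ?thesis using b lower_range_proj[of P A, OF P A(2)] unfolding iff[symmetric] by simp
    qed
    show "inClass Wplus_cls UNIV (cut P A)" if wp: "inClass Wplus_cls UNIV A"
    proof -
      obtain G where G: "finite_rank G" "bounded_belowM UNIV (\<lambda>x. A x + G x)"
        using wp Wplus_iff[OF A(1)] upper_nonpos_iff[OF bopD(1)[OF A(1)]] by blast
      obtain H V where HV: "finite_rank H" "bij V" "bounded_linear V"
          "(\<lambda>x. cut P A x + H x) = (\<lambda>x. (\<lambda>y. A y + G y) (V x))"
        using left_factor_of_weyl[OF C B w fact G(1)] by blast
      have "bounded_belowM UNIV (\<lambda>x. (\<lambda>y. A y + G y) (V x))"
        by (rule comp_bounded_below[OF _ HV(3) G(2) bij_imp_bounded_below[OF HV(2)]])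
          (intro bounded_linear_add bopD(1)[OF A(1)] finite_rank_bounded_linear[OF G(1)])
      then show ?thesis using HV(1,4) Wplus_iff[OF C] upper_nonpos_iff[OF bopD(1)[OF C]] by metis
    qed
    show "inClass Wminus_cls UNIV (cut P A)" if wm: "inClass Wminus_cls UNIV A"
    proof -
      obtain G where G: "finite_rank G" "surj (\<lambda>x. A x + G x)"
        using wm Wminus_iff[OF A(1)] lower_nonneg_iff[OF bopD(1)[OF A(1)]] by blast
      obtain H V where HV: "finite_rank H" "bij V" "bounded_linear V"
          "(\<lambda>x. cut P A x + H x) = (\<lambda>x. (\<lambda>y. A y + G y) (V x))"
        using left_factor_of_weyl[OF C B w fact G(1)] by blast
      have "surj (\<lambda>x. (\<lambda>y. A y + G y) (V x))"
        using comp_surj[OF bij_is_surj[OF HV(2)] G(2)] by (simp add: o_def)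
      then show ?thesis using HV(1,4) Wminus_iff[OF C] lower_nonneg_iff[OF bopD(1)[OF C]] by metis
    qed
  qed (use class_combine[OF C] K in blast)+
qed

lemma semi_cut:
  assumes P: "proj P" and A: "bop J A" "\<And>x. P (A x) = A (P x)"
  shows "upper_semiFredholmM UNIV A \<Longrightarrow> upper_semiFredholmM UNIV (cut P A)"
    and "lower_semiFredholmM UNIV A \<Longrightarrow> lower_semiFredholmM UNIV (cut P A)"
    and "inj A \<Longrightarrow> inj (cut P A)" and "surj A \<Longrightarrow> surj (cut P A)"
proof -
  note iff = class_range_iff_cut[of P A, OF P A]
  have C: "linear (cut P A)" using bop_cut[OF projD(1)[OF P] A(1)] bopD(2) by blast
  show "upper_semiFredholmM UNIV A \<Longrightarrow> upper_semiFredholmM UNIV (cut P A)"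
    using upper_range_proj[of P A, OF P A(2)] iff[of Phiplus_cls] by simp
  show "lower_semiFredholmM UNIV A \<Longrightarrow> lower_semiFredholmM UNIV (cut P A)"
    using lower_range_proj[of P A, OF P A(2)] iff[of Phiminus_cls] by simp
  show "inj (cut P A)" if "inj A"
  proof -
    have "kerM UNIV (cut P A) \<subseteq> kerM UNIV A"
      unfolding kerM_cut[of P A, OF P bopD(2)[OF A(1)] A(2)] by (auto simp: kerM_def)
    also have "\<dots> = {0}" using that kerM_trivial_iff[OF bopD(2)[OF A(1)]] by simp
    finally have "kerM UNIV (cut P A) = {0}" using subspace_0[OF subspace_kerM[OF C]] by blast
    then show ?thesis using kerM_trivial_iff[OF C] by simp
  qed
  show "surj (cut P A)" if "surj A"
    using that iff[of Q_cls] by (simp add: surjM_def range_proj_Int[of P A, OF P A(2)])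
qed

lemma bij_cut:
  assumes "proj P" "bop J A" "\<And>x. P (A x) = A (P x)" "bij A"
  shows "bij (cut P A)"
  using semi_cut(3,4)[of P A, OF assms(1-3)] assms(4) by (simp add: bij_def)

lemma proj_shiftop:
  assumes "proj P" "\<And>x. P (T x) = T (P x)"
  shows "P (shiftop J T t x) = shiftop J T t (P x)"
  using assms(2) proj_linear[OF assms(1)] scaleC_bop[OF projD(1)[OF assms(1)]] by (simp add: shiftop_def)

text \<open>The family is Lipschitz in \<open>t\<close>, with a bound of \<open>P\<close> as
  constant, and it is invertible at \<open>s\<close>, so the Weyl property spreads over
  \<open>C\<close>.\<close>

lemma weyl_cut_on_connected:
  assumes P: "proj P" and PT: "\<And>x. P (T x) = T (P x)" and C: "connected C" "s \<in> C" "bij (shiftop J T s)"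
    and semi: "\<And>t. t \<in> C \<Longrightarrow> upper_semiFredholmM UNIV (cut P (shiftop J T t)) \<or> lower_semiFredholmM UNIV (cut P (shiftop J T t))"
    and t: "t \<in> C"
  shows "weyl (cut P (shiftop J T t))"
proof (rule weyl_on_connected[where S="\<lambda>t. cut P (shiftop J T t)", OF _ _ C(1) semi C(2) _ t])
  show "bounded_linear (cut P (shiftop J T t))" for t
    by (rule bopD(1)[OF bop_cut[OF projD(1)[OF P] bop_shiftop]])
  obtain B where B: "\<And>x. norm (P x) \<le> norm x * B" "B > 0"
    using bounded_linear.pos_bounded[OF bopD(1)[OF projD(1)[OF P]]] by blast
  show "\<exists>d>0. \<forall>s. cmod (s - t) < d \<longrightarrow> (\<forall>x. norm (cut P (shiftop J T s) x - cut P (shiftop J T t) x) \<le> e * norm x)"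
    if e: "e > 0" for t e
  proof (intro exI[of _ "e / B"] conjI allI impI)
    fix s x assume s: "cmod (s - t) < e / B"
    have "cut P (shiftop J T s) x - cut P (shiftop J T t) x = scaleC J (t - s) (P x)"
      by (simp add: cut_def shiftop_def scaleC_diff_left)
    then have "norm (cut P (shiftop J T s) x - cut P (shiftop J T t) x) = cmod (s - t) * norm (P x)"
      by (simp add: norm_scaleC norm_minus_commute)
    also have "\<dots> \<le> (e / B) * (norm x * B)" using s B e by (intro mult_mono B(1)) auto
    also have "\<dots> = e * norm x" using B(2) by simp
    finally show "norm (cut P (shiftop J T s) x - cut P (shiftop J T t) x) \<le> e * norm x" .
  qed (use e B in simp)
  have "bij (cut P (shiftop J T s))"
    by (rule bij_cut[OF P bop_shiftop proj_shiftop[OF P PT] C(3)])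
  then show "weyl (cut P (shiftop J T s))" unfolding weyl_def
    using finite_rank_zero by (intro exI[of _ "\<lambda>x. 0"]) simp
qed

lemma class_semi:
  assumes S: "bop J S" and K: "inClass K UNIV S"
  shows "upper_semiFredholmM UNIV S \<or> lower_semiFredholmM UNIV S"
proof -
  have "inClass M_cls UNIV S \<Longrightarrow> upper_semiFredholmM UNIV S"
    using bounded_below_imp_upper(1)[OF bopD(2)[OF S]] by simp
  moreover have "inClass Q_cls UNIV S \<Longrightarrow> lower_semiFredholmM UNIV S"
    using surj_imp_lower(1) by (simp add: surjM_def)
  ultimately show ?thesis using K Inv_iff[OF S] by (cases K) (simp_all add: FredholmM_def)
qed

text \<open>For each \<open>t\<close> the part of T - t on the range of \<open>P\<close> is also the
  part of some operator in the class. It is therefore semi-Fredholm for all \<open>t\<close>, Weyl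
  by connectedness of the plane, and the Liouville argument makes the range of \<open>P\<close>
  finite dimensional. Where the class provides injectivity or surjectivity, these parts are even
  bijective and \<open>P\<close> vanishes.\<close>

lemma trivial_part_class:
  assumes P: "proj P" and PT: "\<And>x. P (T x) = T (P x)"
    and A: "\<And>t. \<exists>A. bop J A \<and> inClass K UNIV A \<and> (\<forall>x. P (A x) = A (P x)) \<and> cut P (shiftop J T t) = cut P A"
  shows "inClass K UNIV (\<lambda>x. x - P x)"
proof -
  have bQ: "bop J (\<lambda>x. x - P x)" using projD(1)[OF proj_compl[OF P]] .
  obtain s where s: "bij (shiftop J T s)"
  proof -
    obtain B where "\<And>t. cmod t \<ge> B \<Longrightarrow> bij (shiftop J T t)" using bij_shiftop_large by blast
    then show ?thesis using that[of "of_real \<bar>B\<bar>"] by simp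
  qed
  have semi: "upper_semiFredholmM UNIV (cut P (shiftop J T t)) \<or> lower_semiFredholmM UNIV (cut P (shiftop J T t))" for t
  proof -
    obtain A where "bop J A" "inClass K UNIV A" "\<And>x. P (A x) = A (P x)" "cut P (shiftop J T t) = cut P A" using A by blast
    then show ?thesis using class_semi[of A K] semi_cut(1,2)[of P A, OF P] by metis
  qed
  have w: "weyl (cut P (shiftop J T t))" for t
    by (rule weyl_cut_on_connected[OF P PT connected_UNIV UNIV_I s semi UNIV_I])
  have ceq: "cut P (shiftop J T t) = (\<lambda>x. shiftop J T t (P x) + (x - P x))" for t by (simp add: cut_def fun_eq_iff)
  have zero: "inClass K UNIV (\<lambda>x. x - P x)"
    if "\<And>t. inj (cut P (shiftop J T t)) \<or> surj (cut P (shiftop J T t))"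
  proof -
    have "bij (cut P (shiftop J T t))" for t
      by (rule weyl_bij[OF bopD(1)[OF bop_cut[OF projD(1)[OF P] bop_shiftop]] w that])
    then have "P x = 0" for x
      using zero_if_bij_everywhere[OF projD(1)[OF P] projD(2)[OF P] PT] unfolding ceq by blast
    then have "bij (\<lambda>x. x - P x)" by (simp add: bij_betw_def)
    then show ?thesis by (rule bij_class[OF bQ])
  qed
  have "fin_dim (range P)"
    using fin_dim_if_weyl_everywhere[OF projD(1)[OF P] projD(2)[OF P] PT] w unfolding ceq by blast
  then have "finite_rank P" using bopD(1)[OF projD(1)[OF P]] by (simp add: finite_rank_def)
  then have "weyl (\<lambda>x. x - P x)" unfolding weyl_def by (intro exI[of _ P]) (simp add: bij_betw_def)
  note wc = weyl_class[OF bQ this]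
  \<comment> \<open>The complementary projection is idempotent, so its ascent and descent are at
    most 1.\<close>
  have QQ: "((\<lambda>x. x - P x) ^^ Suc 1) = ((\<lambda>x. x - P x) ^^ 1)"
    using proj_linear[OF P] by (simp add: fun_eq_iff)
  have ad: "finite_ascentM UNIV (\<lambda>x. x - P x)" "finite_descentM UNIV (\<lambda>x. x - P x)"
    unfolding finite_ascentM_def finite_descentM_def by (rule exI[of _ 1], simp only: QQ)+
  have up: "upper_semiFredholmM UNIV (\<lambda>x. x - P x)" "lower_semiFredholmM UNIV (\<lambda>x. x - P x)"
    using wc by simp_all
  have injc: "inj (cut P (shiftop J T t))" if "K = M_cls \<or> K = Inv_cls" for t
  proof -
    obtain A where A': "bop J A" "inClass K UNIV A" "\<And>x. P (A x) = A (P x)" "cut P (shiftop J T t) = cut P A" using A by blast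
    then have "inj A" using that Inv_iff[OF A'(1)] by (auto simp: bounded_belowM_def)
    then show ?thesis using semi_cut(3)[of P A, OF P A'(1,3)] A'(4) by simp
  qed
  have surjc: "surj (cut P (shiftop J T t))" if "K = Q_cls" for t
  proof -
    obtain A where A': "bop J A" "inClass K UNIV A" "\<And>x. P (A x) = A (P x)" "cut P (shiftop J T t) = cut P A" using A by blast
    then have "surj A" using that by (auto simp: surjM_def)
    then show ?thesis using semi_cut(4)[of P A, OF P A'(1,3)] A'(4) by simp
  qed
  show ?thesis
  proof (cases "K = M_cls \<or> K = Inv_cls \<or> K = Q_cls")
    case True
    show ?thesis by (rule zero) (use True injc surjc in blast)
  next
    case False
    have "inClass W_cls UNIV (\<lambda>x. x - P x)" using wc class_conjunctions(1) by blast
    then show ?thesis using False wc up ad by (cases K) (simp_all add: FredholmM_def)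
  qed
qed

end

section \<open>Factorization of holomorphic functions on compact sets\<close>

lemma locally_zero_open:
  "open {z :: complex. \<exists>r>0. \<forall>w\<in>ball z r. f w = (0 :: complex)}"
proof (rule open_subopen[THEN iffD2], rule ballI)
  fix z assume "z \<in> {z. \<exists>r>0. \<forall>w\<in>ball z r. f w = 0}"
  then obtain r where r: "r > 0" "\<forall>w\<in>ball z r. f w = 0" by blast
  have "ball z r \<subseteq> {z. \<exists>r>0. \<forall>w\<in>ball z r. f w = 0}"
  proof
    fix w assume "w \<in> ball z r"
    then obtain e where "e > 0" "ball w e \<subseteq> ball z r" using openE[OF open_ball] by blast
    then show "w \<in> {z. \<exists>r>0. \<forall>w\<in>ball z r. f w = 0}" using r(2) by blast
  qed
  then show "\<exists>S. open S \<and> z \<in> S \<and> S \<subseteq> {z. \<exists>r>0. \<forall>w\<in>ball z r. f w = 0}"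
    using r(1) by (intro exI[of _ "ball z r"]) simp
qed

lemma zero_near_limit_of_zeros:
  assumes "open U" "f holomorphic_on U" "z \<in> U" "z islimpt {w. f w = (0 :: complex)}"
  shows "\<exists>r>0. ball z r \<subseteq> U \<and> (\<forall>w\<in>ball z r. f w = 0)"
proof -
  obtain r where r: "r > 0" "ball z r \<subseteq> U" using openE[OF assms(1,3)] by blast
  have "z islimpt ({w. f w = 0} \<inter> ball z r)"
    using islimpt_Int_eventually[OF assms(4)] eventually_at_ball[OF r(1), of z UNIV] by simp
  then have "f w = 0" if "w \<in> ball z r" for w
    using analytic_continuation[OF holomorphic_on_subset[OF assms(2) r(2)] open_ball connected_ball Int_lower2
        centre_in_ball[THEN iffD2, OF r(1)] _ _ that, of "{w. f w = 0}"] by blast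
  then show ?thesis using r by blast
qed

text \<open>Each zero in \<open>K\<close> is divided out with its full multiplicity, so the number
  of distinct zeros drops by one; multiplicities appear as repetitions in \<open>ls\<close>.\<close>

lemma holomorphic_factorization:
  fixes f :: "complex \<Rightarrow> complex"
  assumes U: "open U" and K: "finite {z\<in>K. f z = 0}" "K \<subseteq> U" and f: "f holomorphic_on U"
    and nz: "\<And>z r. z \<in> U \<Longrightarrow> r > 0 \<Longrightarrow> \<exists>w\<in>ball z r. f w \<noteq> 0"
  shows "\<exists>ls h. set ls \<subseteq> {z\<in>K. f z = 0} \<and> h holomorphic_on U \<and>
    (\<forall>z\<in>U. f z = (\<Prod>l\<leftarrow>ls. z - l) * h z) \<and> (\<forall>z\<in>K. h z \<noteq> 0)"
  using K(1) f nz
proof (induction "card {z\<in>K. f z = 0}" arbitrary: f)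
  case 0
  then show ?case by (intro exI[of _ "[]"] exI[of _ f]) auto
next
  case (Suc n)
  then have "{z\<in>K. f z = 0} \<noteq> {}" by (metis card.empty nat.distinct(1))
  then obtain l where l: "l \<in> K" "f l = 0" by blast
  obtain r0 where r0: "r0 > 0" "ball l r0 \<subseteq> U" using openE[OF U] l(1) K(2) by blast
  have "\<not> f constant_on ball l r0"
  proof
    assume "f constant_on ball l r0"
    then have "f w = 0" if "w \<in> ball l r0" for w using that l(2) r0(1) unfolding constant_on_def by force
    then show False using Suc.prems(3)[of l r0] l(1) K(2) r0(1) by blast
  qed
  then obtain g r m where g: "0 < m" "0 < r" "ball l r \<subseteq> ball l r0" "g holomorphic_on ball l r"
      "\<And>w. w \<in> ball l r \<Longrightarrow> f w = (w - l) ^ m * g w" "\<And>w. w \<in> ball l r \<Longrightarrow> g w \<noteq> 0"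
    using holomorphic_factor_zero_nonconstant[of f "ball l r0" l] holomorphic_on_subset[OF Suc.prems(2) r0(2)] l(2) r0(1)
    by (metis centre_in_ball connected_ball open_ball)
  \<comment> \<open>The quotient of \<open>f\<close> by the power of w - l; near \<open>l\<close>
    the local factor \<open>g\<close> fills in the removable singularity.\<close>
  define f1 where "f1 w = (if w \<in> ball l r then g w else f w / (w - l) ^ m)" for w
  have f_eq: "f w = (w - l) ^ m * f1 w" for w
    using g(2,5) by (auto simp: f1_def)
  have f1_eq: "f1 w = f w / (w - l) ^ m" if "w \<noteq> l" for w using f_eq[of w] that by simp
  have "f1 holomorphic_on ball l r \<union> (U - {l})"
  proof (rule holomorphic_on_Un)
    show "f1 holomorphic_on ball l r" using g(4) by (rule holomorphic_transform) (simp add: f1_def)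
    have "(\<lambda>w. f w / (w - l) ^ m) holomorphic_on U - {l}"
      by (intro holomorphic_intros holomorphic_on_subset[OF Suc.prems(2)]) auto
    then show "f1 holomorphic_on U - {l}" by (rule holomorphic_transform) (simp add: f1_eq)
  qed (use U in auto)
  then have f1: "f1 holomorphic_on U" by (rule holomorphic_on_subset) (use g(2) in auto)
  have nz1: "\<exists>w\<in>ball z e. f1 w \<noteq> 0" if ze: "z \<in> U" "e > 0" for z e
  proof -
    obtain w where "w \<in> ball z e" "f w \<noteq> 0" using Suc.prems(3)[OF ze] by blast
    then show ?thesis using f_eq[of w] by auto
  qed
  have "f1 l \<noteq> 0" using g(2,6) by (simp add: f1_def)
  then have zeros: "{z\<in>K. f1 z = 0} = {z\<in>K. f z = 0} - {l}" using f1_eq f_eq g(1) by auto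
  then have card1: "n = card {z\<in>K. f1 z = 0}" using Suc.hyps(2) l Suc.prems(1) by simp
  have fin1: "finite {z\<in>K. f1 z = 0}" using zeros Suc.prems(1) by simp
  obtain ls h where h: "set ls \<subseteq> {z\<in>K. f1 z = 0}" "h holomorphic_on U"
      "\<forall>z\<in>U. f1 z = (\<Prod>l\<leftarrow>ls. z - l) * h z" "\<forall>z\<in>K. h z \<noteq> 0"
    using Suc.hyps(1)[OF card1 fin1 f1 nz1] by blast
  have "f z = (\<Prod>l\<leftarrow>replicate m l @ ls. z - l) * h z" if "z \<in> U" for z
    using f_eq[of z] h(3) that by (simp add: prod_list_replicate)
  moreover have "set (replicate m l @ ls) \<subseteq> {z\<in>K. f z = 0}" using h(1) zeros l by auto
  ultimately show ?case using h(2,4) by blast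
qed

text \<open>The open set W is where f vanishes identically; it may meet the compact set in infinitely many points.\<close>
lemma holomorphic_factorization_compact:
  fixes f :: "complex \<Rightarrow> complex"
  assumes U: "open U" and K: "compact K" "K \<subseteq> U" and f: "f holomorphic_on U"
  shows "\<exists>V W ls h. open V \<and> open W \<and> V \<union> W = U \<and> V \<inter> W = {} \<and> (\<forall>z\<in>W. f z = 0) \<and>
    set ls \<subseteq> {z\<in>K. f z = 0} \<and> h holomorphic_on V \<and> (\<forall>z\<in>V. f z = (\<Prod>l\<leftarrow>ls. z - l) * h z) \<and> (\<forall>z\<in>K \<inter> V. h z \<noteq> 0)"
proof -
  define Z where "Z = {z. \<exists>r>0. \<forall>w\<in>ball z r. f w = 0}"
  define W where "W = U \<inter> Z"
  define V where "V = U - Z"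
  have oZ: "open Z" unfolding Z_def by (rule locally_zero_open)
  have oW: "open W" using U oZ by (auto simp: W_def)
  have limV: "\<not> z islimpt {w. f w = 0}" if "z \<in> V" for z
    using zero_near_limit_of_zeros[OF U f] that unfolding V_def Z_def by blast
  have oV: "open V"
  proof (rule open_subopen[THEN iffD2], rule ballI)
    fix z assume z: "z \<in> V"
    then obtain e where e: "e > 0" "\<And>w. f w = 0 \<Longrightarrow> w \<noteq> z \<Longrightarrow> \<not> dist w z < e"
      using limV[OF z] unfolding islimpt_approachable by blast
    obtain d where d: "d > 0" "ball z d \<subseteq> U" using openE[OF U] z unfolding V_def by blast
    have "ball z (min d e) \<subseteq> V"
    proof
      fix w assume w: "w \<in> ball z (min d e)"
      show "w \<in> V"
      proof (cases "w = z")
        case False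
        have "f w \<noteq> 0" using e(2)[of w] False w by (auto simp: dist_commute)
        then have "w \<notin> Z" unfolding Z_def by (auto intro: centre_in_ball[THEN iffD2])
        then show ?thesis using d(2) w by (auto simp: V_def)
      qed (use z in simp)
    qed
    then show "\<exists>S. open S \<and> z \<in> S \<and> S \<subseteq> V" using d(1) e(1) by (intro exI[of _ "ball z (min d e)"]) simp
  qed
  have KV: "compact (K \<inter> V)"
  proof -
    have "K \<inter> V = K - Z" using K(2) by (auto simp: V_def)
    then show ?thesis using compact_diff[OF K(1) oZ] by simp
  qed
  have fin: "finite {z\<in>K \<inter> V. f z = 0}"
  proof (rule ccontr)
    assume "infinite {z\<in>K \<inter> V. f z = 0}"
    then obtain z where z: "z \<in> K \<inter> V" "z islimpt {z\<in>K \<inter> V. f z = 0}"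
      using KV unfolding compact_eq_Bolzano_Weierstrass by (metis (no_types, lifting) mem_Collect_eq subsetI)
    then have "z islimpt {w. f w = 0}" by (rule_tac islimpt_subset) auto
    then show False using limV z(1) by blast
  qed
  have fV: "f holomorphic_on V" using f by (rule holomorphic_on_subset) (auto simp: V_def)
  have nz: "\<exists>w\<in>ball z r. f w \<noteq> 0" if "z \<in> V" "r > 0" for z r using that unfolding V_def Z_def by blast
  obtain ls h where h: "set ls \<subseteq> {z\<in>K \<inter> V. f z = 0}" "h holomorphic_on V"
      "\<forall>z\<in>V. f z = (\<Prod>l\<leftarrow>ls. z - l) * h z" "\<forall>z\<in>K \<inter> V. h z \<noteq> 0"
    using holomorphic_factorization[OF oV fin _ fV nz] by blast
  have "\<forall>z\<in>W. f z = 0" unfolding W_def Z_def by auto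
  moreover have "V \<union> W = U" "V \<inter> W = {}" by (auto simp: V_def W_def)
  moreover have "set ls \<subseteq> {z\<in>K. f z = 0}" using h(1) by blast
  ultimately show ?thesis using oV oW h(2-4) by blast
qed

section \<open>Classes of functions of the operator\<close>

lemma holomorphic_on_disjoint_Un:
  assumes V: "open V" "open W" "V \<inter> W = {}" and g: "g holomorphic_on V" "h holomorphic_on W"
  shows "(\<lambda>z. if z \<in> V then g z else h z) holomorphic_on V \<union> W"
proof (rule holomorphic_on_Un[OF _ _ V(1,2)])
  show "(\<lambda>z. if z \<in> V then g z else h z) holomorphic_on V"
    by (rule holomorphic_transform[OF g(1)]) simp
  show "(\<lambda>z. if z \<in> V then g z else h z) holomorphic_on W"
    by (rule holomorphic_transform[OF g(2)]) (use V(3) in auto)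
qed

context complex_operator
begin

lemma hfc_shift:
  assumes U: "open U" "spectrum J T \<subseteq> U" and f: "f holomorphic_on U"
  shows "hfc J U (\<lambda>z. f z - c) T x = shiftop J (hfc J U f T) c x"
proof -
  have h: "(\<lambda>z. 1) holomorphic_on U" "(\<lambda>z. c * 1) holomorphic_on U" by simp_all
  have "hfc J U (\<lambda>z. f z - c * 1) T x = hfc J U f T x - hfc J U (\<lambda>z. c * 1) T x"
    by (rule hfc_linear(1)[OF U f h(2)])
  also have "hfc J U (\<lambda>z. c * 1) T x = scaleC J c x"
    unfolding hfc_linear(2)[OF U h(1) h(1)] hfc_one[OF U] ..
  finally show ?thesis by (simp add: shiftop_def)
qed

lemma shiftop_hfc:
  assumes U: "open U" "spectrum J T \<subseteq> U" and f: "f holomorphic_on U"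
  shows "shiftop J T t (hfc J U f T x) = hfc J U (\<lambda>z. (z - t) * f z) T x"
    and "hfc J U f T (shiftop J T t x) = hfc J U (\<lambda>z. (z - t) * f z) T x"
proof -
  have id: "(\<lambda>z. z) holomorphic_on U" and h: "(\<lambda>z. z - t) holomorphic_on U" by (simp_all add: holomorphic_intros)
  have T_id: "hfc J U (\<lambda>z. z) T = T" using hfc_ident[OF U] by (rule ext)
  have sh: "hfc J U (\<lambda>z. z - t) T y = shiftop J T t y" for y using hfc_shift[OF U id, of t y] unfolding T_id .
  show "shiftop J T t (hfc J U f T x) = hfc J U (\<lambda>z. (z - t) * f z) T x"
    using hfc_mult[OF U h f, of x] unfolding sh .
  show "hfc J U f T (shiftop J T t x) = hfc J U (\<lambda>z. (z - t) * f z) T x"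
    using hfc_mult[OF U f h, of x] unfolding sh by (simp only: mult.commute[of "f _"])
qed

lemma cut_inverse_bij:
  assumes P: "proj P" and A: "bop J A" "\<And>x. P (A x) = A (P x)" and B: "bop J B" "\<And>x. P (B x) = B (P x)"
    and AB: "\<And>x. A (B (P x)) = P x" "\<And>x. B (A (P x)) = P x"
  shows "bij (cut P A)"
proof (rule o_bij[of "cut P B"])
  show "cut P B \<circ> cut P A = id"
    using cut_cut_comp[of P B A, OF P B A] AB(2) by (simp add: fun_eq_iff cut_def[of P "\<lambda>x. B (A x)"])
  show "cut P A \<circ> cut P B = id"
    using cut_cut_comp[of P A B, OF P A B] AB(1) by (simp add: fun_eq_iff cut_def[of P "\<lambda>x. A (B x)"])
qed

text \<open>On the range of the projection P1 complementary to E in P, the operator T - t is invertible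
  unless t lies in W, and there it is a restriction of (T - t) P.\<close>
lemma clopen_part_class:
  assumes V: "open V" "open W" "V \<inter> W = {}" "spectrum J T \<subseteq> V \<union> W"
    and P: "proj P" and PT: "\<And>x. P (T x) = T (P x)"
    and K: "\<And>t. t \<in> spectrum J T \<Longrightarrow> t \<in> W \<Longrightarrow> inClass K UNIV (cut P (shiftop J T t))"
  shows "inClass K UNIV (cut P (hfc J (V \<union> W) (\<lambda>z. if z \<in> V then 1 else 0) T))"
proof -
  let ?e = "\<lambda>z. if z \<in> V then 1 else 0 :: complex"
  define E where "E = hfc J (V \<union> W) ?e T"
  define P1 where "P1 x = P x - E (P x)" for x
  have U: "open (V \<union> W)" "spectrum J T \<subseteq> V \<union> W" using V by auto
  have e: "?e holomorphic_on V \<union> W" by (rule holomorphic_on_disjoint_Un[OF V(1-3)]) simp_all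
  have bP: "bop J P" using projD(1)[OF P] .
  have bE: "bop J E" unfolding E_def by (rule bop_hfc[OF U e])
  have E0: "E (x - y) = E x - E y" for x y using linear_diff[OF bopD(2)[OF bE]] .
  have EE: "E (E x) = E x" for x
  proof -
    have "(\<lambda>z. ?e z * ?e z) = ?e" by auto
    then show ?thesis using hfc_mult[OF U e e, of x] unfolding E_def by simp
  qed
  have PE: "P (E x) = E (P x)" for x unfolding E_def by (rule hfc_commute[OF U e bP PT])
  have ET: "E (T x) = T (E x)" for x unfolding E_def by (rule hfc_commute[OF U e T refl, symmetric])
  have b1: "bop J P1" unfolding P1_def[abs_def] by (rule bop_diff[OF linJ bP bop_comp[OF bE bP]])
  have PP1: "P (P1 x) = P1 x" "P1 (P x) = P1 x" and EP1: "E (P1 x) = 0" for x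
    unfolding P1_def using proj_linear[OF P] projD(2)[OF P] by (simp_all add: PE E0 EE)
  have P1: "proj P1" unfolding proj_def using b1 PP1 EP1 by (simp add: P1_def[of "P1 _"])
  have P1T: "P1 (T x) = T (P1 x)" for x
    unfolding P1_def by (simp add: PT ET linear_diff[OF bopD(2)[OF T]])
  note P1S = proj_shiftop[of P1, OF P1 P1T]
  have "\<exists>A. bop J A \<and> inClass K UNIV A \<and> (\<forall>x. P1 (A x) = A (P1 x)) \<and> cut P1 (shiftop J T t) = cut P1 A" for t
  proof -
    consider "t \<notin> spectrum J T" | "t \<in> spectrum J T" "t \<in> W" | "t \<in> V" "t \<in> V \<union> W" using V(4) by blast
    then show ?thesis
    proof cases
      case 1
      then have "inClass K UNIV (shiftop J T t)" using bij_class[OF bop_shiftop] spectrum_iff by blast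
      then show ?thesis using bop_shiftop P1S by blast
    next
      case 2
      have "P1 (cut P (shiftop J T t) x) = cut P (shiftop J T t) (P1 x)" for x
        unfolding cut_def using proj_linear[OF P1] by (simp add: P1S PP1)
      moreover have "cut P1 (shiftop J T t) = cut P1 (cut P (shiftop J T t))"
        by (simp add: fun_eq_iff cut_def PP1)
      ultimately show ?thesis using K[OF 2] bop_cut[OF bP bop_shiftop] by blast
    next
      case 3
      \<comment> \<open>The reciprocal of z - t on \<open>W\<close> alone: its product with z - t is
        1 - e, the function that gives the identity on the range of \<open>P1\<close>.\<close>
      let ?k = "\<lambda>z. if z \<in> V then 0 else 1 / (z - t)"
      have "(\<lambda>z. 1 / (z - t)) holomorphic_on W" using V(3) 3 by (intro holomorphic_intros) auto
      then have k: "?k holomorphic_on V \<union> W" by (intro holomorphic_on_disjoint_Un[OF V(1-3)]) simp_all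
      have zk: "(\<lambda>z. (z - t) * ?k z) holomorphic_on V \<union> W" by (intro holomorphic_intros k)
      have "hfc J (V \<union> W) (\<lambda>z. (z - t) * ?k z) T = hfc J (V \<union> W) (\<lambda>z. 1 - ?e z) T"
        by (rule hfc_cong[OF U zk]) (use 3 V(3) in auto)
      moreover have "hfc J (V \<union> W) (\<lambda>z. 1 - ?e z) T x = x - E x" for x
        using hfc_linear(1)[OF U _ e, of "\<lambda>z. 1" x] hfc_one[OF U] by (simp add: E_def)
      ultimately have zk1: "hfc J (V \<union> W) (\<lambda>z. (z - t) * ?k z) T x = x - E x" for x by simp
      have "bij (cut P1 (shiftop J T t))"
      proof (rule cut_inverse_bij[of P1 "shiftop J T t" "hfc J (V \<union> W) ?k T", OF P1 bop_shiftop P1S])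
        show "bop J (hfc J (V \<union> W) ?k T)" by (rule bop_hfc[OF U k])
        show "P1 (hfc J (V \<union> W) ?k T x) = hfc J (V \<union> W) ?k T (P1 x)" for x
          by (rule hfc_commute[OF U k b1 P1T])
        show "shiftop J T t (hfc J (V \<union> W) ?k T (P1 x)) = P1 x" for x
          unfolding shiftop_hfc(1)[OF U k] zk1 EP1 by simp
        show "hfc J (V \<union> W) ?k T (shiftop J T t (P1 x)) = P1 x" for x
          unfolding shiftop_hfc(2)[OF U k] zk1 EP1 by simp
      qed
      then have "inClass K UNIV (cut P1 (shiftop J T t))" by (rule bij_class[OF bop_cut[OF b1 bop_shiftop]])
      moreover have "P1 (cut P1 (shiftop J T t) x) = cut P1 (shiftop J T t) (P1 x)" for x
        unfolding cut_def using proj_linear[OF P1] projD(2)[OF P1] by (simp add: P1S)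
      moreover have "cut P1 (shiftop J T t) = cut P1 (cut P1 (shiftop J T t))"
        using projD(2)[OF P1] by (simp add: fun_eq_iff cut_def)
      ultimately show ?thesis using bop_cut[OF b1 bop_shiftop] by blast
    qed
  qed
  then have "inClass K UNIV (\<lambda>x. x - P1 x)" by (rule trivial_part_class[of P1 K, OF P1 P1T])
  moreover have "(\<lambda>x. x - P1 x) = cut P E" by (simp add: fun_eq_iff cut_def P1_def)
  ultimately show ?thesis by (simp add: E_def)
qed

lemma class_cut_hfc_mult:
  assumes U: "open U" "spectrum J T \<subseteq> U" and f: "f holomorphic_on U" and g: "g holomorphic_on U"
    and P: "proj P" and PT: "\<And>x. P (T x) = T (P x)"
    and K: "inClass K UNIV (cut P (hfc J U f T))" "inClass K UNIV (cut P (hfc J U g T))"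
  shows "inClass K UNIV (cut P (hfc J U (\<lambda>z. f z * g z) T))"
proof -
  let ?A = "hfc J U f T" and ?B = "hfc J U g T"
  have bP: "bop J P" using projD(1)[OF P] .
  have A: "bop J ?A" "\<And>x. P (?A x) = ?A (P x)" by (rule bop_hfc[OF U f], rule hfc_commute[OF U f bP PT])
  have B: "bop J ?B" "\<And>x. P (?B x) = ?B (P x)" by (rule bop_hfc[OF U g], rule hfc_commute[OF U g bP PT])
  note AB = cut_cut_comp[of P ?A ?B, OF P A B] and BA = cut_cut_comp[of P ?B ?A, OF P B A]
  have prods: "(\<lambda>x. ?A (?B x)) = hfc J U (\<lambda>z. f z * g z) T" "(\<lambda>x. ?B (?A x)) = hfc J U (\<lambda>z. f z * g z) T"
    using hfc_mult[OF U f g] hfc_mult[OF U g f] by (simp_all add: fun_eq_iff mult.commute)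
  have "inClass K UNIV (\<lambda>x. cut P ?A (cut P ?B x))"
    by (rule class_comp[OF bop_cut[OF bP A(1)] bop_cut[OF bP B(1)] _ K]) (simp only: AB BA prods)
  moreover have "(\<lambda>x. cut P ?A (cut P ?B x)) = cut P (hfc J U (\<lambda>z. f z * g z) T)"
    using AB unfolding prods by (rule ext)
  ultimately show ?thesis by simp
qed

lemma class_cut_hfc_linear_factors:
  assumes U: "open U" "spectrum J T \<subseteq> U" and g: "g holomorphic_on U"
    and P: "proj P" and PT: "\<And>x. P (T x) = T (P x)"
    and K: "\<And>l. l \<in> set ls \<Longrightarrow> inClass K UNIV (cut P (shiftop J T l))" "inClass K UNIV (cut P (hfc J U g T))"
  shows "inClass K UNIV (cut P (hfc J U (\<lambda>z. (\<Prod>l\<leftarrow>ls. z - l) * g z) T))"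
  using K(1)
proof (induction ls)
  case Nil
  show ?case using K(2) by simp
next
  case (Cons l ls)
  have hol: "(\<lambda>z. \<Prod>l\<leftarrow>ls. z - l) holomorphic_on U" for ls
    by (induction ls) (simp_all add: holomorphic_intros)
  have id: "(\<lambda>z. z) holomorphic_on U" and l: "(\<lambda>z. z - l) holomorphic_on U" by (simp_all add: holomorphic_intros)
  have T_id: "hfc J U (\<lambda>z. z) T = T" using hfc_ident[OF U] by (rule ext)
  have "hfc J U (\<lambda>z. z - l) T = shiftop J T l" using hfc_shift[OF U id, of l] unfolding T_id by (rule ext)
  then have "inClass K UNIV (cut P (hfc J U (\<lambda>z. z - l) T))" using Cons.prems by simp
  from class_cut_hfc_mult[OF U l holomorphic_on_mult[OF hol g] P PT this Cons.IH] Cons.prems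
  show ?case by (simp add: mult.assoc)
qed

lemma bij_hfc_nonzero:
  assumes U: "open U" "spectrum J T \<subseteq> U" and f: "f holomorphic_on U" and nz: "\<And>z. z \<in> U \<Longrightarrow> f z \<noteq> 0"
  shows "bij (hfc J U f T)"
proof -
  have i: "(\<lambda>z. inverse (f z)) holomorphic_on U" by (intro holomorphic_intros f nz)
  have "hfc J U (\<lambda>z. f z * inverse (f z)) T = hfc J U (\<lambda>z. 1) T"
    "hfc J U (\<lambda>z. inverse (f z) * f z) T = hfc J U (\<lambda>z. 1) T"
    by (rule hfc_cong[OF U holomorphic_on_mult[OF f i]], simp add: nz)
      (rule hfc_cong[OF U holomorphic_on_mult[OF i f]], simp add: nz)
  then show ?thesis
    using hfc_mult[OF U f i] hfc_mult[OF U i f] hfc_one[OF U]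
    by (intro o_bij[of "hfc J U (\<lambda>z. inverse (f z)) T"]) (simp_all add: fun_eq_iff)
qed

theorem class_cut_hfc:
  assumes U: "open U" "spectrum J T \<subseteq> U" and f: "f holomorphic_on U"
    and P: "proj P" and PT: "\<And>x. P (T x) = T (P x)"
    and K: "\<And>l. l \<in> spectrum J T \<Longrightarrow> f l = 0 \<Longrightarrow> inClass K UNIV (cut P (shiftop J T l))"
  shows "inClass K UNIV (cut P (hfc J U f T))"
proof -
  obtain V W ls h where VW: "open V" "open W" "V \<union> W = U" "V \<inter> W = {}" and fW: "\<forall>z\<in>W. f z = 0"
    and ls: "set ls \<subseteq> {z \<in> spectrum J T. f z = 0}" and h: "h holomorphic_on V"
    and fV: "\<forall>z\<in>V. f z = (\<Prod>l\<leftarrow>ls. z - l) * h z" and hnz: "\<forall>z \<in> spectrum J T \<inter> V. h z \<noteq> 0"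
    using holomorphic_factorization_compact[OF U(1) compact_spectrum U(2) f] by blast
  \<comment> \<open>Shrinking \<open>V\<close> removes the zeros of \<open>h\<close>, all of which
    lie off the spectrum. Extended by 1 to \<open>W\<close>, \<open>h\<close> becomes the zero-free
    factor \<open>hh\<close>, while the indicator \<open>e\<close> makes the product vanish on
    \<open>W\<close>.\<close>
  define V' where "V' = {z \<in> V. h z \<noteq> 0}"
  define hh where "hh z = (if z \<in> V' then h z else 1)" for z
  define e where "e z = (if z \<in> V' then 1 else 0 :: complex)" for z
  have hV': "h holomorphic_on V'" using h by (rule holomorphic_on_subset) (auto simp: V'_def)
  have "V' = h -` (- {0}) \<inter> V" by (auto simp: V'_def)
  then have oV': "open V'"
    using continuous_on_open_vimage[OF VW(1), THEN iffD1, OF holomorphic_on_imp_continuous_on[OF h]] by auto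
  have disj: "V' \<inter> W = {}" using VW(4) by (auto simp: V'_def)
  have sp: "spectrum J T \<subseteq> V' \<union> W" using U(2) VW(3) hnz by (auto simp: V'_def)
  have U': "open (V' \<union> W)" using oV' VW(2) by blast
  have U'U: "V' \<union> W \<subseteq> U" using VW(3) by (auto simp: V'_def)
  have hh: "hh holomorphic_on V' \<union> W" unfolding hh_def[abs_def]
    by (rule holomorphic_on_disjoint_Un[OF oV' VW(2) disj hV']) simp
  have e: "e holomorphic_on V' \<union> W" unfolding e_def[abs_def]
    by (rule holomorphic_on_disjoint_Un[OF oV' VW(2) disj]) simp_all
  have he: "(\<lambda>z. hh z * e z) holomorphic_on V' \<union> W" using hh e by (rule holomorphic_on_mult)
  have Kzero: "inClass K UNIV (cut P (shiftop J T l))" if "l \<in> spectrum J T" "l \<in> W" for l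
    using K[OF that(1)] fW that(2) by blast
  have bhh: "bij (hfc J (V' \<union> W) hh T)"
    by (rule bij_hfc_nonzero[OF U' sp hh]) (auto simp: hh_def V'_def)
  have bop_hh: "bop J (hfc J (V' \<union> W) hh T)" by (rule bop_hfc[OF U' sp hh])
  have bP: "bop J P" using projD(1)[OF P] .
  have "bij (cut P (hfc J (V' \<union> W) hh T))"
    by (rule bij_cut[OF P bop_hh hfc_commute[OF U' sp hh bP PT] bhh])
  then have Khh: "inClass K UNIV (cut P (hfc J (V' \<union> W) hh T))" by (rule bij_class[OF bop_cut[OF bP bop_hh]])
  have Ke: "inClass K UNIV (cut P (hfc J (V' \<union> W) e T))" unfolding e_def[abs_def]
    by (rule clopen_part_class[OF oV' VW(2) disj sp P PT Kzero])
  have "inClass K UNIV (cut P (hfc J (V' \<union> W) (\<lambda>z. (\<Prod>l\<leftarrow>ls. z - l) * (hh z * e z)) T))"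
    by (rule class_cut_hfc_linear_factors[OF U' sp he P PT _ class_cut_hfc_mult[OF U' sp hh e P PT Khh Ke]])
      (use K ls in blast)
  moreover have "hfc J (V' \<union> W) f T = hfc J (V' \<union> W) (\<lambda>z. (\<Prod>l\<leftarrow>ls. z - l) * (hh z * e z)) T"
    by (rule hfc_cong[OF U' sp holomorphic_on_subset[OF f U'U]])
      (use fV fW disj in \<open>auto simp: hh_def e_def V'_def\<close>)
  moreover have "hfc J (V' \<union> W) f T = hfc J U f T" by (rule hfc_subset[OF U(1) U' sp U'U f])
  ultimately show ?thesis by simp
qed

text \<open>Algebraically the projection is forced by uniqueness of the decomposition. Its
  continuity is the open mapping theorem for addition from \<open>M\<close> times \<open>N\<close>
  onto the space.\<close>

lemma projection_onto_summand:
  assumes M: "csubspace J M" and N: "csubspace J N" and MN: "M \<inter> N = {0}" "\<And>x. \<exists>m\<in>M. \<exists>n\<in>N. x = m + n"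
  obtains P where "proj P" "range P = M" "range (\<lambda>x. x - P x) = N"
    "\<And>m n. m \<in> M \<Longrightarrow> n \<in> N \<Longrightarrow> P (m + n) = m"
proof -
  have sM: "subspace M" "closed M" and sN: "subspace N" "closed N"
    and J_M: "\<And>x. x \<in> M \<Longrightarrow> J x \<in> M" and J_N: "\<And>x. x \<in> N \<Longrightarrow> J x \<in> N"
    using M N by (auto simp: csubspace_def)
  obtain p q where pq: "\<And>x. p x \<in> M" "\<And>x. q x \<in> N" "\<And>x. x = p x + q x" using MN(2) by metis
  have p: "p (m + n) = m" if "m \<in> M" "n \<in> N" for m n
  proof -
    have "p (m + n) - m = n - q (m + n)" using pq(3)[of "m + n"] by (simp add: algebra_simps)
    moreover have "p (m + n) - m \<in> M" using sM(1) pq(1) that by (simp add: subspace_diff)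
    moreover have "n - q (m + n) \<in> N" using sN(1) pq(2) that by (simp add: subspace_diff)
    ultimately have "p (m + n) - m \<in> M \<inter> N" by simp
    then show ?thesis using MN(1) by simp
  qed
  have pM: "p m = m" if "m \<in> M" for m using p[OF that subspace_0[OF sN(1)]] by simp
  have q: "q x = x - p x" for x using pq(3)[of x] by (simp add: algebra_simps)
  have add: "p (x + y) = p x + p y" for x y
  proof -
    have "x + y = (p x + p y) + (q x + q y)" using pq(3)[of x] pq(3)[of y] by (simp add: algebra_simps)
    then show ?thesis using p[of "p x + p y" "q x + q y"] pq(1,2) sM(1) sN(1) by (simp add: subspace_add)
  qed
  have scale: "p (c *\<^sub>R x) = c *\<^sub>R p x" for c x
  proof -
    have "c *\<^sub>R x = c *\<^sub>R p x + c *\<^sub>R q x" using pq(3)[of x] by (simp add: scaleR_add_right[symmetric])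
    then show ?thesis using p[of "c *\<^sub>R p x" "c *\<^sub>R q x"] pq(1,2) sM(1) sN(1) by (simp add: subspace_scale)
  qed
  have pJ: "p (J x) = J (p x)" for x
  proof -
    have "J x = J (p x) + J (q x)" using pq(3)[of x] linear_add[OF linJ] by metis
    then show ?thesis using p[of "J (p x)" "J (q x)"] pq(1,2) J_M J_N by simp
  qed
  let ?S = "\<lambda>z :: 'a \<times> 'a. fst z + snd z"
  have S: "bounded_linear ?S" by (intro bounded_linear_add bounded_linear_fst bounded_linear_snd)
  have D: "subspace (M \<times> N)" "closed (M \<times> N)" using sM sN by (simp_all add: subspace_Times closed_Times)
  have img: "x \<in> ?S ` (M \<times> N)" for x
    using pq[of x] by (intro image_eqI[of _ _ "(p x, q x)"]) auto
  then have "?S ` (M \<times> N) = UNIV" by blast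
  then obtain C where C: "\<And>y. \<exists>z\<in>M \<times> N. ?S z = y \<and> norm z \<le> C * norm y"
    using open_mapping_closed_image[OF S D] img by (metis closed_UNIV)
  have "norm (p y) \<le> norm y * C" for y
  proof -
    obtain z where z: "z \<in> M \<times> N" "?S z = y" "norm z \<le> C * norm y" using C by blast
    then have "p y = fst z" using p[of "fst z" "snd z"] by auto
    then show ?thesis using z(3) norm_fst_le[of "fst z" "snd z"] by (simp add: mult.commute)
  qed
  then have bp: "bounded_linear p" by (intro bounded_linear_intro[of p C] add scale)
  have pp: "proj p" unfolding proj_def bop_def using bp pJ pM[OF pq(1)] by blast
  have rM: "range p = M" using pq(1) pM by (metis image_subset_iff rangeI subsetI subset_antisym UNIV_I)
  have "range (\<lambda>x. x - p x) = N"
  proof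
    show "range (\<lambda>x. x - p x) \<subseteq> N" using pq(2) q by auto
    show "N \<subseteq> range (\<lambda>x. x - p x)"
    proof
      fix n assume "n \<in> N"
      then have "p n = 0" using p[OF subspace_0[OF sM(1)], of n] by simp
      then show "n \<in> range (\<lambda>x. x - p x)" by (intro image_eqI[of _ _ n]) simp_all
    qed
  qed
  then show thesis using that pp rM p by blast
qed

lemma range_proj_invariant:
  assumes "bop J A" "\<And>x. P (A x) = A (P x)"
  shows "A ` range P \<subseteq> range P"
  using assms(2)[symmetric] by auto

theorem gDR_hfc:
  assumes U: "open U" "spectrum J T \<subseteq> U" and f: "f holomorphic_on U" and gDR: "gDR K J T"
    and zeros: "f -` {0} \<inter> spectrumR K J T = {0}"
  shows "gDR K J (hfc J U f T)"
proof -
  obtain M N where M: "csubspace J M" and N: "csubspace J N" and MN: "M \<inter> N = {0}" "\<forall>x. \<exists>m\<in>M. \<exists>n\<in>N. x = m + n"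
    and inv: "T ` M \<subseteq> M" "T ` N \<subseteq> N" and TM: "inClass K M T" and TN: "rieszM J N T"
    using gDR unfolding gDR_def by blast
  obtain P where P: "proj P" and rP: "range P = M" and rQ: "range (\<lambda>x. x - P x) = N"
    and Pmn: "\<And>m n. m \<in> M \<Longrightarrow> n \<in> N \<Longrightarrow> P (m + n) = m"
    using projection_onto_summand[OF M N MN(1)] MN(2) by metis
  let ?Q = "\<lambda>x. x - P x"
  let ?F = "hfc J U f T"
  have Q: "proj ?Q" by (rule proj_compl[OF P])
  have bP: "bop J P" and bQ: "bop J ?Q" using projD(1) P Q by blast+
  have PT: "P (T x) = T (P x)" for x
  proof -
    have "T x = T (P x) + T (x - P x)" by (simp add: linear_diff[OF bopD(2)[OF T]])
    moreover have "T (P x) \<in> M" "T (x - P x) \<in> N" using inv rP rQ by blast+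
    ultimately show ?thesis using Pmn by simp
  qed
  have QT: "T x - P (T x) = T (x - P x)" for x by (simp add: PT linear_diff[OF bopD(2)[OF T]])
  note PS = proj_shiftop[of P, OF P PT] and QS = proj_shiftop[of ?Q, OF Q QT]
  have KT: "inClass K UNIV (cut P T)" using TM class_range_iff_cut[of P T, OF P T PT] rP by blast
  have Fred: "inClass Phi_cls UNIV (cut ?Q (shiftop J T t))" if "t \<noteq> 0" for t
  proof -
    have "inClass Phi_cls (range ?Q) (shiftop J T t)" using TN that unfolding rQ rieszM_def by simp
    then show ?thesis using class_range_iff_cut[of ?Q "shiftop J T t", OF Q bop_shiftop QS] by blast
  qed
  \<comment> \<open>The connectedness argument starts far out, where T - t is invertible;
    \<open>B > 0\<close> keeps this starting point in the punctured plane.\<close>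
  obtain B where B: "B > 0" "\<And>t. cmod t \<ge> B \<Longrightarrow> bij (shiftop J T t)" using bij_shiftop_large by blast
  have w: "weyl (cut ?Q (shiftop J T t))" if "t \<noteq> 0" for t
  proof (rule weyl_cut_on_connected[of ?Q, OF Q QT])
    show "connected (- {0 :: complex})" by (rule connected_punctured_universe) simp
    show "complex_of_real B \<in> - {0}" "bij (shiftop J T (of_real B))" using B by simp_all
    show "upper_semiFredholmM UNIV (cut ?Q (shiftop J T s)) \<or> lower_semiFredholmM UNIV (cut ?Q (shiftop J T s))"
      if "s \<in> - {0}" for s
      using Fred[of s] that by (simp add: FredholmM_def)
    show "t \<in> - {0}" using that by simp
  qed
  \<comment> \<open>This is what makes the Riesz part work: for nonzero \<open>c\<close>, the zeros
    of f - c avoid 0, the only point where T - t may fail to be Fredholm on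
    \<open>N\<close>.\<close>
  have f0: "f 0 = 0" using zeros by blast
  have Kl: "inClass K UNIV (cut P (shiftop J T l))" if "f l = 0" for l
  proof (cases "l = 0")
    case True
    have "shiftop J T 0 = T" by (simp add: shiftop_def scaleC_zero_left)
    then show ?thesis using KT True by simp
  next
    case False
    then have "l \<notin> spectrumR K J T" using zeros that by blast
    then have "inClass K UNIV (shiftop J T l)" by (simp add: spectrumR_def)
    then show ?thesis by (rule class_range_proj[OF P bop_shiftop PS w[OF False]])
  qed
  have bF: "bop J ?F" by (rule bop_hfc[OF U f])
  have PF: "P (?F x) = ?F (P x)" for x by (rule hfc_commute[OF U f bP PT])
  have QF: "?F x - P (?F x) = ?F (x - P x)" for x by (simp add: PF linear_diff[OF bopD(2)[OF bF]])
  have "inClass K UNIV (cut P ?F)" by (rule class_cut_hfc[OF U f P PT Kl])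
  then have KF: "inClass K M ?F" using class_range_iff_cut[of P ?F, OF P bF PF] rP by blast
  have "FredholmM N (shiftop J ?F c)" if "c \<noteq> 0" for c
  proof -
    have fc: "(\<lambda>z. f z - c) holomorphic_on U" by (intro holomorphic_intros f)
    have Fc: "hfc J U (\<lambda>z. f z - c) T = shiftop J ?F c" using hfc_shift[OF U f] by (rule ext)
    have "l \<noteq> 0" if "f l - c = 0" for l using that f0 \<open>c \<noteq> 0\<close> by auto
    then have "inClass Phi_cls UNIV (cut ?Q (hfc J U (\<lambda>z. f z - c) T))"
      by (intro class_cut_hfc[OF U fc Q QT] Fred) blast
    moreover have "hfc J U (\<lambda>z. f z - c) T x - P (hfc J U (\<lambda>z. f z - c) T x) = hfc J U (\<lambda>z. f z - c) T (x - P x)" for x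
      by (rule hfc_commute[OF U fc bQ QT])
    ultimately have "inClass Phi_cls (range ?Q) (hfc J U (\<lambda>z. f z - c) T)"
      using class_range_iff_cut[of ?Q "hfc J U (\<lambda>z. f z - c) T" Phi_cls, OF Q bop_hfc[OF U fc]] by blast
    then show ?thesis unfolding rQ Fc inClass.simps .
  qed
  then have "rieszM J N ?F" unfolding rieszM_def by blast
  moreover have "?F ` range P \<subseteq> range P" by (rule range_proj_invariant[of ?F P, OF bF PF])
  moreover have "?F ` range ?Q \<subseteq> range ?Q" by (rule range_proj_invariant[of ?F ?Q, OF bF QF])
  ultimately show ?thesis unfolding gDR_def rP rQ using bF M N MN KF by blast
qed

end

theorem theorem2p15:
  fixes J :: "'a::banach \<Rightarrow> 'a" and T :: "'a \<Rightarrow> 'a"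
    and f :: "complex \<Rightarrow> complex" and U :: "complex set" and R :: opclass
  assumes "complex_structure J"
    and "\<not> fin_dim (UNIV :: 'a set)"
    and "bop J T"
    and "open U" and "spectrum J T \<subseteq> U" and "f holomorphic_on U"
    and "gDR R J T"
    and "f -` {0} \<inter> spectrumR R J T = {0}"
  shows "gDR R J (hfc J U f T)"
proof -
  interpret complex_operator J T using assms(1,3) by unfold_locales
  show ?thesis by (rule gDR_hfc[OF assms(4-8)])
qed

end
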